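(* Let $\rho:\mathbb{N}\times\mathbb{N}\to\mathbb{R}_{>0}$, $(j,n)\mapsto\rho_j(n)$, be a function such that for every $j\in\mathbb{N}$ $$\sum_{n=0}^\infty\frac{\rho_j(n)}{\rho_{j+1}(n)}<\infty\qquad\Big(\text{in the non-archimedean case: }\lim_{n\to\infty}\frac{\rho_j(n)}{\rho_{j+1}(n)}=0\Big).$$ Define, in $\mathbf{Ind}(\mathbf{Ban}_R)$, $$\lambda(\rho):=\varprojlim_{j\in\mathbb{N}}\ell^1_*(\rho_j),\qquad \kappa(\rho):=\varinjlim_{j\in\mathbb{N}}\ell^1_*(\rho_j^{-1}),$$ where all transition morphisms are the identity on elements ($e_n\mapsto e_n$). Then $\lambda(\rho)$ and $\kappa(\rho)$ are dual to each other: there is a pairing $\kappa(\rho)\widehat{\otimes}\lambda(\rho)\to R$ such that the induced canonical morphisms $\lambda(\rho)\to\kappa(\rho)^\vee$ and $\kappa(\rho)\to\lambda(\rho)^\vee$ are isomorphisms. In particular $\lambda(\rho)$ and $\kappa(\rho)$ are reflexive bornological $R$-modules.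
   Context: $(R,|\cdot|)$ is a Banach ring: a commutative unital ring with a norm that is submultiplicative ($|ab|\le|a||b|$, $|1|\le 1$) and complete. A Banach $R$-module is an $R$-module with a complete norm satisfying $\|ax\|\le|a|\|x\|$; $\mathbf{Ban}_R$ is the category of Banach $R$-modules and bounded $R$-linear maps, and $\mathbf{Ind}(\mathbf{Ban}_R)$ is its Ind-completion (all limits and colimits exist there). "Non-archimedean case" means $R$ is non-archimedean (ultrametric norm) and one works with non-archimedean Banach modules. $\mathbf{Ind}(\mathbf{Ban}_R)$ carries the closed symmetric monoidal structure extending the completed projective tensor product $\widehat{\otimes}$ (norm on $M\otimes N$: infimum over representations $t=\sum x_i\otimes y_i$ of $\sum\|x_i\|\|y_i\|$, or of $\max\|x_i\|\|y_i\|$ in the non-archimedean case) with internal hom $\underline{\mathrm{Hom}}_R$; $M^\vee:=\underline{\mathrm{Hom}}_R(M,R)$, and $M$ is reflexive if the canonical $M\to M^{\vee\vee}$ is an isomorphism. For $w:\mathbb{N}\to\mathbb{R}_{>0}$: $\ell^1(w)$ is the Banach module of sequences $(x_n)\in R^{\mathbb{N}}$ with $\sum_n|x_n|w(n)<\infty$ (norm = this sum); $\ell^1_{\mathrm{na}}(w)$ is the module of sequences with $|x_n|w(n)\to0$ (norm $\sup_n|x_n|w(n)$); $\ell^1_*(w)$ denotes $\ell^1(w)$ in general and $\ell^1_{\mathrm{na}}(w)$ in the non-archimedean case; $e_n$ is the sequence with $1$ in position $n$ and $0$ elsewhere; $w^{-1}$ denotes $n\mapsto w(n)^{-1}$. A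 bornological $R$-module is an object of $\mathbf{Ind}(\mathbf{Ban}_R)$ isomorphic to a filtered colimit of Banach modules with injective transition maps. *)

theory Defs
  imports Complex_Main "HOL-Algebra.Module"
begin

section \<open>Banach rings and Banach modules\<close>

text \<open>
  Throughout, the flag \<open>na\<close> selects the setting: \<open>na = True\<close> is the non-archimedean case
  (ultrametric norms on the ring and on all modules), \<open>na = False\<close> the general case.
\<close>

record 'r nring = "'r ring" +
  rnm :: "'r \<Rightarrow> real"

record ('r, 'm) nmodule = "('r, 'm) module" +
  nm :: "'m \<Rightarrow> real"

text \<open>The triangle inequality is stated for differences, so that it includes \<open>nu (- x) = nu x\<close>.\<close>

definition banach_norm :: "bool \<Rightarrow> ('a, 'c) ring_scheme \<Rightarrow> ('a \<Rightarrow> real) \<Rightarrow> bool" where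
  "banach_norm na G nu \<longleftrightarrow>
     (\<forall>x\<in>carrier G. 0 \<le> nu x \<and> (nu x = 0 \<longleftrightarrow> x = \<zero>\<^bsub>G\<^esub>)) \<and>
     (\<forall>x\<in>carrier G. \<forall>y\<in>carrier G.
        nu (x \<ominus>\<^bsub>G\<^esub> y) \<le> (if na then max (nu x) (nu y) else nu x + nu y)) \<and>
     (\<forall>s. range s \<subseteq> carrier G \<and>
          (\<forall>e>0. \<exists>N. \<forall>m\<ge>N. \<forall>n\<ge>N. nu (s m \<ominus>\<^bsub>G\<^esub> s n) < e) \<longrightarrow>
          (\<exists>x\<in>carrier G. (\<lambda>n::nat. nu (s n \<ominus>\<^bsub>G\<^esub> x)) \<longlonglongrightarrow> 0))"

definition banach_ring :: "bool \<Rightarrow> 'r nring \<Rightarrow> bool" where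
  "banach_ring na R \<longleftrightarrow> cring R \<and> banach_norm na R (rnm R) \<and>
     (\<forall>a\<in>carrier R. \<forall>b\<in>carrier R. rnm R (a \<otimes>\<^bsub>R\<^esub> b) \<le> rnm R a * rnm R b) \<and>
     rnm R \<one>\<^bsub>R\<^esub> \<le> 1"

definition banach_module :: "bool \<Rightarrow> 'r nring \<Rightarrow> ('r, 'm) nmodule \<Rightarrow> bool" where
  "banach_module na R M \<longleftrightarrow> module R M \<and> banach_norm na M (nm M) \<and>
     (\<forall>a\<in>carrier R. \<forall>x\<in>carrier M. nm M (a \<odot>\<^bsub>M\<^esub> x) \<le> rnm R a * nm M x)"

text \<open>
  The record type of modules extends that of rings; the fields \<open>mult\<close> and \<open>one\<close> of a module
  carry no information.
\<close>

definition ring_as_module :: "'r nring \<Rightarrow> ('r, 'r) nmodule" where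
  "ring_as_module R = \<lparr> carrier = carrier R, mult = undefined, one = undefined,
     zero = \<zero>\<^bsub>R\<^esub>, add = add R, smult = mult R, nm = rnm R \<rparr>"

definition bounded_linear_map ::
    "'r nring \<Rightarrow> ('r, 'm) nmodule \<Rightarrow> ('r, 'n) nmodule \<Rightarrow> ('m \<Rightarrow> 'n) \<Rightarrow> bool" where
  "bounded_linear_map R M N f \<longleftrightarrow> f \<in> carrier M \<rightarrow> carrier N \<and>
     (\<forall>x\<in>carrier M. \<forall>y\<in>carrier M. f (x \<oplus>\<^bsub>M\<^esub> y) = f x \<oplus>\<^bsub>N\<^esub> f y) \<and>
     (\<forall>a\<in>carrier R. \<forall>x\<in>carrier M. f (a \<odot>\<^bsub>M\<^esub> x) = a \<odot>\<^bsub>N\<^esub> f x) \<and>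
     (\<exists>C. \<forall>x\<in>carrier M. nm N (f x) \<le> C * nm M x)"

definition op_norm :: "('r, 'm) nmodule \<Rightarrow> ('r, 'n) nmodule \<Rightarrow> ('m \<Rightarrow> 'n) \<Rightarrow> real" where
  "op_norm M N f = Inf {C. 0 \<le> C \<and> (\<forall>x\<in>carrier M. nm N (f x) \<le> C * nm M x)}"

definition ban_hom ::
    "'r nring \<Rightarrow> ('r, 'm) nmodule \<Rightarrow> ('r, 'n) nmodule \<Rightarrow> ('r, 'm \<Rightarrow> 'n) nmodule" where
  "ban_hom R M N = \<lparr> carrier = {f \<in> extensional (carrier M). bounded_linear_map R M N f},
     mult = undefined, one = undefined,
     zero = (\<lambda>x\<in>carrier M. \<zero>\<^bsub>N\<^esub>),
     add = (\<lambda>f g. \<lambda>x\<in>carrier M. f x \<oplus>\<^bsub>N\<^esub> g x),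
     smult = (\<lambda>a f. \<lambda>x\<in>carrier M. a \<odot>\<^bsub>N\<^esub> f x),
     nm = op_norm M N \<rparr>"


section \<open>The completed projective tensor product\<close>

text \<open>
  Elements of the algebraic tensor product are represented by lists of pairs, the list
  \<open>[(x1, y1), ..., (xk, yk)]\<close> standing for the sum of the \<open>xi \<otimes> yi\<close>; \<open>tensor_eq\<close> is equality
  of the represented tensors.
\<close>

inductive tensor_eq ::
    "'r nring \<Rightarrow> ('r, 'm) nmodule \<Rightarrow> ('r, 'n) nmodule \<Rightarrow> ('m \<times> 'n) list \<Rightarrow> ('m \<times> 'n) list \<Rightarrow> bool"
  for R M N where
  refl: "xs \<in> lists (carrier M \<times> carrier N) \<Longrightarrow> tensor_eq R M N xs xs"
| sym: "tensor_eq R M N xs ys \<Longrightarrow> tensor_eq R M N ys xs"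
| trans: "tensor_eq R M N xs ys \<Longrightarrow> tensor_eq R M N ys zs \<Longrightarrow> tensor_eq R M N xs zs"
| append: "tensor_eq R M N xs xs' \<Longrightarrow> tensor_eq R M N ys ys' \<Longrightarrow>
    tensor_eq R M N (xs @ ys) (xs' @ ys')"
| commute: "xs \<in> lists (carrier M \<times> carrier N) \<Longrightarrow> ys \<in> lists (carrier M \<times> carrier N) \<Longrightarrow>
    tensor_eq R M N (xs @ ys) (ys @ xs)"
| zero: "y \<in> carrier N \<Longrightarrow> tensor_eq R M N [(\<zero>\<^bsub>M\<^esub>, y)] []"
| add_left: "x \<in> carrier M \<Longrightarrow> x' \<in> carrier M \<Longrightarrow> y \<in> carrier N \<Longrightarrow>
    tensor_eq R M N [(x \<oplus>\<^bsub>M\<^esub> x', y)] [(x, y), (x', y)]"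
| add_right: "x \<in> carrier M \<Longrightarrow> y \<in> carrier N \<Longrightarrow> y' \<in> carrier N \<Longrightarrow>
    tensor_eq R M N [(x, y \<oplus>\<^bsub>N\<^esub> y')] [(x, y), (x, y')]"
| smult: "a \<in> carrier R \<Longrightarrow> x \<in> carrier M \<Longrightarrow> y \<in> carrier N \<Longrightarrow>
    tensor_eq R M N [(a \<odot>\<^bsub>M\<^esub> x, y)] [(x, a \<odot>\<^bsub>N\<^esub> y)]"

definition tensor_cost ::
    "bool \<Rightarrow> ('r, 'm) nmodule \<Rightarrow> ('r, 'n) nmodule \<Rightarrow> ('m \<times> 'n) list \<Rightarrow> real" where
  "tensor_cost na M N xs =
     foldr (\<lambda>(x, y) c. if na then max (nm M x * nm N y) c else nm M x * nm N y + c) xs 0"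

definition tensor_seminorm ::
    "bool \<Rightarrow> 'r nring \<Rightarrow> ('r, 'm) nmodule \<Rightarrow> ('r, 'n) nmodule \<Rightarrow> ('m \<times> 'n) list \<Rightarrow> real" where
  "tensor_seminorm na R M N xs = Inf {tensor_cost na M N ys |ys. tensor_eq R M N xs ys}"

definition tensor_diff ::
    "('r, 'm) nmodule \<Rightarrow> ('m \<times> 'n) list \<Rightarrow> ('m \<times> 'n) list \<Rightarrow> ('m \<times> 'n) list" where
  "tensor_diff M xs ys = xs @ map (\<lambda>(x, y). (\<ominus>\<^bsub>M\<^esub> x, y)) ys"

text \<open>The completion consists of the Cauchy sequences of tensors modulo null sequences.\<close>

definition tensor_cauchy ::
    "bool \<Rightarrow> 'r nring \<Rightarrow> ('r, 'm) nmodule \<Rightarrow> ('r, 'n) nmodule \<Rightarrow> (nat \<Rightarrow> ('m \<times> 'n) list) set" where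
  "tensor_cauchy na R M N = {s. range s \<subseteq> lists (carrier M \<times> carrier N) \<and>
     (\<forall>e>0. \<exists>K. \<forall>m\<ge>K. \<forall>n\<ge>K. tensor_seminorm na R M N (tensor_diff M (s m) (s n)) < e)}"

definition tensor_class ::
    "bool \<Rightarrow> 'r nring \<Rightarrow> ('r, 'm) nmodule \<Rightarrow> ('r, 'n) nmodule \<Rightarrow>
     (nat \<Rightarrow> ('m \<times> 'n) list) \<Rightarrow> (nat \<Rightarrow> ('m \<times> 'n) list) set" where
  "tensor_class na R M N s = {u \<in> tensor_cauchy na R M N.
     (\<lambda>n. tensor_seminorm na R M N (tensor_diff M (s n) (u n))) \<longlonglongrightarrow> 0}"

definition ban_tensor ::
    "bool \<Rightarrow> 'r nring \<Rightarrow> ('r, 'm) nmodule \<Rightarrow> ('r, 'n) nmodule \<Rightarrow>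
     ('r, (nat \<Rightarrow> ('m \<times> 'n) list) set) nmodule" where
  "ban_tensor na R M N = \<lparr>
     carrier = tensor_class na R M N ` tensor_cauchy na R M N,
     mult = undefined, one = undefined,
     zero = tensor_class na R M N (\<lambda>n. []),
     add = (\<lambda>A B. \<Union>s\<in>A. \<Union>u\<in>B. tensor_class na R M N (\<lambda>n. s n @ u n)),
     smult = (\<lambda>a A. \<Union>s\<in>A. tensor_class na R M N (\<lambda>n. map (\<lambda>(x, y). (a \<odot>\<^bsub>M\<^esub> x, y)) (s n))),
     nm = (\<lambda>A. lim (\<lambda>n. tensor_seminorm na R M N ((SOME s. s \<in> A) n))) \<rparr>"

definition pure_tensor ::
    "bool \<Rightarrow> 'r nring \<Rightarrow> ('r, 'm) nmodule \<Rightarrow> ('r, 'n) nmodule \<Rightarrow>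
     'm \<Rightarrow> 'n \<Rightarrow> (nat \<Rightarrow> ('m \<times> 'n) list) set" where
  "pure_tensor na R M N x y = tensor_class na R M N (\<lambda>n. [(x, y)])"

definition tensor_map ::
    "bool \<Rightarrow> 'r nring \<Rightarrow> ('r, 'p) nmodule \<Rightarrow> ('r, 'q) nmodule \<Rightarrow> ('m \<Rightarrow> 'p) \<Rightarrow> ('n \<Rightarrow> 'q) \<Rightarrow>
     (nat \<Rightarrow> ('m \<times> 'n) list) set \<Rightarrow> (nat \<Rightarrow> ('p \<times> 'q) list) set" where
  "tensor_map na R P Q f g A =
     (\<Union>s\<in>A. tensor_class na R P Q (\<lambda>n. map (map_prod f g) (s n)))"


section \<open>The category \<open>Ind(Ban_R)\<close>\<close>

text \<open>
  An ind-object is a directed system of Banach modules, thought of as its formal colimit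
  (filtered index categories may be replaced by directed preorders).  A morphism
  in \<open>lim_i colim_j Hom (X_i, Y_j)\<close> is given by representatives \<open>X_i \<rightarrow> Y_(im_idx i)\<close>,
  and \<open>ind_eq\<close> is equality of the morphisms so represented.
\<close>

record ('r, 'i, 'm) ind_sys =
  idx :: "'i set"
  ile :: "'i \<Rightarrow> 'i \<Rightarrow> bool"
  obj :: "'i \<Rightarrow> ('r, 'm) nmodule"
  tr :: "'i \<Rightarrow> 'i \<Rightarrow> 'm \<Rightarrow> 'm"

definition ind_obj :: "bool \<Rightarrow> 'r nring \<Rightarrow> ('r, 'i, 'm) ind_sys \<Rightarrow> bool" where
  "ind_obj na R X \<longleftrightarrow> idx X \<noteq> {} \<and>
     (\<forall>i\<in>idx X. ile X i i) \<and>
     (\<forall>i\<in>idx X. \<forall>j\<in>idx X. \<forall>k\<in>idx X. ile X i j \<and> ile X j k \<longrightarrow> ile X i k) \<and>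
     (\<forall>i\<in>idx X. \<forall>j\<in>idx X. \<exists>k\<in>idx X. ile X i k \<and> ile X j k) \<and>
     (\<forall>i\<in>idx X. banach_module na R (obj X i)) \<and>
     (\<forall>i\<in>idx X. \<forall>j\<in>idx X. ile X i j \<longrightarrow> bounded_linear_map R (obj X i) (obj X j) (tr X i j)) \<and>
     (\<forall>i\<in>idx X. \<forall>x\<in>carrier (obj X i). tr X i i x = x) \<and>
     (\<forall>i\<in>idx X. \<forall>j\<in>idx X. \<forall>k\<in>idx X. ile X i j \<and> ile X j k \<longrightarrow>
        (\<forall>x\<in>carrier (obj X i). tr X j k (tr X i j x) = tr X i k x))"

record ('i, 'm, 'j, 'n) ind_map =
  im_idx :: "'i \<Rightarrow> 'j"
  im_map :: "'i \<Rightarrow> 'm \<Rightarrow> 'n"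

definition ind_mor ::
    "bool \<Rightarrow> 'r nring \<Rightarrow> ('r, 'i, 'm) ind_sys \<Rightarrow> ('r, 'j, 'n) ind_sys \<Rightarrow>
     ('i, 'm, 'j, 'n) ind_map \<Rightarrow> bool" where
  "ind_mor na R X Y f \<longleftrightarrow> ind_obj na R X \<and> ind_obj na R Y \<and>
     (\<forall>i\<in>idx X. im_idx f i \<in> idx Y \<and>
        bounded_linear_map R (obj X i) (obj Y (im_idx f i)) (im_map f i)) \<and>
     (\<forall>i\<in>idx X. \<forall>i'\<in>idx X. ile X i i' \<longrightarrow>
        (\<exists>k\<in>idx Y. ile Y (im_idx f i) k \<and> ile Y (im_idx f i') k \<and>
           (\<forall>x\<in>carrier (obj X i).
              tr Y (im_idx f i') k (im_map f i' (tr X i i' x)) = tr Y (im_idx f i) k (im_map f i x))))"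

definition ind_eq ::
    "('r, 'i, 'm) ind_sys \<Rightarrow> ('r, 'j, 'n) ind_sys \<Rightarrow>
     ('i, 'm, 'j, 'n) ind_map \<Rightarrow> ('i, 'm, 'j, 'n) ind_map \<Rightarrow> bool" where
  "ind_eq X Y f g \<longleftrightarrow> (\<forall>i\<in>idx X. \<exists>k\<in>idx Y. ile Y (im_idx f i) k \<and> ile Y (im_idx g i) k \<and>
     (\<forall>x\<in>carrier (obj X i). tr Y (im_idx f i) k (im_map f i x) = tr Y (im_idx g i) k (im_map g i x)))"

definition ind_id :: "('i, 'm, 'i, 'm) ind_map" where
  "ind_id = \<lparr> im_idx = (\<lambda>i. i), im_map = (\<lambda>i x. x) \<rparr>"

definition ind_comp ::
    "('j, 'n, 'k, 'p) ind_map \<Rightarrow> ('i, 'm, 'j, 'n) ind_map \<Rightarrow> ('i, 'm, 'k, 'p) ind_map" where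
  "ind_comp g f = \<lparr> im_idx = (\<lambda>i. im_idx g (im_idx f i)),
     im_map = (\<lambda>i x. im_map g (im_idx f i) (im_map f i x)) \<rparr>"

definition ind_iso ::
    "bool \<Rightarrow> 'r nring \<Rightarrow> ('r, 'i, 'm) ind_sys \<Rightarrow> ('r, 'j, 'n) ind_sys \<Rightarrow>
     ('i, 'm, 'j, 'n) ind_map \<Rightarrow> bool" where
  "ind_iso na R X Y f \<longleftrightarrow> ind_mor na R X Y f \<and>
     (\<exists>g. ind_mor na R Y X g \<and> ind_eq X X (ind_comp g f) ind_id \<and> ind_eq Y Y (ind_comp f g) ind_id)"

definition ind_const :: "('r, 'm) nmodule \<Rightarrow> ('r, unit, 'm) ind_sys" where
  "ind_const M = \<lparr> idx = UNIV, ile = (\<lambda>i j. True), obj = (\<lambda>i. M), tr = (\<lambda>i j x. x) \<rparr>"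

definition ind_unit :: "'r nring \<Rightarrow> ('r, unit, 'r) ind_sys" where
  "ind_unit R = ind_const (ring_as_module R)"

definition const_map :: "('m \<Rightarrow> 'n) \<Rightarrow> (unit, 'm, unit, 'n) ind_map" where
  "const_map f = \<lparr> im_idx = (\<lambda>i. ()), im_map = (\<lambda>i. f) \<rparr>"

definition ind_tensor ::
    "bool \<Rightarrow> 'r nring \<Rightarrow> ('r, 'i, 'm) ind_sys \<Rightarrow> ('r, 'j, 'n) ind_sys \<Rightarrow>
     ('r, 'i \<times> 'j, (nat \<Rightarrow> ('m \<times> 'n) list) set) ind_sys" where
  "ind_tensor na R X Y = \<lparr> idx = idx X \<times> idx Y,
     ile = (\<lambda>(i, j) (i', j'). ile X i i' \<and> ile Y j j'),
     obj = (\<lambda>(i, j). ban_tensor na R (obj X i) (obj Y j)),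
     tr = (\<lambda>(i, j) (i', j'). tensor_map na R (obj X i') (obj Y j') (tr X i i') (tr Y j j')) \<rparr>"


section \<open>Limits of Banach modules and duals in \<open>Ind(Ban_R)\<close>\<close>

text \<open>
  \<open>t i j : M j \<rightarrow> M i\<close> for \<open>r i j\<close>.
\<close>

definition inverse_system ::
    "bool \<Rightarrow> 'r nring \<Rightarrow> 'i set \<Rightarrow> ('i \<Rightarrow> 'i \<Rightarrow> bool) \<Rightarrow> ('i \<Rightarrow> ('r, 'm) nmodule) \<Rightarrow>
     ('i \<Rightarrow> 'i \<Rightarrow> 'm \<Rightarrow> 'm) \<Rightarrow> bool" where
  "inverse_system na R I r M t \<longleftrightarrow>
     (\<forall>i\<in>I. r i i) \<and>
     (\<forall>i\<in>I. \<forall>j\<in>I. \<forall>k\<in>I. r i j \<and> r j k \<longrightarrow> r i k) \<and>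
     (\<forall>i\<in>I. banach_module na R (M i)) \<and>
     (\<forall>i\<in>I. \<forall>j\<in>I. r i j \<longrightarrow> bounded_linear_map R (M j) (M i) (t i j)) \<and>
     (\<forall>i\<in>I. \<forall>x\<in>carrier (M i). t i i x = x) \<and>
     (\<forall>i\<in>I. \<forall>j\<in>I. \<forall>k\<in>I. r i j \<and> r j k \<longrightarrow>
        (\<forall>x\<in>carrier (M k). t i j (t j k x) = t i k x))"

text \<open>
  In \<open>Ind(Ban_R)\<close> the limit of an inverse system of Banach modules is the union, over all
  \<open>\<phi> : I \<rightarrow> (0, \<infinity>)\<close>, of the Banach modules of those compatible families \<open>x\<close> for which
  \<open>nm (x i) / \<phi> i\<close> is bounded.  That this is a limit cone is
  proved in \<open>ind_lim_proj\<close> and \<open>ind_lim_universal\<close> below.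
\<close>

definition bounded_families ::
    "'i set \<Rightarrow> ('i \<Rightarrow> 'i \<Rightarrow> bool) \<Rightarrow> ('i \<Rightarrow> ('r, 'm) nmodule) \<Rightarrow> ('i \<Rightarrow> 'i \<Rightarrow> 'm \<Rightarrow> 'm) \<Rightarrow>
     ('i \<Rightarrow> real) \<Rightarrow> ('r, 'i \<Rightarrow> 'm) nmodule" where
  "bounded_families I r M t \<phi> = \<lparr>
     carrier = {x \<in> PiE I (\<lambda>i. carrier (M i)).
       (\<forall>i\<in>I. \<forall>j\<in>I. r i j \<longrightarrow> t i j (x j) = x i) \<and> (\<exists>C. \<forall>i\<in>I. nm (M i) (x i) \<le> C * \<phi> i)},
     mult = undefined, one = undefined,
     zero = (\<lambda>i\<in>I. \<zero>\<^bsub>M i\<^esub>),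
     add = (\<lambda>x y. \<lambda>i\<in>I. x i \<oplus>\<^bsub>M i\<^esub> y i),
     smult = (\<lambda>a x. \<lambda>i\<in>I. a \<odot>\<^bsub>M i\<^esub> x i),
     nm = (\<lambda>x. Inf {C. 0 \<le> C \<and> (\<forall>i\<in>I. nm (M i) (x i) \<le> C * \<phi> i)}) \<rparr>"

definition ind_lim ::
    "'i set \<Rightarrow> ('i \<Rightarrow> 'i \<Rightarrow> bool) \<Rightarrow> ('i \<Rightarrow> ('r, 'm) nmodule) \<Rightarrow> ('i \<Rightarrow> 'i \<Rightarrow> 'm \<Rightarrow> 'm) \<Rightarrow>
     ('r, 'i \<Rightarrow> real, 'i \<Rightarrow> 'm) ind_sys" where
  "ind_lim I r M t = \<lparr> idx = {\<phi>. \<forall>i\<in>I. 0 < \<phi> i},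
     ile = (\<lambda>\<phi> \<psi>. \<forall>i\<in>I. \<phi> i \<le> \<psi> i),
     obj = bounded_families I r M t,
     tr = (\<lambda>\<phi> \<psi> x. x) \<rparr>"

definition lim_proj :: "'i \<Rightarrow> ('i \<Rightarrow> real, 'i \<Rightarrow> 'm, unit, 'm) ind_map" where
  "lim_proj i = \<lparr> im_idx = (\<lambda>\<phi>. ()), im_map = (\<lambda>\<phi> x. x i) \<rparr>"

text \<open>
  The dual \<open>X\<^sup>\<or> = Hom (X, R)\<close>: the internal Hom out of \<open>X = colim_i X_i\<close> is
  \<open>lim_i Hom (X_i, R)\<close>, the limit being taken in \<open>Ind(Ban_R)\<close>.
\<close>

definition ind_dual ::
    "'r nring \<Rightarrow> ('r, 'i, 'm) ind_sys \<Rightarrow> ('r, 'i \<Rightarrow> real, 'i \<Rightarrow> 'm \<Rightarrow> 'r) ind_sys" where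
  "ind_dual R X = ind_lim (idx X) (ile X) (\<lambda>i. ban_hom R (obj X i) (ring_as_module R))
     (\<lambda>i j f. \<lambda>x\<in>carrier (obj X i). f (tr X i j x))"

text \<open>
  The two adjuncts of a pairing \<open>p : X \<otimes> Y \<rightarrow> R\<close>, namely \<open>Y \<rightarrow> X\<^sup>\<or>\<close> and \<open>X \<rightarrow> Y\<^sup>\<or>\<close>; on elements,
  \<open>y \<mapsto> (x \<mapsto> p (x \<otimes> y))\<close> and \<open>x \<mapsto> (y \<mapsto> p (x \<otimes> y))\<close>.  The indices only have to bound the norms
  of the resulting functionals.
\<close>

definition adj_right ::
    "bool \<Rightarrow> 'r nring \<Rightarrow> ('r, 'i, 'm) ind_sys \<Rightarrow> ('r, 'j, 'n) ind_sys \<Rightarrow>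
     ('i \<times> 'j, (nat \<Rightarrow> ('m \<times> 'n) list) set, unit, 'r) ind_map \<Rightarrow>
     ('j, 'n, 'i \<Rightarrow> real, 'i \<Rightarrow> 'm \<Rightarrow> 'r) ind_map" where
  "adj_right na R X Y p = \<lparr>
     im_idx = (\<lambda>j i. 1 + op_norm (ban_tensor na R (obj X i) (obj Y j)) (ring_as_module R) (im_map p (i, j))),
     im_map = (\<lambda>j y. \<lambda>i\<in>idx X. \<lambda>x\<in>carrier (obj X i).
       im_map p (i, j) (pure_tensor na R (obj X i) (obj Y j) x y)) \<rparr>"

definition adj_left ::
    "bool \<Rightarrow> 'r nring \<Rightarrow> ('r, 'i, 'm) ind_sys \<Rightarrow> ('r, 'j, 'n) ind_sys \<Rightarrow>
     ('i \<times> 'j, (nat \<Rightarrow> ('m \<times> 'n) list) set, unit, 'r) ind_map \<Rightarrow>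
     ('i, 'm, 'j \<Rightarrow> real, 'j \<Rightarrow> 'n \<Rightarrow> 'r) ind_map" where
  "adj_left na R X Y p = \<lparr>
     im_idx = (\<lambda>i j. 1 + op_norm (ban_tensor na R (obj X i) (obj Y j)) (ring_as_module R) (im_map p (i, j))),
     im_map = (\<lambda>i x. \<lambda>j\<in>idx Y. \<lambda>y\<in>carrier (obj Y j).
       im_map p (i, j) (pure_tensor na R (obj X i) (obj Y j) x y)) \<rparr>"

text \<open>
  The canonical morphism \<open>X \<rightarrow> X\<^sup>\<or>\<^sup>\<or>\<close>, \<open>x \<mapsto> (f \<mapsto> f x)\<close>.  On the step of \<open>X\<^sup>\<or>\<close> with index \<open>\<phi>\<close>,
  evaluation at an element of \<open>X_i\<close> has norm at most \<open>\<phi> i\<close> times the norm of that element.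
\<close>

definition to_bidual ::
    "'r nring \<Rightarrow> ('r, 'i, 'm) ind_sys \<Rightarrow>
     ('i, 'm, ('i \<Rightarrow> real) \<Rightarrow> real, ('i \<Rightarrow> real) \<Rightarrow> ('i \<Rightarrow> 'm \<Rightarrow> 'r) \<Rightarrow> 'r) ind_map" where
  "to_bidual R X = \<lparr>
     im_idx = (\<lambda>i \<phi>. \<phi> i),
     im_map = (\<lambda>i x. \<lambda>\<phi>\<in>idx (ind_dual R X). \<lambda>f\<in>carrier (obj (ind_dual R X) \<phi>). f i x) \<rparr>"

definition reflexive :: "bool \<Rightarrow> 'r nring \<Rightarrow> ('r, 'i, 'm) ind_sys \<Rightarrow> bool" where
  "reflexive na R X \<longleftrightarrow> ind_iso na R X (ind_dual R (ind_dual R X)) (to_bidual R X)"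

text \<open>
  It is no restriction that \<open>Y\<close> has the index and element types of \<open>X\<close>: if \<open>X\<close> is isomorphic to
  a system with injective transition maps, then for every \<open>i\<close> the kernels of \<open>X_i \<rightarrow> X_j\<close> are
  the same for all large \<open>j\<close>, and \<open>Y\<close> can be taken to consist of the quotients by these kernels.
\<close>

definition bornological :: "bool \<Rightarrow> 'r nring \<Rightarrow> ('r, 'i, 'm) ind_sys \<Rightarrow> bool" where
  "bornological na R X \<longleftrightarrow> (\<exists>(Y :: ('r, 'i, 'm) ind_sys) f. ind_iso na R X Y f \<and>
     (\<forall>i\<in>idx Y. \<forall>j\<in>idx Y. ile Y i j \<longrightarrow> inj_on (tr Y i j) (carrier (obj Y i))))"


section \<open>Weighted sequence modules\<close>

definition l1 :: "bool \<Rightarrow> 'r nring \<Rightarrow> (nat \<Rightarrow> real) \<Rightarrow> ('r, nat \<Rightarrow> 'r) nmodule" where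
  "l1 na R w = \<lparr>
     carrier = {x. range x \<subseteq> carrier R \<and>
       (if na then (\<lambda>n. rnm R (x n) * w n) \<longlonglongrightarrow> 0 else summable (\<lambda>n. rnm R (x n) * w n))},
     mult = undefined, one = undefined,
     zero = (\<lambda>n. \<zero>\<^bsub>R\<^esub>),
     add = (\<lambda>x y n. x n \<oplus>\<^bsub>R\<^esub> y n),
     smult = (\<lambda>a x n. a \<otimes>\<^bsub>R\<^esub> x n),
     nm = (\<lambda>x. if na then (SUP n. rnm R (x n) * w n) else (\<Sum>n. rnm R (x n) * w n)) \<rparr>"

definition lambda_space ::
    "bool \<Rightarrow> 'r nring \<Rightarrow> (nat \<Rightarrow> nat \<Rightarrow> real) \<Rightarrow> ('r, nat \<Rightarrow> real, nat \<Rightarrow> nat \<Rightarrow> 'r) ind_sys" where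
  "lambda_space na R \<rho> = ind_lim UNIV (\<le>) (\<lambda>j. l1 na R (\<rho> j)) (\<lambda>i j x. x)"

text \<open>
  A filtered colimit of Banach modules in \<open>Ind(Ban_R)\<close> is the directed system itself
  (\<open>ind_colim_incl\<close>, \<open>ind_colim_universal\<close>).
\<close>

definition kappa_space ::
    "bool \<Rightarrow> 'r nring \<Rightarrow> (nat \<Rightarrow> nat \<Rightarrow> real) \<Rightarrow> ('r, nat, nat \<Rightarrow> 'r) ind_sys" where
  "kappa_space na R \<rho> = \<lparr> idx = UNIV, ile = (\<le>),
     obj = (\<lambda>j. l1 na R (\<lambda>n. inverse (\<rho> j n))), tr = (\<lambda>i j x. x) \<rparr>"

section \<open>\<open>ind_lim\<close> is a limit and a directed system is its own colimit\<close>

lemma banach_norm_minus: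
  assumes G: "abelian_group G" and b: "banach_norm na G nu" and x: "x \<in> carrier G"
  shows "nu (\<ominus>\<^bsub>G\<^esub> x) = nu x"
proof -
  interpret abelian_group G by fact
  have le: "nu (\<ominus>\<^bsub>G\<^esub> y) \<le> nu y" if y: "y \<in> carrier G" for y
  proof -
    have "nu (\<zero>\<^bsub>G\<^esub> \<ominus>\<^bsub>G\<^esub> y) \<le> (if na then max (nu \<zero>\<^bsub>G\<^esub>) (nu y) else nu \<zero>\<^bsub>G\<^esub> + nu y)"
      using b y unfolding banach_norm_def by auto
    moreover have "nu \<zero>\<^bsub>G\<^esub> = 0" "0 \<le> nu y" using b y unfolding banach_norm_def by auto
    moreover have "\<zero>\<^bsub>G\<^esub> \<ominus>\<^bsub>G\<^esub> y = \<ominus>\<^bsub>G\<^esub> y" using y by (simp add: minus_eq)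
    ultimately show ?thesis by (simp split: if_splits)
  qed
  show ?thesis using le[of x] le[of "\<ominus>\<^bsub>G\<^esub> x"] x by simp
qed

lemma banach_norm_add:
  assumes G: "abelian_group G" and b: "banach_norm na G nu"
    and x: "x \<in> carrier G" and y: "y \<in> carrier G"
  shows "nu (x \<oplus>\<^bsub>G\<^esub> y) \<le> (if na then max (nu x) (nu y) else nu x + nu y)"
    and "nu (x \<oplus>\<^bsub>G\<^esub> y) \<le> nu x + nu y"
    and "nu (x \<ominus>\<^bsub>G\<^esub> y) \<le> nu x + nu y"
proof -
  interpret abelian_group G by fact
  have "nu (x \<ominus>\<^bsub>G\<^esub> (\<ominus>\<^bsub>G\<^esub> y)) \<le> (if na then max (nu x) (nu (\<ominus>\<^bsub>G\<^esub> y)) else nu x + nu (\<ominus>\<^bsub>G\<^esub> y))"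
    using b x y unfolding banach_norm_def by auto
  moreover have "x \<ominus>\<^bsub>G\<^esub> (\<ominus>\<^bsub>G\<^esub> y) = x \<oplus>\<^bsub>G\<^esub> y" using x y by (simp add: minus_eq)
  ultimately show *: "nu (x \<oplus>\<^bsub>G\<^esub> y) \<le> (if na then max (nu x) (nu y) else nu x + nu y)"
    using banach_norm_minus[OF G b y] by (auto split: if_splits)
  have nn: "0 \<le> nu x" "0 \<le> nu y" using b x y unfolding banach_norm_def by auto
  show "nu (x \<oplus>\<^bsub>G\<^esub> y) \<le> nu x + nu y" using * nn by (simp split: if_splits)
  have "nu (x \<ominus>\<^bsub>G\<^esub> y) \<le> (if na then max (nu x) (nu y) else nu x + nu y)"
    using b x y unfolding banach_norm_def by auto
  then show "nu (x \<ominus>\<^bsub>G\<^esub> y) \<le> nu x + nu y" using nn by (simp split: if_splits)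
qed

lemma banach_norm_complete:
  assumes "banach_norm na G nu" and "\<And>n::nat. s n \<in> carrier G"
    and "\<forall>e>0. \<exists>N. \<forall>m\<ge>N. \<forall>n\<ge>N. nu (s m \<ominus>\<^bsub>G\<^esub> s n) < e"
  shows "\<exists>x\<in>carrier G. (\<lambda>n. nu (s n \<ominus>\<^bsub>G\<^esub> x)) \<longlonglongrightarrow> 0"
proof -
  have "range s \<subseteq> carrier G" using assms(2) by auto
  with assms(1,3) show ?thesis unfolding banach_norm_def by presburger
qed

lemma abelian_group_diff:
  assumes "abelian_group G" and x: "x \<in> carrier G" and y: "y \<in> carrier G" and z: "z \<in> carrier G"
  shows "x \<ominus>\<^bsub>G\<^esub> z = (x \<ominus>\<^bsub>G\<^esub> y) \<oplus>\<^bsub>G\<^esub> (y \<ominus>\<^bsub>G\<^esub> z)"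
    and "y = x \<ominus>\<^bsub>G\<^esub> (x \<ominus>\<^bsub>G\<^esub> y)"
proof -
  interpret abelian_group G by fact
  have "(x \<ominus>\<^bsub>G\<^esub> y) \<oplus>\<^bsub>G\<^esub> (y \<ominus>\<^bsub>G\<^esub> z) = x \<oplus>\<^bsub>G\<^esub> (\<ominus>\<^bsub>G\<^esub> y \<oplus>\<^bsub>G\<^esub> (y \<oplus>\<^bsub>G\<^esub> \<ominus>\<^bsub>G\<^esub> z))"
    using x y z by (simp add: minus_eq a_assoc)
  also have "\<dots> = x \<ominus>\<^bsub>G\<^esub> z" using x y z by (simp add: minus_eq r_neg1)
  finally show "x \<ominus>\<^bsub>G\<^esub> z = (x \<ominus>\<^bsub>G\<^esub> y) \<oplus>\<^bsub>G\<^esub> (y \<ominus>\<^bsub>G\<^esub> z)" by simp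
  have "x \<ominus>\<^bsub>G\<^esub> (x \<ominus>\<^bsub>G\<^esub> y) = x \<oplus>\<^bsub>G\<^esub> (\<ominus>\<^bsub>G\<^esub> x \<oplus>\<^bsub>G\<^esub> y)"
    using x y by (simp add: minus_eq minus_add)
  also have "\<dots> = y" using x y by (simp add: r_neg2)
  finally show "y = x \<ominus>\<^bsub>G\<^esub> (x \<ominus>\<^bsub>G\<^esub> y)" by simp
qed

lemma banach_moduleD:
  assumes "banach_module na R M"
  shows "module R M" "abelian_group M" "cring R" "banach_norm na M (nm M)"
    "\<And>a x. a \<in> carrier R \<Longrightarrow> x \<in> carrier M \<Longrightarrow> nm M (a \<odot>\<^bsub>M\<^esub> x) \<le> rnm R a * nm M x"
    "\<And>x. x \<in> carrier M \<Longrightarrow> 0 \<le> nm M x"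
    "\<And>x. x \<in> carrier M \<Longrightarrow> nm M x = 0 \<longleftrightarrow> x = \<zero>\<^bsub>M\<^esub>"
  using assms unfolding banach_module_def banach_norm_def module_def by auto

lemma Inf_bound:
  fixes a b :: "'i \<Rightarrow> real"
  assumes ex: "\<exists>C. \<forall>i\<in>I. a i \<le> C * b i" and b: "\<And>i. i \<in> I \<Longrightarrow> 0 \<le> b i"
  defines "c \<equiv> Inf {C. 0 \<le> C \<and> (\<forall>i\<in>I. a i \<le> C * b i)}"
  shows "0 \<le> c" "\<And>i. i \<in> I \<Longrightarrow> a i \<le> c * b i"
    "\<And>C. 0 \<le> C \<Longrightarrow> (\<And>i. i \<in> I \<Longrightarrow> a i \<le> C * b i) \<Longrightarrow> c \<le> C"
proof -
  let ?S = "{C. 0 \<le> C \<and> (\<forall>i\<in>I. a i \<le> C * b i)}"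
  obtain C0 where C0: "\<forall>i\<in>I. a i \<le> C0 * b i" using ex by blast
  have "max 0 C0 \<in> ?S"
    using C0 b by (auto intro: order_trans[OF _ mult_right_mono])
  then have ne: "?S \<noteq> {}" by blast
  have bdd: "bdd_below ?S" by (rule bdd_belowI[of _ 0]) auto
  show "0 \<le> c" unfolding c_def using ne by (intro cInf_greatest) auto
  show "c \<le> C" if "0 \<le> C" "\<And>i. i \<in> I \<Longrightarrow> a i \<le> C * b i" for C
    unfolding c_def using that bdd by (intro cInf_lower) auto
  show "a i \<le> c * b i" if i: "i \<in> I" for i
  proof (cases "b i = 0")
    case True then show ?thesis using C0 i by fastforce
  next
    case False
    then have pos: "0 < b i" using b[OF i] by simp
    have "a i / b i \<le> c" unfolding c_def
      using ne i pos by (intro cInf_greatest) (auto simp: divide_le_eq)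
    then show ?thesis using pos by (simp add: divide_le_eq)
  qed
qed

text \<open>Both \<open>ban_hom\<close> and \<open>bounded_families\<close> are instances of the following construction.\<close>

definition bounded_fun ::
    "'i set \<Rightarrow> ('i \<Rightarrow> ('r, 'm) nmodule) \<Rightarrow> ('i \<Rightarrow> real) \<Rightarrow> (('i \<Rightarrow> 'm) \<Rightarrow> bool) \<Rightarrow> ('r, 'i \<Rightarrow> 'm) nmodule"
  where
  "bounded_fun I M \<phi> P = \<lparr>
     carrier = {x \<in> PiE I (\<lambda>i. carrier (M i)). P x \<and> (\<exists>C. \<forall>i\<in>I. nm (M i) (x i) \<le> C * \<phi> i)},
     mult = undefined, one = undefined,
     zero = (\<lambda>i\<in>I. \<zero>\<^bsub>M i\<^esub>),
     add = (\<lambda>x y. \<lambda>i\<in>I. x i \<oplus>\<^bsub>M i\<^esub> y i),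
     smult = (\<lambda>a x. \<lambda>i\<in>I. a \<odot>\<^bsub>M i\<^esub> x i),
     nm = (\<lambda>x. Inf {C. 0 \<le> C \<and> (\<forall>i\<in>I. nm (M i) (x i) \<le> C * \<phi> i)}) \<rparr>"

lemma bounded_fun_nm:
  assumes x: "x \<in> carrier (bounded_fun I M \<phi> P)" and \<phi>: "\<And>i. i \<in> I \<Longrightarrow> 0 \<le> \<phi> i"
  shows "0 \<le> nm (bounded_fun I M \<phi> P) x"
    "\<And>i. i \<in> I \<Longrightarrow> nm (M i) (x i) \<le> nm (bounded_fun I M \<phi> P) x * \<phi> i"
  using x by (auto simp: bounded_fun_def intro!: Inf_bound(1) Inf_bound(2) \<phi>)

lemma bounded_fun_nm_le:
  assumes \<phi>: "\<And>i. i \<in> I \<Longrightarrow> 0 \<le> \<phi> i" and "0 \<le> C" "\<And>i. i \<in> I \<Longrightarrow> nm (M i) (x i) \<le> C * \<phi> i"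
  shows "nm (bounded_fun I M \<phi> P) x \<le> C"
  using assms unfolding bounded_fun_def by (auto intro!: Inf_bound(3))

lemma bounded_fun_banach:
  fixes I :: "'i set" and M :: "'i \<Rightarrow> ('r, 'm) nmodule"
  assumes R: "banach_ring na R"
    and M: "\<And>i. i \<in> I \<Longrightarrow> banach_module na R (M i)" and \<phi>: "\<And>i. i \<in> I \<Longrightarrow> 0 \<le> \<phi> i"
    and P0: "P (\<lambda>i\<in>I. \<zero>\<^bsub>M i\<^esub>)"
    and Pa: "\<And>x y. x \<in> PiE I (\<lambda>i. carrier (M i)) \<Longrightarrow> y \<in> PiE I (\<lambda>i. carrier (M i)) \<Longrightarrow>
      P x \<Longrightarrow> P y \<Longrightarrow> P (\<lambda>i\<in>I. x i \<oplus>\<^bsub>M i\<^esub> y i)"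
    and Ps: "\<And>a x. a \<in> carrier R \<Longrightarrow> x \<in> PiE I (\<lambda>i. carrier (M i)) \<Longrightarrow>
      P x \<Longrightarrow> P (\<lambda>i\<in>I. a \<odot>\<^bsub>M i\<^esub> x i)"
    and Pl: "\<And>s x. (\<And>n::nat. s n \<in> PiE I (\<lambda>i. carrier (M i))) \<Longrightarrow> (\<And>n. P (s n)) \<Longrightarrow>
      x \<in> PiE I (\<lambda>i. carrier (M i)) \<Longrightarrow>
      (\<And>i. i \<in> I \<Longrightarrow> (\<lambda>n. nm (M i) (s n i \<ominus>\<^bsub>M i\<^esub> x i)) \<longlonglongrightarrow> 0) \<Longrightarrow> P x"
  shows "banach_module na R (bounded_fun I M \<phi> P)"
proof -
  let ?B = "bounded_fun I M \<phi> P"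
  let ?n = "nm ?B"
  note MD = banach_moduleD[OF M]
  have crR: "cring R" using R unfolding banach_ring_def by simp
  interpret R: cring R by fact
  have Mm: "module R (M i)" if "i \<in> I" for i using MD(1)[OF that] .
  have Mg: "abelian_group (M i)" if "i \<in> I" for i using MD(2)[OF that] .
  have smc: "a \<odot>\<^bsub>M i\<^esub> z \<in> carrier (M i)" if "a \<in> carrier R" "i \<in> I" "z \<in> carrier (M i)" for a i z
    using module.smult_closed[OF Mm[OF that(2)] that(1,3)] .
  have nn: "0 \<le> nm (M i) z" if "i \<in> I" "z \<in> carrier (M i)" for i z using MD(6)[OF that] .
  have n0: "nm (M i) \<zero>\<^bsub>M i\<^esub> = 0" if "i \<in> I" for i
    using MD(7)[OF that] abelian_group.axioms(1)[OF Mg[OF that]] abelian_monoid.zero_closed by blast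
  have Rnn: "0 \<le> rnm R a" if "a \<in> carrier R" for a
    using R that unfolding banach_ring_def banach_norm_def by auto
  have cI: "x \<in> carrier ?B"
    if "x \<in> PiE I (\<lambda>i. carrier (M i))" "P x" "\<And>i. i \<in> I \<Longrightarrow> nm (M i) (x i) \<le> C * \<phi> i" for x C
    using that unfolding bounded_fun_def by auto
  have cD: "x \<in> PiE I (\<lambda>i. carrier (M i))" "P x" if "x \<in> carrier ?B" for x
    using that unfolding bounded_fun_def by auto
  have cDi: "x i \<in> carrier (M i)" if "x \<in> carrier ?B" "i \<in> I" for x i
    using cD(1)[OF that(1)] that(2) by auto
  have nD: "0 \<le> ?n x" "\<And>i. i \<in> I \<Longrightarrow> nm (M i) (x i) \<le> ?n x * \<phi> i" if "x \<in> carrier ?B" for x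
    using bounded_fun_nm(1,2)[OF that \<phi>] by auto
  have ext: "x = y" if "x \<in> carrier ?B" "y \<in> carrier ?B" "\<And>i. i \<in> I \<Longrightarrow> x i = y i" for x y
    using PiE_ext[OF cD(1)[OF that(1)] cD(1)[OF that(2)] that(3)] by blast
  have zero: "\<zero>\<^bsub>?B\<^esub> = (\<lambda>i\<in>I. \<zero>\<^bsub>M i\<^esub>)" and add: "\<And>x y. x \<oplus>\<^bsub>?B\<^esub> y = (\<lambda>i\<in>I. x i \<oplus>\<^bsub>M i\<^esub> y i)"
    and sm: "\<And>a x. a \<odot>\<^bsub>?B\<^esub> x = (\<lambda>i\<in>I. a \<odot>\<^bsub>M i\<^esub> x i)"
    unfolding bounded_fun_def by auto
  have z_in: "\<zero>\<^bsub>?B\<^esub> \<in> carrier ?B"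
    unfolding zero using P0 n0 Mg by (intro cI[where C=0]) (auto simp: abelian_group.axioms(1) abelian_monoid.zero_closed)
  have a_in: "x \<oplus>\<^bsub>?B\<^esub> y \<in> carrier ?B" if x: "x \<in> carrier ?B" and y: "y \<in> carrier ?B" for x y
  proof (unfold add, rule cI)
    show "(\<lambda>i\<in>I. x i \<oplus>\<^bsub>M i\<^esub> y i) \<in> PiE I (\<lambda>i. carrier (M i))"
      using cDi[OF x] cDi[OF y] Mg by (auto simp: abelian_group.axioms(1) abelian_monoid.a_closed)
    show "P (\<lambda>i\<in>I. x i \<oplus>\<^bsub>M i\<^esub> y i)" using Pa cD x y by blast
    fix i assume i: "i \<in> I"
    have "nm (M i) (x i \<oplus>\<^bsub>M i\<^esub> y i) \<le> nm (M i) (x i) + nm (M i) (y i)"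
      using banach_norm_add(2)[OF Mg[OF i] MD(4)[OF i]] cDi x y i by blast
    also have "\<dots> \<le> (?n x + ?n y) * \<phi> i" using nD(2)[OF x i] nD(2)[OF y i] by (simp add: distrib_right)
    finally show "nm (M i) ((\<lambda>i\<in>I. x i \<oplus>\<^bsub>M i\<^esub> y i) i) \<le> (?n x + ?n y) * \<phi> i" using i by simp
  qed
  have sb: "nm (M i) (a \<odot>\<^bsub>M i\<^esub> x i) \<le> (rnm R a * ?n x) * \<phi> i"
    if a: "a \<in> carrier R" and x: "x \<in> carrier ?B" and i: "i \<in> I" for a x i
  proof -
    have "nm (M i) (a \<odot>\<^bsub>M i\<^esub> x i) \<le> rnm R a * nm (M i) (x i)"
      using MD(5)[OF i a] cDi[OF x i] by blast
    also have "\<dots> \<le> rnm R a * (?n x * \<phi> i)" using nD(2)[OF x i] Rnn[OF a] by (intro mult_left_mono) auto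
    finally show ?thesis by (simp add: mult.assoc)
  qed
  have s_in: "a \<odot>\<^bsub>?B\<^esub> x \<in> carrier ?B" if a: "a \<in> carrier R" and x: "x \<in> carrier ?B" for a x
  proof (unfold sm, rule cI)
    show "(\<lambda>i\<in>I. a \<odot>\<^bsub>M i\<^esub> x i) \<in> PiE I (\<lambda>i. carrier (M i))"
      using cDi[OF x] a smc by auto
    show "P (\<lambda>i\<in>I. a \<odot>\<^bsub>M i\<^esub> x i)" using Ps cD x a by blast
    fix i assume i: "i \<in> I"
    show "nm (M i) ((\<lambda>i\<in>I. a \<odot>\<^bsub>M i\<^esub> x i) i) \<le> (rnm R a * ?n x) * \<phi> i" using i sb[OF a x i] by simp
  qed
  have m1: "(\<ominus>\<^bsub>R\<^esub> \<one>\<^bsub>R\<^esub>) \<odot>\<^bsub>M i\<^esub> z = \<ominus>\<^bsub>M i\<^esub> z" if "i \<in> I" "z \<in> carrier (M i)" for i z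
    using module.smult_l_minus[OF Mm[OF that(1)], of "\<one>\<^bsub>R\<^esub>" z] that
    by (simp add: module.smult_one[OF Mm[OF that(1)]])
  note cl = a_in s_in z_in R.a_closed R.m_closed R.a_inv_closed R.one_closed
  have grp: "abelian_group ?B"
  proof (rule abelian_groupI)
    fix x y z assume x: "x \<in> carrier ?B" and y: "y \<in> carrier ?B" and z: "z \<in> carrier ?B"
    show "x \<oplus>\<^bsub>?B\<^esub> y \<oplus>\<^bsub>?B\<^esub> z = x \<oplus>\<^bsub>?B\<^esub> (y \<oplus>\<^bsub>?B\<^esub> z)"
      by (rule ext, (blast intro: cl x y z)[1], (blast intro: cl x y z)[1],
        use  x y z cDi Mg smc R.a_inv_closed in \<open>auto simp: add abelian_group.axioms(1) abelian_monoid.a_assoc\<close>)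
  next
    fix x y assume x: "x \<in> carrier ?B" and y: "y \<in> carrier ?B"
    show "x \<oplus>\<^bsub>?B\<^esub> y = y \<oplus>\<^bsub>?B\<^esub> x"
      by (rule ext, (blast intro: cl x y)[1], (blast intro: cl x y)[1],
        use  x y cDi Mg smc R.a_inv_closed in \<open>auto simp: add abelian_group.axioms(1) abelian_monoid.a_comm\<close>)
    show "x \<oplus>\<^bsub>?B\<^esub> y \<in> carrier ?B" using a_in x y .
  next
    fix x assume x: "x \<in> carrier ?B"
    show "\<zero>\<^bsub>?B\<^esub> \<oplus>\<^bsub>?B\<^esub> x = x"
      by (rule ext, (blast intro: cl x)[1], (blast intro: cl x)[1],
        use   x cDi Mg smc R.a_inv_closed in \<open>auto simp: add zero abelian_group.axioms(1) abelian_monoid.l_zero\<close>)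
    show "\<exists>y\<in>carrier ?B. y \<oplus>\<^bsub>?B\<^esub> x = \<zero>\<^bsub>?B\<^esub>"
    proof (rule bexI)
      show *: "(\<ominus>\<^bsub>R\<^esub> \<one>\<^bsub>R\<^esub>) \<odot>\<^bsub>?B\<^esub> x \<in> carrier ?B" using s_in x by simp
      show "(\<ominus>\<^bsub>R\<^esub> \<one>\<^bsub>R\<^esub>) \<odot>\<^bsub>?B\<^esub> x \<oplus>\<^bsub>?B\<^esub> x = \<zero>\<^bsub>?B\<^esub>"
        by (rule ext, (blast intro: cl x *)[1], (blast intro: cl x *)[1],
        use   x cDi Mg smc R.a_inv_closed in \<open>auto simp: add zero sm m1 abelian_group.l_neg\<close>)
    qed
  qed (use z_in in auto)
  interpret B: abelian_group ?B by fact
  have mod: "module R ?B"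
  proof (rule moduleI)
    fix a b x y assume a: "a \<in> carrier R" and b: "b \<in> carrier R" and x: "x \<in> carrier ?B"
    show "(a \<oplus>\<^bsub>R\<^esub> b) \<odot>\<^bsub>?B\<^esub> x = a \<odot>\<^bsub>?B\<^esub> x \<oplus>\<^bsub>?B\<^esub> b \<odot>\<^bsub>?B\<^esub> x"
      by (rule ext, (blast intro: cl x a b)[1], (blast intro: cl x a b)[1],
        use   x cDi a b smc R.a_inv_closed in \<open>auto simp: add sm module.smult_l_distr[OF Mm]\<close>)
    show "(a \<otimes>\<^bsub>R\<^esub> b) \<odot>\<^bsub>?B\<^esub> x = a \<odot>\<^bsub>?B\<^esub> (b \<odot>\<^bsub>?B\<^esub> x)"
      by (rule ext, (blast intro: cl x a b)[1], (blast intro: cl x a b)[1],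
        use   x cDi a b smc R.a_inv_closed in \<open>auto simp: add sm module.smult_assoc1[OF Mm]\<close>)
  next
    fix a x y assume a: "a \<in> carrier R" and x: "x \<in> carrier ?B" and y: "y \<in> carrier ?B"
    show "a \<odot>\<^bsub>?B\<^esub> (x \<oplus>\<^bsub>?B\<^esub> y) = a \<odot>\<^bsub>?B\<^esub> x \<oplus>\<^bsub>?B\<^esub> a \<odot>\<^bsub>?B\<^esub> y"
      by (rule ext, (blast intro: cl x y a)[1], (blast intro: cl x y a)[1],
        use   x y cDi a smc R.a_inv_closed in \<open>auto simp: add sm module.smult_r_distr[OF Mm]\<close>)
  next
    fix x assume x: "x \<in> carrier ?B"
    show "\<one>\<^bsub>R\<^esub> \<odot>\<^bsub>?B\<^esub> x = x"
      by (rule ext, (blast intro: cl x)[1], (blast intro: cl x)[1],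
        use  x cDi smc R.a_inv_closed in \<open>auto simp: sm module.smult_one[OF Mm]\<close>)
  qed (use s_in crR grp in auto)
  have mi: "(\<ominus>\<^bsub>?B\<^esub> x) i = \<ominus>\<^bsub>M i\<^esub> x i" if x: "x \<in> carrier ?B" and i: "i \<in> I" for x i
  proof -
    have "\<ominus>\<^bsub>?B\<^esub> x = (\<ominus>\<^bsub>R\<^esub> \<one>\<^bsub>R\<^esub>) \<odot>\<^bsub>?B\<^esub> x"
      using module.smult_l_minus[OF mod, of "\<one>\<^bsub>R\<^esub>" x] x by (simp add: module.smult_one[OF mod])
    then show ?thesis using m1 cDi x i by (simp add: sm)
  qed
  have di: "(x \<ominus>\<^bsub>?B\<^esub> y) i = x i \<ominus>\<^bsub>M i\<^esub> y i"
    if x: "x \<in> carrier ?B" and y: "y \<in> carrier ?B" and i: "i \<in> I" for x y i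
    using mi[OF y i] i by (simp add: a_minus_def add)
  have norm: "banach_norm na ?B ?n"
    unfolding banach_norm_def
  proof (intro conjI ballI allI impI)
    fix x assume x: "x \<in> carrier ?B"
    show "0 \<le> ?n x" using nD(1)[OF x] .
    show "(?n x = 0) = (x = \<zero>\<^bsub>?B\<^esub>)"
    proof
      assume 0: "?n x = 0"
      show "x = \<zero>\<^bsub>?B\<^esub>"
      proof (rule ext[OF x z_in])
        fix i assume i: "i \<in> I"
        have "nm (M i) (x i) = 0" using nD(2)[OF x i] 0 nn[OF i cDi[OF x i]] by simp
        then show "x i = \<zero>\<^bsub>?B\<^esub> i" using MD(7)[OF i cDi[OF x i]] i by (simp add: zero)
      qed
    next
      assume "x = \<zero>\<^bsub>?B\<^esub>"
      then have "?n x \<le> 0" using n0 by (intro bounded_fun_nm_le \<phi>) (auto simp: zero)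
      then show "?n x = 0" using nD(1)[OF x] by simp
    qed
  next
    fix x y assume x: "x \<in> carrier ?B" and y: "y \<in> carrier ?B"
    let ?C = "if na then max (?n x) (?n y) else ?n x + ?n y"
    show "?n (x \<ominus>\<^bsub>?B\<^esub> y) \<le> ?C"
    proof (rule bounded_fun_nm_le[OF \<phi>])
      show "0 \<le> ?C" using nD(1)[OF x] nD(1)[OF y] by auto
      fix i assume i: "i \<in> I"
      have "nm (M i) (x i \<ominus>\<^bsub>M i\<^esub> y i) \<le>
          (if na then max (nm (M i) (x i)) (nm (M i) (y i)) else nm (M i) (x i) + nm (M i) (y i))"
        using MD(4)[OF i] cDi[OF x i] cDi[OF y i] unfolding banach_norm_def by auto
      also have "\<dots> \<le> ?C * \<phi> i"
      proof -
        have "nm (M i) (x i) \<le> max (?n x) (?n y) * \<phi> i" "nm (M i) (y i) \<le> max (?n x) (?n y) * \<phi> i"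
          using nD(2)[OF x i] nD(2)[OF y i] \<phi>[OF i]
          by (auto intro: order_trans[OF _ mult_right_mono])
        then show ?thesis using nD(2)[OF x i] nD(2)[OF y i] by (auto simp: distrib_right)
      qed
      finally show "nm (M i) ((x \<ominus>\<^bsub>?B\<^esub> y) i) \<le> ?C * \<phi> i" using di[OF x y i] by simp
    qed
  next
    fix s :: "nat \<Rightarrow> 'i \<Rightarrow> 'm"
    assume s: "range s \<subseteq> carrier ?B \<and> (\<forall>e>0. \<exists>N. \<forall>m\<ge>N. \<forall>n\<ge>N. ?n (s m \<ominus>\<^bsub>?B\<^esub> s n) < e)"
    have sc: "\<exists>N. \<forall>m\<ge>N. \<forall>n\<ge>N. ?n (s m \<ominus>\<^bsub>?B\<^esub> s n) < e" if "0 < e" for e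
      using s that by simp
    have sin: "s n \<in> carrier ?B" for n using s by auto
    have dle: "nm (M i) (s m i \<ominus>\<^bsub>M i\<^esub> s n i) \<le> ?n (s m \<ominus>\<^bsub>?B\<^esub> s n) * \<phi> i" if i: "i \<in> I" for m n i
      using nD(2)[OF B.minus_closed[OF sin sin] i, of m n] di[OF sin sin i, of m n] by simp
    have ci: "\<exists>z\<in>carrier (M i). (\<lambda>n. nm (M i) (s n i \<ominus>\<^bsub>M i\<^esub> z)) \<longlonglongrightarrow> 0" if i: "i \<in> I" for i
    proof -
      have "\<exists>N. \<forall>m\<ge>N. \<forall>n\<ge>N. nm (M i) (s m i \<ominus>\<^bsub>M i\<^esub> s n i) < e" if e: "0 < e" for e
      proof -
        have p: "0 < 1 + \<phi> i" using \<phi>[OF i] by simp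
        then have e': "0 < e / (1 + \<phi> i)" using e by simp
        then obtain N where N: "\<And>m n. m \<ge> N \<Longrightarrow> n \<ge> N \<Longrightarrow> ?n (s m \<ominus>\<^bsub>?B\<^esub> s n) < e / (1 + \<phi> i)"
          using sc[OF e'] by auto
        have "nm (M i) (s m i \<ominus>\<^bsub>M i\<^esub> s n i) < e" if "m \<ge> N" "n \<ge> N" for m n
        proof -
          have "?n (s m \<ominus>\<^bsub>?B\<^esub> s n) * \<phi> i \<le> ?n (s m \<ominus>\<^bsub>?B\<^esub> s n) * (1 + \<phi> i)"
            using nD(1)[OF B.minus_closed[OF sin sin], of m n] by (simp add: distrib_left)
          also have "\<dots> < e" using N[OF that] p by (simp add: pos_less_divide_eq)
          finally show ?thesis using dle[OF i, of m n] by simp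
        qed
        then show ?thesis by blast
      qed
      moreover have "range (\<lambda>n. s n i) \<subseteq> carrier (M i)" using cDi[OF sin i] by auto
      ultimately show ?thesis by (intro banach_norm_complete[OF MD(4)[OF i]]) auto
    qed
    then obtain y where y: "\<And>i. i \<in> I \<Longrightarrow> y i \<in> carrier (M i)"
      "\<And>i. i \<in> I \<Longrightarrow> (\<lambda>n. nm (M i) (s n i \<ominus>\<^bsub>M i\<^esub> y i)) \<longlonglongrightarrow> 0" by metis
    define x where "x = (\<lambda>i\<in>I. y i)"
    have xP: "x \<in> PiE I (\<lambda>i. carrier (M i))" using y by (auto simp: x_def)
    have xl: "(\<lambda>n. nm (M i) (s n i \<ominus>\<^bsub>M i\<^esub> x i)) \<longlonglongrightarrow> 0" if "i \<in> I" for i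
      using y(2)[OF that] that by (simp add: x_def)
    have Px: "P x" using Pl[OF cD(1)[OF sin] cD(2)[OF sin] xP xl] .
    have bnd: "nm (M i) (s n i \<ominus>\<^bsub>M i\<^esub> x i) \<le> e * \<phi> i"
      if i: "i \<in> I" and N: "\<And>m. m \<ge> N \<Longrightarrow> ?n (s n \<ominus>\<^bsub>?B\<^esub> s m) \<le> e" for i n e N
    proof -
      interpret Mi: abelian_group "M i" using Mg[OF i] .
      have xi: "x i \<in> carrier (M i)" using xP i by auto
      have "nm (M i) (s n i \<ominus>\<^bsub>M i\<^esub> x i) \<le> e * \<phi> i + nm (M i) (s m i \<ominus>\<^bsub>M i\<^esub> x i)" if m: "m \<ge> N" for m
      proof -
        have "s n i \<ominus>\<^bsub>M i\<^esub> x i = (s n i \<ominus>\<^bsub>M i\<^esub> s m i) \<oplus>\<^bsub>M i\<^esub> (s m i \<ominus>\<^bsub>M i\<^esub> x i)"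
          by (rule abelian_group_diff(1)[OF Mg[OF i] cDi[OF sin i] cDi[OF sin i] xi])
        then have "nm (M i) (s n i \<ominus>\<^bsub>M i\<^esub> x i) \<le> nm (M i) (s n i \<ominus>\<^bsub>M i\<^esub> s m i) + nm (M i) (s m i \<ominus>\<^bsub>M i\<^esub> x i)"
          using banach_norm_add(2)[OF Mg[OF i] MD(4)[OF i]] cDi[OF sin i] xi by simp
        also have "nm (M i) (s n i \<ominus>\<^bsub>M i\<^esub> s m i) \<le> e * \<phi> i"
          by (rule order_trans[OF dle[OF i] mult_right_mono[OF N[OF m] \<phi>[OF i]]])
        finally show ?thesis by simp
      qed
      moreover have "(\<lambda>m. e * \<phi> i + nm (M i) (s m i \<ominus>\<^bsub>M i\<^esub> x i)) \<longlonglongrightarrow> e * \<phi> i + 0"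
        by (intro tendsto_intros xl[OF i])
      ultimately show ?thesis
        by (intro LIMSEQ_le_const[of _ "e * \<phi> i"]) auto
    qed
    have xB: "x \<in> carrier ?B"
    proof -
      obtain N where N: "\<And>m n. m \<ge> N \<Longrightarrow> n \<ge> N \<Longrightarrow> ?n (s m \<ominus>\<^bsub>?B\<^esub> s n) < 1"
        using sc[of 1] by auto
      have "nm (M i) (x i) \<le> (1 + ?n (s N)) * \<phi> i" if i: "i \<in> I" for i
      proof -
        interpret Mi: abelian_group "M i" using Mg[OF i] .
        have xi: "x i \<in> carrier (M i)" using xP i by auto
        have "x i = s N i \<ominus>\<^bsub>M i\<^esub> (s N i \<ominus>\<^bsub>M i\<^esub> x i)"
          by (rule abelian_group_diff(2)[OF Mg[OF i] cDi[OF sin i] xi xi])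
        then have "nm (M i) (x i) \<le> nm (M i) (s N i) + nm (M i) (s N i \<ominus>\<^bsub>M i\<^esub> x i)"
          using banach_norm_add(3)[OF Mg[OF i] MD(4)[OF i], of "s N i" "s N i \<ominus>\<^bsub>M i\<^esub> x i"] cDi[OF sin i, of N] xi
          by simp
        also have "\<dots> \<le> ?n (s N) * \<phi> i + 1 * \<phi> i"
          using N[of N] by (intro add_mono nD(2)[OF sin i] bnd[OF i, of N]) (auto intro: less_imp_le)
        finally show ?thesis by (simp add: distrib_right)
      qed
      then show ?thesis using cI[OF xP Px] by blast
    qed
    have "(\<lambda>n. ?n (s n \<ominus>\<^bsub>?B\<^esub> x)) \<longlonglongrightarrow> 0"
    proof (rule LIMSEQ_I)
      fix e :: real assume e: "0 < e"
      then obtain N where N: "\<And>m n. m \<ge> N \<Longrightarrow> n \<ge> N \<Longrightarrow> ?n (s m \<ominus>\<^bsub>?B\<^esub> s n) < e / 2"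
        using sc[of "e / 2"] by auto
      have "norm (?n (s n \<ominus>\<^bsub>?B\<^esub> x) - 0) < e" if n: "n \<ge> N" for n
      proof -
        have "?n (s n \<ominus>\<^bsub>?B\<^esub> x) \<le> e / 2"
        proof (rule bounded_fun_nm_le[OF \<phi>])
          fix i assume i: "i \<in> I"
          have "nm (M i) (s n i \<ominus>\<^bsub>M i\<^esub> x i) \<le> e / 2 * \<phi> i"
            using bnd[OF i, of N n "e / 2"] N[OF n] by (auto intro: less_imp_le)
          then show "nm (M i) ((s n \<ominus>\<^bsub>?B\<^esub> x) i) \<le> e / 2 * \<phi> i" using di[OF sin xB i] by simp
        qed (use e in auto)
        then show ?thesis using nD(1)[OF B.minus_closed[OF sin xB], of n] e by simp
      qed
      then show "\<exists>N. \<forall>n\<ge>N. norm (?n (s n \<ominus>\<^bsub>?B\<^esub> x) - 0) < e" by blast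
    qed
    then show "\<exists>x\<in>carrier ?B. (\<lambda>n. ?n (s n \<ominus>\<^bsub>?B\<^esub> x)) \<longlonglongrightarrow> 0" using xB by blast
  qed
  have "?n (a \<odot>\<^bsub>?B\<^esub> x) \<le> rnm R a * ?n x" if a: "a \<in> carrier R" and x: "x \<in> carrier ?B" for a x
    using sb[OF a x] Rnn[OF a] nD(1)[OF x] by (intro bounded_fun_nm_le[OF \<phi>]) (auto simp: sm)
  then show ?thesis unfolding banach_module_def using mod norm by blast
qed

lemma banach_conv_unique:
  assumes M: "banach_module na R M" and s: "\<And>n::nat. s n \<in> carrier M"
    and x: "x \<in> carrier M" and y: "y \<in> carrier M"
    and lx: "(\<lambda>n. nm M (s n \<ominus>\<^bsub>M\<^esub> x)) \<longlonglongrightarrow> 0" and ly: "(\<lambda>n. nm M (s n \<ominus>\<^bsub>M\<^esub> y)) \<longlonglongrightarrow> 0"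
  shows "x = y"
proof -
  interpret abelian_group M using banach_moduleD(2)[OF M] .
  note D = banach_moduleD[OF M]
  have "nm M (x \<ominus>\<^bsub>M\<^esub> y) \<le> nm M (s n \<ominus>\<^bsub>M\<^esub> y) + nm M (s n \<ominus>\<^bsub>M\<^esub> x)" for n
  proof -
    have "x \<ominus>\<^bsub>M\<^esub> y = (s n \<ominus>\<^bsub>M\<^esub> y) \<ominus>\<^bsub>M\<^esub> (s n \<ominus>\<^bsub>M\<^esub> x)"
    proof -
      have "(s n \<ominus>\<^bsub>M\<^esub> y) \<ominus>\<^bsub>M\<^esub> (s n \<ominus>\<^bsub>M\<^esub> x) = s n \<oplus>\<^bsub>M\<^esub> (\<ominus>\<^bsub>M\<^esub> y \<oplus>\<^bsub>M\<^esub> (\<ominus>\<^bsub>M\<^esub> s n \<oplus>\<^bsub>M\<^esub> x))"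
        using s[of n] x y by (simp add: minus_eq minus_add a_assoc)
      also have "\<ominus>\<^bsub>M\<^esub> y \<oplus>\<^bsub>M\<^esub> (\<ominus>\<^bsub>M\<^esub> s n \<oplus>\<^bsub>M\<^esub> x) = \<ominus>\<^bsub>M\<^esub> s n \<oplus>\<^bsub>M\<^esub> (x \<oplus>\<^bsub>M\<^esub> \<ominus>\<^bsub>M\<^esub> y)"
        using s[of n] x y by (simp add: a_ac)
      also have "s n \<oplus>\<^bsub>M\<^esub> \<dots> = x \<ominus>\<^bsub>M\<^esub> y" using s[of n] x y by (simp add: minus_eq r_neg2)
      finally show ?thesis by simp
    qed
    then show ?thesis using banach_norm_add(3)[OF D(2) D(4)] s x y by simp
  qed
  moreover have "(\<lambda>n. nm M (s n \<ominus>\<^bsub>M\<^esub> y) + nm M (s n \<ominus>\<^bsub>M\<^esub> x)) \<longlonglongrightarrow> 0 + 0"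
    by (intro tendsto_intros lx ly)
  ultimately have "nm M (x \<ominus>\<^bsub>M\<^esub> y) \<le> 0" by (intro LIMSEQ_le_const) auto
  then have "nm M (x \<ominus>\<^bsub>M\<^esub> y) = 0" using D(6) x y minus_closed by (metis order_antisym)
  then have 0: "x \<ominus>\<^bsub>M\<^esub> y = \<zero>\<^bsub>M\<^esub>" using D(7) x y minus_closed by blast
  show ?thesis using abelian_group_diff(2)[OF D(2) x y y] x unfolding 0 by (simp add: minus_eq)
qed

lemma null_squeeze:
  fixes f g :: "nat \<Rightarrow> real"
  assumes "\<And>n. 0 \<le> f n" "\<And>n. f n \<le> g n" "g \<longlonglongrightarrow> 0"
  shows "f \<longlonglongrightarrow> 0"
  using assms by (intro tendsto_sandwich[OF _ _ tendsto_const assms(3)]) auto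

lemma banach_conv_add:
  assumes M: "banach_module na R M" and s: "\<And>n::nat. s n \<in> carrier M" and u: "\<And>n. u n \<in> carrier M"
    and x: "x \<in> carrier M" and y: "y \<in> carrier M"
    and lx: "(\<lambda>n. nm M (s n \<ominus>\<^bsub>M\<^esub> x)) \<longlonglongrightarrow> 0" and ly: "(\<lambda>n. nm M (u n \<ominus>\<^bsub>M\<^esub> y)) \<longlonglongrightarrow> 0"
  shows "(\<lambda>n. nm M (s n \<oplus>\<^bsub>M\<^esub> u n \<ominus>\<^bsub>M\<^esub> (x \<oplus>\<^bsub>M\<^esub> y))) \<longlonglongrightarrow> 0"
proof -
  interpret abelian_group M using banach_moduleD(2)[OF M] .
  note D = banach_moduleD[OF M]
  have l: "(\<lambda>n. nm M (s n \<ominus>\<^bsub>M\<^esub> x) + nm M (u n \<ominus>\<^bsub>M\<^esub> y)) \<longlonglongrightarrow> 0"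
    by (rule tendsto_add_zero[OF lx ly])
  have e: "s n \<oplus>\<^bsub>M\<^esub> u n \<ominus>\<^bsub>M\<^esub> (x \<oplus>\<^bsub>M\<^esub> y) = (s n \<ominus>\<^bsub>M\<^esub> x) \<oplus>\<^bsub>M\<^esub> (u n \<ominus>\<^bsub>M\<^esub> y)" for n
    using s[of n] u[of n] x y by (simp add: minus_eq minus_add a_ac)
  have c: "s n \<ominus>\<^bsub>M\<^esub> x \<in> carrier M" "u n \<ominus>\<^bsub>M\<^esub> y \<in> carrier M" for n
    using s[of n] u[of n] x y by simp_all
  show ?thesis unfolding e
    by (rule null_squeeze[OF D(6)[OF a_closed[OF c]] banach_norm_add(2)[OF D(2) D(4) c] l])
qed

lemma blmD:
  assumes "bounded_linear_map R M N f"
  shows "\<And>x. x \<in> carrier M \<Longrightarrow> f x \<in> carrier N"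
    "\<And>x y. x \<in> carrier M \<Longrightarrow> y \<in> carrier M \<Longrightarrow> f (x \<oplus>\<^bsub>M\<^esub> y) = f x \<oplus>\<^bsub>N\<^esub> f y"
    "\<And>a x. a \<in> carrier R \<Longrightarrow> x \<in> carrier M \<Longrightarrow> f (a \<odot>\<^bsub>M\<^esub> x) = a \<odot>\<^bsub>N\<^esub> f x"
  using assms unfolding bounded_linear_map_def by auto

lemma blm_minus:
  assumes M: "banach_module na R M" and N: "banach_module na R N" and f: "bounded_linear_map R M N f"
    and x: "x \<in> carrier M" and y: "y \<in> carrier M"
  shows "f (x \<ominus>\<^bsub>M\<^esub> y) = f x \<ominus>\<^bsub>N\<^esub> f y"
proof -
  interpret M: module R M using banach_moduleD(1)[OF M] .
  interpret N: module R N using banach_moduleD(1)[OF N] .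
  have "f ((\<ominus>\<^bsub>R\<^esub> \<one>\<^bsub>R\<^esub>) \<odot>\<^bsub>M\<^esub> y) = (\<ominus>\<^bsub>R\<^esub> \<one>\<^bsub>R\<^esub>) \<odot>\<^bsub>N\<^esub> f y" using blmD(3)[OF f] y by simp
  then have "f (\<ominus>\<^bsub>M\<^esub> y) = \<ominus>\<^bsub>N\<^esub> f y"
    using blmD(1)[OF f] y by (simp add: M.smult_l_minus N.smult_l_minus)
  then show ?thesis using blmD(2)[OF f x, of "\<ominus>\<^bsub>M\<^esub> y"] y by (simp add: a_minus_def)
qed

lemma blm_bound:
  assumes M: "banach_module na R M" and f: "bounded_linear_map R M N f"
  shows "0 \<le> op_norm M N f" "\<And>x. x \<in> carrier M \<Longrightarrow> nm N (f x) \<le> op_norm M N f * nm M x"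
proof -
  have 1: "\<exists>C. \<forall>x\<in>carrier M. nm N (f x) \<le> C * nm M x" using f unfolding bounded_linear_map_def by blast
  note * = Inf_bound(1,2)[OF 1 banach_moduleD(6)[OF M]]
  show "0 \<le> op_norm M N f" "\<And>x. x \<in> carrier M \<Longrightarrow> nm N (f x) \<le> op_norm M N f * nm M x"
    unfolding op_norm_def using * by auto
qed

lemma blm_conv:
  assumes M: "banach_module na R M" and N: "banach_module na R N" and f: "bounded_linear_map R M N f"
    and s: "\<And>n::nat. s n \<in> carrier M" and x: "x \<in> carrier M"
    and l: "(\<lambda>n. nm M (s n \<ominus>\<^bsub>M\<^esub> x)) \<longlonglongrightarrow> 0"
  shows "(\<lambda>n. nm N (f (s n) \<ominus>\<^bsub>N\<^esub> f x)) \<longlonglongrightarrow> 0"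
proof -
  interpret M: abelian_group M using banach_moduleD(2)[OF M] .
  interpret N: abelian_group N using banach_moduleD(2)[OF N] .
  have e: "f (s n) \<ominus>\<^bsub>N\<^esub> f x = f (s n \<ominus>\<^bsub>M\<^esub> x)" for n
    by (rule blm_minus[OF M N f s x, symmetric])
  have c: "s n \<ominus>\<^bsub>M\<^esub> x \<in> carrier M" for n by (rule M.minus_closed[OF s x])
  show ?thesis unfolding e
    by (rule null_squeeze[OF banach_moduleD(6)[OF N blmD(1)[OF f c]] blm_bound(2)[OF M f c]
          tendsto_mult_right_zero[OF l]])
qed

lemma blm_smult:
  assumes R: "banach_ring na R" and M: "banach_module na R M" and a: "a \<in> carrier R"
  shows "bounded_linear_map R M M (\<lambda>x. a \<odot>\<^bsub>M\<^esub> x)"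
proof -
  interpret M: module R M using banach_moduleD(1)[OF M] .
  show ?thesis unfolding bounded_linear_map_def
    using a banach_moduleD(5)[OF M a]
    by (auto simp: M.smult_r_distr M.smult_assoc1[symmetric] M.R.m_comm)
qed

lemma ring_as_module_banach:
  assumes "banach_ring na R"
  shows "banach_module na R (ring_as_module R)"
proof -
  have R: "cring R" using assms unfolding banach_ring_def by simp
  interpret cring R by fact
  let ?M = "ring_as_module R"
  have s: "carrier ?M = carrier R" "\<zero>\<^bsub>?M\<^esub> = \<zero>\<^bsub>R\<^esub>" "add ?M = add R" "smult ?M = mult R" "nm ?M = rnm R"
    by (auto simp: ring_as_module_def)
  have g: "abelian_group ?M"
    by (rule abelian_groupI) (auto simp: s a_ac intro: bexI[of _ "\<ominus>\<^bsub>R\<^esub> _"] l_neg)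
  have m: "module R ?M"
    by (rule moduleI[OF R g]) (auto simp: s l_distr r_distr m_assoc)
  have i: "a_inv ?M = a_inv R"
    by (auto simp: a_inv_def m_inv_def s)
  have "banach_norm na ?M (nm ?M) = banach_norm na R (rnm R)"
    unfolding banach_norm_def by (simp add: s i a_minus_def)
  then show ?thesis using assms m unfolding banach_module_def banach_ring_def by (simp add: s)
qed

lemma ban_hom_banach:
  assumes R: "banach_ring na R" and M: "banach_module na R M" and N: "banach_module na R N"
  shows "banach_module na R (ban_hom R M N)"
proof -
  interpret M: module R M using banach_moduleD(1)[OF M] .
  interpret N: module R N using banach_moduleD(1)[OF N] .
  define P where "P = (\<lambda>f.
     (\<forall>x\<in>carrier M. \<forall>y\<in>carrier M. f (x \<oplus>\<^bsub>M\<^esub> y) = f x \<oplus>\<^bsub>N\<^esub> f y) \<and>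
     (\<forall>a\<in>carrier R. \<forall>x\<in>carrier M. f (a \<odot>\<^bsub>M\<^esub> x) = a \<odot>\<^bsub>N\<^esub> f x))"
  have eq: "ban_hom R M N = bounded_fun (carrier M) (\<lambda>_. N) (nm M) P"
    unfolding ban_hom_def bounded_fun_def op_norm_def bounded_linear_map_def P_def PiE_def by auto
  show ?thesis unfolding eq
  proof (rule bounded_fun_banach[OF R N])
    show "\<And>i. i \<in> carrier M \<Longrightarrow> 0 \<le> nm M i" by (rule banach_moduleD(6)[OF M])
    show "P (\<lambda>i\<in>carrier M. \<zero>\<^bsub>N\<^esub>)" unfolding P_def by auto
    fix x y assume *: "x \<in> carrier M \<rightarrow>\<^sub>E carrier N" "y \<in> carrier M \<rightarrow>\<^sub>E carrier N" "P x" "P y"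
    show "P (\<lambda>i\<in>carrier M. x i \<oplus>\<^bsub>N\<^esub> y i)"
      using *(3,4) PiE_mem[OF *(1)] PiE_mem[OF *(2)]
      unfolding P_def by (auto simp: N.M.a_ac N.smult_r_distr)
  next
    fix a x assume *: "a \<in> carrier R" "x \<in> carrier M \<rightarrow>\<^sub>E carrier N" "P x"
    show "P (\<lambda>i\<in>carrier M. a \<odot>\<^bsub>N\<^esub> x i)"
      using *(1,3) PiE_mem[OF *(2)]
      unfolding P_def by (auto simp: N.smult_r_distr N.smult_assoc1[symmetric] M.R.m_comm)
  next
    fix s x assume s: "\<And>n::nat. s n \<in> carrier M \<rightarrow>\<^sub>E carrier N" "\<And>n. P (s n)"
      and x: "x \<in> carrier M \<rightarrow>\<^sub>E carrier N"
      and l: "\<And>i. i \<in> carrier M \<Longrightarrow> (\<lambda>n. nm N (s n i \<ominus>\<^bsub>N\<^esub> x i)) \<longlonglongrightarrow> 0"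
    note sm = PiE_mem[OF s(1)] and xm = PiE_mem[OF x]
    show "P x" unfolding P_def
    proof (intro conjI ballI)
      fix i j assume i: "i \<in> carrier M" and j: "j \<in> carrier M"
      have ij: "i \<oplus>\<^bsub>M\<^esub> j \<in> carrier M" using i j by simp
      have e: "s n (i \<oplus>\<^bsub>M\<^esub> j) = s n i \<oplus>\<^bsub>N\<^esub> s n j" for n using s(2)[of n] i j unfolding P_def by blast
      show "x (i \<oplus>\<^bsub>M\<^esub> j) = x i \<oplus>\<^bsub>N\<^esub> x j"
        by (rule banach_conv_unique[OF N sm[OF ij] xm[OF ij] _ l[OF ij]])
          (use xm i j banach_conv_add[OF N sm[OF i] sm[OF j] xm[OF i] xm[OF j] l[OF i] l[OF j]] in \<open>auto simp: e\<close>)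
    next
      fix a i assume a: "a \<in> carrier R" and i: "i \<in> carrier M"
      have ai: "a \<odot>\<^bsub>M\<^esub> i \<in> carrier M" using a i by simp
      have e: "s n (a \<odot>\<^bsub>M\<^esub> i) = a \<odot>\<^bsub>N\<^esub> s n i" for n using s(2)[of n] a i unfolding P_def by blast
      show "x (a \<odot>\<^bsub>M\<^esub> i) = a \<odot>\<^bsub>N\<^esub> x i"
        by (rule banach_conv_unique[OF N sm[OF ai] xm[OF ai] _ l[OF ai]])
          (use a xm[OF i] blm_conv[OF N N blm_smult[OF R N a] sm[OF i] xm[OF i] l[OF i]] in \<open>auto simp: e\<close>)
    qed
  qed
qed

lemma inverse_systemD:
  assumes "inverse_system na R I r M t"
  shows "\<And>i. i \<in> I \<Longrightarrow> r i i"
    "\<And>i j k. i \<in> I \<Longrightarrow> j \<in> I \<Longrightarrow> k \<in> I \<Longrightarrow> r i j \<Longrightarrow> r j k \<Longrightarrow> r i k"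
    "\<And>i. i \<in> I \<Longrightarrow> banach_module na R (M i)"
    "\<And>i j. i \<in> I \<Longrightarrow> j \<in> I \<Longrightarrow> r i j \<Longrightarrow> bounded_linear_map R (M j) (M i) (t i j)"
  using assms unfolding inverse_system_def by blast+

lemma bounded_families_banach:
  assumes R: "banach_ring na R" and S: "inverse_system na R I r M t" and \<phi>: "\<And>i. i \<in> I \<Longrightarrow> 0 < \<phi> i"
  shows "banach_module na R (bounded_families I r M t \<phi>)"
proof -
  note SD = inverse_systemD[OF S]
  define P where "P = (\<lambda>x. \<forall>i\<in>I. \<forall>j\<in>I. r i j \<longrightarrow> t i j (x j) = x i)"
  have eq: "bounded_families I r M t \<phi> = bounded_fun I M \<phi> P"
    unfolding bounded_families_def bounded_fun_def P_def by auto
  show ?thesis unfolding eq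
  proof (rule bounded_fun_banach[OF R SD(3)])
    show "P (\<lambda>i\<in>I. \<zero>\<^bsub>M i\<^esub>)" unfolding P_def
    proof (intro ballI impI)
      fix i j assume i: "i \<in> I" and j: "j \<in> I" and r: "r i j"
      interpret Mi: module R "M i" using banach_moduleD(1)[OF SD(3)[OF i]] .
      interpret Mj: module R "M j" using banach_moduleD(1)[OF SD(3)[OF j]] .
      have "t i j (\<zero>\<^bsub>R\<^esub> \<odot>\<^bsub>M j\<^esub> \<zero>\<^bsub>M j\<^esub>) = \<zero>\<^bsub>R\<^esub> \<odot>\<^bsub>M i\<^esub> t i j \<zero>\<^bsub>M j\<^esub>"
        by (rule blmD(3)[OF SD(4)[OF i j r]]) simp_all
      then show "t i j ((\<lambda>i\<in>I. \<zero>\<^bsub>M i\<^esub>) j) = (\<lambda>i\<in>I. \<zero>\<^bsub>M i\<^esub>) i"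
        using blmD(1)[OF SD(4)[OF i j r]] i j by simp
    qed
    fix x y assume *: "x \<in> (\<Pi>\<^sub>E i\<in>I. carrier (M i))" "y \<in> (\<Pi>\<^sub>E i\<in>I. carrier (M i))" "P x" "P y"
    show "P (\<lambda>i\<in>I. x i \<oplus>\<^bsub>M i\<^esub> y i)"
      using *(3,4) PiE_mem[OF *(1)] PiE_mem[OF *(2)] blmD(2)[OF SD(4)] unfolding P_def by simp
  next
    fix a x assume *: "a \<in> carrier R" "x \<in> (\<Pi>\<^sub>E i\<in>I. carrier (M i))" "P x"
    show "P (\<lambda>i\<in>I. a \<odot>\<^bsub>M i\<^esub> x i)"
      using *(1,3) PiE_mem[OF *(2)] blmD(3)[OF SD(4)] unfolding P_def by simp
  next
    fix s x assume s: "\<And>n::nat. s n \<in> (\<Pi>\<^sub>E i\<in>I. carrier (M i))" "\<And>n. P (s n)"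
      and x: "x \<in> (\<Pi>\<^sub>E i\<in>I. carrier (M i))"
      and l: "\<And>i. i \<in> I \<Longrightarrow> (\<lambda>n. nm (M i) (s n i \<ominus>\<^bsub>M i\<^esub> x i)) \<longlonglongrightarrow> 0"
    note sm = PiE_mem[OF s(1)] and xm = PiE_mem[OF x]
    show "P x" unfolding P_def
    proof (intro ballI impI)
      fix i j assume i: "i \<in> I" and j: "j \<in> I" and r: "r i j"
      have e: "t i j (s n j) = s n i" for n using s(2)[of n] i j r unfolding P_def by blast
      show "t i j (x j) = x i"
        by (rule banach_conv_unique[OF SD(3)[OF i] sm[OF i] _ xm[OF i] _ l[OF i]])
          (use xm[OF j] blmD(1)[OF SD(4)[OF i j r]]
            blm_conv[OF SD(3)[OF j] SD(3)[OF i] SD(4)[OF i j r] sm[OF j] xm[OF j] l[OF j]] in \<open>auto simp: e\<close>)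
    qed
  qed (use \<phi> in \<open>auto intro: less_imp_le\<close>)
qed

lemma bounded_familiesD:
  assumes S: "inverse_system na R I r M t" and \<phi>: "\<And>i. i \<in> I \<Longrightarrow> 0 < \<phi> i"
    and x: "x \<in> carrier (bounded_families I r M t \<phi>)"
  shows "x \<in> PiE I (\<lambda>i. carrier (M i))"
    "\<And>i j. i \<in> I \<Longrightarrow> j \<in> I \<Longrightarrow> r i j \<Longrightarrow> t i j (x j) = x i"
    "0 \<le> nm (bounded_families I r M t \<phi>) x"
    "\<And>i. i \<in> I \<Longrightarrow> nm (M i) (x i) \<le> nm (bounded_families I r M t \<phi>) x * \<phi> i"
  using x \<phi> Inf_bound(1,2)[of I "\<lambda>i. nm (M i) (x i)" \<phi>]
  by (auto simp: bounded_families_def less_imp_le)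

lemma bounded_families_nm_le:
  assumes "\<And>i. i \<in> I \<Longrightarrow> 0 < \<phi> i" "0 \<le> C" "\<And>i. i \<in> I \<Longrightarrow> nm (M i) (x i) \<le> C * \<phi> i"
  shows "nm (bounded_families I r M t \<phi>) x \<le> C"
  using assms Inf_bound(3)[of I "\<lambda>i. nm (M i) (x i)" \<phi> C]
  by (auto simp: bounded_families_def less_imp_le)

lemma ind_lim_obj:
  assumes R: "banach_ring na R" and S: "inverse_system na R I r M t"
  shows "ind_obj na R (ind_lim I r M t)"
proof -
  let ?L = "ind_lim I r M t"
  have s: "idx ?L = {\<phi>. \<forall>i\<in>I. 0 < \<phi> i}" "\<And>\<phi> \<psi>. ile ?L \<phi> \<psi> = (\<forall>i\<in>I. \<phi> i \<le> \<psi> i)"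
    "obj ?L = bounded_families I r M t" "tr ?L = (\<lambda>\<phi> \<psi> x. x)"
    by (auto simp: ind_lim_def)
  have b: "bounded_linear_map R (obj ?L \<phi>) (obj ?L \<psi>) (\<lambda>x. x)"
    if \<phi>: "\<forall>i\<in>I. 0 < \<phi> i" and \<psi>: "\<forall>i\<in>I. 0 < \<psi> i" and le: "\<forall>i\<in>I. \<phi> i \<le> \<psi> i" for \<phi> \<psi>
  proof -
    let ?n = "nm (bounded_families I r M t \<phi>)"
    have *: "nm (M i) (x i) \<le> ?n x * \<psi> i"
      if x: "x \<in> carrier (bounded_families I r M t \<phi>)" and i: "i \<in> I" for x i
    proof -
      have "nm (M i) (x i) \<le> ?n x * \<phi> i" using bounded_familiesD(4)[OF S _ x i] \<phi> by auto
      also have "\<dots> \<le> ?n x * \<psi> i"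
        using bounded_familiesD(3)[OF S _ x] \<phi> le i by (intro mult_left_mono) auto
      finally show ?thesis .
    qed
    have c: "x \<in> carrier (bounded_families I r M t \<psi>)"
      if x: "x \<in> carrier (bounded_families I r M t \<phi>)" for x
      using *[OF x] x by (auto simp: bounded_families_def)
    have "nm (bounded_families I r M t \<psi>) x \<le> 1 * ?n x"
      if x: "x \<in> carrier (bounded_families I r M t \<phi>)" for x
      using *[OF x] \<psi> bounded_familiesD(3)[OF S _ x] \<phi> by (intro bounded_families_nm_le) auto
    then have "\<exists>C. \<forall>x\<in>carrier (bounded_families I r M t \<phi>). nm (bounded_families I r M t \<psi>) x \<le> C * ?n x"
      by (intro exI[of _ 1] ballI)
    moreover have "add (bounded_families I r M t \<phi>) = add (bounded_families I r M t \<psi>)"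
      "smult (bounded_families I r M t \<phi>) = smult (bounded_families I r M t \<psi>)"
      by (simp_all add: bounded_families_def)
    ultimately show ?thesis using c unfolding bounded_linear_map_def s by simp
  qed
  have "(\<lambda>_. 1) \<in> idx ?L" by (simp add: s)
  then have "idx ?L \<noteq> {}" by blast
  moreover have "\<forall>\<phi>\<in>idx ?L. \<forall>\<psi>\<in>idx ?L. \<exists>k\<in>idx ?L. ile ?L \<phi> k \<and> ile ?L \<psi> k"
  proof (intro ballI)
    fix \<phi> \<psi> assume "\<phi> \<in> idx ?L" "\<psi> \<in> idx ?L"
    then show "\<exists>k\<in>idx ?L. ile ?L \<phi> k \<and> ile ?L \<psi> k"
      by (intro bexI[of _ "\<lambda>i. max (\<phi> i) (\<psi> i)"]) (auto simp: s less_max_iff_disj)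
  qed
  moreover have "\<forall>\<phi>\<in>idx ?L. \<forall>\<psi>\<in>idx ?L. ile ?L \<phi> \<psi> \<longrightarrow>
      bounded_linear_map R (obj ?L \<phi>) (obj ?L \<psi>) (tr ?L \<phi> \<psi>)"
    using b by (simp add: s)
  moreover have "\<forall>\<phi>\<in>idx ?L. banach_module na R (obj ?L \<phi>)"
    using bounded_families_banach[OF R S] by (simp add: s)
  moreover have "\<forall>\<phi>\<in>idx ?L. \<forall>\<psi>\<in>idx ?L. \<forall>\<chi>\<in>idx ?L. ile ?L \<phi> \<psi> \<and> ile ?L \<psi> \<chi> \<longrightarrow> ile ?L \<phi> \<chi>"
    by (simp add: s) (meson order_trans)
  moreover have "\<forall>\<phi>\<in>idx ?L. ile ?L \<phi> \<phi>" "\<forall>\<phi>\<in>idx ?L. \<forall>x\<in>carrier (obj ?L \<phi>). tr ?L \<phi> \<phi> x = x"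
    "\<forall>\<phi>\<in>idx ?L. \<forall>\<psi>\<in>idx ?L. \<forall>\<chi>\<in>idx ?L. ile ?L \<phi> \<psi> \<and> ile ?L \<psi> \<chi> \<longrightarrow>
        (\<forall>x\<in>carrier (obj ?L \<phi>). tr ?L \<psi> \<chi> (tr ?L \<phi> \<psi> x) = tr ?L \<phi> \<chi> x)"
    by (simp_all add: s)
  ultimately show ?thesis unfolding ind_obj_def by (intro conjI)
qed

lemma ind_const_obj:
  assumes "banach_module na R M" shows "ind_obj na R (ind_const M)"
proof -
  have "bounded_linear_map R M M (\<lambda>x. x)"
    unfolding bounded_linear_map_def by (auto intro: exI[of _ 1])
  then show ?thesis using assms unfolding ind_obj_def ind_const_def by simp
qed

lemma ind_mor_const_iff:
  "ind_mor na R T (ind_const M) f \<longleftrightarrow> ind_obj na R T \<and> ind_obj na R (ind_const M) \<and>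
     (\<forall>k\<in>idx T. bounded_linear_map R (obj T k) M (im_map f k)) \<and>
     (\<forall>k\<in>idx T. \<forall>l\<in>idx T. ile T k l \<longrightarrow>
        (\<forall>x\<in>carrier (obj T k). im_map f l (tr T k l x) = im_map f k x))"
  unfolding ind_mor_def by (auto simp: ind_const_def)

lemma ind_eq_const_iff:
  "ind_eq T (ind_const M) f g \<longleftrightarrow> (\<forall>k\<in>idx T. \<forall>x\<in>carrier (obj T k). im_map f k x = im_map g k x)"
  unfolding ind_eq_def by (auto simp: ind_const_def)

text \<open>The projections form a cone, and this cone is universal among all ind-objects.\<close>

lemma ind_lim_proj:
  assumes R: "banach_ring na R" and S: "inverse_system na R I r M t"
  shows "i \<in> I \<Longrightarrow> ind_mor na R (ind_lim I r M t) (ind_const (M i)) (lim_proj i)"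
    and "i \<in> I \<Longrightarrow> j \<in> I \<Longrightarrow> r i j \<Longrightarrow>
      ind_eq (ind_lim I r M t) (ind_const (M i)) (ind_comp (const_map (t i j)) (lim_proj j)) (lim_proj i)"
proof -
  show "ind_mor na R (ind_lim I r M t) (ind_const (M i)) (lim_proj i)" if i: "i \<in> I"
    unfolding ind_mor_const_iff
  proof (intro conjI ballI)
    fix \<phi> assume "\<phi> \<in> idx (ind_lim I r M t)"
    then have \<phi>: "0 < \<phi> i" if "i \<in> I" for i using that by (simp add: ind_lim_def)
    note D = bounded_familiesD[where \<phi> = \<phi>, OF S \<phi>]
    have "\<forall>x\<in>carrier (bounded_families I r M t \<phi>). nm (M i) (x i) \<le> \<phi> i * nm (bounded_families I r M t \<phi>) x"
      using D(4)[OF _ _ i] by (simp add: mult.commute)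
    moreover have "\<forall>x\<in>carrier (bounded_families I r M t \<phi>). x i \<in> carrier (M i)"
      using D(1) i by blast
    ultimately show "bounded_linear_map R (obj (ind_lim I r M t) \<phi>) (M i) (im_map (lim_proj i) \<phi>)"
      unfolding bounded_linear_map_def lim_proj_def ind_lim_def
      using i by (auto simp: bounded_families_def)
  qed (use ind_lim_obj[OF R S] ind_const_obj inverse_systemD(3)[OF S i] in \<open>auto simp: lim_proj_def ind_lim_def\<close>)
  show "ind_eq (ind_lim I r M t) (ind_const (M i)) (ind_comp (const_map (t i j)) (lim_proj j)) (lim_proj i)"
    if "i \<in> I" "j \<in> I" "r i j"
    using that unfolding ind_eq_const_iff
    by (auto simp: ind_comp_def const_map_def lim_proj_def ind_lim_def bounded_families_def)
qed

lemma ind_lim_universal: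
  fixes T :: "('r, 'k, 'n) ind_sys" and f :: "'i \<Rightarrow> ('k, 'n, unit, 'm) ind_map"
  assumes R: "banach_ring na R" and S: "inverse_system na R I r M t"
    and T: "ind_obj na R T"
    and f: "\<And>i. i \<in> I \<Longrightarrow> ind_mor na R T (ind_const (M i)) (f i)"
    and cone: "\<And>i j. i \<in> I \<Longrightarrow> j \<in> I \<Longrightarrow> r i j \<Longrightarrow>
      ind_eq T (ind_const (M i)) (ind_comp (const_map (t i j)) (f j)) (f i)"
  obtains g where "ind_mor na R T (ind_lim I r M t) g"
    and "\<And>i. i \<in> I \<Longrightarrow> ind_eq T (ind_const (M i)) (ind_comp (lim_proj i) g) (f i)"
    and "\<And>g'. ind_mor na R T (ind_lim I r M t) g' \<Longrightarrow>
      (\<And>i. i \<in> I \<Longrightarrow> ind_eq T (ind_const (M i)) (ind_comp (lim_proj i) g') (f i)) \<Longrightarrow>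
      ind_eq T (ind_lim I r M t) g' g"
proof -
  let ?L = "ind_lim I r M t"
  define g where "g = \<lparr> im_idx = (\<lambda>k i. 1 + op_norm (obj T k) (M i) (im_map (f i) k)),
    im_map = (\<lambda>k x. \<lambda>i\<in>I. im_map (f i) k x) \<rparr>"
  have TB: "banach_module na R (obj T k)" if "k \<in> idx T" for k
    using T that unfolding ind_obj_def by blast
  have fb: "bounded_linear_map R (obj T k) (M i) (im_map (f i) k)" if "k \<in> idx T" "i \<in> I" for k i
    using f[OF that(2)] that(1) unfolding ind_mor_const_iff by blast
  have fc: "im_map (f i) l (tr T k l x) = im_map (f i) k x"
    if "k \<in> idx T" "l \<in> idx T" "ile T k l" "x \<in> carrier (obj T k)" "i \<in> I" for k l x i
    using f[OF that(5)] that(1-4) unfolding ind_mor_const_iff by blast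
  have tc: "t i j (im_map (f j) k x) = im_map (f i) k x"
    if "k \<in> idx T" "x \<in> carrier (obj T k)" "i \<in> I" "j \<in> I" "r i j" for i j k x
    using cone[OF that(3-5)] that(1,2) unfolding ind_eq_const_iff by (simp add: ind_comp_def const_map_def)
  have pos: "0 < im_idx g k i" if "k \<in> idx T" "i \<in> I" for k i
    using blm_bound(1)[OF TB[OF that(1)] fb[OF that]] by (simp add: g_def)
  have L: "ind_obj na R ?L" by (rule ind_lim_obj[OF R S])
  have gb: "nm (M i) (im_map g k x i) \<le> nm (obj T k) x * im_idx g k i"
    if k: "k \<in> idx T" and x: "x \<in> carrier (obj T k)" and i: "i \<in> I" for k x i
  proof -
    have "nm (M i) (im_map (f i) k x) \<le> op_norm (obj T k) (M i) (im_map (f i) k) * nm (obj T k) x"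
      by (rule blm_bound(2)[OF TB[OF k] fb[OF k i] x])
    then show ?thesis using banach_moduleD(6)[OF TB[OF k] x] i by (simp add: g_def algebra_simps)
  qed
  have gc: "im_map g k x \<in> carrier (bounded_families I r M t (im_idx g k))"
    if k: "k \<in> idx T" and x: "x \<in> carrier (obj T k)" for k x
  proof -
    have "\<exists>C. \<forall>i\<in>I. nm (M i) (im_map g k x i) \<le> C * im_idx g k i" using gb[OF k x] by blast
    moreover have "im_map g k x \<in> PiE I (\<lambda>i. carrier (M i))"
      using blmD(1)[OF fb[OF k] x] by (auto simp: g_def)
    moreover have "\<forall>i\<in>I. \<forall>j\<in>I. r i j \<longrightarrow> t i j (im_map g k x j) = im_map g k x i"
      using tc[OF k x] by (simp add: g_def)
    ultimately show ?thesis by (simp add: bounded_families_def)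
  qed
  have gmor: "ind_mor na R T ?L g" unfolding ind_mor_def
  proof (intro conjI ballI impI T L)
    fix k assume k: "k \<in> idx T"
    show i: "im_idx g k \<in> idx ?L" using pos[OF k] by (simp add: ind_lim_def)
    have "bounded_linear_map R (obj T k) (bounded_families I r M t (im_idx g k)) (im_map g k)"
      unfolding bounded_linear_map_def
    proof (intro conjI ballI)
      show "im_map g k \<in> carrier (obj T k) \<rightarrow> carrier (bounded_families I r M t (im_idx g k))"
        using gc[OF k] by blast
      show "\<exists>C. \<forall>x\<in>carrier (obj T k). nm (bounded_families I r M t (im_idx g k)) (im_map g k x) \<le> C * nm (obj T k) x"
        using gb[OF k] pos[OF k] banach_moduleD(6)[OF TB[OF k]]
        by (intro exI[of _ 1] ballI bounded_families_nm_le) auto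
    next
      fix x y assume "x \<in> carrier (obj T k)" "y \<in> carrier (obj T k)"
      then show "im_map g k (x \<oplus>\<^bsub>obj T k\<^esub> y) = im_map g k x \<oplus>\<^bsub>bounded_families I r M t (im_idx g k)\<^esub> im_map g k y"
        using blmD(2)[OF fb[OF k]] by (auto simp: g_def bounded_families_def)
    next
      fix a x assume "a \<in> carrier R" "x \<in> carrier (obj T k)"
      then show "im_map g k (a \<odot>\<^bsub>obj T k\<^esub> x) = a \<odot>\<^bsub>bounded_families I r M t (im_idx g k)\<^esub> im_map g k x"
        using blmD(3)[OF fb[OF k]] by (auto simp: g_def bounded_families_def)
    qed
    then show "bounded_linear_map R (obj T k) (obj ?L (im_idx g k)) (im_map g k)"
      by (simp add: ind_lim_def)
  next
    fix k l assume k: "k \<in> idx T" and l: "l \<in> idx T" and kl: "ile T k l"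
    have "im_map g l (tr T k l x) = im_map g k x" if "x \<in> carrier (obj T k)" for x
      using fc[OF k l kl that] by (auto simp: g_def)
    then show "\<exists>m\<in>idx ?L. ile ?L (im_idx g k) m \<and> ile ?L (im_idx g l) m \<and>
        (\<forall>x\<in>carrier (obj T k). tr ?L (im_idx g l) m (im_map g l (tr T k l x)) = tr ?L (im_idx g k) m (im_map g k x))"
      using pos[OF k] pos[OF l]
      by (intro bexI[of _ "\<lambda>i. max (im_idx g k i) (im_idx g l i)"]) (auto simp: ind_lim_def less_max_iff_disj)
  qed
  have gf: "ind_eq T (ind_const (M i)) (ind_comp (lim_proj i) g) (f i)" if "i \<in> I" for i
    using that unfolding ind_eq_const_iff by (simp add: ind_comp_def lim_proj_def g_def)
  have "ind_eq T ?L g' g"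
    if g': "ind_mor na R T ?L g'"
      and e: "\<And>i. i \<in> I \<Longrightarrow> ind_eq T (ind_const (M i)) (ind_comp (lim_proj i) g') (f i)" for g'
    unfolding ind_eq_def
  proof
    fix k assume k: "k \<in> idx T"
    have p: "0 < im_idx g' k i" if "i \<in> I" for i
      using g' k that unfolding ind_mor_def by (auto simp: ind_lim_def)
    have "im_map g' k x = im_map g k x" if x: "x \<in> carrier (obj T k)" for x
    proof (rule PiE_ext)
      have "bounded_linear_map R (obj T k) (bounded_families I r M t (im_idx g' k)) (im_map g' k)"
        using g' k unfolding ind_mor_def by (auto simp: ind_lim_def)
      from blmD(1)[OF this x] show "im_map g' k x \<in> PiE I (\<lambda>i. carrier (M i))"
        by (simp add: bounded_families_def)
      show "im_map g k x \<in> PiE I (\<lambda>i. carrier (M i))" using gc[OF k x] by (simp add: bounded_families_def)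
      fix i assume i: "i \<in> I"
      show "im_map g' k x i = im_map g k x i"
        using e[OF i] gf[OF i] k x unfolding ind_eq_const_iff by (simp add: ind_comp_def lim_proj_def)
    qed
    then show "\<exists>m\<in>idx ?L. ile ?L (im_idx g' k) m \<and> ile ?L (im_idx g k) m \<and>
        (\<forall>x\<in>carrier (obj T k). tr ?L (im_idx g' k) m (im_map g' k x) = tr ?L (im_idx g k) m (im_map g k x))"
      using pos[OF k] p
      by (intro bexI[of _ "\<lambda>i. max (im_idx g' k i) (im_idx g k i)"]) (auto simp: ind_lim_def less_max_iff_disj)
  qed
  with gmor gf show thesis by (rule that)
qed

lemma blm_comp:
  assumes M: "banach_module na R M" and N: "banach_module na R N"
    and f: "bounded_linear_map R M N f" and g: "bounded_linear_map R N P g"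
  shows "bounded_linear_map R M P (\<lambda>x. g (f x))"
    and "\<And>x. x \<in> carrier M \<Longrightarrow> nm P (g (f x)) \<le> (op_norm M N f * op_norm N P g) * nm M x"
proof -
  have *: "nm P (g (f x)) \<le> (op_norm M N f * op_norm N P g) * nm M x" if x: "x \<in> carrier M" for x
  proof -
    have "nm P (g (f x)) \<le> op_norm N P g * nm N (f x)"
      by (rule blm_bound(2)[OF N g blmD(1)[OF f x]])
    also have "\<dots> \<le> op_norm N P g * (op_norm M N f * nm M x)"
      by (rule mult_left_mono[OF blm_bound(2)[OF M f x] blm_bound(1)[OF N g]])
    finally show ?thesis by (simp add: mult_ac)
  qed
  then show "\<And>x. x \<in> carrier M \<Longrightarrow> nm P (g (f x)) \<le> (op_norm M N f * op_norm N P g) * nm M x" .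
  show "bounded_linear_map R M P (\<lambda>x. g (f x))"
    using * blmD[OF f] blmD[OF g] unfolding bounded_linear_map_def by auto
qed

lemma ban_hom_precompose:
  assumes M: "banach_module na R M" and N: "banach_module na R N"
    and f: "bounded_linear_map R M N f" and P: "banach_module na R P"
  shows "bounded_linear_map R (ban_hom R N P) (ban_hom R M P) (\<lambda>g. \<lambda>x\<in>carrier M. g (f x))"
proof -
  interpret M: module R M using banach_moduleD(1)[OF M] .
  let ?h = "\<lambda>g. \<lambda>x\<in>carrier M. g (f x)"
  have h: "?h g \<in> carrier (ban_hom R M P)" if "g \<in> carrier (ban_hom R N P)" for g
  proof -
    have "bounded_linear_map R N P g" using that by (simp add: ban_hom_def)
    from blm_comp(1)[OF M N f this] show ?thesis
      by (simp add: ban_hom_def bounded_linear_map_def Pi_iff)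
  qed
  have "nm (ban_hom R M P) (?h g) \<le> op_norm M N f * nm (ban_hom R N P) g"
    if "g \<in> carrier (ban_hom R N P)" for g
  proof -
    have g: "bounded_linear_map R N P g" using that by (simp add: ban_hom_def)
    have e: "\<exists>C. \<forall>x\<in>carrier M. nm P (?h g x) \<le> C * nm M x"
      using blm_comp(2)[OF M N f g] by auto
    show ?thesis
      using Inf_bound(3)[OF e banach_moduleD(6)[OF M], of "op_norm M N f * op_norm N P g"]
        blm_comp(2)[OF M N f g] blm_bound(1)[OF M f] blm_bound(1)[OF N g]
      by (simp add: ban_hom_def op_norm_def)
  qed
  moreover have "?h (g \<oplus>\<^bsub>ban_hom R N P\<^esub> g') = ?h g \<oplus>\<^bsub>ban_hom R M P\<^esub> ?h g'" for g g'
    using blmD(1)[OF f] by (auto simp: ban_hom_def)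
  moreover have "?h (a \<odot>\<^bsub>ban_hom R N P\<^esub> g) = a \<odot>\<^bsub>ban_hom R M P\<^esub> ?h g" for a g
    using blmD(1)[OF f] by (auto simp: ban_hom_def)
  ultimately show ?thesis using h unfolding bounded_linear_map_def[of _ "ban_hom R N P"] by blast
qed

lemma ind_dual_inverse_system:
  assumes R: "banach_ring na R" and X: "ind_obj na R X"
  shows "inverse_system na R (idx X) (ile X) (\<lambda>i. ban_hom R (obj X i) (ring_as_module R))
     (\<lambda>i j f. \<lambda>x\<in>carrier (obj X i). f (tr X i j x))"
proof -
  note RM = ring_as_module_banach[OF R]
  have B: "banach_module na R (obj X i)" if "i \<in> idx X" for i
    using X that unfolding ind_obj_def by blast
  have T: "bounded_linear_map R (obj X i) (obj X j) (tr X i j)" if "i \<in> idx X" "j \<in> idx X" "ile X i j" for i j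
    using X that unfolding ind_obj_def by blast
  have id: "tr X i i x = x" if "i \<in> idx X" "x \<in> carrier (obj X i)" for i x
    using X that unfolding ind_obj_def by blast
  have comp: "tr X j k (tr X i j x) = tr X i k x"
    if "i \<in> idx X" "j \<in> idx X" "k \<in> idx X" "ile X i j" "ile X j k" "x \<in> carrier (obj X i)" for i j k x
    using X that unfolding ind_obj_def by blast
  have refl: "ile X i i" if "i \<in> idx X" for i
    using X that unfolding ind_obj_def by blast
  have trans: "ile X i k"
    if "i \<in> idx X" "j \<in> idx X" "k \<in> idx X" "ile X i j" "ile X j k" for i j k
    using X that unfolding ind_obj_def by blast
  show ?thesis unfolding inverse_system_def
  proof (intro conjI ballI impI)
    fix i assume i: "i \<in> idx X"
    show "ile X i i" by (rule refl[OF i])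
    show "banach_module na R (ban_hom R (obj X i) (ring_as_module R))"
      by (rule ban_hom_banach[OF R B[OF i] RM])
    fix f assume f: "f \<in> carrier (ban_hom R (obj X i) (ring_as_module R))"
    then have e: "f \<in> extensional (carrier (obj X i))" by (simp add: ban_hom_def)
    show "(\<lambda>x\<in>carrier (obj X i). f (tr X i i x)) = f"
    proof
      fix x show "(\<lambda>x\<in>carrier (obj X i). f (tr X i i x)) x = f x"
        using id[OF i] extensional_arb[OF e] by (cases "x \<in> carrier (obj X i)") auto
    qed
  next
    fix i j k assume "i \<in> idx X" "j \<in> idx X" "k \<in> idx X" "ile X i j \<and> ile X j k"
    then show "ile X i k" using trans by blast
  next
    fix i j assume i: "i \<in> idx X" and j: "j \<in> idx X" and ij: "ile X i j"
    show "bounded_linear_map R (ban_hom R (obj X j) (ring_as_module R)) (ban_hom R (obj X i) (ring_as_module R))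
        (\<lambda>f. \<lambda>x\<in>carrier (obj X i). f (tr X i j x))"
      by (rule ban_hom_precompose[OF B[OF i] B[OF j] T[OF i j ij] RM])
  next
    fix i j k f assume i: "i \<in> idx X" and j: "j \<in> idx X" and k: "k \<in> idx X"
      and r: "ile X i j \<and> ile X j k"
    show "(\<lambda>x\<in>carrier (obj X i). (\<lambda>x\<in>carrier (obj X j). f (tr X j k x)) (tr X i j x)) =
        (\<lambda>x\<in>carrier (obj X i). f (tr X i k x))"
      using comp[OF i j k] r blmD(1)[OF T[OF i j]] by (intro restrict_ext) auto
  qed
qed

lemma ind_dual_obj:
  assumes "banach_ring na R" "ind_obj na R X" shows "ind_obj na R (ind_dual R X)"
  unfolding ind_dual_def by (rule ind_lim_obj[OF assms(1) ind_dual_inverse_system[OF assms]])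

text \<open>A directed system is the colimit, in \<open>Ind(Ban_R)\<close>, of its own terms.\<close>

definition colim_incl :: "'i \<Rightarrow> (unit, 'm, 'i, 'm) ind_map" where
  "colim_incl i = \<lparr> im_idx = (\<lambda>u. i), im_map = (\<lambda>u x. x) \<rparr>"

lemma ind_colim_incl:
  assumes R: "banach_ring na R" and X: "ind_obj na R X"
  shows "i \<in> idx X \<Longrightarrow> ind_mor na R (ind_const (obj X i)) X (colim_incl i)"
    and "i \<in> idx X \<Longrightarrow> j \<in> idx X \<Longrightarrow> ile X i j \<Longrightarrow>
      ind_eq (ind_const (obj X i)) X (ind_comp (colim_incl j) (const_map (tr X i j))) (colim_incl i)"
proof -
  have refl: "ile X i i" if "i \<in> idx X" for i using X that unfolding ind_obj_def by blast
  have id: "tr X i i x = x" if "i \<in> idx X" "x \<in> carrier (obj X i)" for i x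
    using X that unfolding ind_obj_def by blast
  have car: "tr X i j x \<in> carrier (obj X j)"
    if "i \<in> idx X" "j \<in> idx X" "ile X i j" "x \<in> carrier (obj X i)" for i j x
    using X that unfolding ind_obj_def bounded_linear_map_def by blast
  show "ind_mor na R (ind_const (obj X i)) X (colim_incl i)" if i: "i \<in> idx X"
  proof -
    have B: "banach_module na R (obj X i)" using X i unfolding ind_obj_def by blast
    have "bounded_linear_map R (obj X i) (obj X i) (\<lambda>x. x)"
      unfolding bounded_linear_map_def by (auto intro: exI[of _ 1])
    then show ?thesis using X i ind_const_obj[OF B] refl[OF i] unfolding ind_mor_def
      by (auto simp: colim_incl_def ind_const_def)
  qed
  show "ind_eq (ind_const (obj X i)) X (ind_comp (colim_incl j) (const_map (tr X i j))) (colim_incl i)"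
    if "i \<in> idx X" "j \<in> idx X" "ile X i j"
    using that refl[OF that(2)] id[OF that(2) car[OF that]] unfolding ind_eq_def
    by (auto simp: colim_incl_def ind_const_def ind_comp_def const_map_def intro!: bexI[of _ j])
qed

lemma ind_colim_universal:
  fixes T :: "('r, 'k, 'n) ind_sys" and f :: "'i \<Rightarrow> (unit, 'm, 'k, 'n) ind_map"
  assumes R: "banach_ring na R" and X: "ind_obj na R X" and T: "ind_obj na R T"
    and f: "\<And>i. i \<in> idx X \<Longrightarrow> ind_mor na R (ind_const (obj X i)) T (f i)"
    and cocone: "\<And>i j. i \<in> idx X \<Longrightarrow> j \<in> idx X \<Longrightarrow> ile X i j \<Longrightarrow>
      ind_eq (ind_const (obj X i)) T (ind_comp (f j) (const_map (tr X i j))) (f i)"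
  obtains g where "ind_mor na R X T g"
    and "\<And>i. i \<in> idx X \<Longrightarrow> ind_eq (ind_const (obj X i)) T (ind_comp g (colim_incl i)) (f i)"
    and "\<And>g'. ind_mor na R X T g' \<Longrightarrow>
      (\<And>i. i \<in> idx X \<Longrightarrow> ind_eq (ind_const (obj X i)) T (ind_comp g' (colim_incl i)) (f i)) \<Longrightarrow>
      ind_eq X T g' g"
proof -
  define g where "g = \<lparr> im_idx = (\<lambda>i. im_idx (f i) ()), im_map = (\<lambda>i. im_map (f i) ()) \<rparr>"
  have fi: "im_idx (f i) () \<in> idx T" if "i \<in> idx X" for i
    using f[OF that] unfolding ind_mor_def by (simp add: ind_const_def)
  have refl: "ile T k k" if "k \<in> idx T" for k using T that unfolding ind_obj_def by blast
  have "ind_mor na R X T g" unfolding ind_mor_def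
  proof (intro conjI ballI impI X T)
    fix i assume i: "i \<in> idx X"
    show "im_idx g i \<in> idx T" using fi[OF i] by (simp add: g_def)
    show "bounded_linear_map R (obj X i) (obj T (im_idx g i)) (im_map g i)"
      using f[OF i] unfolding ind_mor_def by (simp add: ind_const_def g_def)
  next
    fix i j assume i: "i \<in> idx X" and j: "j \<in> idx X" and ij: "ile X i j"
    show "\<exists>k\<in>idx T. ile T (im_idx g i) k \<and> ile T (im_idx g j) k \<and>
        (\<forall>x\<in>carrier (obj X i). tr T (im_idx g j) k (im_map g j (tr X i j x)) = tr T (im_idx g i) k (im_map g i x))"
      using cocone[OF i j ij] unfolding ind_eq_def
      by (auto simp: g_def ind_const_def ind_comp_def const_map_def)
  qed
  moreover have "ind_eq (ind_const (obj X i)) T (ind_comp g (colim_incl i)) (f i)" if "i \<in> idx X" for i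
    using fi[OF that] refl[OF fi[OF that]] unfolding ind_eq_def
    by (auto simp: g_def ind_const_def ind_comp_def colim_incl_def)
  moreover have "ind_eq X T g' g"
    if "\<And>i. i \<in> idx X \<Longrightarrow> ind_eq (ind_const (obj X i)) T (ind_comp g' (colim_incl i)) (f i)" for g'
    using that unfolding ind_eq_def
    by (simp add: g_def ind_const_def ind_comp_def colim_incl_def)
  ultimately show thesis by (rule that)
qed

end

theory Submission
  imports Defs "HOL-Library.Multiset"
begin

text \<open>
  The pairing is \<open>\<Sum> x_n y_n\<close>.  A functional \<open>f\<close> on either side is determined by its values \<open>y_n = f e_n\<close> on the
  unit vectors, and the point is to bound these.  If \<open>f\<close> is in the step \<open>\<phi>\<close> of \<open>\<kappa>(\<rho>)\<^sup>\<or>\<close>, then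
  \<open>|y_n| \<rho>_(j+1)(n)\<close> is at most a multiple of \<open>\<phi>_(j+1)\<close>, and the assumption on \<open>\<rho>_j / \<rho>_(j+1)\<close> turns this
  supremum bound for \<open>j + 1\<close> into an \<open>\<ell>\<^sup>1\<close> bound for \<open>j\<close>.  For a step \<open>\<Phi>\<close> of \<open>\<lambda>(\<rho>)\<^sup>\<or>\<close>, a gliding hump argument gives a
  single \<open>J\<close> with \<open>|y_n|\<close> at most a multiple of \<open>\<rho>_J(n)\<close>, so that \<open>y\<close> lies in the step \<open>J + 1\<close> of \<open>\<kappa>(\<rho>)\<close>; here
  \<open>f\<close> is recovered from \<open>y\<close> because the truncations of an element of a step of \<open>\<lambda>(\<rho>)\<close> converge to it in a larger step.
  Reflexivity is then formal.
\<close>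

section \<open>The completed projective tensor product\<close>

text \<open>In either setting a bounded functional on a module of weight \<open>w\<close> yields
  only |f e_n| <= C w(n), so the dual of a step is a module of supremum type, not one of the given
  kind. The hypothesis interleaves the two kinds of systems with a shift of one index, which limits
  and colimits do not see. The delicate side is the dual of \<lambda>(\<rho>). There
  \<open>\<Phi>\<close> bounds the functional on each step \<open>\<phi>\<close> by a multiple of
  \<open>\<Phi> \<phi>\<close>, and \<open>\<Phi>\<close> is an arbitrary positive function: nothing
  relates its values at different \<open>\<phi>\<close>, and continuity for a single norm of the
  system is not given but has to be produced. What saves the argument is that every positive
  sequence \<open>\<phi>\<close> is admissible, also one built by diagonalisation, and that the
  single number \<open>\<Phi> \<phi>\<close> is finite. Since R need not contain real scalars, unit
  vectors cannot be rescaled; a scaling is a factor \<open>t\<close> in a norm bound. The index J so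
  found depends on \<open>\<Phi>\<close> only and not on the functional, as a morphism of
  ind-objects requires.\<close>

lemma blm_zero:
  assumes M: "banach_module na R M" and N: "banach_module na R N" and f: "bounded_linear_map R M N f"
  shows "f \<zero>\<^bsub>M\<^esub> = \<zero>\<^bsub>N\<^esub>"
proof -
  interpret M: abelian_group M using banach_moduleD(2)[OF M] .
  interpret N: abelian_group N using banach_moduleD(2)[OF N] .
  have "f (\<zero>\<^bsub>M\<^esub> \<ominus>\<^bsub>M\<^esub> \<zero>\<^bsub>M\<^esub>) = f \<zero>\<^bsub>M\<^esub> \<ominus>\<^bsub>N\<^esub> f \<zero>\<^bsub>M\<^esub>" by (rule blm_minus[OF M N f]) simp_all
  then have "f (\<zero>\<^bsub>M\<^esub> \<oplus>\<^bsub>M\<^esub> \<ominus>\<^bsub>M\<^esub> \<zero>\<^bsub>M\<^esub>) = \<zero>\<^bsub>N\<^esub>"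
    using blmD(1)[OF f, of "\<zero>\<^bsub>M\<^esub>"] by (simp add: M.minus_eq N.minus_eq N.r_neg del: M.l_zero)
  then show ?thesis by (simp only: M.r_neg[OF M.zero_closed])
qed

lemma banach_norm_zero:
  assumes "banach_module na R M" shows "nm M \<zero>\<^bsub>M\<^esub> = 0"
  using banach_moduleD(2,7)[OF assms] abelian_group.axioms(1) abelian_monoid.zero_closed by blast

lemma blm_minus_map:
  assumes M: "banach_module na R M"
  shows "bounded_linear_map R M M (\<lambda>x. \<ominus>\<^bsub>M\<^esub> x)"
proof -
  interpret M: module R M using banach_moduleD(1)[OF M] .
  show ?thesis unfolding bounded_linear_map_def
    using banach_norm_minus[OF banach_moduleD(2,4)[OF M]]
    by (auto simp: M.minus_add M.smult_r_minus intro: exI[of _ 1])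
qed

lemma blm_id: "bounded_linear_map R M M (\<lambda>x. x)"
  unfolding bounded_linear_map_def by (auto intro: exI[of _ 1])

lemma tensor_cost_simps:
  "tensor_cost na M N [] = 0"
  "tensor_cost na M N ((x, y) # xs) =
    (if na then max (nm M x * nm N y) (tensor_cost na M N xs) else nm M x * nm N y + tensor_cost na M N xs)"
  by (simp_all add: tensor_cost_def)

locale banach_pair =
  fixes na :: bool and R :: "'r nring" and M :: "('r, 'm) nmodule" and N :: "('r, 'n) nmodule"
  assumes R: "banach_ring na R" and M: "banach_module na R M" and N: "banach_module na R N"
begin

sublocale M: module R M using banach_moduleD(1)[OF M] .
sublocale N: module R N using banach_moduleD(1)[OF N] .

abbreviation V where "V \<equiv> lists (carrier M \<times> carrier N)"
abbreviation teq (infix "\<approx>" 50) where "xs \<approx> ys \<equiv> tensor_eq R M N xs ys"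
abbreviation cost where "cost \<equiv> tensor_cost na M N"
abbreviation q where "q \<equiv> tensor_seminorm na R M N"
abbreviation diff where "diff \<equiv> tensor_diff M"
abbreviation neg where "neg \<equiv> map (\<lambda>(x, y). (\<ominus>\<^bsub>M\<^esub> x, y))"
abbreviation scale where "scale a \<equiv> map (\<lambda>(x, y). (a \<odot>\<^bsub>M\<^esub> x, y))"
abbreviation CS where "CS \<equiv> tensor_cauchy na R M N"
abbreviation cls where "cls \<equiv> tensor_class na R M N"
abbreviation TT where "TT \<equiv> ban_tensor na R M N"

declare tensor_eq.trans [trans]

text \<open>Both memberships go through the induction together, because the symmetry rule exchanges
  them.\<close>

lemma teq_lists:
  assumes "xs \<approx> ys" shows "xs \<in> V" "ys \<in> V"
proof -
  have "xs \<in> V \<and> ys \<in> V" using assms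
    by induction auto
  then show "xs \<in> V" "ys \<in> V" by auto
qed

text \<open>The rule \<open>commute\<close> swaps two blocks, so the head of \<open>xs\<close> can
  be moved from the front to its place in \<open>ys\<close>. From here on every rearrangement of
  summands is reduced to an equality of multisets.\<close>

lemma teq_mset: "xs \<in> V \<Longrightarrow> mset xs = mset ys \<Longrightarrow> xs \<approx> ys"
proof (induction xs arbitrary: ys)
  case Nil then show ?case by (auto intro: tensor_eq.refl)
next
  case (Cons z xs)
  from Cons.prems(2) have "z \<in> set ys" by (metis list.set_intros(1) set_mset_mset)
  then obtain us vs where ys: "ys = us @ z # vs" by (meson split_list)
  have "set (z # xs) = set ys" using Cons.prems(2) by (metis set_mset_mset)
  then have c: "z \<in> carrier M \<times> carrier N" "us \<in> V" "vs \<in> V"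
    using Cons.prems(1) ys by (auto simp: in_lists_conv_set)
  have "xs \<approx> us @ vs" using Cons ys by auto
  then have "[z] @ xs \<approx> [z] @ (us @ vs)" using c by (intro tensor_eq.append tensor_eq.refl) auto
  moreover have "([z] @ us) @ vs \<approx> (us @ [z]) @ vs"
    using c by (intro tensor_eq.append tensor_eq.refl tensor_eq.commute) auto
  ultimately show ?case using ys by (auto intro: tensor_eq.trans)
qed

lemma cost_nonneg: "xs \<in> V \<Longrightarrow> 0 \<le> cost xs"
  using banach_moduleD(6)[OF M] banach_moduleD(6)[OF N]
  by (induction xs) (auto simp: tensor_cost_simps le_max_iff_disj)

text \<open>The fold starts from 0 also in the non-archimedean case, so for empty \<open>xs\<close>
  the right-hand side is \<open>max 0 (cost ys)\<close>; this is where \<open>cost ys\<close> has to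
  be nonnegative.\<close>

lemma cost_append:
  "xs \<in> V \<Longrightarrow> ys \<in> V \<Longrightarrow> cost (xs @ ys) = (if na then max (cost xs) (cost ys) else cost xs + cost ys)"
  using cost_nonneg[of ys]
  by (induction xs) (auto simp: tensor_cost_simps max.assoc max_absorb2)

lemma q_bdd: "xs \<in> V \<Longrightarrow> bdd_below {cost ys |ys. xs \<approx> ys}"
  using cost_nonneg teq_lists by (intro bdd_belowI[of _ 0]) auto

lemma q_le: "xs \<approx> ys \<Longrightarrow> q xs \<le> cost ys"
  unfolding tensor_seminorm_def using q_bdd teq_lists(1) by (intro cInf_lower) auto

text \<open>The infimum need not be attained, so estimates of \<open>q\<close> are made on
  representatives that are optimal up to \<open>e\<close>.\<close>

lemma q_ex:
  assumes "xs \<in> V" "0 < e" obtains ys where "xs \<approx> ys" "cost ys < q xs + e"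
proof -
  have "{cost ys |ys. xs \<approx> ys} \<noteq> {}" using assms tensor_eq.refl by blast
  then obtain c where "c \<in> {cost ys |ys. xs \<approx> ys}" "c < q xs + e"
    using cInf_lessD[of "{cost ys |ys. xs \<approx> ys}" "q xs + e"] assms unfolding tensor_seminorm_def by auto
  then show ?thesis using that by auto
qed

lemma q_nonneg: assumes "xs \<in> V" shows "0 \<le> q xs"
  unfolding tensor_seminorm_def
proof (rule cInf_greatest)
  show "{cost ys |ys. xs \<approx> ys} \<noteq> {}" using tensor_eq.refl[OF assms] by blast
qed (use cost_nonneg teq_lists in blast)

lemma q_cong: assumes "xs \<approx> ys" shows "q xs = q ys"
proof -
  have "xs \<approx> zs \<longleftrightarrow> ys \<approx> zs" for zs using assms tensor_eq.sym tensor_eq.trans by metis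
  then show ?thesis unfolding tensor_seminorm_def by simp
qed

lemma q_Nil: "q [] = 0"
  using q_le[OF tensor_eq.refl, of "[]"] q_nonneg[of "[]"] by (simp add: tensor_cost_def)

lemma q_append:
  assumes "xs \<in> V" "ys \<in> V"
  shows "q (xs @ ys) \<le> (if na then max (q xs) (q ys) else q xs + q ys)"
proof (rule field_le_epsilon)
  fix e :: real assume e: "0 < e"
  obtain xs' where x: "xs \<approx> xs'" "cost xs' < q xs + e / 2" by (rule q_ex[OF assms(1), of "e / 2"]) (use e in auto)
  obtain ys' where y: "ys \<approx> ys'" "cost ys' < q ys + e / 2" by (rule q_ex[OF assms(2), of "e / 2"]) (use e in auto)
  have "q (xs @ ys) \<le> cost (xs' @ ys')" using x y by (intro q_le tensor_eq.append)
  also have "\<dots> = (if na then max (cost xs') (cost ys') else cost xs' + cost ys')"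
    using x y teq_lists by (intro cost_append) blast+
  also have "\<dots> \<le> (if na then max (q xs) (q ys) else q xs + q ys) + e" using x y e by auto
  finally show "q (xs @ ys) \<le> (if na then max (q xs) (q ys) else q xs + q ys) + e" .
qed

lemma q_append': "xs \<in> V \<Longrightarrow> ys \<in> V \<Longrightarrow> q (xs @ ys) \<le> q xs + q ys"
  using q_append[of xs ys] q_nonneg[of xs] q_nonneg[of ys] by (auto split: if_splits)

end

lemma tensor_eq_map:
  assumes P: "banach_pair na R M N" and Q: "banach_pair na R M' N'"
    and f: "bounded_linear_map R M M' f" and g: "bounded_linear_map R N N' g"
    and eq: "tensor_eq R M N xs ys"
  shows "tensor_eq R M' N' (map (map_prod f g) xs) (map (map_prod f g) ys)"
proof -
  interpret P: banach_pair na R M N by fact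
  interpret Q: banach_pair na R M' N' by fact
  note F = blmD[OF f] blm_zero[OF P.M Q.M f] blmD[OF g] blm_zero[OF P.N Q.N g]
  have V: "map (map_prod f g) us \<in> Q.V" if "us \<in> P.V" for us
    using that F(1,5) by (auto simp: in_lists_conv_set)
  show ?thesis using eq
  proof induction
    case (sym xs ys) then show ?case by (blast intro: tensor_eq.sym)
  next
    case (trans xs ys zs) then show ?case by (blast intro: tensor_eq.trans)
  qed (use V F in \<open>auto intro: tensor_eq.intros simp del: map_map\<close>)
qed

text \<open>\<open>a\<close> and \<open>b\<close> are arbitrary bounds instead of operator norms:
  negation has to come out with the factor 1, and multiplication by a ring element with the norm of
  that element.\<close>

lemma tensor_seminorm_map:
  assumes P: "banach_pair na R M N" and Q: "banach_pair na R M' N'"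
    and f: "bounded_linear_map R M M' f" and g: "bounded_linear_map R N N' g"
    and a: "0 \<le> a" "\<And>x. x \<in> carrier M \<Longrightarrow> nm M' (f x) \<le> a * nm M x"
    and b: "0 \<le> b" "\<And>x. x \<in> carrier N \<Longrightarrow> nm N' (g x) \<le> b * nm N x"
    and xs: "xs \<in> lists (carrier M \<times> carrier N)"
  shows "tensor_seminorm na R M' N' (map (map_prod f g) xs) \<le> a * b * tensor_seminorm na R M N xs"
proof -
  interpret P: banach_pair na R M N by fact
  interpret Q: banach_pair na R M' N' by fact
  have ab: "0 \<le> a * b" using a(1) b(1) by simp
  have c: "Q.cost (map (map_prod f g) us) \<le> a * b * P.cost us" if "us \<in> P.V" for us
    using that
  proof (induction us)
    case Nil then show ?case by (simp add: tensor_cost_def)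
  next
    case (Cons z us)
    obtain x y where z: "z = (x, y)" by (cases z)
    have xy: "x \<in> carrier M" "y \<in> carrier N" using Cons z by auto
    have "nm M' (f x) * nm N' (g y) \<le> (a * nm M x) * (b * nm N y)"
      by (rule mult_mono)
        (use a b xy banach_moduleD(6)[OF Q.N] blmD(1)[OF g] banach_moduleD(6)[OF P.M] in auto)
    then have 1: "nm M' (f x) * nm N' (g y) \<le> a * b * (nm M x * nm N y)" by (simp add: algebra_simps)
    have 2: "Q.cost (map (map_prod f g) us) \<le> a * b * P.cost us" using Cons by auto
    have "max (nm M' (f x) * nm N' (g y)) (Q.cost (map (map_prod f g) us)) \<le> a * b * max (nm M x * nm N y) (P.cost us)"
      using 1 2 mult_left_mono[OF max.cobounded1 ab, of "nm M x * nm N y" "P.cost us"]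
        mult_left_mono[OF max.cobounded2 ab, of "P.cost us" "nm M x * nm N y"] by linarith
    then show ?case using 1 2 z by (auto simp: tensor_cost_def distrib_left)
  qed
  show ?thesis
  proof (rule field_le_epsilon)
    fix e :: real assume e: "0 < e"
    \<comment> \<open>The summand 1 keeps the tolerance meaningful when \<open>a * b\<close> is 0.
      The same device recurs in the later Lipschitz estimates.\<close>
    have p: "0 < e / (a * b + 1)" using e ab by auto
    obtain ys where ys: "P.teq xs ys" "P.cost ys < P.q xs + e / (a * b + 1)" by (rule P.q_ex[OF xs p])
    have "Q.q (map (map_prod f g) xs) \<le> Q.cost (map (map_prod f g) ys)"
      by (rule Q.q_le[OF tensor_eq_map[OF P Q f g ys(1)]])
    also have "\<dots> \<le> a * b * P.cost ys" using c P.teq_lists(2)[OF ys(1)] by blast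
    also have "\<dots> \<le> a * b * (P.q xs + e / (a * b + 1))" using ys(2) ab by (intro mult_left_mono) auto
    also have "\<dots> \<le> a * b * P.q xs + e"
    proof -
      have "a * b * (e / (a * b + 1)) \<le> e" using e ab by (simp add: divide_simps)
      then show ?thesis by (simp add: distrib_left)
    qed
    finally show "Q.q (map (map_prod f g) xs) \<le> a * b * P.q xs + e" .
  qed
qed


section \<open>The pseudo-metric on tensors and its completion\<close>

context banach_pair
begin

abbreviation dd where "dd xs ys \<equiv> q (diff xs ys)"

lemma neg_map_prod: "neg = map (map_prod (\<lambda>x. \<ominus>\<^bsub>M\<^esub> x) (\<lambda>y. y))"
  and scale_map_prod: "scale a = map (map_prod (\<lambda>x. a \<odot>\<^bsub>M\<^esub> x) (\<lambda>y. y))"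
  by (simp_all add: map_prod_def)

lemma neg_V: "xs \<in> V \<Longrightarrow> neg xs \<in> V"
  by (auto simp: in_lists_conv_set)

lemma diff_V: "xs \<in> V \<Longrightarrow> ys \<in> V \<Longrightarrow> diff xs ys \<in> V"
  using neg_V[of ys] by (simp add: tensor_diff_def)

lemma neg_neg: "xs \<in> V \<Longrightarrow> neg (neg xs) = xs"
  by (induction xs) auto

lemma teq_neg: "xs \<approx> ys \<Longrightarrow> neg xs \<approx> neg ys"
  unfolding neg_map_prod
  by (rule tensor_eq_map[OF banach_pair_axioms banach_pair_axioms blm_minus_map[OF M] blm_id])

text \<open>Negation is an involution that does not increase the seminorm; applying this to a list
  and to its negative gives equality.\<close>

lemma q_neg: assumes xs: "xs \<in> V" shows "q (neg xs) = q xs"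
proof -
  have *: "q (neg ys) \<le> q ys" if "ys \<in> V" for ys
    using tensor_seminorm_map[OF banach_pair_axioms banach_pair_axioms blm_minus_map[OF M] blm_id, of 1 1 ys] that
      banach_norm_minus[OF banach_moduleD(2,4)[OF M]]
    unfolding neg_map_prod by simp
  show ?thesis using *[OF xs] *[OF neg_V[OF xs]] neg_neg[OF xs] by simp
qed

text \<open>Reordering puts each summand next to its negative. Additivity in the left factor, read
  backwards, merges the two into a summand with left factor zero.\<close>

lemma neg_cancel: "xs \<in> V \<Longrightarrow> xs @ neg xs \<approx> []"
proof (induction xs)
  case Nil then show ?case by (auto intro: tensor_eq.refl)
next
  case (Cons z xs)
  obtain x y where z: "z = (x, y)" by (cases z)
  have xy: "x \<in> carrier M" "y \<in> carrier N" and xs: "xs \<in> V" using Cons.prems z by auto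
  have "(z # xs) @ neg (z # xs) \<approx> [(x, y), (\<ominus>\<^bsub>M\<^esub> x, y)] @ (xs @ neg xs)"
    using z xy xs neg_V[OF xs] by (intro teq_mset) auto
  also have "\<dots> \<approx> [(x \<oplus>\<^bsub>M\<^esub> \<ominus>\<^bsub>M\<^esub> x, y)] @ []"
    using xy Cons.IH[OF xs] by (intro tensor_eq.append tensor_eq.sym[OF tensor_eq.add_left]) auto
  also have "\<dots> \<approx> []" using xy by (auto simp: M.r_neg intro: tensor_eq.zero)
  finally show ?case .
qed

lemma dd_cong: "xs \<approx> xs' \<Longrightarrow> ys \<approx> ys' \<Longrightarrow> dd xs ys = dd xs' ys'"
  unfolding tensor_diff_def by (intro q_cong tensor_eq.append teq_neg)

lemma dd_nonneg: "xs \<in> V \<Longrightarrow> ys \<in> V \<Longrightarrow> 0 \<le> dd xs ys"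
  by (intro q_nonneg diff_V)

lemma dd_teq: assumes "xs \<approx> ys" shows "dd xs ys = 0"
proof -
  have ys: "ys \<in> V" using assms teq_lists by blast
  have "dd xs ys = dd ys ys" using assms ys by (intro dd_cong tensor_eq.refl)
  also have "\<dots> = q []" unfolding tensor_diff_def by (rule q_cong[OF neg_cancel[OF ys]])
  finally show ?thesis by (simp add: q_Nil)
qed

lemma dd_sym: assumes "xs \<in> V" "ys \<in> V" shows "dd xs ys = dd ys xs"
proof -
  have "neg (diff xs ys) = neg xs @ ys" using neg_neg[OF assms(2)] by (simp add: tensor_diff_def)
  then have "q (diff xs ys) = q (neg xs @ ys)" using q_neg[OF diff_V[OF assms]] by simp
  also have "\<dots> = q (diff ys xs)" unfolding tensor_diff_def
    using assms neg_V by (intro q_cong teq_mset) (auto simp del: map_eq_conv)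
  finally show ?thesis .
qed

lemma diff_trans:
  assumes "xs \<in> V" "ys \<in> V" "zs \<in> V" shows "diff xs ys @ diff ys zs \<approx> diff xs zs"
proof -
  have "diff xs ys @ diff ys zs \<approx> (ys @ neg ys) @ diff xs zs"
    using assms neg_V unfolding tensor_diff_def by (intro teq_mset) auto
  also have "\<dots> \<approx> [] @ diff xs zs"
    using assms diff_V by (intro tensor_eq.append neg_cancel tensor_eq.refl)
  finally show ?thesis by simp
qed

lemma dd_trans:
  assumes "xs \<in> V" "ys \<in> V" "zs \<in> V" shows "dd xs zs \<le> dd xs ys + dd ys zs"
  using q_append'[OF diff_V[OF assms(1,2)] diff_V[OF assms(2,3)]] q_cong[OF diff_trans[OF assms]] by simp

lemma dd_append:
  assumes "xs \<in> V" "ys \<in> V" "us \<in> V" "vs \<in> V" shows "dd (xs @ us) (ys @ vs) \<le> dd xs ys + dd us vs"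
proof -
  have "diff (xs @ us) (ys @ vs) \<approx> diff xs ys @ diff us vs"
    unfolding tensor_diff_def using assms neg_V by (intro teq_mset) auto
  then show ?thesis using q_append'[OF diff_V[OF assms(1,2)] diff_V[OF assms(3,4)]] q_cong by simp
qed

lemma dd_Nil: "dd xs [] = q xs"
  by (simp add: tensor_diff_def)

lemma q_dd: assumes "xs \<in> V" "ys \<in> V" shows "\<bar>q xs - q ys\<bar> \<le> dd xs ys"
  using dd_trans[OF assms, of "[]"] dd_trans[OF assms(2,1), of "[]"] dd_sym[OF assms] by (simp add: dd_Nil)

lemma CS_V: "s \<in> CS \<Longrightarrow> s n \<in> V"
  unfolding tensor_cauchy_def by blast

lemma CS_D: "s \<in> CS \<Longrightarrow> 0 < e \<Longrightarrow> \<exists>K. \<forall>m\<ge>K. \<forall>n\<ge>K. dd (s m) (s n) < e"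
  unfolding tensor_cauchy_def by blast

lemma CS_I:
  "(\<And>n. s n \<in> V) \<Longrightarrow> (\<And>e. 0 < e \<Longrightarrow> \<exists>K. \<forall>m\<ge>K. \<forall>n\<ge>K. dd (s m) (s n) < e) \<Longrightarrow> s \<in> CS"
  unfolding tensor_cauchy_def by blast

lemma CS_const: "xs \<in> V \<Longrightarrow> (\<lambda>n. xs) \<in> CS"
  by (rule CS_I) (auto simp: dd_teq tensor_eq.refl)

lemma CS_append: assumes s: "s \<in> CS" and u: "u \<in> CS" shows "(\<lambda>n. s n @ u n) \<in> CS"
proof (rule CS_I)
  show "s n @ u n \<in> V" for n using CS_V[OF s] CS_V[OF u] by simp
  fix e :: real assume "0 < e"
  then obtain K L where K: "\<forall>m\<ge>K. \<forall>n\<ge>K. dd (s m) (s n) < e / 2" and L: "\<forall>m\<ge>L. \<forall>n\<ge>L. dd (u m) (u n) < e / 2"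
    using CS_D[OF s, of "e / 2"] CS_D[OF u, of "e / 2"] by auto
  have "dd (s m @ u m) (s n @ u n) < e" if "m \<ge> max K L" "n \<ge> max K L" for m n
  proof -
    have "dd (s m) (s n) < e / 2" "dd (u m) (u n) < e / 2" using K L that by auto
    then show ?thesis using dd_append[OF CS_V[OF s, of m] CS_V[OF s, of n] CS_V[OF u, of m] CS_V[OF u, of n]] by linarith
  qed
  then show "\<exists>K. \<forall>m\<ge>K. \<forall>n\<ge>K. dd (s m @ u m) (s n @ u n) < e" by blast
qed

lemma mem_cls: "u \<in> cls s \<longleftrightarrow> u \<in> CS \<and> (\<lambda>n. dd (s n) (u n)) \<longlonglongrightarrow> 0"
  by (simp add: tensor_class_def)

lemma cls_self: "s \<in> CS \<Longrightarrow> s \<in> cls s"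
  by (simp add: mem_cls dd_teq tensor_eq.refl CS_V)

lemma dd_null_trans:
  assumes "s \<in> CS" "u \<in> CS" "v \<in> CS" "(\<lambda>n. dd (s n) (u n)) \<longlonglongrightarrow> 0" "(\<lambda>n. dd (u n) (v n)) \<longlonglongrightarrow> 0"
  shows "(\<lambda>n. dd (s n) (v n)) \<longlonglongrightarrow> 0"
  by (rule null_squeeze[OF dd_nonneg dd_trans tendsto_add_zero[OF assms(4,5)]]) (use assms CS_V in auto)

lemma cls_eq:
  assumes s: "s \<in> CS" and u: "u \<in> CS" shows "cls s = cls u \<longleftrightarrow> (\<lambda>n. dd (s n) (u n)) \<longlonglongrightarrow> 0"
proof
  assume "cls s = cls u" then have "u \<in> cls s" using cls_self[OF u] by simp
  then show "(\<lambda>n. dd (s n) (u n)) \<longlonglongrightarrow> 0" by (simp add: mem_cls)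
next
  assume 1: "(\<lambda>n. dd (s n) (u n)) \<longlonglongrightarrow> 0"
  have 2: "(\<lambda>n. dd (u n) (s n)) \<longlonglongrightarrow> 0" using 1 dd_sym[OF CS_V[OF s] CS_V[OF u]] by simp
  show "cls s = cls u"
    using dd_null_trans[OF u s _ 2] dd_null_trans[OF s u _ 1] by (auto simp: mem_cls)
qed

lemma cls_teq: "s \<in> CS \<Longrightarrow> u \<in> CS \<Longrightarrow> (\<And>n. s n \<approx> u n) \<Longrightarrow> cls s = cls u"
  by (simp add: cls_eq dd_teq)

lemma cls_mem: assumes "s \<in> CS" "u \<in> cls s" shows "u \<in> CS" "cls u = cls s"
  using assms cls_eq[of s u] by (auto simp: mem_cls)

lemma T_carrier: "carrier TT = cls ` CS"
  and T_zero: "\<zero>\<^bsub>TT\<^esub> = cls (\<lambda>n. [])"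
  by (simp_all add: ban_tensor_def)

text \<open>The union in the definition of the sum runs over all representatives, but concatenation
  is Lipschitz for \<open>dd\<close>, so all of them give the same class and the union collapses to
  it.\<close>

lemma T_add:
  assumes s: "s \<in> CS" and u: "u \<in> CS"
  shows "cls s \<oplus>\<^bsub>TT\<^esub> cls u = cls (\<lambda>n. s n @ u n)"
proof -
  have "cls (\<lambda>n. s' n @ u' n) = cls (\<lambda>n. s n @ u n)" if s': "s' \<in> cls s" and u': "u' \<in> cls u" for s' u'
  proof -
    note 1 = cls_mem(1)[OF s s'] cls_mem(1)[OF u u']
    have l: "(\<lambda>n. dd (s' n) (s n)) \<longlonglongrightarrow> 0" "(\<lambda>n. dd (u' n) (u n)) \<longlonglongrightarrow> 0"
      using cls_mem[OF s s'] cls_mem[OF u u'] cls_eq s u by blast+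
    show ?thesis
      by (subst cls_eq[OF CS_append[OF 1] CS_append[OF s u]],
          rule null_squeeze[OF dd_nonneg dd_append tendsto_add_zero[OF l]])
        (use 1 s u CS_V in auto)
  qed
  then have "(\<Union>s'\<in>cls s. \<Union>u'\<in>cls u. cls (\<lambda>n. s' n @ u' n)) = cls (\<lambda>n. s n @ u n)"
    using cls_self[OF s] cls_self[OF u] by blast
  then show ?thesis by (simp add: ban_tensor_def)
qed

text \<open>The norm is defined with a representative picked by choice. Since \<open>q\<close> is
  1-Lipschitz for \<open>dd\<close>, its values along a Cauchy sequence converge, and equivalent
  sequences have the same limit.\<close>

lemma T_nm: assumes s: "s \<in> CS" shows "(\<lambda>n. q (s n)) \<longlonglongrightarrow> nm TT (cls s)"
proof -
  define u where "u = (SOME u. u \<in> cls s)"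
  have u: "u \<in> cls s" unfolding u_def by (rule someI[of "\<lambda>u. u \<in> cls s", OF cls_self[OF s]])
  note uC = cls_mem(1)[OF s u]
  have "Cauchy (\<lambda>n. q (u n))"
  proof (rule metric_CauchyI)
    fix e :: real assume "0 < e"
    then obtain K where K: "\<forall>m\<ge>K. \<forall>n\<ge>K. dd (u m) (u n) < e" using CS_D[OF uC] by blast
    have "dist (q (u m)) (q (u n)) < e" if "m \<ge> K" "n \<ge> K" for m n
      using q_dd[OF CS_V[OF uC] CS_V[OF uC], of m n] K that by (auto simp: dist_real_def intro: le_less_trans)
    then show "\<exists>M. \<forall>m\<ge>M. \<forall>n\<ge>M. dist (q (u m)) (q (u n)) < e" by blast
  qed
  then have l: "(\<lambda>n. q (u n)) \<longlonglongrightarrow> lim (\<lambda>n. q (u n))"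
    by (simp add: Cauchy_convergent_iff convergent_LIMSEQ_iff)
  have "(\<lambda>n. \<bar>q (s n) - q (u n)\<bar>) \<longlonglongrightarrow> 0"
    by (rule null_squeeze[of _ "\<lambda>n. dd (s n) (u n)"])
      (use q_dd CS_V[OF s] CS_V[OF uC] u in \<open>auto simp: mem_cls\<close>)
  then have "(\<lambda>n. q (s n) - q (u n)) \<longlonglongrightarrow> 0" by (simp add: tendsto_rabs_zero_iff)
  from tendsto_add[OF this l] show ?thesis by (simp add: ban_tensor_def u_def)
qed

end


section \<open>Functoriality and the Banach module structure of the completion\<close>

lemma tensor_map_dd:
  assumes P: "banach_pair na R M N" and Q: "banach_pair na R M' N'"
    and f: "bounded_linear_map R M M' f" and g: "bounded_linear_map R N N' g"
    and xs: "xs \<in> lists (carrier M \<times> carrier N)" and ys: "ys \<in> lists (carrier M \<times> carrier N)"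
  shows "tensor_seminorm na R M' N' (tensor_diff M' (map (map_prod f g) xs) (map (map_prod f g) ys))
    \<le> op_norm M M' f * op_norm N N' g * tensor_seminorm na R M N (tensor_diff M xs ys)"
proof -
  interpret P: banach_pair na R M N by fact
  interpret Q: banach_pair na R M' N' by fact
  have m: "f (\<ominus>\<^bsub>M\<^esub> x) = \<ominus>\<^bsub>M'\<^esub> f x" if "x \<in> carrier M" for x
    using blm_minus[OF P.M Q.M f P.M.zero_closed that] blm_zero[OF P.M Q.M f] blmD(1)[OF f that] that
    by (simp add: P.M.minus_eq Q.M.minus_eq)
  have e: "P.neg us \<in> P.V \<and> Q.neg (map (map_prod f g) us) = map (map_prod f g) (P.neg us)" if "us \<in> P.V" for us
    using that by (induction us) (auto simp: m)
  have "Q.diff (map (map_prod f g) xs) (map (map_prod f g) ys) = map (map_prod f g) (P.diff xs ys)"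
    using e[OF ys] by (simp add: tensor_diff_def)
  then show ?thesis
    using tensor_seminorm_map[OF P Q f g blm_bound[OF P.M f] blm_bound[OF P.N g] P.diff_V[OF xs ys]] by simp
qed

text \<open>The map on lists is Lipschitz, so it preserves Cauchy sequences and null differences.
  The union in \<open>tensor_map\<close> therefore runs over copies of a single class.\<close>

lemma tensor_map_class:
  assumes P: "banach_pair na R M N" and Q: "banach_pair na R M' N'"
    and f: "bounded_linear_map R M M' f" and g: "bounded_linear_map R N N' g"
    and s: "s \<in> tensor_cauchy na R M N"
  shows "(\<lambda>n. map (map_prod f g) (s n)) \<in> tensor_cauchy na R M' N'"
    and "tensor_map na R M' N' f g (tensor_class na R M N s) =
      tensor_class na R M' N' (\<lambda>n. map (map_prod f g) (s n))"
proof -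
  interpret P: banach_pair na R M N by fact
  interpret Q: banach_pair na R M' N' by fact
  let ?F = "map (map_prod f g)"
  let ?c = "op_norm M M' f * op_norm N N' g"
  have c0: "0 \<le> ?c" using blm_bound(1)[OF P.M f] blm_bound(1)[OF P.N g] by simp
  have FV: "?F us \<in> Q.V" if "us \<in> P.V" for us
    using that blmD(1)[OF f] blmD(1)[OF g] by (auto simp: in_lists_conv_set)
  have C: "(\<lambda>n. ?F (s n)) \<in> Q.CS" if s: "s \<in> P.CS" for s
  proof (rule Q.CS_I)
    show "?F (s n) \<in> Q.V" for n by (rule FV[OF P.CS_V[OF s]])
    fix e :: real assume e: "0 < e"
    then have "0 < e / (?c + 1)" using c0 by auto
    then obtain K where K: "\<forall>m\<ge>K. \<forall>n\<ge>K. P.dd (s m) (s n) < e / (?c + 1)" using P.CS_D[OF s] by blast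
    have "Q.dd (?F (s m)) (?F (s n)) < e" if "m \<ge> K" "n \<ge> K" for m n
    proof -
      have "Q.dd (?F (s m)) (?F (s n)) \<le> ?c * P.dd (s m) (s n)"
        by (rule tensor_map_dd[OF P Q f g P.CS_V[OF s] P.CS_V[OF s]])
      also have "\<dots> \<le> (?c + 1) * P.dd (s m) (s n)"
        using P.dd_nonneg[OF P.CS_V[OF s] P.CS_V[OF s]] by (intro mult_right_mono) auto
      also have "\<dots> < (?c + 1) * (e / (?c + 1))"
        using K that c0 by (intro mult_strict_left_mono) auto
      finally show ?thesis using c0 by simp
    qed
    then show "\<exists>K. \<forall>m\<ge>K. \<forall>n\<ge>K. Q.dd (?F (s m)) (?F (s n)) < e" by blast
  qed
  show "(\<lambda>n. ?F (s n)) \<in> Q.CS" by (rule C[OF s])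
  have "Q.cls (\<lambda>n. ?F (u n)) = Q.cls (\<lambda>n. ?F (s n))" if u: "u \<in> P.cls s" for u
  proof -
    note uC = P.cls_mem(1)[OF s u]
    have l: "(\<lambda>n. P.dd (u n) (s n)) \<longlonglongrightarrow> 0" using P.cls_mem(2)[OF s u] P.cls_eq[OF uC s] by blast
    show ?thesis
      by (subst Q.cls_eq[OF C[OF uC] C[OF s]],
        rule null_squeeze[OF Q.dd_nonneg tensor_map_dd[OF P Q f g] tendsto_mult_right_zero[OF l]])
        (use FV P.CS_V uC s in blast)+
  qed
  then show "tensor_map na R M' N' f g (P.cls s) = Q.cls (\<lambda>n. ?F (s n))"
    unfolding tensor_map_def using P.cls_self[OF s] by blast
qed

context banach_pair
begin

text \<open>Scaling is the tensor map of multiplication by \<open>a\<close> and the identity, so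
  that the general result on tensor maps applies to it.\<close>

lemma CS_scale:
  assumes a: "a \<in> carrier R" and s: "s \<in> CS"
  shows "(\<lambda>n. scale a (s n)) \<in> CS" and "a \<odot>\<^bsub>TT\<^esub> cls s = cls (\<lambda>n. scale a (s n))"
  using tensor_map_class[OF banach_pair_axioms banach_pair_axioms blm_smult[OF R M a] blm_id s]
  unfolding scale_map_prod by (simp_all add: ban_tensor_def tensor_map_def map_prod_def)

lemma CS_neg: assumes s: "s \<in> CS" shows "(\<lambda>n. neg (s n)) \<in> CS"
  using tensor_map_class(1)[OF banach_pair_axioms banach_pair_axioms blm_minus_map[OF M] blm_id s]
  unfolding neg_map_prod .

lemma scale_V: "a \<in> carrier R \<Longrightarrow> xs \<in> V \<Longrightarrow> scale a xs \<in> V"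
  by (auto simp: in_lists_conv_set)

text \<open>Of the laws of scalar multiplication this is the only one that fails for lists and holds
  only up to tensor equality: the two sides have different lengths.\<close>

lemma scale_add:
  assumes a: "a \<in> carrier R" and b: "b \<in> carrier R"
  shows "xs \<in> V \<Longrightarrow> scale (a \<oplus>\<^bsub>R\<^esub> b) xs \<approx> scale a xs @ scale b xs"
proof (induction xs)
  case Nil then show ?case by (auto intro: tensor_eq.refl)
next
  case (Cons z xs)
  obtain x y where z: "z = (x, y)" by (cases z)
  have xy: "x \<in> carrier M" "y \<in> carrier N" and xs: "xs \<in> V" using Cons.prems z by auto
  note c = scale_V[OF a xs] scale_V[OF b xs]
  have "scale (a \<oplus>\<^bsub>R\<^esub> b) (z # xs) = [(a \<odot>\<^bsub>M\<^esub> x \<oplus>\<^bsub>M\<^esub> b \<odot>\<^bsub>M\<^esub> x, y)] @ scale (a \<oplus>\<^bsub>R\<^esub> b) xs"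
    using z xy a b by (simp add: M.smult_l_distr)
  also have "\<dots> \<approx> [(a \<odot>\<^bsub>M\<^esub> x, y), (b \<odot>\<^bsub>M\<^esub> x, y)] @ (scale a xs @ scale b xs)"
    using xy a b by (intro tensor_eq.append tensor_eq.add_left Cons.IH[OF xs]) auto
  also have "\<dots> \<approx> scale a (z # xs) @ scale b (z # xs)"
    using z xy a b c by (intro teq_mset) auto
  finally show ?case .
qed

lemma T_group: "abelian_group TT"
proof (rule abelian_groupI)
  have nil: "(\<lambda>n. []) \<in> CS" by (rule CS_const) simp
  show "\<zero>\<^bsub>TT\<^esub> \<in> carrier TT" using nil by (simp add: T_carrier T_zero)
  fix x assume "x \<in> carrier TT"
  then obtain s where s: "s \<in> CS" "x = cls s" by (auto simp: T_carrier)
  show "\<zero>\<^bsub>TT\<^esub> \<oplus>\<^bsub>TT\<^esub> x = x" using T_add[OF nil s(1)] s by (simp add: T_zero)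
  have "cls (\<lambda>n. neg (s n)) \<oplus>\<^bsub>TT\<^esub> x = \<zero>\<^bsub>TT\<^esub>"
  proof -
    have "neg (s n) @ s n \<approx> []" for n
      using tensor_eq.trans[OF tensor_eq.commute[OF neg_V[OF CS_V[OF s(1), of n]] CS_V[OF s(1), of n]] neg_cancel[OF CS_V[OF s(1), of n]]] .
    then show ?thesis
      unfolding s(2) T_add[OF CS_neg[OF s(1)] s(1)] T_zero
      by (intro cls_teq CS_append CS_neg s nil)
  qed
  then show "\<exists>y\<in>carrier TT. y \<oplus>\<^bsub>TT\<^esub> x = \<zero>\<^bsub>TT\<^esub>" using CS_neg[OF s(1)] by (auto simp: T_carrier)
  fix y assume "y \<in> carrier TT"
  then obtain u where u: "u \<in> CS" "y = cls u" by (auto simp: T_carrier)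
  show "x \<oplus>\<^bsub>TT\<^esub> y \<in> carrier TT" using CS_append[OF s(1) u(1)] by (simp add: s u T_add T_carrier)
  show "x \<oplus>\<^bsub>TT\<^esub> y = y \<oplus>\<^bsub>TT\<^esub> x"
    unfolding s(2) u(2) T_add[OF s(1) u(1)] T_add[OF u(1) s(1)]
    using s(1) u(1) CS_V by (intro cls_teq CS_append tensor_eq.commute)
  fix z assume "z \<in> carrier TT"
  then obtain v where v: "v \<in> CS" "z = cls v" by (auto simp: T_carrier)
  show "x \<oplus>\<^bsub>TT\<^esub> y \<oplus>\<^bsub>TT\<^esub> z = x \<oplus>\<^bsub>TT\<^esub> (y \<oplus>\<^bsub>TT\<^esub> z)"
    using T_add[OF CS_append[OF s(1) u(1)] v(1)] T_add[OF s(1) CS_append[OF u(1) v(1)]]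
    by (simp add: s(2) u(2) v(2) T_add s(1) u(1) v(1))
qed

lemma T_module: "module R TT"
proof (rule moduleI[OF M.R.is_cring T_group])
  fix a x assume a: "a \<in> carrier R" and "x \<in> carrier TT"
  then obtain s where s: "s \<in> CS" "x = cls s" by (auto simp: T_carrier)
  note as = CS_scale[OF a s(1)]
  show "a \<odot>\<^bsub>TT\<^esub> x \<in> carrier TT" using as by (simp add: s T_carrier)
  fix b assume b: "b \<in> carrier R"
  note bs = CS_scale[OF b s(1)]
  show "(a \<oplus>\<^bsub>R\<^esub> b) \<odot>\<^bsub>TT\<^esub> x = a \<odot>\<^bsub>TT\<^esub> x \<oplus>\<^bsub>TT\<^esub> b \<odot>\<^bsub>TT\<^esub> x"
    unfolding s(2) as(2) bs(2) CS_scale(2)[OF M.R.a_closed[OF a b] s(1)] T_add[OF as(1) bs(1)]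
    by (intro cls_teq CS_append CS_scale as bs scale_add[OF a b] CS_V M.R.a_closed a b s)
  have e: "scale (a \<otimes>\<^bsub>R\<^esub> b) (s n) = scale a (scale b (s n))" for n
    using CS_V[OF s(1), of n] a b by (auto simp: M.smult_assoc1 in_lists_conv_set)
  show "(a \<otimes>\<^bsub>R\<^esub> b) \<odot>\<^bsub>TT\<^esub> x = a \<odot>\<^bsub>TT\<^esub> (b \<odot>\<^bsub>TT\<^esub> x)"
    unfolding s(2) bs(2) CS_scale(2)[OF a bs(1)] CS_scale(2)[OF M.R.m_closed[OF a b] s(1)] by (simp only: e)
next
  fix a x y assume a: "a \<in> carrier R" and "x \<in> carrier TT" "y \<in> carrier TT"
  then obtain s u where s: "s \<in> CS" "x = cls s" and u: "u \<in> CS" "y = cls u" by (auto simp: T_carrier)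
  note as = CS_scale[OF a s(1)] and au = CS_scale[OF a u(1)]
  show "a \<odot>\<^bsub>TT\<^esub> (x \<oplus>\<^bsub>TT\<^esub> y) = a \<odot>\<^bsub>TT\<^esub> x \<oplus>\<^bsub>TT\<^esub> a \<odot>\<^bsub>TT\<^esub> y"
    unfolding s(2) u(2) as(2) au(2) T_add[OF as(1) au(1)] T_add[OF s(1) u(1)]
      CS_scale(2)[OF a CS_append[OF s(1) u(1)]] by simp
next
  fix x assume "x \<in> carrier TT"
  then obtain s where s: "s \<in> CS" "x = cls s" by (auto simp: T_carrier)
  have "scale \<one>\<^bsub>R\<^esub> (s n) = s n" for n
    using CS_V[OF s(1), of n] by (intro map_idI) (auto simp: in_lists_conv_set)
  then show "\<one>\<^bsub>R\<^esub> \<odot>\<^bsub>TT\<^esub> x = x" unfolding s(2) CS_scale(2)[OF M.R.one_closed s(1)] by simp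
qed

text \<open>The additive inverse of a class is identified, by uniqueness, with the class of the
  termwise negatives. Hence the norm of a difference is the limit of the distances
  \<open>dd\<close>, the form in which completeness is tested.\<close>

lemma T_diff:
  assumes s: "s \<in> CS" and u: "u \<in> CS"
  shows "cls s \<ominus>\<^bsub>TT\<^esub> cls u = cls (\<lambda>n. diff (s n) (u n))" and "(\<lambda>n. diff (s n) (u n)) \<in> CS"
proof -
  interpret TT: abelian_group TT by (rule T_group)
  note n = CS_neg[OF u]
  have "neg (u n) @ u n \<approx> []" for n
    using tensor_eq.trans[OF tensor_eq.commute[OF neg_V[OF CS_V[OF u, of n]] CS_V[OF u, of n]] neg_cancel[OF CS_V[OF u, of n]]] .
  then have "cls (\<lambda>n. neg (u n)) \<oplus>\<^bsub>TT\<^esub> cls u = \<zero>\<^bsub>TT\<^esub>"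
    unfolding T_add[OF n u] T_zero by (intro cls_teq CS_append n u CS_const) auto
  then have "\<ominus>\<^bsub>TT\<^esub> cls u = cls (\<lambda>n. neg (u n))"
    using n u by (intro TT.minus_equality) (auto simp: T_carrier)
  then show "cls s \<ominus>\<^bsub>TT\<^esub> cls u = cls (\<lambda>n. diff (s n) (u n))" "(\<lambda>n. diff (s n) (u n)) \<in> CS"
    using T_add[OF s n] CS_append[OF s n] by (simp_all add: a_minus_def tensor_diff_def)
qed

end


context banach_pair
begin

lemma T_nm_pos: assumes s: "s \<in> CS" shows "0 \<le> nm TT (cls s)"
  by (rule LIMSEQ_le_const[OF T_nm[OF s]]) (use q_nonneg CS_V[OF s] in blast)

lemma T_nm_le:
  assumes s: "s \<in> CS" and "\<And>n. n \<ge> K \<Longrightarrow> q (s n) \<le> e" shows "nm TT (cls s) \<le> e"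
  by (rule LIMSEQ_le_const2[OF T_nm[OF s]]) (use assms in blast)

lemma T_complete:
  fixes S :: "nat \<Rightarrow> (nat \<Rightarrow> ('m \<times> 'n) list) set"
  assumes S: "\<And>k. S k \<in> carrier TT"
    and cau: "\<And>e. 0 < e \<Longrightarrow> \<exists>K. \<forall>k\<ge>K. \<forall>l\<ge>K. nm TT (S k \<ominus>\<^bsub>TT\<^esub> S l) < e"
  shows "\<exists>x\<in>carrier TT. (\<lambda>k. nm TT (S k \<ominus>\<^bsub>TT\<^esub> x)) \<longlonglongrightarrow> 0"
proof -
  interpret TT: abelian_group TT by (rule T_group)
  have "\<forall>k. \<exists>s\<in>CS. S k = cls s" using S by (auto simp: T_carrier)
  then obtain s where s: "\<And>k. s k \<in> CS" "\<And>k. S k = cls (s k)" by metis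
  note sV = CS_V[OF s(1)]
  have "\<exists>K. \<forall>m\<ge>K. \<forall>n\<ge>K. dd (s k m) (s k n) < inverse (real (Suc k))" for k
    by (rule CS_D[OF s(1)]) simp
  then obtain K where K: "\<And>k m n. m \<ge> K k \<Longrightarrow> n \<ge> K k \<Longrightarrow> dd (s k m) (s k n) < inverse (real (Suc k))" by metis
  define t where "t = (\<lambda>k. s k (K k))"
  have tV: "t k \<in> V" for k unfolding t_def by (rule sV)
  have dk: "dd (s k n) (t k) \<le> inverse (real (Suc k))" if "n \<ge> K k" for k n
    unfolding t_def using K[OF that, of "K k"] by auto
  have inv: "\<exists>L. \<forall>k\<ge>L. inverse (real (Suc k)) < e" if "0 < e" for e :: real
    using LIMSEQ_inverse_real_of_nat that by (auto simp: LIMSEQ_def)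
  have tC: "t \<in> CS"
  proof (rule CS_I[OF tV])
    fix e :: real assume e: "0 < e"
    then obtain A B where A: "\<forall>k\<ge>A. \<forall>l\<ge>A. nm TT (S k \<ominus>\<^bsub>TT\<^esub> S l) < e / 3"
      and B: "\<forall>k\<ge>B. inverse (real (Suc k)) < e / 3" using cau[of "e / 3"] inv[of "e / 3"] by auto
    have "dd (t k) (t l) < e" if k: "k \<ge> max A B" and l: "l \<ge> max A B" for k l
    proof -
      have "(\<lambda>n. dd (s k n) (s l n)) \<longlonglongrightarrow> nm TT (S k \<ominus>\<^bsub>TT\<^esub> S l)"
        using T_nm[OF T_diff(2)[OF s(1) s(1)]] by (simp add: s(2) T_diff(1)[OF s(1) s(1)])
      moreover have "nm TT (S k \<ominus>\<^bsub>TT\<^esub> S l) < e / 3" using A k l by simp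
      ultimately have "eventually (\<lambda>n. dd (s k n) (s l n) < e / 3) sequentially" by (rule order_tendstoD(2))
      then obtain n0 where n0: "\<forall>n\<ge>n0. dd (s k n) (s l n) < e / 3" by (auto simp: eventually_sequentially)
      \<comment> \<open>At this position both representatives are close to their frozen lists, and
        the distance of the two classes is already visible on the lists themselves.\<close>
      define n where "n = max n0 (max (K k) (K l))"
      have "dd (t k) (t l) \<le> dd (t k) (s k n) + (dd (s k n) (s l n) + dd (s l n) (t l))"
        using dd_trans[OF tV[of k] sV[of k n] tV[of l]] dd_trans[OF sV[of k n] sV[of l n] tV[of l]] by linarith
      moreover have "dd (t k) (s k n) < e / 3"
        using dk[of k n] dd_sym[OF tV[of k] sV[of k n]] B k unfolding n_def by force
      moreover have "dd (s l n) (t l) < e / 3"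
        using dk[of l n] B l unfolding n_def by force
      moreover have "dd (s k n) (s l n) < e / 3" using n0 unfolding n_def by simp
      ultimately show ?thesis by linarith
    qed
    then show "\<exists>K. \<forall>m\<ge>K. \<forall>n\<ge>K. dd (t m) (t n) < e" by blast
  qed
  have "(\<lambda>k. nm TT (S k \<ominus>\<^bsub>TT\<^esub> cls t)) \<longlonglongrightarrow> 0"
  proof (rule LIMSEQ_I)
    fix e :: real assume e: "0 < e"
    then obtain A where A: "\<forall>m\<ge>A. \<forall>n\<ge>A. dd (t m) (t n) < e / 4" using CS_D[OF tC, of "e / 4"] by auto
    obtain B where B: "\<forall>k\<ge>B. inverse (real (Suc k)) < e / 4" using inv[of "e / 4"] e by auto
    have "norm (nm TT (S k \<ominus>\<^bsub>TT\<^esub> cls t) - 0) < e" if k: "k \<ge> max A B" for k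
    proof -
      have "dd (s k n) (t n) \<le> e / 2" if n: "n \<ge> max A (K k)" for n
      proof -
        have "dd (s k n) (t k) \<le> e / 4" using dk[of n k] dk[of k n] B k n by force
        moreover have "dd (t k) (t n) \<le> e / 4" using A k n by (simp add: less_imp_le)
        ultimately show ?thesis using dd_trans[OF sV[of k n] tV[of k] tV[of n]] by linarith
      qed
      then have "nm TT (S k \<ominus>\<^bsub>TT\<^esub> cls t) \<le> e / 2"
        unfolding s(2) T_diff(1)[OF s(1) tC] by (rule T_nm_le[OF T_diff(2)[OF s(1) tC]])
      moreover have "0 \<le> nm TT (S k \<ominus>\<^bsub>TT\<^esub> cls t)"
        unfolding s(2) T_diff(1)[OF s(1) tC] by (rule T_nm_pos[OF T_diff(2)[OF s(1) tC]])
      ultimately show ?thesis using e by simp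
    qed
    then show "\<exists>L. \<forall>k\<ge>L. norm (nm TT (S k \<ominus>\<^bsub>TT\<^esub> cls t) - 0) < e" by blast
  qed
  then show ?thesis using tC by (auto simp: T_carrier)
qed

theorem ban_tensor_banach: "banach_module na R TT"
  unfolding banach_module_def banach_norm_def
proof (intro conjI ballI allI impI)
  show "module R TT" by (rule T_module)
  fix x assume "x \<in> carrier TT"
  then obtain s where s: "s \<in> CS" "x = cls s" by (auto simp: T_carrier)
  show "0 \<le> nm TT x" unfolding s(2) by (rule T_nm_pos[OF s(1)])
  have nil: "(\<lambda>n. []) \<in> CS" by (rule CS_const) simp
  have "nm TT x = 0 \<longleftrightarrow> (\<lambda>n. q (s n)) \<longlonglongrightarrow> 0"
    using T_nm[OF s(1)] LIMSEQ_unique by (auto simp: s(2))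
  also have "\<dots> \<longleftrightarrow> x = \<zero>\<^bsub>TT\<^esub>" unfolding s(2) T_zero cls_eq[OF s(1) nil] dd_Nil ..
  finally show "nm TT x = 0 \<longleftrightarrow> x = \<zero>\<^bsub>TT\<^esub>" .
  fix y assume "y \<in> carrier TT"
  then obtain u where u: "u \<in> CS" "y = cls u" by (auto simp: T_carrier)
  have "q (diff (s n) (u n)) \<le> (if na then max (q (s n)) (q (u n)) else q (s n) + q (u n))" for n
    using q_append[OF CS_V[OF s(1), of n] neg_V[OF CS_V[OF u(1), of n]]]
    unfolding tensor_diff_def q_neg[OF CS_V[OF u(1), of n]] .
  moreover have "(\<lambda>n. if na then max (q (s n)) (q (u n)) else q (s n) + q (u n)) \<longlonglongrightarrow>
      (if na then max (nm TT x) (nm TT y) else nm TT x + nm TT y)"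
    using T_nm[OF s(1)] T_nm[OF u(1)] by (auto simp: s(2) u(2) intro!: tendsto_intros)
  ultimately show "nm TT (x \<ominus>\<^bsub>TT\<^esub> y) \<le> (if na then max (nm TT x) (nm TT y) else nm TT x + nm TT y)"
    unfolding s(2) u(2) T_diff(1)[OF s(1) u(1)]
    by (intro LIMSEQ_le[OF T_nm[OF T_diff(2)[OF s(1) u(1)]]]) auto
next
  fix S :: "nat \<Rightarrow> (nat \<Rightarrow> ('m \<times> 'n) list) set"
  assume "range S \<subseteq> carrier TT \<and> (\<forall>e>0. \<exists>N. \<forall>m\<ge>N. \<forall>n\<ge>N. nm TT (S m \<ominus>\<^bsub>TT\<^esub> S n) < e)"
  then show "\<exists>x\<in>carrier TT. (\<lambda>n. nm TT (S n \<ominus>\<^bsub>TT\<^esub> x)) \<longlonglongrightarrow> 0" by (intro T_complete) auto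
next
  fix a x assume a: "a \<in> carrier R" and "x \<in> carrier TT"
  then obtain s where s: "s \<in> CS" "x = cls s" by (auto simp: T_carrier)
  have a0: "0 \<le> rnm R a" using R a unfolding banach_ring_def banach_norm_def by blast
  have "q (scale a (s n)) \<le> rnm R a * q (s n)" for n
    using tensor_seminorm_map[OF banach_pair_axioms banach_pair_axioms blm_smult[OF R M a] blm_id a0
        banach_moduleD(5)[OF M a], of 1 "s n"] CS_V[OF s(1), of n]
    unfolding scale_map_prod by simp
  then show "nm TT (a \<odot>\<^bsub>TT\<^esub> x) \<le> rnm R a * nm TT x"
    unfolding s(2) CS_scale(2)[OF a s(1)]
    by (intro LIMSEQ_le[OF T_nm[OF CS_scale(1)[OF a s(1)]] tendsto_mult_left[OF T_nm[OF s(1)]]]) auto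
qed

end

lemma tensor_map_blm:
  assumes P: "banach_pair na R M N" and Q: "banach_pair na R M' N'"
    and f: "bounded_linear_map R M M' f" and g: "bounded_linear_map R N N' g"
  shows "bounded_linear_map R (ban_tensor na R M N) (ban_tensor na R M' N') (tensor_map na R M' N' f g)"
proof -
  interpret P: banach_pair na R M N by fact
  interpret Q: banach_pair na R M' N' by fact
  let ?t = "tensor_map na R M' N' f g" and ?F = "map (map_prod f g)"
  let ?c = "op_norm M M' f * op_norm N N' g"
  note C = tensor_map_class[OF P Q f g]
  show ?thesis unfolding bounded_linear_map_def
  proof (intro conjI ballI exI[of _ ?c] funcsetI)
    fix x assume "x \<in> carrier P.TT"
    then obtain s where s: "s \<in> P.CS" "x = P.cls s" by (auto simp: P.T_carrier)
    show "?t x \<in> carrier Q.TT" using C[OF s(1)] by (simp add: s(2) Q.T_carrier)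
    have "Q.q (?F (s n)) \<le> ?c * P.q (s n)" for n
      by (rule tensor_seminorm_map[OF P Q f g blm_bound[OF P.M f] blm_bound[OF P.N g] P.CS_V[OF s(1)]])
    then show "nm Q.TT (?t x) \<le> ?c * nm P.TT x"
      unfolding s(2) C(2)[OF s(1)]
      by (intro LIMSEQ_le[OF Q.T_nm[OF C(1)[OF s(1)]] tendsto_mult_left[OF P.T_nm[OF s(1)]]]) auto
    fix y assume "y \<in> carrier P.TT"
    then obtain u where u: "u \<in> P.CS" "y = P.cls u" by (auto simp: P.T_carrier)
    show "?t (x \<oplus>\<^bsub>P.TT\<^esub> y) = ?t x \<oplus>\<^bsub>Q.TT\<^esub> ?t y"
      unfolding s(2) u(2) P.T_add[OF s(1) u(1)] C(2)[OF P.CS_append[OF s(1) u(1)]] C(2)[OF s(1)] C(2)[OF u(1)]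
        Q.T_add[OF C(1)[OF s(1)] C(1)[OF u(1)]] by simp
  next
    fix a x assume a: "a \<in> carrier R" and "x \<in> carrier P.TT"
    then obtain s where s: "s \<in> P.CS" "x = P.cls s" by (auto simp: P.T_carrier)
    have "?F (P.scale a (s n)) = Q.scale a (?F (s n))" for n
      using P.CS_V[OF s(1), of n] a blmD(3)[OF f] by (auto simp: in_lists_conv_set)
    then show "?t (a \<odot>\<^bsub>P.TT\<^esub> x) = a \<odot>\<^bsub>Q.TT\<^esub> ?t x"
      unfolding s(2) P.CS_scale(2)[OF a s(1)] C(2)[OF P.CS_scale(1)[OF a s(1)]] C(2)[OF s(1)]
        Q.CS_scale(2)[OF a C(1)[OF s(1)]] by (simp only:)
  qed
qed

section \<open>Universal property for bounded bilinear maps\<close>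

definition bilinear_sum :: "('r, 'p) nmodule \<Rightarrow> ('m \<Rightarrow> 'n \<Rightarrow> 'p) \<Rightarrow> ('m \<times> 'n) list \<Rightarrow> 'p" where
  "bilinear_sum P \<beta> xs = foldr (\<lambda>(x, y) z. \<beta> x y \<oplus>\<^bsub>P\<^esub> z) xs \<zero>\<^bsub>P\<^esub>"

text \<open>The limit is required along every representative of the class at once, so that
  independence of the representative is settled by the existence proof.\<close>

definition tensor_ext ::
    "('r, 'p) nmodule \<Rightarrow> ('m \<Rightarrow> 'n \<Rightarrow> 'p) \<Rightarrow> (nat \<Rightarrow> ('m \<times> 'n) list) set \<Rightarrow> 'p" where
  "tensor_ext P \<beta> A = (SOME z. z \<in> carrier P \<and>
     (\<forall>s\<in>A. (\<lambda>n. nm P (bilinear_sum P \<beta> (s n) \<ominus>\<^bsub>P\<^esub> z)) \<longlonglongrightarrow> 0))"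

locale banach_bilinear = banach_pair na R M N
  for na and R :: "'r nring" and M :: "('r, 'm) nmodule" and N :: "('r, 'n) nmodule" +
  fixes P :: "('r, 'p) nmodule" and \<beta> :: "'m \<Rightarrow> 'n \<Rightarrow> 'p" and c :: real
  assumes P: "banach_module na R P"
    and \<beta>_closed: "x \<in> carrier M \<Longrightarrow> y \<in> carrier N \<Longrightarrow> \<beta> x y \<in> carrier P"
    and \<beta>_add_left: "x \<in> carrier M \<Longrightarrow> x' \<in> carrier M \<Longrightarrow> y \<in> carrier N \<Longrightarrow>
      \<beta> (x \<oplus>\<^bsub>M\<^esub> x') y = \<beta> x y \<oplus>\<^bsub>P\<^esub> \<beta> x' y"
    and \<beta>_add_right: "x \<in> carrier M \<Longrightarrow> y \<in> carrier N \<Longrightarrow> y' \<in> carrier N \<Longrightarrow>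
      \<beta> x (y \<oplus>\<^bsub>N\<^esub> y') = \<beta> x y \<oplus>\<^bsub>P\<^esub> \<beta> x y'"
    and \<beta>_smult_left: "a \<in> carrier R \<Longrightarrow> x \<in> carrier M \<Longrightarrow> y \<in> carrier N \<Longrightarrow>
      \<beta> (a \<odot>\<^bsub>M\<^esub> x) y = a \<odot>\<^bsub>P\<^esub> \<beta> x y"
    and \<beta>_smult_right: "a \<in> carrier R \<Longrightarrow> x \<in> carrier M \<Longrightarrow> y \<in> carrier N \<Longrightarrow>
      \<beta> x (a \<odot>\<^bsub>N\<^esub> y) = a \<odot>\<^bsub>P\<^esub> \<beta> x y"
    and c_nonneg: "0 \<le> c"
    and \<beta>_bound: "x \<in> carrier M \<Longrightarrow> y \<in> carrier N \<Longrightarrow> nm P (\<beta> x y) \<le> c * (nm M x * nm N y)"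
begin

sublocale P: module R P using banach_moduleD(1)[OF P] .

abbreviation bs where "bs \<equiv> bilinear_sum P \<beta>"

lemma bs_simps [simp]: "bs [] = \<zero>\<^bsub>P\<^esub>" "bs ((x, y) # xs) = \<beta> x y \<oplus>\<^bsub>P\<^esub> bs xs"
  by (simp_all add: bilinear_sum_def)

lemma bs_closed [intro]: "xs \<in> V \<Longrightarrow> bs xs \<in> carrier P"
  by (induction xs) (auto simp: \<beta>_closed)

lemma bs_append: "xs \<in> V \<Longrightarrow> ys \<in> V \<Longrightarrow> bs (xs @ ys) = bs xs \<oplus>\<^bsub>P\<^esub> bs ys"
  by (induction xs) (auto simp: \<beta>_closed bs_closed P.M.a_assoc in_lists_conv_set)

lemma bs_scale: "a \<in> carrier R \<Longrightarrow> xs \<in> V \<Longrightarrow> bs (scale a xs) = a \<odot>\<^bsub>P\<^esub> bs xs"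
  by (induction xs) (auto simp: \<beta>_closed bs_closed P.smult_r_distr \<beta>_smult_left in_lists_conv_set)

lemma \<beta>_zero_left: assumes "y \<in> carrier N" shows "\<beta> \<zero>\<^bsub>M\<^esub> y = \<zero>\<^bsub>P\<^esub>"
  using \<beta>_smult_left[OF M.R.zero_closed M.zero_closed assms] \<beta>_closed[OF M.zero_closed assms] by simp

text \<open>Each generating relation of \<open>tensor_eq\<close> is an identity that bilinear maps
  satisfy; a scalar may cross the tensor sign because it can be pulled out of either
  argument.\<close>

lemma bs_teq: assumes "xs \<approx> ys" shows "bs xs = bs ys"
  using assms
proof induction
  case (append xs xs' ys ys')
  then show ?case using bs_append teq_lists[OF append(1)] teq_lists[OF append(2)] by simp
next
  case (commute xs ys) then show ?case by (simp add: bs_append bs_closed P.a_comm)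
qed (auto simp: \<beta>_closed \<beta>_add_left \<beta>_add_right \<beta>_smult_left \<beta>_smult_right \<beta>_zero_left)

lemma bs_cost: "xs \<in> V \<Longrightarrow> nm P (bs xs) \<le> c * cost xs"
proof (induction xs)
  case Nil then show ?case using banach_norm_zero[OF P] by (simp add: tensor_cost_simps)
next
  case (Cons z xs)
  obtain x y where z: "z = (x, y)" by (cases z)
  have xy: "x \<in> carrier M" "y \<in> carrier N" and xs: "xs \<in> V" using Cons.prems z by auto
  let ?n = "nm M x * nm N y"
  have "nm P (\<beta> x y \<oplus>\<^bsub>P\<^esub> bs xs) \<le>
      (if na then max (nm P (\<beta> x y)) (nm P (bs xs)) else nm P (\<beta> x y) + nm P (bs xs))"
    by (rule banach_norm_add(1)[OF banach_moduleD(2,4)[OF P] \<beta>_closed[OF xy] bs_closed[OF xs]])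
  also have "\<dots> \<le> (if na then max (c * ?n) (c * cost xs) else c * ?n + c * cost xs)"
    using \<beta>_bound[OF xy] Cons.IH[OF xs] by auto
  also have "\<dots> = c * (if na then max ?n (cost xs) else ?n + cost xs)"
    using c_nonneg by (simp add: max_mult_distrib_left distrib_left)
  finally show ?case unfolding z bs_simps tensor_cost_simps .
qed

lemma bs_q: assumes xs: "xs \<in> V" shows "nm P (bs xs) \<le> c * q xs"
proof (rule field_le_epsilon)
  fix e :: real assume e: "0 < e"
  then have "0 < e / (c + 1)" using c_nonneg by simp
  then obtain ys where ys: "xs \<approx> ys" "cost ys < q xs + e / (c + 1)" by (rule q_ex[OF xs])
  have "nm P (bs xs) \<le> c * cost ys" using bs_teq[OF ys(1)] bs_cost teq_lists(2)[OF ys(1)] by simp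
  also have "\<dots> \<le> c * (q xs + e / (c + 1))" using ys(2) c_nonneg by (intro mult_left_mono) auto
  also have "\<dots> \<le> c * q xs + e"
  proof -
    have "c * (e / (c + 1)) \<le> e" using e c_nonneg by (simp add: divide_simps)
    then show ?thesis by (simp add: distrib_left)
  qed
  finally show "nm P (bs xs) \<le> c * q xs + e" .
qed

lemma bs_diff: assumes "xs \<in> V" "ys \<in> V" shows "bs xs \<ominus>\<^bsub>P\<^esub> bs ys = bs (diff xs ys)"
proof -
  have "bs (neg ys) \<oplus>\<^bsub>P\<^esub> bs ys = bs (neg ys @ ys)" using assms neg_V by (simp only: bs_append)
  also have "\<dots> = \<zero>\<^bsub>P\<^esub>"
    using bs_teq[OF tensor_eq.trans[OF tensor_eq.commute[OF neg_V[OF assms(2)] assms(2)] neg_cancel[OF assms(2)]]] by simp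
  finally have "\<ominus>\<^bsub>P\<^esub> bs ys = bs (neg ys)"
    using assms neg_V by (intro P.minus_equality) (auto intro: bs_closed)
  then show ?thesis unfolding tensor_diff_def a_minus_def using assms neg_V by (simp only: bs_append)
qed

text \<open>\<open>bs\<close> is Lipschitz with constant \<open>c\<close> for \<open>dd\<close>:
  Cauchy sequences go to Cauchy sequences in the complete module \<open>P\<close>, and equivalent
  ones to sequences with the same limit.\<close>

lemma tensor_ext:
  assumes s: "s \<in> CS"
  shows "tensor_ext P \<beta> (cls s) \<in> carrier P"
    and "(\<lambda>n. nm P (bs (s n) \<ominus>\<^bsub>P\<^esub> tensor_ext P \<beta> (cls s))) \<longlonglongrightarrow> 0"
proof -
  note sV = CS_V[OF s]
  have "\<exists>z\<in>carrier P. (\<lambda>n. nm P (bs (s n) \<ominus>\<^bsub>P\<^esub> z)) \<longlonglongrightarrow> 0"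
  proof (rule banach_norm_complete[OF banach_moduleD(4)[OF P]])
    show "bs (s n) \<in> carrier P" for n using sV by auto
    show "\<forall>e>0. \<exists>K. \<forall>m\<ge>K. \<forall>n\<ge>K. nm P (bs (s m) \<ominus>\<^bsub>P\<^esub> bs (s n)) < e"
    proof (intro allI impI)
      fix e :: real assume e: "0 < e"
      then have "0 < e / (c + 1)" using c_nonneg by simp
      then obtain K where K: "\<forall>m\<ge>K. \<forall>n\<ge>K. dd (s m) (s n) < e / (c + 1)" using CS_D[OF s] by blast
      have "nm P (bs (s m) \<ominus>\<^bsub>P\<^esub> bs (s n)) < e" if "m \<ge> K" "n \<ge> K" for m n
      proof -
        have "nm P (bs (s m) \<ominus>\<^bsub>P\<^esub> bs (s n)) \<le> c * dd (s m) (s n)"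
          unfolding bs_diff[OF sV sV] by (rule bs_q[OF diff_V[OF sV sV]])
        also have "\<dots> \<le> (c + 1) * dd (s m) (s n)" using dd_nonneg[OF sV sV] by (intro mult_right_mono) auto
        also have "\<dots> < (c + 1) * (e / (c + 1))" using K that c_nonneg by (intro mult_strict_left_mono) auto
        finally show ?thesis using c_nonneg by simp
      qed
      then show "\<exists>K. \<forall>m\<ge>K. \<forall>n\<ge>K. nm P (bs (s m) \<ominus>\<^bsub>P\<^esub> bs (s n)) < e" by blast
    qed
  qed
  then obtain z where z: "z \<in> carrier P" "(\<lambda>n. nm P (bs (s n) \<ominus>\<^bsub>P\<^esub> z)) \<longlonglongrightarrow> 0" by blast
  have "(\<lambda>n. nm P (bs (u n) \<ominus>\<^bsub>P\<^esub> z)) \<longlonglongrightarrow> 0" if u: "u \<in> cls s" for u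
  proof -
    note uC = cls_mem(1)[OF s u] and uV = CS_V[OF cls_mem(1)[OF s u]]
    have l: "(\<lambda>n. dd (u n) (s n)) \<longlonglongrightarrow> 0" using cls_mem(2)[OF s u] cls_eq[OF uC s] by blast
    have b: "nm P (bs (u n) \<ominus>\<^bsub>P\<^esub> z) \<le> c * dd (u n) (s n) + nm P (bs (s n) \<ominus>\<^bsub>P\<^esub> z)" for n
    proof -
      have "bs (u n) \<ominus>\<^bsub>P\<^esub> z = bs (diff (u n) (s n)) \<oplus>\<^bsub>P\<^esub> (bs (s n) \<ominus>\<^bsub>P\<^esub> z)"
        using abelian_group_diff(1)[OF banach_moduleD(2)[OF P] bs_closed[OF uV] bs_closed[OF sV] z(1)]
        by (simp add: bs_diff[OF uV sV])
      then have "nm P (bs (u n) \<ominus>\<^bsub>P\<^esub> z) \<le> nm P (bs (diff (u n) (s n))) + nm P (bs (s n) \<ominus>\<^bsub>P\<^esub> z)"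
        using banach_norm_add(2)[OF banach_moduleD(2,4)[OF P]] bs_closed[OF diff_V[OF uV sV]] bs_closed[OF sV] z(1) by simp
      then show ?thesis using bs_q[OF diff_V[OF uV sV], of n n] by linarith
    qed
    have "(\<lambda>n. c * dd (u n) (s n) + nm P (bs (s n) \<ominus>\<^bsub>P\<^esub> z)) \<longlonglongrightarrow> 0"
      by (rule tendsto_add_zero[OF tendsto_mult_right_zero[OF l] z(2)])
    from null_squeeze[OF banach_moduleD(6)[OF P P.M.minus_closed[OF bs_closed[OF uV] z(1)]] b this] show ?thesis .
  qed
  with z have "z \<in> carrier P \<and> (\<forall>u\<in>cls s. (\<lambda>n. nm P (bs (u n) \<ominus>\<^bsub>P\<^esub> z)) \<longlonglongrightarrow> 0)" by blast
  from someI[of "\<lambda>z. z \<in> carrier P \<and> (\<forall>u\<in>cls s. (\<lambda>n. nm P (bs (u n) \<ominus>\<^bsub>P\<^esub> z)) \<longlonglongrightarrow> 0)", OF this]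
  have D: "tensor_ext P \<beta> (cls s) \<in> carrier P \<and>
      (\<forall>u\<in>cls s. (\<lambda>n. nm P (bs (u n) \<ominus>\<^bsub>P\<^esub> tensor_ext P \<beta> (cls s))) \<longlonglongrightarrow> 0)"
    unfolding tensor_ext_def .
  from conjunct1[OF D] show "tensor_ext P \<beta> (cls s) \<in> carrier P" .
  from bspec[OF conjunct2[OF D] cls_self[OF s]]
  show "(\<lambda>n. nm P (bs (s n) \<ominus>\<^bsub>P\<^esub> tensor_ext P \<beta> (cls s))) \<longlonglongrightarrow> 0" .
qed

lemma tensor_ext_eqI:
  assumes s: "s \<in> CS" and z: "z \<in> carrier P" "(\<lambda>n. nm P (bs (s n) \<ominus>\<^bsub>P\<^esub> z)) \<longlonglongrightarrow> 0"
  shows "tensor_ext P \<beta> (cls s) = z"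
  by (rule banach_conv_unique[OF P bs_closed[OF CS_V[OF s]] tensor_ext(1)[OF s] z(1) tensor_ext(2)[OF s] z(2)])

lemma tensor_ext_pure:
  assumes x: "x \<in> carrier M" and y: "y \<in> carrier N"
  shows "pure_tensor na R M N x y \<in> carrier TT" "tensor_ext P \<beta> (pure_tensor na R M N x y) = \<beta> x y"
proof -
  have C: "(\<lambda>n. [(x, y)]) \<in> CS" using x y by (intro CS_const) auto
  show "pure_tensor na R M N x y \<in> carrier TT" using C by (simp add: pure_tensor_def T_carrier)
  show "tensor_ext P \<beta> (pure_tensor na R M N x y) = \<beta> x y" unfolding pure_tensor_def
    by (rule tensor_ext_eqI[OF C])
      (use x y \<beta>_closed banach_norm_zero[OF P] in \<open>auto simp: P.minus_eq P.r_neg\<close>)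
qed

lemma tensor_ext_blm: "bounded_linear_map R TT P (tensor_ext P \<beta>)"
  unfolding bounded_linear_map_def
proof (intro conjI ballI exI[of _ c] funcsetI)
  fix x assume "x \<in> carrier TT"
  then obtain s where s: "s \<in> CS" "x = cls s" by (auto simp: T_carrier)
  note sV = CS_V[OF s(1)]
  note e = tensor_ext[OF s(1)]
  show "tensor_ext P \<beta> x \<in> carrier P" using e(1) by (simp add: s(2))
  show "nm P (tensor_ext P \<beta> x) \<le> c * nm TT x"
  proof -
    let ?z = "tensor_ext P \<beta> x"
    \<comment> \<open>The limit is bounded through its approximants; the second summand tends to 0,
      so the constant \<open>c\<close> survives.\<close>
    have "nm P ?z \<le> c * q (s n) + nm P (bs (s n) \<ominus>\<^bsub>P\<^esub> ?z)" for n
    proof -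
      have z: "?z \<in> carrier P" using e(1) by (simp add: s(2))
      have "?z = bs (s n) \<ominus>\<^bsub>P\<^esub> (bs (s n) \<ominus>\<^bsub>P\<^esub> ?z)"
        by (rule abelian_group_diff(2)[OF banach_moduleD(2)[OF P] bs_closed[OF sV] z z])
      then have "nm P ?z \<le> nm P (bs (s n)) + nm P (bs (s n) \<ominus>\<^bsub>P\<^esub> ?z)"
        using banach_norm_add(3)[OF banach_moduleD(2,4)[OF P] bs_closed[OF sV[of n]], of "bs (s n) \<ominus>\<^bsub>P\<^esub> ?z"]
          bs_closed[OF sV[of n]] z by simp
      then show ?thesis using bs_q[OF sV[of n]] by linarith
    qed
    moreover have "(\<lambda>n. c * q (s n) + nm P (bs (s n) \<ominus>\<^bsub>P\<^esub> ?z)) \<longlonglongrightarrow> c * nm TT x + 0"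
      unfolding s(2) by (rule tendsto_add[OF tendsto_mult_left[OF T_nm[OF s(1)]] e(2)])
    ultimately show ?thesis by (intro LIMSEQ_le_const) auto
  qed
  fix y assume "y \<in> carrier TT"
  then obtain u where u: "u \<in> CS" "y = cls u" by (auto simp: T_carrier)
  note uV = CS_V[OF u(1)]
  note e' = tensor_ext[OF u(1)]
  show "tensor_ext P \<beta> (x \<oplus>\<^bsub>TT\<^esub> y) = tensor_ext P \<beta> x \<oplus>\<^bsub>P\<^esub> tensor_ext P \<beta> y"
    unfolding s(2) u(2) T_add[OF s(1) u(1)]
  proof (rule tensor_ext_eqI[OF CS_append[OF s(1) u(1)] P.M.a_closed[OF e(1) e'(1)]])
    show "(\<lambda>n. nm P (bs (s n @ u n) \<ominus>\<^bsub>P\<^esub> (tensor_ext P \<beta> (cls s) \<oplus>\<^bsub>P\<^esub> tensor_ext P \<beta> (cls u)))) \<longlonglongrightarrow> 0"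
      unfolding bs_append[OF sV uV]
      by (rule banach_conv_add[OF P bs_closed[OF sV] bs_closed[OF uV] e(1) e'(1) e(2) e'(2)])
  qed
next
  fix a x assume a: "a \<in> carrier R" and "x \<in> carrier TT"
  then obtain s where s: "s \<in> CS" "x = cls s" by (auto simp: T_carrier)
  note sV = CS_V[OF s(1)]
  note e = tensor_ext[OF s(1)]
  show "tensor_ext P \<beta> (a \<odot>\<^bsub>TT\<^esub> x) = a \<odot>\<^bsub>P\<^esub> tensor_ext P \<beta> x"
    unfolding s(2) CS_scale(2)[OF a s(1)]
  proof (rule tensor_ext_eqI[OF CS_scale(1)[OF a s(1)] P.smult_closed[OF a e(1)]])
    show "(\<lambda>n. nm P (bs (scale a (s n)) \<ominus>\<^bsub>P\<^esub> a \<odot>\<^bsub>P\<^esub> tensor_ext P \<beta> (cls s))) \<longlonglongrightarrow> 0"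
      unfolding bs_scale[OF a sV] by (rule blm_conv[OF P P blm_smult[OF R P a] bs_closed[OF sV] e])
  qed
qed

end

text \<open>This makes the extensions of a compatible family of bilinear maps commute with the
  transition maps of a tensor product of ind-objects, hence form one morphism.\<close>

lemma tensor_ext_map:
  assumes P: "banach_bilinear na R M N L \<beta> c" and Q: "banach_bilinear na R M' N' L \<beta>' c'"
    and f: "bounded_linear_map R M M' f" and g: "bounded_linear_map R N N' g"
    and eq: "\<And>x y. x \<in> carrier M \<Longrightarrow> y \<in> carrier N \<Longrightarrow> \<beta>' (f x) (g y) = \<beta> x y"
    and A: "A \<in> carrier (ban_tensor na R M N)"
  shows "tensor_ext L \<beta>' (tensor_map na R M' N' f g A) = tensor_ext L \<beta> A"
proof -
  interpret P: banach_bilinear na R M N L \<beta> c by fact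
  interpret Q: banach_bilinear na R M' N' L \<beta>' c' by fact
  obtain s where s: "s \<in> P.CS" "A = P.cls s" using A by (auto simp: P.T_carrier)
  note C = tensor_map_class[OF P.banach_pair_axioms Q.banach_pair_axioms f g s(1)]
  have "Q.bs (map (map_prod f g) xs) = P.bs xs" if "xs \<in> P.V" for xs
    using that by (induction xs) (auto simp: eq)
  then have "Q.bs (map (map_prod f g) (s n)) = P.bs (s n)" for n using P.CS_V[OF s(1)] by blast
  with P.tensor_ext[OF s(1)] show ?thesis unfolding s(2) C(2)
    by (intro Q.tensor_ext_eqI[OF C(1)]) (simp_all only:)
qed

section \<open>Morphisms of ind-objects\<close>

lemma ind_objD:
  assumes "ind_obj na R X"
  shows "\<And>i. i \<in> idx X \<Longrightarrow> ile X i i"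
    "\<And>i j k. i \<in> idx X \<Longrightarrow> j \<in> idx X \<Longrightarrow> k \<in> idx X \<Longrightarrow> ile X i j \<Longrightarrow> ile X j k \<Longrightarrow> ile X i k"
    "\<And>i j. i \<in> idx X \<Longrightarrow> j \<in> idx X \<Longrightarrow> \<exists>k\<in>idx X. ile X i k \<and> ile X j k"
    "\<And>i. i \<in> idx X \<Longrightarrow> banach_module na R (obj X i)"
    "\<And>i j. i \<in> idx X \<Longrightarrow> j \<in> idx X \<Longrightarrow> ile X i j \<Longrightarrow> bounded_linear_map R (obj X i) (obj X j) (tr X i j)"
    "\<And>i x. i \<in> idx X \<Longrightarrow> x \<in> carrier (obj X i) \<Longrightarrow> tr X i i x = x"
    "\<And>i j k x. i \<in> idx X \<Longrightarrow> j \<in> idx X \<Longrightarrow> k \<in> idx X \<Longrightarrow> ile X i j \<Longrightarrow> ile X j k \<Longrightarrow>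
      x \<in> carrier (obj X i) \<Longrightarrow> tr X j k (tr X i j x) = tr X i k x"
proof -
  note A = assms[unfolded ind_obj_def]
  note A1 = A[THEN conjunct2] note A2 = A1[THEN conjunct2] note A3 = A2[THEN conjunct2]
  note A4 = A3[THEN conjunct2] note A5 = A4[THEN conjunct2] note A6 = A5[THEN conjunct2]
  show "ile X i i" if "i \<in> idx X" for i
    using A1[THEN conjunct1] that by (rule bspec)
  show "ile X i k" if "i \<in> idx X" "j \<in> idx X" "k \<in> idx X" "ile X i j" "ile X j k" for i j k
    using A2[THEN conjunct1] that by blast
  show "\<exists>k\<in>idx X. ile X i k \<and> ile X j k" if "i \<in> idx X" "j \<in> idx X" for i j
    using A3[THEN conjunct1] that by simp
  show "banach_module na R (obj X i)" if "i \<in> idx X" for i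
    using A4[THEN conjunct1] that by (rule bspec)
  show "bounded_linear_map R (obj X i) (obj X j) (tr X i j)" if "i \<in> idx X" "j \<in> idx X" "ile X i j" for i j
    using A5[THEN conjunct1] that by simp
  show "tr X i i x = x" if "i \<in> idx X" "x \<in> carrier (obj X i)" for i x
    using A6[THEN conjunct1] that by simp
  show "tr X j k (tr X i j x) = tr X i k x" if "i \<in> idx X" "j \<in> idx X" "k \<in> idx X" "ile X i j" "ile X j k"
    "x \<in> carrier (obj X i)" for i j k x
    using A6[THEN conjunct2] that by blast
qed

lemma ind_morD:
  assumes "ind_mor na R X Y f"
  shows "ind_obj na R X" "ind_obj na R Y"
    "\<And>i. i \<in> idx X \<Longrightarrow> im_idx f i \<in> idx Y"
    "\<And>i. i \<in> idx X \<Longrightarrow> bounded_linear_map R (obj X i) (obj Y (im_idx f i)) (im_map f i)"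
    "\<And>i x. i \<in> idx X \<Longrightarrow> x \<in> carrier (obj X i) \<Longrightarrow> im_map f i x \<in> carrier (obj Y (im_idx f i))"
proof -
  note A = assms[unfolded ind_mor_def]
  show "ind_obj na R X" using A by (rule conjunct1)
  show "ind_obj na R Y" using A[THEN conjunct2] by (rule conjunct1)
  note B = A[THEN conjunct2, THEN conjunct2, THEN conjunct1, rule_format]
  show *: "bounded_linear_map R (obj X i) (obj Y (im_idx f i)) (im_map f i)" if "i \<in> idx X" for i
    using B[OF that] by (rule conjunct2)
  show "im_idx f i \<in> idx Y" if "i \<in> idx X" for i using B[OF that] by (rule conjunct1)
  show "im_map f i x \<in> carrier (obj Y (im_idx f i))" if "i \<in> idx X" "x \<in> carrier (obj X i)" for i x
    using blmD(1)[OF *[OF that(1)] that(2)] .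
qed

text \<open>Equality in the colimit of two maps from a set into possibly different steps. Both
  \<open>ind_eq\<close> and the compatibility clause of \<open>ind_mor\<close> are instances, so
  transitivity and push-forward are proved once for both.\<close>

definition eventually_equal ::
    "('r, 'j, 'n) ind_sys \<Rightarrow> 's set \<Rightarrow> 'j \<Rightarrow> ('s \<Rightarrow> 'n) \<Rightarrow> 'j \<Rightarrow> ('s \<Rightarrow> 'n) \<Rightarrow> bool" where
  "eventually_equal Y S k F l G \<longleftrightarrow> (\<exists>m\<in>idx Y. ile Y k m \<and> ile Y l m \<and>
     (\<forall>x\<in>S. tr Y k m (F x) = tr Y l m (G x)))"

lemma ind_eq_alt:
  "ind_eq X Y f g \<longleftrightarrow>
    (\<forall>i\<in>idx X. eventually_equal Y (carrier (obj X i)) (im_idx f i) (im_map f i) (im_idx g i) (im_map g i))"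
  unfolding ind_eq_def eventually_equal_def ..

lemma ind_mor_alt:
  "ind_mor na R X Y f \<longleftrightarrow> ind_obj na R X \<and> ind_obj na R Y \<and>
     (\<forall>i\<in>idx X. im_idx f i \<in> idx Y \<and>
        bounded_linear_map R (obj X i) (obj Y (im_idx f i)) (im_map f i)) \<and>
     (\<forall>i\<in>idx X. \<forall>i'\<in>idx X. ile X i i' \<longrightarrow>
       eventually_equal Y (carrier (obj X i)) (im_idx f i) (im_map f i) (im_idx f i') (\<lambda>x. im_map f i' (tr X i i' x)))"
proof -
  have "(\<exists>k\<in>K. P k \<and> Q k \<and> (\<forall>x\<in>S. a k x = b k x)) = (\<exists>k\<in>K. P k \<and> Q k \<and> (\<forall>x\<in>S. b k x = a k x))"
    for K :: "'k set" and P Q and S :: "'s set" and a b :: "'k \<Rightarrow> 's \<Rightarrow> 't"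
    by metis
  note * = this
  show ?thesis unfolding ind_mor_def eventually_equal_def by (subst *) simp
qed

lemma eventually_equal_refl: "ind_obj na R Y \<Longrightarrow> k \<in> idx Y \<Longrightarrow> eventually_equal Y S k F k F"
  unfolding eventually_equal_def by (rule bexI[of _ k]) (simp_all add: ind_objD(1))

lemma eventually_equal_sym: "eventually_equal Y S k F l G \<Longrightarrow> eventually_equal Y S l G k F"
  unfolding eventually_equal_def by (elim bexE conjE, rule bexI) simp_all

text \<open>Directedness provides an index beyond the two witnesses, and functoriality of the
  transition maps carries both equations there.\<close>

lemma eventually_equal_trans:
  assumes Y: "ind_obj na R Y" and k: "k \<in> idx Y" "l \<in> idx Y" "m \<in> idx Y"
    and F: "F \<in> S \<rightarrow> carrier (obj Y k)" "G \<in> S \<rightarrow> carrier (obj Y l)" "H \<in> S \<rightarrow> carrier (obj Y m)"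
    and 1: "eventually_equal Y S k F l G" and 2: "eventually_equal Y S l G m H"
  shows "eventually_equal Y S k F m H"
proof -
  obtain a where a: "a \<in> idx Y" "ile Y k a" "ile Y l a" "\<And>x. x \<in> S \<Longrightarrow> tr Y k a (F x) = tr Y l a (G x)"
    using 1 unfolding eventually_equal_def by blast
  obtain b where b: "b \<in> idx Y" "ile Y l b" "ile Y m b" "\<And>x. x \<in> S \<Longrightarrow> tr Y l b (G x) = tr Y m b (H x)"
    using 2 unfolding eventually_equal_def by blast
  obtain c where c: "c \<in> idx Y" "ile Y a c" "ile Y b c" using ind_objD(3)[OF Y a(1) b(1)] by blast
  note T = ind_objD(7)[OF Y]
  have "tr Y k c (F x) = tr Y m c (H x)" if x: "x \<in> S" for x
  proof -
    have in_car: "F x \<in> carrier (obj Y k)" "G x \<in> carrier (obj Y l)" "H x \<in> carrier (obj Y m)" using F x by auto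
    have "tr Y k c (F x) = tr Y a c (tr Y k a (F x))"
      using T[OF k(1) a(1) c(1) a(2) c(2) in_car(1)] by simp
    also have "\<dots> = tr Y l c (G x)" using a(4)[OF x] T[OF k(2) a(1) c(1) a(3) c(2) in_car(2)] by simp
    also have "\<dots> = tr Y b c (tr Y l b (G x))" using T[OF k(2) b(1) c(1) b(2) c(3) in_car(2)] by simp
    also have "\<dots> = tr Y m c (H x)" using b(4)[OF x] T[OF k(3) b(1) c(1) b(3) c(3) in_car(3)] by simp
    finally show ?thesis .
  qed
  moreover have "ile Y k c" "ile Y m c"
    using ind_objD(2)[OF Y k(1) a(1) c(1) a(2) c(2)] ind_objD(2)[OF Y k(3) b(1) c(1) b(3) c(3)] by auto
  ultimately show ?thesis unfolding eventually_equal_def using c(1) by blast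
qed

text \<open>\<open>F\<close> and \<open>G\<close> coincide in a common step \<open>m\<close>. Since
  \<open>g\<close> is compatible with the transitions from \<open>k\<close> and from
  \<open>l\<close> to \<open>m\<close>, each of the two images is eventually equal to the image of
  that common value.\<close>

lemma eventually_equal_push:
  assumes g: "ind_mor na R Y Z g" and k: "k \<in> idx Y" "l \<in> idx Y"
    and F: "F \<in> S \<rightarrow> carrier (obj Y k)" "G \<in> S \<rightarrow> carrier (obj Y l)"
    and e: "eventually_equal Y S k F l G"
  shows "eventually_equal Z S (im_idx g k) (\<lambda>x. im_map g k (F x)) (im_idx g l) (\<lambda>x. im_map g l (G x))"
proof -
  note D = ind_morD[OF g]
  obtain m where m: "m \<in> idx Y" "ile Y k m" "ile Y l m" "\<And>x. x \<in> S \<Longrightarrow> tr Y k m (F x) = tr Y l m (G x)"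
    using e unfolding eventually_equal_def by blast
  have *: "eventually_equal Z S (im_idx g k) (\<lambda>x. im_map g k (F x)) (im_idx g m) (\<lambda>x. im_map g m (tr Y k m (F x)))"
    if "k \<in> idx Y" "ile Y k m" "F \<in> S \<rightarrow> carrier (obj Y k)" for k F
  proof -
    have "eventually_equal Z (carrier (obj Y k)) (im_idx g k) (im_map g k) (im_idx g m) (\<lambda>x. im_map g m (tr Y k m x))"
      using g that(1,2) m(1) unfolding ind_mor_alt by blast
    then show ?thesis using that(3) unfolding eventually_equal_def by blast
  qed
  have T: "tr Y k m x \<in> carrier (obj Y m)" if "k \<in> idx Y" "ile Y k m" "x \<in> carrier (obj Y k)" for k x
    using blmD(1)[OF ind_objD(5)[OF D(1) that(1) m(1) that(2)] that(3)] .
  have "eventually_equal Z S (im_idx g k) (\<lambda>x. im_map g k (F x)) (im_idx g m) (\<lambda>x. im_map g m (tr Y l m (G x)))"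
    using *[OF k(1) m(2) F(1)] m(4) unfolding eventually_equal_def by simp
  from eventually_equal_trans[OF D(2) D(3)[OF k(1)] D(3)[OF m(1)] D(3)[OF k(2)] _ _ _ this eventually_equal_sym[OF *[OF k(2) m(3) F(2)]]]
  show ?thesis using D(5)[OF k(1)] D(5)[OF k(2)] D(5)[OF m(1)] F T[OF k(2) m(3)] by (auto simp: Pi_iff)
qed

lemma ind_id_mor: assumes "ind_obj na R X" shows "ind_mor na R X X ind_id"
proof -
  have "eventually_equal X (carrier (obj X i)) i (\<lambda>x. x) j (\<lambda>x. tr X i j x)"
    if "i \<in> idx X" "j \<in> idx X" "ile X i j" for i j
    unfolding eventually_equal_def using that ind_objD(1)[OF assms that(2)]
      ind_objD(7)[OF assms that(1,2,2,3)] by (intro bexI[of _ j]) auto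
  then show ?thesis using assms unfolding ind_mor_alt by (simp add: ind_id_def blm_id)
qed

lemma ind_comp_mor:
  assumes f: "ind_mor na R X Y f" and g: "ind_mor na R Y Z g"
  shows "ind_mor na R X Z (ind_comp g f)"
proof -
  note F = ind_morD[OF f] and G = ind_morD[OF g]
  have "bounded_linear_map R (obj X i) (obj Z (im_idx g (im_idx f i))) (\<lambda>x. im_map g (im_idx f i) (im_map f i x))"
    if i: "i \<in> idx X" for i
    by (rule blm_comp(1)[OF ind_objD(4)[OF F(1) i] ind_objD(4)[OF F(2) F(3)[OF i]] F(4)[OF i] G(4)[OF F(3)[OF i]]])
  moreover have "eventually_equal Z (carrier (obj X i)) (im_idx g (im_idx f i)) (\<lambda>x. im_map g (im_idx f i) (im_map f i x))
      (im_idx g (im_idx f j)) (\<lambda>x. im_map g (im_idx f j) (im_map f j (tr X i j x)))"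
    if i: "i \<in> idx X" and j: "j \<in> idx X" and ij: "ile X i j" for i j
    by (rule eventually_equal_push[OF g F(3)[OF i] F(3)[OF j]])
      (use f i j ij F(5) blmD(1)[OF ind_objD(5)[OF F(1) i j ij]] in \<open>auto simp: ind_mor_alt\<close>)
  ultimately show ?thesis using F(1,3) G(2,3) unfolding ind_mor_alt by (simp add: ind_comp_def)
qed

lemma ind_eq_refl: assumes "ind_mor na R X Y f" shows "ind_eq X Y f f"
  using ind_morD(3)[OF assms] by (simp add: ind_eq_alt eventually_equal_refl[OF ind_morD(2)[OF assms]])

lemma ind_eq_sym: "ind_eq X Y f g \<Longrightarrow> ind_eq X Y g f"
  unfolding ind_eq_alt by (blast intro: eventually_equal_sym)

lemma ind_eq_trans:
  assumes "ind_mor na R X Y f" "ind_mor na R X Y g" "ind_mor na R X Y h" "ind_eq X Y f g" "ind_eq X Y g h"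
  shows "ind_eq X Y f h"
  unfolding ind_eq_alt
proof
  fix i assume i: "i \<in> idx X"
  note D = ind_morD[OF assms(1)] ind_morD[OF assms(2)] ind_morD[OF assms(3)]
  show "eventually_equal Y (carrier (obj X i)) (im_idx f i) (im_map f i) (im_idx h i) (im_map h i)"
    by (rule eventually_equal_trans[OF D(2) D(3)[OF i] D(8)[OF i] D(13)[OF i], where G = "im_map g i"])
      (use assms(4,5) i D(5,10,15) in \<open>auto simp: ind_eq_alt\<close>)
qed

lemma ind_comp_cong_right:
  assumes "ind_mor na R X Y f" "ind_mor na R X Y f'" "ind_mor na R Y Z g" "ind_eq X Y f f'"
  shows "ind_eq X Z (ind_comp g f) (ind_comp g f')"
  unfolding ind_eq_alt
proof
  fix i assume i: "i \<in> idx X"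
  note D = ind_morD[OF assms(1)] ind_morD[OF assms(2)]
  show "eventually_equal Z (carrier (obj X i)) (im_idx (ind_comp g f) i) (im_map (ind_comp g f) i)
      (im_idx (ind_comp g f') i) (im_map (ind_comp g f') i)"
    using eventually_equal_push[OF assms(3) D(3)[OF i] D(8)[OF i], of "im_map f i" "carrier (obj X i)" "im_map f' i"]
      D(5)[OF i] D(10)[OF i] assms(4) i unfolding ind_eq_alt ind_comp_def by auto
qed

lemma ind_comp_cong_left:
  assumes "ind_mor na R X Y f" "ind_eq Y Z g g'"
  shows "ind_eq X Z (ind_comp g f) (ind_comp g' f)"
  unfolding ind_eq_def
proof
  fix i assume i: "i \<in> idx X"
  note D = ind_morD(3,5)[OF assms(1) i]
  from bspec[OF assms(2)[unfolded ind_eq_def] D(1)] D(2)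
  show "\<exists>k\<in>idx Z. ile Z (im_idx (ind_comp g f) i) k \<and> ile Z (im_idx (ind_comp g' f) i) k \<and>
      (\<forall>x\<in>carrier (obj X i). tr Z (im_idx (ind_comp g f) i) k (im_map (ind_comp g f) i x) =
        tr Z (im_idx (ind_comp g' f) i) k (im_map (ind_comp g' f) i x))"
    by (auto simp: ind_comp_def)
qed

text \<open>Composition of representatives is strictly associative and unital, so only the
  cancellation of inverses has to be carried out up to \<open>ind_eq\<close>.\<close>

lemma ind_comp_assoc: "ind_comp h (ind_comp g f) = ind_comp (ind_comp h g) f"
  and ind_comp_id_left: "ind_comp ind_id f = f"
  and ind_comp_id_right: "ind_comp f ind_id = f"
  by (simp_all add: ind_comp_def ind_id_def)

lemma ind_iso_cong:
  assumes f: "ind_iso na R X Y f" and f': "ind_mor na R X Y f'" and e: "ind_eq X Y f f'"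
  shows "ind_iso na R X Y f'"
proof -
  obtain g where m: "ind_mor na R X Y f" and g: "ind_mor na R Y X g"
    "ind_eq X X (ind_comp g f) ind_id" "ind_eq Y Y (ind_comp f g) ind_id"
    using f unfolding ind_iso_def by blast
  note X = ind_morD(1)[OF m] and Y = ind_morD(2)[OF m]
  have "ind_eq X X (ind_comp g f') ind_id"
    by (rule ind_eq_trans[OF ind_comp_mor[OF f' g(1)] ind_comp_mor[OF m g(1)] ind_id_mor[OF X]
          ind_comp_cong_right[OF f' m g(1) ind_eq_sym[OF e]] g(2)])
  moreover have "ind_eq Y Y (ind_comp f' g) ind_id"
    by (rule ind_eq_trans[OF ind_comp_mor[OF g(1) f'] ind_comp_mor[OF g(1) m] ind_id_mor[OF Y]
          ind_comp_cong_left[OF g(1) ind_eq_sym[OF e]] g(3)])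
  ultimately show ?thesis unfolding ind_iso_def using f' g(1) by blast
qed

text \<open>If \<open>h\<close> inverts \<open>g f\<close>, then \<open>h g\<close> inverts
  \<open>f\<close>. Reflexivity is obtained from this with the map to the bidual as \<open>f\<close>
  and a dualised isomorphism as \<open>g\<close>.\<close>

lemma ind_iso_cancel_left:
  assumes f: "ind_mor na R X Y f" and g: "ind_iso na R Y Z g" and gf: "ind_iso na R X Z (ind_comp g f)"
  shows "ind_iso na R X Y f"
proof -
  obtain g' where m: "ind_mor na R Y Z g" and g': "ind_mor na R Z Y g'"
    "ind_eq Y Y (ind_comp g' g) ind_id"
    using g unfolding ind_iso_def by blast
  obtain h where h: "ind_mor na R Z X h"
    "ind_eq X X (ind_comp h (ind_comp g f)) ind_id" "ind_eq Z Z (ind_comp (ind_comp g f) h) ind_id"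
    using gf unfolding ind_iso_def by blast
  note Y = ind_morD(1)[OF m]
  let ?k = "ind_comp h g"
  have k: "ind_mor na R Y X ?k" by (rule ind_comp_mor[OF m h(1)])
  note fk = ind_comp_mor[OF k f] and gfh = ind_comp_mor[OF h(1) ind_comp_mor[OF f m]]
  \<comment> \<open>Composing \<open>f h g\<close> on the left with \<open>g' g\<close> changes
    nothing up to \<open>ind_eq\<close>. As \<open>g f h g\<close> equals \<open>g\<close>, the same
    composite is also \<open>g' g\<close>, that is, the identity.\<close>
  have 1: "ind_eq Y Y (ind_comp (ind_comp g' g) (ind_comp f ?k)) (ind_comp f ?k)"
    using ind_comp_cong_left[OF fk g'(2)] by (simp only: ind_comp_id_left)
  have "ind_eq Y Z (ind_comp (ind_comp (ind_comp g f) h) g) g"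
    using ind_comp_cong_left[OF m h(3)] by (simp only: ind_comp_id_left)
  from ind_comp_cong_right[OF ind_comp_mor[OF m gfh] m g'(1) this]
  have 2: "ind_eq Y Y (ind_comp (ind_comp g' g) (ind_comp f ?k)) (ind_comp g' g)"
    by (simp only: ind_comp_assoc)
  have "ind_eq Y Y (ind_comp f ?k) (ind_comp g' g)"
    by (rule ind_eq_trans[OF fk ind_comp_mor[OF fk ind_comp_mor[OF m g'(1)]] ind_comp_mor[OF m g'(1)] ind_eq_sym[OF 1] 2])
  from ind_eq_trans[OF fk ind_comp_mor[OF m g'(1)] ind_id_mor[OF Y] this g'(2)]
  have "ind_eq Y Y (ind_comp f ?k) ind_id" .
  moreover have "ind_eq X X (ind_comp ?k f) ind_id" using h(2) by (simp only: ind_comp_assoc)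
  ultimately show ?thesis unfolding ind_iso_def using f k by blast
qed

section \<open>Duals\<close>

lemma ind_dual_simps:
  "idx (ind_dual R X) = {\<phi>. \<forall>i\<in>idx X. 0 < \<phi> i}"
  "ile (ind_dual R X) \<phi> \<psi> \<longleftrightarrow> (\<forall>i\<in>idx X. \<phi> i \<le> \<psi> i)"
  "tr (ind_dual R X) \<phi> \<psi> f = f"
  "f \<oplus>\<^bsub>obj (ind_dual R X) \<phi>\<^esub> g = (\<lambda>i\<in>idx X. \<lambda>x\<in>carrier (obj X i). f i x \<oplus>\<^bsub>R\<^esub> g i x)"
  "a \<odot>\<^bsub>obj (ind_dual R X) \<phi>\<^esub> f = (\<lambda>i\<in>idx X. \<lambda>x\<in>carrier (obj X i). a \<otimes>\<^bsub>R\<^esub> f i x)"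
  by (simp_all add: ind_dual_def ind_lim_def bounded_families_def ban_hom_def ring_as_module_def)

lemma ring_as_module_simps:
  "carrier (ring_as_module R) = carrier R" "x \<oplus>\<^bsub>ring_as_module R\<^esub> y = x \<oplus>\<^bsub>R\<^esub> y"
  "a \<odot>\<^bsub>ring_as_module R\<^esub> x = a \<otimes>\<^bsub>R\<^esub> x" "nm (ring_as_module R) x = rnm R x"
  "\<zero>\<^bsub>ring_as_module R\<^esub> = \<zero>\<^bsub>R\<^esub>"
  by (simp_all add: ring_as_module_def)

text \<open>The bound on values passes through two infima: the norm in the step bounds the operator
  norm of \<open>f i\<close>, and this bounds \<open>f i x\<close>.\<close>

lemma ind_dualD:
  assumes R: "banach_ring na R" and X: "ind_obj na R X"
    and \<phi>: "\<phi> \<in> idx (ind_dual R X)" and f: "f \<in> carrier (obj (ind_dual R X) \<phi>)"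
  shows "f \<in> PiE (idx X) (\<lambda>i. carrier (ban_hom R (obj X i) (ring_as_module R)))"
    "\<And>i. i \<in> idx X \<Longrightarrow> f i \<in> extensional (carrier (obj X i))"
    "\<And>i. i \<in> idx X \<Longrightarrow> bounded_linear_map R (obj X i) (ring_as_module R) (f i)"
    "\<And>i x. i \<in> idx X \<Longrightarrow> x \<in> carrier (obj X i) \<Longrightarrow> f i x \<in> carrier R"
    "0 \<le> nm (obj (ind_dual R X) \<phi>) f"
    "\<And>i x. i \<in> idx X \<Longrightarrow> x \<in> carrier (obj X i) \<Longrightarrow>
      rnm R (f i x) \<le> nm (obj (ind_dual R X) \<phi>) f * \<phi> i * nm (obj X i) x"
    "\<And>i j x. i \<in> idx X \<Longrightarrow> j \<in> idx X \<Longrightarrow> ile X i j \<Longrightarrow> x \<in> carrier (obj X i) \<Longrightarrow> f j (tr X i j x) = f i x"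
proof -
  have \<phi>: "\<And>i. i \<in> idx X \<Longrightarrow> 0 < \<phi> i" using \<phi> by (simp add: ind_dual_simps)
  have f': "f \<in> carrier (bounded_families (idx X) (ile X) (\<lambda>i. ban_hom R (obj X i) (ring_as_module R))
     (\<lambda>i j f. \<lambda>x\<in>carrier (obj X i). f (tr X i j x)) \<phi>)"
    and n: "obj (ind_dual R X) \<phi> = bounded_families (idx X) (ile X) (\<lambda>i. ban_hom R (obj X i) (ring_as_module R))
     (\<lambda>i j f. \<lambda>x\<in>carrier (obj X i). f (tr X i j x)) \<phi>"
    using f by (simp_all add: ind_dual_def ind_lim_def)
  note D = bounded_familiesD[where \<phi> = \<phi>, OF ind_dual_inverse_system[OF R X] \<phi> f']
  show "f \<in> PiE (idx X) (\<lambda>i. carrier (ban_hom R (obj X i) (ring_as_module R)))" by (rule D(1))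
  show nn: "0 \<le> nm (obj (ind_dual R X) \<phi>) f" using D(3) by (simp add: n)
  fix i assume i: "i \<in> idx X"
  have fi: "f i \<in> carrier (ban_hom R (obj X i) (ring_as_module R))" by (rule PiE_mem[OF D(1) i])
  show "f i \<in> extensional (carrier (obj X i))" using fi by (simp add: ban_hom_def)
  show b: "bounded_linear_map R (obj X i) (ring_as_module R) (f i)" using fi by (simp add: ban_hom_def)
  fix x assume x: "x \<in> carrier (obj X i)"
  note B = ind_objD(4)[OF X i]
  show "f i x \<in> carrier R" using blmD(1)[OF b x] by (simp add: ring_as_module_simps)
  have "rnm R (f i x) \<le> op_norm (obj X i) (ring_as_module R) (f i) * nm (obj X i) x"
    using blm_bound(2)[OF B b x] by (simp add: ring_as_module_simps)
  also have "\<dots> \<le> nm (obj (ind_dual R X) \<phi>) f * \<phi> i * nm (obj X i) x"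
    using D(4)[OF _ i] banach_moduleD(6)[OF B x] by (intro mult_right_mono) (simp_all add: n ban_hom_def)
  finally show "rnm R (f i x) \<le> nm (obj (ind_dual R X) \<phi>) f * \<phi> i * nm (obj X i) x" .
  fix j assume j: "j \<in> idx X" and ij: "ile X i j"
  have "(\<lambda>x\<in>carrier (obj X i). f j (tr X i j x)) = f i" using D(2)[OF _ i j ij] by simp
  from fun_cong[OF this, of x] show "f j (tr X i j x) = f i x" using x by simp
qed

text \<open>The restrictions in \<open>f\<close> are forced, because an element of a dual is a
  family of functions that is extensional both in the index and in the argument.\<close>

lemma ind_dual_memI:
  assumes R: "banach_ring na R" and X: "ind_obj na R X" and \<phi>: "\<phi> \<in> idx (ind_dual R X)"
    and b: "\<And>i. i \<in> idx X \<Longrightarrow> bounded_linear_map R (obj X i) (ring_as_module R) (F i)"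
    and n: "\<And>i x. i \<in> idx X \<Longrightarrow> x \<in> carrier (obj X i) \<Longrightarrow> rnm R (F i x) \<le> c * \<phi> i * nm (obj X i) x"
    and c: "0 \<le> c"
    and t: "\<And>i j x. i \<in> idx X \<Longrightarrow> j \<in> idx X \<Longrightarrow> ile X i j \<Longrightarrow> x \<in> carrier (obj X i) \<Longrightarrow> F j (tr X i j x) = F i x"
  defines "f \<equiv> \<lambda>i\<in>idx X. \<lambda>x\<in>carrier (obj X i). F i x"
  shows "f \<in> carrier (obj (ind_dual R X) \<phi>)" "nm (obj (ind_dual R X) \<phi>) f \<le> c"
proof -
  have \<phi>: "\<And>i. i \<in> idx X \<Longrightarrow> 0 < \<phi> i" using \<phi> by (simp add: ind_dual_simps)
  have h: "f i \<in> carrier (ban_hom R (obj X i) (ring_as_module R))" if i: "i \<in> idx X" for i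
  proof -
    interpret M: module R "obj X i" using banach_moduleD(1)[OF ind_objD(4)[OF X i]] .
    show ?thesis using b[OF i] i by (simp add: f_def ban_hom_def bounded_linear_map_def Pi_iff)
  qed
  have o: "nm (ban_hom R (obj X i) (ring_as_module R)) (f i) \<le> c * \<phi> i" if i: "i \<in> idx X" for i
  proof -
    have e: "\<exists>C. \<forall>x\<in>carrier (obj X i). nm (ring_as_module R) (f i x) \<le> C * nm (obj X i) x"
      using n[OF i] i by (intro exI[of _ "c * \<phi> i"]) (simp add: f_def ring_as_module_simps)
    show ?thesis
      using Inf_bound(3)[OF e banach_moduleD(6)[OF ind_objD(4)[OF X i]], of "c * \<phi> i"] n[OF i] c \<phi>[OF i] i
      by (simp add: ban_hom_def op_norm_def f_def ring_as_module_simps)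
  qed
  have tt: "(\<lambda>x\<in>carrier (obj X i). f j (tr X i j x)) = f i"
    if i: "i \<in> idx X" and j: "j \<in> idx X" and ij: "ile X i j" for i j
    using blmD(1)[OF ind_objD(5)[OF X i j ij]] t[OF i j ij] i j by (auto simp: f_def)
  have "f \<in> PiE (idx X) (\<lambda>i. carrier (ban_hom R (obj X i) (ring_as_module R)))"
    using h by (auto simp: f_def)
  then show "f \<in> carrier (obj (ind_dual R X) \<phi>)"
    using o tt by (auto simp: ind_dual_def ind_lim_def bounded_families_def intro!: exI[of _ c])
  show "nm (obj (ind_dual R X) \<phi>) f \<le> c"
    using bounded_families_nm_le[of "idx X" \<phi> c "\<lambda>i. ban_hom R (obj X i) (ring_as_module R)" f] \<phi> c o
    by (simp add: ind_dual_def ind_lim_def)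
qed

text \<open>Elements of a dual are plain extensional families of functions whatever their step, so
  they can be compared as functions even when \<open>\<phi>\<close> and \<open>\<psi>\<close>
  differ.\<close>

lemma ind_dual_ext:
  assumes R: "banach_ring na R" and X: "ind_obj na R X"
    and "\<phi> \<in> idx (ind_dual R X)" "f \<in> carrier (obj (ind_dual R X) \<phi>)"
    and "\<psi> \<in> idx (ind_dual R X)" "g \<in> carrier (obj (ind_dual R X) \<psi>)"
    and e: "\<And>i x. i \<in> idx X \<Longrightarrow> x \<in> carrier (obj X i) \<Longrightarrow> f i x = g i x"
  shows "f = g"
proof -
  note F = ind_dualD[OF R X assms(3,4)] and G = ind_dualD[OF R X assms(5,6)]
  show ?thesis
  proof (rule PiE_ext[OF F(1) G(1)])
    fix i assume i: "i \<in> idx X"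
    show "f i = g i" by (rule extensionalityI[OF F(2)[OF i] G(2)[OF i] e[OF i]])
  qed
qed

text \<open>The transition maps of a limit do not change families, so equal functions represent
  equal morphisms. A common step is the pointwise maximum of the two indices, which is positive as
  soon as the index of \<open>f\<close> is.\<close>

lemma ind_eq_limI:
  assumes f: "\<And>k i. k \<in> idx T \<Longrightarrow> i \<in> I \<Longrightarrow> 0 < im_idx f k i"
    and e: "\<And>k x. k \<in> idx T \<Longrightarrow> x \<in> carrier (obj T k) \<Longrightarrow> im_map f k x = im_map g k x"
  shows "ind_eq T (ind_lim I r M t) f g"
  unfolding ind_eq_def
proof
  fix k assume "k \<in> idx T"
  then show "\<exists>m\<in>idx (ind_lim I r M t). ile (ind_lim I r M t) (im_idx f k) m \<and> ile (ind_lim I r M t) (im_idx g k) m \<and>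
        (\<forall>x\<in>carrier (obj T k). tr (ind_lim I r M t) (im_idx f k) m (im_map f k x) =
          tr (ind_lim I r M t) (im_idx g k) m (im_map g k x))"
    using f e by (intro bexI[of _ "\<lambda>i. max (im_idx f k i) (im_idx g k i)"]) (auto simp: ind_lim_def less_max_iff_disj)
qed

lemma ind_eq_dualI:
  assumes f: "ind_mor na R T (ind_dual R X) f"
    and e: "\<And>k x. k \<in> idx T \<Longrightarrow> x \<in> carrier (obj T k) \<Longrightarrow> im_map f k x = im_map g k x"
  shows "ind_eq T (ind_dual R X) f g"
  unfolding ind_dual_def using ind_morD(3)[OF f] e by (intro ind_eq_limI) (auto simp: ind_dual_simps)

text \<open>A morphism into a dual amounts to compatible bilinear forms \<open>\<beta> k i\<close>,
  bounded by the index that the representative assigns. The two adjuncts, the dual of a morphism and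
  the map to the bidual are all obtained in this way.\<close>

lemma ind_mor_dualI:
  assumes R: "banach_ring na R" and T: "ind_obj na R T" and X: "ind_obj na R X"
    and pos: "\<And>k i. k \<in> idx T \<Longrightarrow> i \<in> idx X \<Longrightarrow> 0 < im_idx f k i"
    and map: "\<And>k y. k \<in> idx T \<Longrightarrow> y \<in> carrier (obj T k) \<Longrightarrow>
      im_map f k y = (\<lambda>i\<in>idx X. \<lambda>x\<in>carrier (obj X i). \<beta> k i y x)"
    and closed: "\<And>k i y x. k \<in> idx T \<Longrightarrow> i \<in> idx X \<Longrightarrow> y \<in> carrier (obj T k) \<Longrightarrow> x \<in> carrier (obj X i) \<Longrightarrow>
      \<beta> k i y x \<in> carrier R"
    and bound: "\<And>k i y x. k \<in> idx T \<Longrightarrow> i \<in> idx X \<Longrightarrow> y \<in> carrier (obj T k) \<Longrightarrow> x \<in> carrier (obj X i) \<Longrightarrow>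
      rnm R (\<beta> k i y x) \<le> im_idx f k i * (nm (obj T k) y * nm (obj X i) x)"
    and add: "\<And>k i y x x'. k \<in> idx T \<Longrightarrow> i \<in> idx X \<Longrightarrow> y \<in> carrier (obj T k) \<Longrightarrow> x \<in> carrier (obj X i) \<Longrightarrow>
      x' \<in> carrier (obj X i) \<Longrightarrow> \<beta> k i y (x \<oplus>\<^bsub>obj X i\<^esub> x') = \<beta> k i y x \<oplus>\<^bsub>R\<^esub> \<beta> k i y x'"
    and smult: "\<And>k i y x a. k \<in> idx T \<Longrightarrow> i \<in> idx X \<Longrightarrow> y \<in> carrier (obj T k) \<Longrightarrow> x \<in> carrier (obj X i) \<Longrightarrow>
      a \<in> carrier R \<Longrightarrow> \<beta> k i y (a \<odot>\<^bsub>obj X i\<^esub> x) = a \<otimes>\<^bsub>R\<^esub> \<beta> k i y x"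
    and add': "\<And>k i y y' x. k \<in> idx T \<Longrightarrow> i \<in> idx X \<Longrightarrow> y \<in> carrier (obj T k) \<Longrightarrow> y' \<in> carrier (obj T k) \<Longrightarrow>
      x \<in> carrier (obj X i) \<Longrightarrow> \<beta> k i (y \<oplus>\<^bsub>obj T k\<^esub> y') x = \<beta> k i y x \<oplus>\<^bsub>R\<^esub> \<beta> k i y' x"
    and smult': "\<And>k i y x a. k \<in> idx T \<Longrightarrow> i \<in> idx X \<Longrightarrow> y \<in> carrier (obj T k) \<Longrightarrow> x \<in> carrier (obj X i) \<Longrightarrow>
      a \<in> carrier R \<Longrightarrow> \<beta> k i (a \<odot>\<^bsub>obj T k\<^esub> y) x = a \<otimes>\<^bsub>R\<^esub> \<beta> k i y x"
    and tr: "\<And>k i j y x. k \<in> idx T \<Longrightarrow> i \<in> idx X \<Longrightarrow> j \<in> idx X \<Longrightarrow> ile X i j \<Longrightarrow> y \<in> carrier (obj T k) \<Longrightarrow>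
      x \<in> carrier (obj X i) \<Longrightarrow> \<beta> k j y (tr X i j x) = \<beta> k i y x"
    and tr': "\<And>k l i y x. k \<in> idx T \<Longrightarrow> l \<in> idx T \<Longrightarrow> ile T k l \<Longrightarrow> i \<in> idx X \<Longrightarrow> y \<in> carrier (obj T k) \<Longrightarrow>
      x \<in> carrier (obj X i) \<Longrightarrow> \<beta> l i (tr T k l y) x = \<beta> k i y x"
  shows "ind_mor na R T (ind_dual R X) f"
proof -
  have pos': "im_idx f k \<in> idx (ind_dual R X)" if "k \<in> idx T" for k
    using pos[OF that] by (simp add: ind_dual_simps)
  have mem: "im_map f k y \<in> carrier (obj (ind_dual R X) (im_idx f k)) \<and>
      nm (obj (ind_dual R X) (im_idx f k)) (im_map f k y) \<le> nm (obj T k) y"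
    if k: "k \<in> idx T" and y: "y \<in> carrier (obj T k)" for k y
  proof -
    have "bounded_linear_map R (obj X i) (ring_as_module R) (\<beta> k i y)" if i: "i \<in> idx X" for i
      unfolding bounded_linear_map_def ring_as_module_simps
      using closed[OF k i y] bound[OF k i y] add[OF k i y] smult[OF k i y]
      by (auto simp: mult.assoc intro!: exI[of _ "im_idx f k i * nm (obj T k) y"])
    moreover have "rnm R (\<beta> k i y x) \<le> nm (obj T k) y * im_idx f k i * nm (obj X i) x"
      if "i \<in> idx X" "x \<in> carrier (obj X i)" for i x using bound[OF k that(1) y that(2)] by (simp add: mult_ac)
    ultimately show ?thesis unfolding map[OF k y]
      using ind_dual_memI[OF R X pos'[OF k], of "\<lambda>i. \<beta> k i y" "nm (obj T k) y"]
        banach_moduleD(6)[OF ind_objD(4)[OF T k] y] tr[OF k _ _ _ y] by blast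
  qed
  have b: "bounded_linear_map R (obj T k) (obj (ind_dual R X) (im_idx f k)) (im_map f k)" if k: "k \<in> idx T" for k
  proof -
    interpret M: module R "obj T k" using banach_moduleD(1)[OF ind_objD(4)[OF T k]] .
    show ?thesis unfolding bounded_linear_map_def
    proof (intro conjI ballI)
      show "im_map f k \<in> carrier (obj T k) \<rightarrow> carrier (obj (ind_dual R X) (im_idx f k))" using mem[OF k] by blast
      show "\<exists>C. \<forall>x\<in>carrier (obj T k). nm (obj (ind_dual R X) (im_idx f k)) (im_map f k x) \<le> C * nm (obj T k) x"
        using mem[OF k] by (intro exI[of _ 1]) simp
    next
      fix y y' assume y: "y \<in> carrier (obj T k)" "y' \<in> carrier (obj T k)"
      then show "im_map f k (y \<oplus>\<^bsub>obj T k\<^esub> y') =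
          im_map f k y \<oplus>\<^bsub>obj (ind_dual R X) (im_idx f k)\<^esub> im_map f k y'"
        using add'[OF k _ y] by (auto simp: map[OF k] ind_dual_simps intro!: restrict_ext)
    next
      fix a y assume y: "a \<in> carrier R" "y \<in> carrier (obj T k)"
      then show "im_map f k (a \<odot>\<^bsub>obj T k\<^esub> y) = a \<odot>\<^bsub>obj (ind_dual R X) (im_idx f k)\<^esub> im_map f k y"
        using smult'[OF k _ y(2) _ y(1)] by (auto simp: map[OF k] ind_dual_simps intro!: restrict_ext)
    qed
  qed
  show ?thesis unfolding ind_mor_alt
  proof (intro conjI ballI impI T ind_dual_obj[OF R X] pos' b)
    fix k l assume k: "k \<in> idx T" and l: "l \<in> idx T" and kl: "ile T k l"
    have "im_map f k y = im_map f l (tr T k l y)" if y: "y \<in> carrier (obj T k)" for y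
      unfolding map[OF k y] map[OF l blmD(1)[OF ind_objD(5)[OF T k l kl] y]]
      using tr'[OF k l kl _ y] by (intro restrict_ext) simp
    then show "eventually_equal (ind_dual R X) (carrier (obj T k)) (im_idx f k) (im_map f k) (im_idx f l)
        (\<lambda>x. im_map f l (tr T k l x))"
      unfolding eventually_equal_def using pos[OF k] pos[OF l]
      by (intro bexI[of _ "\<lambda>i. max (im_idx f k i) (im_idx f l i)"]) (auto simp: ind_dual_simps less_max_iff_disj)
  qed
qed

text \<open>A compatible family of functionals is a functional on the colimit, so it cannot
  distinguish representatives that become equal in a later step.\<close>

lemma ind_dual_eventually_equal:
  assumes R: "banach_ring na R" and X: "ind_obj na R X"
    and f: "\<phi> \<in> idx (ind_dual R X)" "f \<in> carrier (obj (ind_dual R X) \<phi>)"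
    and k: "k \<in> idx X" "l \<in> idx X" and F: "F \<in> S \<rightarrow> carrier (obj X k)" "G \<in> S \<rightarrow> carrier (obj X l)"
    and e: "eventually_equal X S k F l G" and x: "x \<in> S"
  shows "f k (F x) = f l (G x)"
proof -
  obtain m where m: "m \<in> idx X" "ile X k m" "ile X l m" "tr X k m (F x) = tr X l m (G x)"
    using e x unfolding eventually_equal_def by blast
  note D = ind_dualD(7)[OF R X f]
  have "f k (F x) = f m (tr X k m (F x))" using D[OF k(1) m(1,2)] F(1) x by fastforce
  also have "\<dots> = f l (G x)" unfolding m(4) using D[OF k(2) m(1,3)] F(2) x by fastforce
  finally show ?thesis .
qed

text \<open>The summand 1 keeps the index positive also when the representative of \<open>g\<close>
  has operator norm 0.\<close>

definition dual_map ::
    "('r, 'i, 'm) ind_sys \<Rightarrow> ('r, 'j, 'n) ind_sys \<Rightarrow> ('i, 'm, 'j, 'n) ind_map \<Rightarrow>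
     ('j \<Rightarrow> real, 'j \<Rightarrow> 'n \<Rightarrow> 'r, 'i \<Rightarrow> real, 'i \<Rightarrow> 'm \<Rightarrow> 'r) ind_map" where
  "dual_map X Y g = \<lparr>
     im_idx = (\<lambda>\<phi> i. (1 + op_norm (obj X i) (obj Y (im_idx g i)) (im_map g i)) * \<phi> (im_idx g i)),
     im_map = (\<lambda>\<phi> f. \<lambda>i\<in>idx X. \<lambda>x\<in>carrier (obj X i). f (im_idx g i) (im_map g i x)) \<rparr>"

lemma dual_map_mor:
  assumes R: "banach_ring na R" and g: "ind_mor na R X Y g"
  shows "ind_mor na R (ind_dual R Y) (ind_dual R X) (dual_map X Y g)"
proof -
  note G = ind_morD[OF g]
  note D = ind_dualD[OF R G(2)]
  have op: "0 \<le> op_norm (obj X i) (obj Y (im_idx g i)) (im_map g i)" if "i \<in> idx X" for i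
    by (rule blm_bound(1)[OF ind_objD(4)[OF G(1) that] G(4)[OF that]])
  show ?thesis
  proof (rule ind_mor_dualI[OF R ind_dual_obj[OF R G(2)] G(1),
      where \<beta> = "\<lambda>\<phi> i f x. f (im_idx g i) (im_map g i x)"])
    fix \<phi> i assume "\<phi> \<in> idx (ind_dual R Y)" "i \<in> idx X"
    then show "0 < im_idx (dual_map X Y g) \<phi> i"
      using G(3) op[of i] by (auto simp: dual_map_def ind_dual_simps intro!: mult_pos_pos)
  next
    fix \<phi> f assume \<phi>: "\<phi> \<in> idx (ind_dual R Y)" and f: "f \<in> carrier (obj (ind_dual R Y) \<phi>)"
    show "im_map (dual_map X Y g) \<phi> f = (\<lambda>i\<in>idx X. \<lambda>x\<in>carrier (obj X i). f (im_idx g i) (im_map g i x))"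
      by (simp add: dual_map_def)
  next
    fix \<phi> i f x assume \<phi>: "\<phi> \<in> idx (ind_dual R Y)" and i: "i \<in> idx X"
      and f: "f \<in> carrier (obj (ind_dual R Y) \<phi>)" and x: "x \<in> carrier (obj X i)"
    note Df = D[OF \<phi> f]
    note gi = G(3)[OF i] G(5)[OF i]
    note L = blmD[OF Df(3)[OF gi(1)], unfolded ring_as_module_simps]
    show "f (im_idx g i) (im_map g i x) \<in> carrier R" by (rule Df(4)[OF gi(1) gi(2)[OF x]])
    show "rnm R (f (im_idx g i) (im_map g i x)) \<le>
        im_idx (dual_map X Y g) \<phi> i * (nm (obj (ind_dual R Y) \<phi>) f * nm (obj X i) x)"
    proof -
      let ?c = "op_norm (obj X i) (obj Y (im_idx g i)) (im_map g i)"
      let ?n = "nm (obj (ind_dual R Y) \<phi>) f * \<phi> (im_idx g i)"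
      have n: "0 \<le> ?n" using Df(5) \<phi> gi(1) by (simp add: ind_dual_simps less_imp_le)
      have x0: "0 \<le> nm (obj X i) x" by (rule banach_moduleD(6)[OF ind_objD(4)[OF G(1) i] x])
      have "rnm R (f (im_idx g i) (im_map g i x)) \<le> ?n * nm (obj Y (im_idx g i)) (im_map g i x)"
        by (rule Df(6)[OF gi(1) gi(2)[OF x]])
      also have "\<dots> \<le> ?n * (?c * nm (obj X i) x)"
        by (rule mult_left_mono[OF blm_bound(2)[OF ind_objD(4)[OF G(1) i] G(4)[OF i] x] n])
      also have "\<dots> \<le> ?n * ((1 + ?c) * nm (obj X i) x)"
        using n x0 by (intro mult_left_mono mult_right_mono) auto
      finally show ?thesis by (simp add: dual_map_def mult_ac)
    qed
    show "f (im_idx g i) (im_map g i (x \<oplus>\<^bsub>obj X i\<^esub> x')) =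
        f (im_idx g i) (im_map g i x) \<oplus>\<^bsub>R\<^esub> f (im_idx g i) (im_map g i x')" if "x' \<in> carrier (obj X i)" for x'
      using blmD(2)[OF G(4)[OF i] x that] L(2)[OF gi(2)[OF x] gi(2)[OF that]] by simp
    show "f (im_idx g i) (im_map g i (a \<odot>\<^bsub>obj X i\<^esub> x)) = a \<otimes>\<^bsub>R\<^esub> f (im_idx g i) (im_map g i x)"
      if "a \<in> carrier R" for a
      using blmD(3)[OF G(4)[OF i] that x] L(3)[OF that gi(2)[OF x]] by simp
    show "(f \<oplus>\<^bsub>obj (ind_dual R Y) \<phi>\<^esub> f') (im_idx g i) (im_map g i x) =
        f (im_idx g i) (im_map g i x) \<oplus>\<^bsub>R\<^esub> f' (im_idx g i) (im_map g i x)" for f'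
      using gi(1) gi(2)[OF x] by (simp add: ind_dual_simps)
    show "(a \<odot>\<^bsub>obj (ind_dual R Y) \<phi>\<^esub> f) (im_idx g i) (im_map g i x) = a \<otimes>\<^bsub>R\<^esub> f (im_idx g i) (im_map g i x)" for a
      using gi(1) gi(2)[OF x] by (simp add: ind_dual_simps)
    show "(tr (ind_dual R Y) \<phi> \<psi> f) (im_idx g i) (im_map g i x) = f (im_idx g i) (im_map g i x)" for \<psi>
      by (simp add: ind_dual_simps)
  next
    fix \<phi> i j f x assume \<phi>: "\<phi> \<in> idx (ind_dual R Y)" and i: "i \<in> idx X" and j: "j \<in> idx X" and ij: "ile X i j"
      and f: "f \<in> carrier (obj (ind_dual R Y) \<phi>)" and x: "x \<in> carrier (obj X i)"
    \<comment> \<open>\<open>g\<close> commutes with the transition maps only after passing to a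
      later step of \<open>Y\<close>; a compatible family \<open>f\<close> does not see the
      difference.\<close>
    have "eventually_equal Y (carrier (obj X i)) (im_idx g i) (im_map g i) (im_idx g j) (\<lambda>x. im_map g j (tr X i j x))"
      using g i j ij unfolding ind_mor_alt by blast
    then show "f (im_idx g j) (im_map g j (tr X i j x)) = f (im_idx g i) (im_map g i x)"
      using ind_dual_eventually_equal[OF R G(2) \<phi> f G(3)[OF i] G(3)[OF j], of "im_map g i" "carrier (obj X i)"
          "\<lambda>x. im_map g j (tr X i j x)" x] x
        G(5)[OF i] G(5)[OF j] blmD(1)[OF ind_objD(5)[OF G(1) i j ij]] by auto
  qed
qed

text \<open>The composite evaluates \<open>f\<close> at the image of \<open>x\<close> under
  \<open>g\<close> followed by \<open>h\<close>. This image is eventually equal to \<open>x\<close>,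
  so \<open>f\<close> takes the same value on both.\<close>

lemma dual_map_inverse:
  assumes R: "banach_ring na R" and g: "ind_mor na R X Y g" and h: "ind_mor na R Y X h"
    and e: "ind_eq X X (ind_comp h g) ind_id"
  shows "ind_eq (ind_dual R X) (ind_dual R X) (ind_comp (dual_map X Y g) (dual_map Y X h)) ind_id"
proof (rule ind_eq_dualI[OF ind_comp_mor[OF dual_map_mor[OF R h] dual_map_mor[OF R g]]])
  note G = ind_morD[OF g] and H = ind_morD[OF h]
  note m = ind_comp_mor[OF dual_map_mor[OF R h] dual_map_mor[OF R g]]
  fix \<phi> f assume \<phi>: "\<phi> \<in> idx (ind_dual R X)" and f: "f \<in> carrier (obj (ind_dual R X) \<phi>)"
  show "im_map (ind_comp (dual_map X Y g) (dual_map Y X h)) \<phi> f = im_map ind_id \<phi> f"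
  proof (rule ind_dual_ext[OF R G(1) ind_morD(3)[OF m \<phi>] ind_morD(5)[OF m \<phi> f] \<phi>])
    show "im_map ind_id \<phi> f \<in> carrier (obj (ind_dual R X) \<phi>)" using f by (simp add: ind_id_def)
    fix i x assume i: "i \<in> idx X" and x: "x \<in> carrier (obj X i)"
    let ?k = "im_idx g i" and ?y = "im_map g i x"
    have 1: "im_map (ind_comp (dual_map X Y g) (dual_map Y X h)) \<phi> f i x = f (im_idx h ?k) (im_map h ?k ?y)"
      using i x G(3)[OF i] G(5)[OF i x] by (simp add: ind_comp_def dual_map_def)
    have "eventually_equal X (carrier (obj X i)) (im_idx h ?k) (\<lambda>x. im_map h ?k (im_map g i x)) i (\<lambda>x. x)"
      using e i unfolding ind_eq_alt by (simp add: ind_comp_def ind_id_def)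
    from ind_dual_eventually_equal[OF R G(1) \<phi> f H(3)[OF G(3)[OF i]] i _ _ this x]
    show "im_map (ind_comp (dual_map X Y g) (dual_map Y X h)) \<phi> f i x = im_map ind_id \<phi> f i x"
      using 1 G(3)[OF i] G(5)[OF i] H(5) by (auto simp: ind_id_def)
  qed
qed

lemma ind_iso_dual:
  assumes R: "banach_ring na R" and g: "ind_iso na R X Y g"
  shows "ind_iso na R (ind_dual R Y) (ind_dual R X) (dual_map X Y g)"
proof -
  obtain h where m: "ind_mor na R X Y g" and h: "ind_mor na R Y X h"
    "ind_eq X X (ind_comp h g) ind_id" "ind_eq Y Y (ind_comp g h) ind_id"
    using g unfolding ind_iso_def by blast
  show ?thesis unfolding ind_iso_def
    using dual_map_mor[OF R m] dual_map_mor[OF R h(1)] dual_map_inverse[OF R m h(1,2)] dual_map_inverse[OF R h(1) m h(3)]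
    by blast
qed

lemma to_bidual_mor:
  assumes R: "banach_ring na R" and X: "ind_obj na R X"
  shows "ind_mor na R X (ind_dual R (ind_dual R X)) (to_bidual R X)"
proof (rule ind_mor_dualI[OF R X ind_dual_obj[OF R X], where \<beta> = "\<lambda>i \<phi> x f. f i x"])
  fix i \<phi> assume "i \<in> idx X" "\<phi> \<in> idx (ind_dual R X)"
  then show "0 < im_idx (to_bidual R X) i \<phi>" by (simp add: to_bidual_def ind_dual_simps)
next
  fix i x assume "i \<in> idx X" "x \<in> carrier (obj X i)"
  show "im_map (to_bidual R X) i x = (\<lambda>\<phi>\<in>idx (ind_dual R X). \<lambda>f\<in>carrier (obj (ind_dual R X) \<phi>). f i x)"
    by (simp add: to_bidual_def)
next
  fix i \<phi> x f assume i: "i \<in> idx X" and \<phi>: "\<phi> \<in> idx (ind_dual R X)" and x: "x \<in> carrier (obj X i)"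
    and f: "f \<in> carrier (obj (ind_dual R X) \<phi>)"
  note D = ind_dualD[OF R X \<phi> f]
  note L = blmD[OF D(3)[OF i], unfolded ring_as_module_simps]
  show "f i x \<in> carrier R" by (rule D(4)[OF i x])
  show "rnm R (f i x) \<le> im_idx (to_bidual R X) i \<phi> * (nm (obj X i) x * nm (obj (ind_dual R X) \<phi>) f)"
    using D(6)[OF i x] by (simp add: to_bidual_def mult_ac)
  show "(f \<oplus>\<^bsub>obj (ind_dual R X) \<phi>\<^esub> f') i x = f i x \<oplus>\<^bsub>R\<^esub> f' i x" for f'
    using i x by (simp add: ind_dual_simps)
  show "(a \<odot>\<^bsub>obj (ind_dual R X) \<phi>\<^esub> f) i x = a \<otimes>\<^bsub>R\<^esub> f i x" for a
    using i x by (simp add: ind_dual_simps)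
  show "f i (x \<oplus>\<^bsub>obj X i\<^esub> x') = f i x \<oplus>\<^bsub>R\<^esub> f i x'" if "x' \<in> carrier (obj X i)" for x'
    by (rule L(2)[OF x that])
  show "f i (a \<odot>\<^bsub>obj X i\<^esub> x) = a \<otimes>\<^bsub>R\<^esub> f i x" if "a \<in> carrier R" for a
    by (rule L(3)[OF that x])
  show "(tr (ind_dual R X) \<phi> \<psi> f) i x = f i x" for \<psi>
    by (simp add: ind_dual_simps)
  show "f j (tr X i j x) = f i x" if "j \<in> idx X" "ile X i j" for j
    by (rule D(7)[OF i that x])
qed

text \<open>The composite \<open>Y \<rightarrow> Y\<^sup>\<or>\<^sup>\<or> \<rightarrow> X\<^sup>\<or>\<close> of the canonical morphism with the dual of \<open>b : X \<rightarrow> Y\<^sup>\<or>\<close> is \<open>a\<close>.\<close>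

lemma reflexive_if_dual_pair:
  assumes R: "banach_ring na R"
    and a: "ind_iso na R Y (ind_dual R X) a" and b: "ind_iso na R X (ind_dual R Y) b"
    and ab: "\<And>i j x y. i \<in> idx X \<Longrightarrow> j \<in> idx Y \<Longrightarrow> x \<in> carrier (obj X i) \<Longrightarrow> y \<in> carrier (obj Y j) \<Longrightarrow>
      im_map a j y i x = im_map b i x j y"
  shows "reflexive na R Y"
proof -
  have am: "ind_mor na R Y (ind_dual R X) a" and bm: "ind_mor na R X (ind_dual R Y) b"
    using a b unfolding ind_iso_def by auto
  note A = ind_morD[OF am] and B = ind_morD[OF bm]
  let ?d = "dual_map X (ind_dual R Y) b" and ?t = "to_bidual R Y"
  have t: "ind_mor na R Y (ind_dual R (ind_dual R Y)) ?t" by (rule to_bidual_mor[OF R A(1)])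
  have d: "ind_iso na R (ind_dual R (ind_dual R Y)) (ind_dual R X) ?d" by (rule ind_iso_dual[OF R b])
  have dt: "ind_mor na R Y (ind_dual R X) (ind_comp ?d ?t)" by (rule ind_comp_mor[OF t dual_map_mor[OF R bm]])
  have "ind_eq Y (ind_dual R X) a (ind_comp ?d ?t)"
  proof (rule ind_eq_dualI[OF am])
    fix j y assume j: "j \<in> idx Y" and y: "y \<in> carrier (obj Y j)"
    show "im_map a j y = im_map (ind_comp ?d ?t) j y"
    proof (rule ind_dual_ext[OF R B(1) A(3)[OF j] A(5)[OF j y] ind_morD(3)[OF dt j] ind_morD(5)[OF dt j y]])
      fix i x assume i: "i \<in> idx X" and x: "x \<in> carrier (obj X i)"
      show "im_map a j y i x = im_map (ind_comp ?d ?t) j y i x"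
        using i x B(3)[OF i] B(5)[OF i x] ab[OF i j x y] by (simp add: ind_comp_def dual_map_def to_bidual_def)
    qed
  qed
  from ind_iso_cancel_left[OF t d ind_iso_cong[OF a dt this]] show ?thesis unfolding reflexive_def .
qed

section \<open>Weighted sequence modules\<close>

text \<open>Membership of a real sequence in c_0 or in l^1. With one predicate for both settings,
  each later estimate is stated and used only once.\<close>

definition small :: "bool \<Rightarrow> (nat \<Rightarrow> real) \<Rightarrow> bool" where
  "small na a \<longleftrightarrow> (if na then a \<longlonglongrightarrow> 0 else summable a)"

definition seq_norm :: "bool \<Rightarrow> (nat \<Rightarrow> real) \<Rightarrow> real" where
  "seq_norm na a = (if na then SUP n. a n else \<Sum>n. a n)"

text \<open>In contrast to an inequality for \<open>seq_norm\<close>, this is meaningful before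
  smallness is known, and it involves only single terms or finite sums, so it passes to pointwise
  limits.\<close>

definition seq_norm_le :: "bool \<Rightarrow> (nat \<Rightarrow> real) \<Rightarrow> real \<Rightarrow> bool" where
  "seq_norm_le na a e \<longleftrightarrow> (if na then \<forall>n. a n \<le> e else \<forall>N. (\<Sum>n<N. a n) \<le> e)"

lemma small_tendsto: "small na a \<Longrightarrow> a \<longlonglongrightarrow> 0"
  by (auto simp: small_def summable_LIMSEQ_zero split: if_splits)

lemma small_bdd: assumes "small na a" shows "bdd_above (range a)"
  using convergent_imp_Bseq[OF convergentI[OF small_tendsto[OF assms]]] by (rule Bseq_bdd_above)

lemma seq_norm_le_iff:
  assumes "small na a" "\<And>n. 0 \<le> a n" shows "seq_norm na a \<le> e \<longleftrightarrow> seq_norm_le na a e"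
proof (cases na)
  case True
  then show ?thesis using cSUP_le_iff[OF _ small_bdd[OF assms(1)], of e] by (simp add: seq_norm_def seq_norm_le_def)
next
  case False
  then have s: "summable a" using assms(1) by (simp add: small_def)
  show ?thesis
    using suminf_le_const[OF s, of e] sum_le_suminf[OF s, of "{..<_}"] assms(2) False
    by (auto simp: seq_norm_def seq_norm_le_def intro: order_trans)
qed

lemma seq_norm_le_0: assumes "seq_norm_le na a e" "\<And>n. 0 \<le> a n" shows "a n \<le> e" "0 \<le> e"
proof -
  show "a n \<le> e"
  proof (cases na)
    case True then show ?thesis using assms(1) by (simp add: seq_norm_le_def)
  next
    case False
    have "a n \<le> (\<Sum>k<Suc n. a k)" using sum_nonneg[of "{..<n}" a] assms(2) by simp
    also have "\<dots> \<le> e" using assms(1) False unfolding seq_norm_le_def by presburger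
    finally show ?thesis .
  qed
  then show "0 \<le> e" using assms(2) order_trans by blast
qed

lemma seq_norm_ge:
  assumes "small na a" "\<And>n. 0 \<le> a n" shows "a n \<le> seq_norm na a" "0 \<le> seq_norm na a"
  using seq_norm_le_0[of na a "seq_norm na a"] seq_norm_le_iff[OF assms] assms(2) by auto

lemma seq_norm_le_mono: "seq_norm_le na b e \<Longrightarrow> (\<And>n. a n \<le> b n) \<Longrightarrow> seq_norm_le na a e"
  unfolding seq_norm_le_def using sum_mono[of "{..<_}" a b] order_trans by (metis (no_types, lifting))

lemma small_mono:
  assumes "small na b" "\<And>n. 0 \<le> a n" "\<And>n. a n \<le> b n" shows "small na a"
proof (cases na)
  case True then show ?thesis using assms(1) null_squeeze[OF assms(2,3)] by (simp add: small_def)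
next
  case False
  then have "summable b" using assms(1) by (simp add: small_def)
  then have "summable a" by (rule summable_comparison_test'[where N = 0]) (use assms(2,3) in simp)
  then show ?thesis using False by (simp add: small_def)
qed

lemma seq_norm_mono:
  assumes "small na b" "\<And>n. 0 \<le> a n" "\<And>n. a n \<le> b n" shows "seq_norm na a \<le> seq_norm na b"
proof -
  have b: "\<And>n. 0 \<le> b n" using assms order_trans by blast
  have "seq_norm_le na b (seq_norm na b)" using seq_norm_le_iff[OF assms(1) b, of "seq_norm na b"] by simp
  from seq_norm_le_mono[OF this assms(3)] show ?thesis using seq_norm_le_iff[OF small_mono[OF assms] assms(2)] by simp
qed

lemma small_cmult: "small na a \<Longrightarrow> small na (\<lambda>n. c * a n)"
  by (cases na) (simp_all add: small_def tendsto_mult_right_zero summable_mult)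

lemma seq_norm_cmult:
  assumes a: "small na a" "\<And>n. 0 \<le> a n" and c: "0 \<le> c" shows "seq_norm na (\<lambda>n. c * a n) \<le> c * seq_norm na a"
proof -
  have "seq_norm_le na (\<lambda>n. c * a n) (c * seq_norm na a)"
    using seq_norm_le_iff[OF a, of "seq_norm na a"] c
    by (auto simp: seq_norm_le_def sum_distrib_left[symmetric] intro: mult_left_mono split: if_splits)
  then show ?thesis using seq_norm_le_iff[OF small_cmult[OF a(1)], of c] a(2) c by simp
qed

lemma small_add: "small na a \<Longrightarrow> small na b \<Longrightarrow> small na (\<lambda>n. a n + b n)"
  by (cases na) (simp_all add: small_def tendsto_add_zero summable_add)

text \<open>The termwise combination is a maximum in the non-archimedean case, so that the
  ultrametric inequality carries over from the ring to sequences.\<close>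

lemma seq_norm_add:
  assumes a: "small na a" "\<And>n. 0 \<le> a n" and b: "small na b" "\<And>n. 0 \<le> b n"
  shows "seq_norm na (\<lambda>n. if na then max (a n) (b n) else a n + b n) \<le>
    (if na then max (seq_norm na a) (seq_norm na b) else seq_norm na a + seq_norm na b)"
proof -
  let ?c = "\<lambda>n. if na then max (a n) (b n) else a n + b n"
  have 0: "0 \<le> ?c n" for n using a(2)[of n] b(2)[of n] by auto
  have s: "small na ?c" using a b by (intro small_mono[OF small_add[OF a(1) b(1)] 0]) auto
  have "seq_norm_le na ?c (if na then max (seq_norm na a) (seq_norm na b) else seq_norm na a + seq_norm na b)"
    using seq_norm_le_iff[OF a, of "seq_norm na a"] seq_norm_le_iff[OF b, of "seq_norm na b"]
    by (auto simp: seq_norm_le_def sum.distrib intro: add_mono max.coboundedI1 max.coboundedI2 split: if_splits)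
  then show ?thesis using seq_norm_le_iff[OF s 0] by blast
qed

text \<open>In one setting the terms are eventually small, in the other the Cauchy criterion bounds
  the tail sums. The convergence of series and of truncations rests on this.\<close>

lemma seq_norm_tail:
  assumes a: "small na a" "\<And>n. 0 \<le> a n"
  shows "small na (\<lambda>n. if n < N then 0 else a n)" "(\<lambda>N. seq_norm na (\<lambda>n. if n < N then 0 else a n)) \<longlonglongrightarrow> 0"
    "seq_norm na (\<lambda>n. if n < N then 0 else a n) \<le> seq_norm na a" "0 \<le> seq_norm na (\<lambda>n. if n < N then 0 else a n)"
proof -
  let ?t = "\<lambda>N n. if n < N then 0 else a n"
  have t0: "0 \<le> ?t N n" for N n using a(2) by simp
  have ts: "small na (?t N)" for N by (rule small_mono[OF a(1) t0]) (use a(2) in auto)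
  show "small na (?t N)" by (rule ts)
  show "seq_norm na (?t N) \<le> seq_norm na a" by (rule seq_norm_mono[OF a(1) t0]) (use a(2) in auto)
  show "0 \<le> seq_norm na (?t N)" by (rule seq_norm_ge(2)[OF ts t0])
  show "(\<lambda>N. seq_norm na (?t N)) \<longlonglongrightarrow> 0"
  proof (rule LIMSEQ_I)
    fix e :: real assume e: "0 < e"
    have "\<exists>K. \<forall>N\<ge>K. seq_norm_le na (?t N) (e / 2)"
    proof (cases na)
      case True
      then have "a \<longlonglongrightarrow> 0" using a(1) by (simp add: small_def)
      then obtain K where "\<forall>n\<ge>K. norm (a n - 0) < e / 2" using e LIMSEQ_D[of a 0 "e / 2"] by auto
      then have "seq_norm_le na (?t N) (e / 2)" if "N \<ge> K" for N
        using e a(2) True that by (auto simp: seq_norm_le_def intro: less_imp_le)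
      then show ?thesis by blast
    next
      case False
      then have s: "summable a" using a(1) by (simp add: small_def)
      obtain K where K: "\<And>m n. m \<ge> K \<Longrightarrow> norm (sum a {m..<n}) < e / 2"
        using s[unfolded summable_Cauchy, rule_format, of "e / 2"] e by auto
      have "(\<Sum>n<L. ?t N n) \<le> e / 2" if N: "N \<ge> K" for N L
      proof -
        have "(\<Sum>n<L. ?t N n) = sum a {N..<L}"
          by (rule sum.mono_neutral_cong_right) auto
        then show ?thesis using K[OF N, of L] by simp
      qed
      then show ?thesis using False by (auto simp: seq_norm_le_def)
    qed
    then obtain K where K: "\<forall>N\<ge>K. seq_norm_le na (?t N) (e / 2)" by blast
    have "norm (seq_norm na (?t N) - 0) < e" if "N \<ge> K" for N
    proof -
      have "seq_norm na (?t N) \<le> e / 2" using K that seq_norm_le_iff[OF ts t0] by blast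
      then show ?thesis using e seq_norm_ge(2)[OF ts t0, of N] by simp
    qed
    then show "\<exists>K. \<forall>N\<ge>K. norm (seq_norm na (?t N) - 0) < e" by blast
  qed
qed

text \<open>A Fatou-type argument: the bound concerns single terms or finite partial sums, and each
  of these converges.\<close>

lemma seq_norm_le_limit:
  assumes "\<And>n. (\<lambda>m. b m n) \<longlonglongrightarrow> a n" and "\<And>m. m \<ge> K \<Longrightarrow> seq_norm_le na (b m) e"
  shows "seq_norm_le na a e"
proof (cases na)
  case True
  have "a n \<le> e" for n
    by (rule LIMSEQ_le_const2[OF assms(1)]) (use assms(2) True in \<open>auto simp: seq_norm_le_def\<close>)
  then show ?thesis using True by (simp add: seq_norm_le_def)
next
  case False
  have "(\<Sum>n<N. a n) \<le> e" for N
    by (rule LIMSEQ_le_const2[OF tendsto_sum[OF assms(1)]]) (use assms(2) False in \<open>auto simp: seq_norm_le_def\<close>)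
  then show ?thesis using False by (simp add: seq_norm_le_def)
qed

text \<open>For null sequences the approximation is used with every \<open>e\<close>. In the
  summable case one value of \<open>e\<close> is enough, since bounded partial sums of the
  nonnegative \<open>c\<close> already make \<open>c\<close> summable.\<close>

lemma small_approx:
  assumes a: "\<And>n. 0 \<le> a n"
    and ap: "\<And>e. 0 < e \<Longrightarrow> \<exists>b c. small na b \<and> (\<forall>n. 0 \<le> c n) \<and> seq_norm_le na c e \<and> (\<forall>n. a n \<le> c n + b n)"
  shows "small na a"
proof (cases na)
  case True
  have "\<exists>K. \<forall>n\<ge>K. norm (a n - 0) < e" if e: "0 < e" for e
  proof -
    obtain b c where b: "small na b" and c: "seq_norm_le na c (e / 2)" and abc: "\<forall>n. a n \<le> c n + b n"
      using ap[of "e / 2"] e by auto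
    obtain K where K: "\<forall>n\<ge>K. norm (b n - 0) < e / 2"
      using b True e LIMSEQ_D[of b 0 "e / 2"] by (auto simp: small_def)
    have "norm (a n - 0) < e" if "n \<ge> K" for n
    proof -
      have "c n \<le> e / 2" using c True by (simp add: seq_norm_le_def)
      moreover have "\<bar>b n\<bar> < e / 2" using K that by simp
      ultimately show ?thesis using abc[rule_format, of n] a[of n] by simp
    qed
    then show ?thesis by blast
  qed
  then show ?thesis using True by (simp add: small_def LIMSEQ_iff)
next
  case False
  obtain b c where b: "small na b" and c: "seq_norm_le na c 1" "\<forall>n. 0 \<le> c n" and abc: "\<forall>n. a n \<le> c n + b n"
    using ap[of 1] by auto
  have "summable c" using c False by (intro summableI_nonneg_bounded[of c 1]) (auto simp: seq_norm_le_def)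
  then have "small na (\<lambda>n. c n + b n)" using b False by (simp add: small_def summable_add)
  then show ?thesis by (rule small_mono[OF _ a abc[rule_format]])
qed

section \<open>The weighted modules as Banach modules\<close>

lemma l1_simps:
  "carrier (l1 na R w) = {x. range x \<subseteq> carrier R \<and> small na (\<lambda>n. rnm R (x n) * w n)}"
  "\<zero>\<^bsub>l1 na R w\<^esub> = (\<lambda>n. \<zero>\<^bsub>R\<^esub>)"
  "x \<oplus>\<^bsub>l1 na R w\<^esub> y = (\<lambda>n. x n \<oplus>\<^bsub>R\<^esub> y n)"
  "a \<odot>\<^bsub>l1 na R w\<^esub> x = (\<lambda>n. a \<otimes>\<^bsub>R\<^esub> x n)"
  "nm (l1 na R w) x = seq_norm na (\<lambda>n. rnm R (x n) * w n)"
  by (simp_all add: l1_def small_def seq_norm_def)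

lemma banach_ringD:
  assumes "banach_ring na R"
  shows "cring R" "abelian_group R" "banach_norm na R (rnm R)"
    "\<And>a. a \<in> carrier R \<Longrightarrow> 0 \<le> rnm R a" "\<And>a. a \<in> carrier R \<Longrightarrow> rnm R a = 0 \<longleftrightarrow> a = \<zero>\<^bsub>R\<^esub>"
    "\<And>a b. a \<in> carrier R \<Longrightarrow> b \<in> carrier R \<Longrightarrow> rnm R (a \<otimes>\<^bsub>R\<^esub> b) \<le> rnm R a * rnm R b"
    "rnm R \<one>\<^bsub>R\<^esub> \<le> 1" "rnm R \<zero>\<^bsub>R\<^esub> = 0"
proof -
  show c: "cring R" using assms by (simp add: banach_ring_def)
  then interpret cring R .
  show "abelian_group R" ..
  show "banach_norm na R (rnm R)" "\<And>a. a \<in> carrier R \<Longrightarrow> 0 \<le> rnm R a"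
    "\<And>a. a \<in> carrier R \<Longrightarrow> rnm R a = 0 \<longleftrightarrow> a = \<zero>\<^bsub>R\<^esub>"
    "\<And>a b. a \<in> carrier R \<Longrightarrow> b \<in> carrier R \<Longrightarrow> rnm R (a \<otimes>\<^bsub>R\<^esub> b) \<le> rnm R a * rnm R b"
    "rnm R \<one>\<^bsub>R\<^esub> \<le> 1" using assms by (auto simp: banach_ring_def banach_norm_def)
  then show "rnm R \<zero>\<^bsub>R\<^esub> = 0" by blast
qed

text \<open>One dominating sequence gives membership and the norm estimate together. The main
  instance is a multiple of the ratio of two consecutive weights.\<close>

lemma l1_I:
  assumes "\<And>n. x n \<in> carrier R" "small na b" "\<And>n. rnm R (x n) * w n \<le> b n"
    and "banach_ring na R" "\<And>n. 0 < w n"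
  shows "x \<in> carrier (l1 na R w)" "nm (l1 na R w) x \<le> seq_norm na b"
proof -
  have 0: "0 \<le> rnm R (x n) * w n" for n using banach_ringD(4)[OF assms(4) assms(1)] assms(5)[of n] by simp
  show "x \<in> carrier (l1 na R w)" using small_mono[OF assms(2) 0 assms(3)] assms(1) by (auto simp: l1_simps)
  show "nm (l1 na R w) x \<le> seq_norm na b" unfolding l1_simps by (rule seq_norm_mono[OF assms(2) 0 assms(3)])
qed

lemma l1_D:
  assumes "banach_ring na R" "\<And>n. 0 < w n" "x \<in> carrier (l1 na R w)"
  shows "\<And>n. x n \<in> carrier R" "small na (\<lambda>n. rnm R (x n) * w n)" "\<And>n. 0 \<le> rnm R (x n) * w n"
    "\<And>n. rnm R (x n) * w n \<le> nm (l1 na R w) x" "0 \<le> nm (l1 na R w) x"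
proof -
  show c: "x n \<in> carrier R" for n using assms(3) by (auto simp: l1_simps)
  show s: "small na (\<lambda>n. rnm R (x n) * w n)" using assms(3) by (simp add: l1_simps)
  show n: "0 \<le> rnm R (x n) * w n" for n using banach_ringD(4)[OF assms(1) c] assms(2)[of n] by simp
  show "\<And>n. rnm R (x n) * w n \<le> nm (l1 na R w) x" "0 \<le> nm (l1 na R w) x"
    using seq_norm_ge[OF s n] by (simp_all add: l1_simps)
qed


lemma abelian_group_diff_cancel:
  assumes "abelian_group G" and a: "a \<in> carrier G" and b: "b \<in> carrier G" and x: "x \<in> carrier G"
  shows "(a \<ominus>\<^bsub>G\<^esub> b) \<ominus>\<^bsub>G\<^esub> (a \<ominus>\<^bsub>G\<^esub> x) = \<ominus>\<^bsub>G\<^esub> (b \<ominus>\<^bsub>G\<^esub> x)"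
proof -
  interpret abelian_group G by fact
  have "(a \<ominus>\<^bsub>G\<^esub> b) \<ominus>\<^bsub>G\<^esub> (a \<ominus>\<^bsub>G\<^esub> x) = a \<oplus>\<^bsub>G\<^esub> (\<ominus>\<^bsub>G\<^esub> b \<oplus>\<^bsub>G\<^esub> (\<ominus>\<^bsub>G\<^esub> a \<oplus>\<^bsub>G\<^esub> x))"
    using a b x by (simp add: minus_eq minus_add a_assoc)
  also have "\<ominus>\<^bsub>G\<^esub> b \<oplus>\<^bsub>G\<^esub> (\<ominus>\<^bsub>G\<^esub> a \<oplus>\<^bsub>G\<^esub> x) = \<ominus>\<^bsub>G\<^esub> a \<oplus>\<^bsub>G\<^esub> (\<ominus>\<^bsub>G\<^esub> b \<oplus>\<^bsub>G\<^esub> x)"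
    using a b x by (simp add: a_lcomm)
  also have "a \<oplus>\<^bsub>G\<^esub> \<dots> = \<ominus>\<^bsub>G\<^esub> b \<oplus>\<^bsub>G\<^esub> x" using a b x by (simp add: r_neg2)
  also have "\<dots> = \<ominus>\<^bsub>G\<^esub> (b \<ominus>\<^bsub>G\<^esub> x)" using b x by (simp add: minus_eq minus_add)
  finally show ?thesis .
qed

lemma rnm_diff:
  assumes R: "banach_ring na R" and "a \<in> carrier R" "b \<in> carrier R"
  shows "\<bar>rnm R a - rnm R b\<bar> \<le> rnm R (a \<ominus>\<^bsub>R\<^esub> b)"
proof -
  note D = banach_ringD[OF R]
  interpret abelian_group R by (rule D(2))
  have 1: "rnm R x \<le> rnm R (x \<ominus>\<^bsub>R\<^esub> y) + rnm R y" if x: "x \<in> carrier R" and y: "y \<in> carrier R" for x y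
  proof -
    have "x = (x \<ominus>\<^bsub>R\<^esub> y) \<oplus>\<^bsub>R\<^esub> y" using x y by (simp add: minus_eq a_assoc l_neg)
    then show ?thesis using banach_norm_add(2)[OF D(2,3), of "x \<ominus>\<^bsub>R\<^esub> y" y] x y by simp
  qed
  have "\<ominus>\<^bsub>R\<^esub> (b \<ominus>\<^bsub>R\<^esub> a) = a \<ominus>\<^bsub>R\<^esub> b" using assms(2,3) by (simp add: minus_eq minus_add a_comm)
  then have "rnm R (b \<ominus>\<^bsub>R\<^esub> a) = rnm R (a \<ominus>\<^bsub>R\<^esub> b)"
    using banach_norm_minus[OF D(2,3), of "b \<ominus>\<^bsub>R\<^esub> a"] assms(2,3) by simp
  then show ?thesis using 1[OF assms(2,3)] 1[OF assms(3,2)] by linarith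
qed

lemma l1_add_closed:
  assumes R: "banach_ring na R" and w: "\<And>n. 0 < w n"
    and x: "x \<in> carrier (l1 na R w)" and y: "y \<in> carrier (l1 na R w)"
  shows "(\<lambda>n. x n \<oplus>\<^bsub>R\<^esub> y n) \<in> carrier (l1 na R w)"
proof (rule l1_I(1)[OF _ small_add[OF l1_D(2)[OF R w x] l1_D(2)[OF R w y]] _ R w])
  note D = banach_ringD[OF R]
  interpret abelian_group R by (rule D(2))
  note X = l1_D(1)[OF R w x] and Y = l1_D(1)[OF R w y]
  fix n
  show "x n \<oplus>\<^bsub>R\<^esub> y n \<in> carrier R" using X Y by simp
  have "rnm R (x n \<oplus>\<^bsub>R\<^esub> y n) * w n \<le> (rnm R (x n) + rnm R (y n)) * w n"
    using banach_norm_add(2)[OF D(2,3) X Y] w[of n] by (intro mult_right_mono) (auto simp: less_imp_le)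
  then show "rnm R (x n \<oplus>\<^bsub>R\<^esub> y n) * w n \<le> rnm R (x n) * w n + rnm R (y n) * w n" by (simp add: distrib_right)
qed

lemma l1_smult_closed:
  assumes R: "banach_ring na R" and w: "\<And>n. 0 < w n" and a: "a \<in> carrier R"
    and x: "x \<in> carrier (l1 na R w)"
  shows "(\<lambda>n. a \<otimes>\<^bsub>R\<^esub> x n) \<in> carrier (l1 na R w)"
    and "nm (l1 na R w) (\<lambda>n. a \<otimes>\<^bsub>R\<^esub> x n) \<le> rnm R a * nm (l1 na R w) x"
proof -
  note D = banach_ringD[OF R]
  interpret cring R by (rule D(1))
  note X = l1_D[OF R w x]
  have 1: "a \<otimes>\<^bsub>R\<^esub> x n \<in> carrier R" for n using a X(1) by simp
  have 2: "rnm R (a \<otimes>\<^bsub>R\<^esub> x n) * w n \<le> rnm R a * (rnm R (x n) * w n)" for n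
    using mult_right_mono[OF D(6)[OF a X(1)[of n]], of "w n"] w[of n] by (simp add: mult.assoc)
  note I = l1_I[of _ R, OF 1 small_cmult[OF X(2)] 2 R w]
  show "(\<lambda>n. a \<otimes>\<^bsub>R\<^esub> x n) \<in> carrier (l1 na R w)" by (rule I(1))
  have "seq_norm na (\<lambda>n. rnm R a * (rnm R (x n) * w n)) \<le> rnm R a * seq_norm na (\<lambda>n. rnm R (x n) * w n)"
    by (rule seq_norm_cmult[OF X(2,3) D(4)[OF a]])
  then show "nm (l1 na R w) (\<lambda>n. a \<otimes>\<^bsub>R\<^esub> x n) \<le> rnm R a * nm (l1 na R w) x"
    using I(2) by (simp add: l1_simps)
qed

lemma l1_module:
  assumes R: "banach_ring na R" and w: "\<And>n. 0 < w n"
  shows "module R (l1 na R w)"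
    and "\<And>x y. x \<in> carrier (l1 na R w) \<Longrightarrow> y \<in> carrier (l1 na R w) \<Longrightarrow>
      x \<ominus>\<^bsub>l1 na R w\<^esub> y = (\<lambda>n. x n \<ominus>\<^bsub>R\<^esub> y n)"
proof -
  let ?L = "l1 na R w"
  note D = banach_ringD[OF R]
  interpret cring R by (rule D(1))
  note E = l1_D(1)[OF R w]
  have zero: "(\<lambda>n. \<zero>\<^bsub>R\<^esub>) \<in> carrier ?L"
    by (rule l1_I(1)[of _ _ _ "\<lambda>n. 0"]) (use D(8) R w in \<open>auto simp: small_def\<close>)
  have minus: "(\<lambda>n. \<ominus>\<^bsub>R\<^esub> x n) \<in> carrier ?L" if x: "x \<in> carrier ?L" for x
    using l1_smult_closed(1)[OF R w _ x, of "\<ominus>\<^bsub>R\<^esub> \<one>\<^bsub>R\<^esub>"] E[OF x] by (simp add: l_minus)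
  have g: "abelian_group ?L"
  proof (rule abelian_groupI)
    fix x y z assume x: "x \<in> carrier ?L" and y: "y \<in> carrier ?L" and z: "z \<in> carrier ?L"
    show "x \<oplus>\<^bsub>?L\<^esub> y \<oplus>\<^bsub>?L\<^esub> z = x \<oplus>\<^bsub>?L\<^esub> (y \<oplus>\<^bsub>?L\<^esub> z)"
      using E[OF x] E[OF y] E[OF z] by (simp add: l1_simps a_assoc)
  next
    fix x y assume x: "x \<in> carrier ?L" and y: "y \<in> carrier ?L"
    show "x \<oplus>\<^bsub>?L\<^esub> y = y \<oplus>\<^bsub>?L\<^esub> x" using E[OF x] E[OF y] by (simp add: l1_simps a_comm)
    show "x \<oplus>\<^bsub>?L\<^esub> y \<in> carrier ?L" using l1_add_closed[OF R w x y] by (simp only: l1_simps(3))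
  next
    fix x assume x: "x \<in> carrier ?L"
    show "\<zero>\<^bsub>?L\<^esub> \<oplus>\<^bsub>?L\<^esub> x = x" using E[OF x] by (simp add: l1_simps)
    show "\<exists>y\<in>carrier ?L. y \<oplus>\<^bsub>?L\<^esub> x = \<zero>\<^bsub>?L\<^esub>"
      using E[OF x] by (intro bexI[OF _ minus[OF x]]) (simp add: l1_simps l_neg)
  qed (use zero in \<open>simp add: l1_simps(2)\<close>)
  show "module R ?L"
  proof (rule moduleI[OF D(1) g])
    fix a x assume "a \<in> carrier R" "x \<in> carrier ?L"
    then show "a \<odot>\<^bsub>?L\<^esub> x \<in> carrier ?L" using l1_smult_closed(1)[OF R w] by (simp only: l1_simps(4))
  qed (use E in \<open>simp_all add: l1_simps(2,3,4) l_distr r_distr m_assoc\<close>)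
  interpret L: abelian_group ?L by (rule g)
  fix x y assume x: "x \<in> carrier ?L" and y: "y \<in> carrier ?L"
  have "\<ominus>\<^bsub>?L\<^esub> y = (\<lambda>n. \<ominus>\<^bsub>R\<^esub> y n)"
    using E[OF y] by (intro L.minus_equality minus y) (simp add: l1_simps l_neg)
  then show "x \<ominus>\<^bsub>?L\<^esub> y = (\<lambda>n. x n \<ominus>\<^bsub>R\<^esub> y n)" by (simp add: a_minus_def l1_simps(3))
qed

text \<open>Positive weights make the coordinates Cauchy. The Fatou argument turns the uniform
  Cauchy estimate into a bound on \<open>s k - x\<close>; approximation by some \<open>s K\<close>
  then shows that \<open>x\<close> belongs to the module, and the same bound gives
  convergence.\<close>

lemma l1_complete:
  assumes R: "banach_ring na R" and w: "\<And>n. 0 < w n"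
    and s: "\<And>k::nat. s k \<in> carrier (l1 na R w)"
    and cau: "\<And>e. 0 < e \<Longrightarrow> \<exists>K. \<forall>k\<ge>K. \<forall>m\<ge>K. nm (l1 na R w) (s k \<ominus>\<^bsub>l1 na R w\<^esub> s m) < e"
  shows "\<exists>x\<in>carrier (l1 na R w). (\<lambda>k. nm (l1 na R w) (s k \<ominus>\<^bsub>l1 na R w\<^esub> x)) \<longlonglongrightarrow> 0"
proof -
  let ?L = "l1 na R w"
  note D = banach_ringD[OF R]
  interpret cring R by (rule D(1))
  interpret L: module R ?L by (rule l1_module(1)[OF R w])
  note minus = l1_module(2)[OF R w]
  note E = l1_D[OF R w s]
  note d = l1_D[OF R w L.M.minus_closed[OF s s], unfolded minus[OF s s]]
  have nd: "nm ?L (s k \<ominus>\<^bsub>?L\<^esub> s m) = seq_norm na (\<lambda>n. rnm R (s k n \<ominus>\<^bsub>R\<^esub> s m n) * w n)" for k m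
    unfolding minus[OF s s] by (simp add: l1_simps)
  have "\<exists>y\<in>carrier R. (\<lambda>k. rnm R (s k n \<ominus>\<^bsub>R\<^esub> y)) \<longlonglongrightarrow> 0" for n
  proof (rule banach_norm_complete[OF D(3) E(1)], intro allI impI)
    fix e :: real assume "0 < e"
    then have "0 < e * w n" using w by simp
    then obtain K where K: "\<forall>k\<ge>K. \<forall>m\<ge>K. nm ?L (s k \<ominus>\<^bsub>?L\<^esub> s m) < e * w n" using cau by blast
    have "rnm R (s k n \<ominus>\<^bsub>R\<^esub> s m n) < e" if "k \<ge> K" "m \<ge> K" for k m
    proof -
      have "rnm R (s k n \<ominus>\<^bsub>R\<^esub> s m n) * w n < e * w n"
        using le_less_trans[OF d(4)[of k n m]] K that unfolding minus[OF s s] by blast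
      then show ?thesis using w[of n] by simp
    qed
    then show "\<exists>K. \<forall>k\<ge>K. \<forall>m\<ge>K. rnm R (s k n \<ominus>\<^bsub>R\<^esub> s m n) < e" by blast
  qed
  then obtain x where x: "\<And>n. x n \<in> carrier R" "\<And>n. (\<lambda>k. rnm R (s k n \<ominus>\<^bsub>R\<^esub> x n)) \<longlonglongrightarrow> 0" by metis
  \<comment> \<open>The norm of R is 1-Lipschitz, so letting \<open>m\<close> grow replaces
    \<open>s m\<close> by its coordinatewise limit inside the norm.\<close>
  have lim: "(\<lambda>m. rnm R (s k n \<ominus>\<^bsub>R\<^esub> s m n) * w n) \<longlonglongrightarrow> rnm R (s k n \<ominus>\<^bsub>R\<^esub> x n) * w n" for k n
  proof -
    have "\<bar>rnm R (s k n \<ominus>\<^bsub>R\<^esub> s m n) - rnm R (s k n \<ominus>\<^bsub>R\<^esub> x n)\<bar> \<le> rnm R (s m n \<ominus>\<^bsub>R\<^esub> x n)" for m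
    proof -
      have "(s k n \<ominus>\<^bsub>R\<^esub> s m n) \<ominus>\<^bsub>R\<^esub> (s k n \<ominus>\<^bsub>R\<^esub> x n) = \<ominus>\<^bsub>R\<^esub> (s m n \<ominus>\<^bsub>R\<^esub> x n)"
        by (rule abelian_group_diff_cancel[OF D(2) E(1) E(1) x(1)])
      then show ?thesis
        using rnm_diff[OF R, of "s k n \<ominus>\<^bsub>R\<^esub> s m n" "s k n \<ominus>\<^bsub>R\<^esub> x n"] banach_norm_minus[OF D(2,3)]
          E(1)[of k n] E(1)[of m n] x(1)[of n] by simp
    qed
    then have "(\<lambda>m. \<bar>rnm R (s k n \<ominus>\<^bsub>R\<^esub> s m n) - rnm R (s k n \<ominus>\<^bsub>R\<^esub> x n)\<bar>) \<longlonglongrightarrow> 0"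
      by (intro null_squeeze[OF _ _ x(2)[of n]]) simp_all
    then have "(\<lambda>m. rnm R (s k n \<ominus>\<^bsub>R\<^esub> s m n) - rnm R (s k n \<ominus>\<^bsub>R\<^esub> x n)) \<longlonglongrightarrow> 0"
      by (simp only: tendsto_rabs_zero_iff)
    then have "(\<lambda>m. rnm R (s k n \<ominus>\<^bsub>R\<^esub> s m n)) \<longlonglongrightarrow> rnm R (s k n \<ominus>\<^bsub>R\<^esub> x n)" by (simp only: LIM_zero_iff)
    then show ?thesis by (rule tendsto_mult_right)
  qed
  let ?A = "\<lambda>k n. rnm R (s k n \<ominus>\<^bsub>R\<^esub> x n) * w n"
  have A0: "0 \<le> ?A k n" for k n using D(4)[OF minus_closed[OF E(1)[of k n] x(1)[of n]]] w[of n] by simp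
  have Ale: "\<exists>K. \<forall>k\<ge>K. seq_norm_le na (?A k) e" if e: "0 < e" for e
  proof -
    obtain K where K: "\<forall>k\<ge>K. \<forall>m\<ge>K. nm ?L (s k \<ominus>\<^bsub>?L\<^esub> s m) < e" using cau[OF e] by blast
    have "seq_norm_le na (?A k) e" if k: "k \<ge> K" for k
    proof (rule seq_norm_le_limit[OF lim, where K = K])
      fix m assume "m \<ge> K"
      then have "seq_norm na (\<lambda>n. rnm R (s k n \<ominus>\<^bsub>R\<^esub> s m n) * w n) \<le> e" using K k nd by (simp add: less_imp_le)
      then show "seq_norm_le na (\<lambda>n. rnm R (s k n \<ominus>\<^bsub>R\<^esub> s m n) * w n) e"
        using seq_norm_le_iff[OF d(2,3)] by blast
    qed
    then show ?thesis by blast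
  qed
  have xL: "x \<in> carrier ?L"
  proof -
    have "small na (\<lambda>n. rnm R (x n) * w n)"
    proof (rule small_approx)
      show "0 \<le> rnm R (x n) * w n" for n using D(4)[OF x(1)[of n]] w[of n] by simp
      fix e :: real assume "0 < e"
      then obtain K where K: "seq_norm_le na (?A K) e" using Ale by blast
      have "rnm R (x n) * w n \<le> ?A K n + rnm R (s K n) * w n" for n
      proof -
        have "rnm R (x n) \<le> rnm R (s K n \<ominus>\<^bsub>R\<^esub> x n) + rnm R (s K n)"
          using rnm_diff[OF R E(1)[of K n] x(1)[of n]] by linarith
        from mult_right_mono[OF this, of "w n"] show ?thesis using w[of n] by (simp add: distrib_right)
      qed
      then show "\<exists>b c. small na b \<and> (\<forall>n. 0 \<le> c n) \<and> seq_norm_le na c e \<and> (\<forall>n. rnm R (x n) * w n \<le> c n + b n)"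
        by (intro exI[of _ "\<lambda>n. rnm R (s K n) * w n"] exI[of _ "?A K"] conjI allI E(2) A0 K)
    qed
    then show ?thesis using x(1) by (auto simp: l1_simps)
  qed
  have As: "small na (?A k)" for k
    using l1_D(2)[OF R w L.M.minus_closed[OF s xL]] unfolding minus[OF s xL] .
  have "(\<lambda>k. seq_norm na (?A k)) \<longlonglongrightarrow> 0"
  proof (rule LIMSEQ_I)
    fix e :: real assume e: "0 < e"
    then obtain K where K: "\<forall>k\<ge>K. seq_norm_le na (?A k) (e / 2)" using Ale[of "e / 2"] by auto
    have "norm (seq_norm na (?A k) - 0) < e" if "k \<ge> K" for k
    proof -
      have "seq_norm na (?A k) \<le> e / 2" using K that seq_norm_le_iff[OF As A0] by blast
      then show ?thesis using seq_norm_ge(2)[OF As A0, of k] e by simp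
    qed
    then show "\<exists>K. \<forall>k\<ge>K. norm (seq_norm na (?A k) - 0) < e" by blast
  qed
  then have "(\<lambda>k. nm ?L (s k \<ominus>\<^bsub>?L\<^esub> x)) \<longlonglongrightarrow> 0" unfolding minus[OF s xL] by (simp add: l1_simps(5))
  then show ?thesis using xL by blast
qed

lemma l1_banach:
  fixes R :: "'a nring"
  assumes R: "banach_ring na R" and w: "\<And>n. 0 < w n"
  shows "banach_module na R (l1 na R w)"
  unfolding banach_module_def banach_norm_def
proof (intro conjI ballI allI impI)
  let ?L = "l1 na R w"
  note D = banach_ringD[OF R]
  interpret cring R by (rule D(1))
  show "module R ?L" by (rule l1_module(1)[OF R w])
  fix x assume x: "x \<in> carrier ?L"
  note X = l1_D[OF R w x]
  show "0 \<le> nm ?L x" by (rule X(5))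
  show "nm ?L x = 0 \<longleftrightarrow> x = \<zero>\<^bsub>?L\<^esub>"
  proof
    assume 0: "nm ?L x = 0"
    have "x n = \<zero>\<^bsub>R\<^esub>" for n
    proof -
      have "rnm R (x n) * w n = 0" using X(3,4)[of n] 0 by simp
      then show ?thesis using w[of n] D(5)[OF X(1)[of n]] by simp
    qed
    then show "x = \<zero>\<^bsub>?L\<^esub>" by (auto simp: l1_simps)
  next
    assume "x = \<zero>\<^bsub>?L\<^esub>"
    then show "nm ?L x = 0" using D(8) by (simp add: l1_simps seq_norm_def)
  qed
  fix y assume y: "y \<in> carrier ?L"
  note Y = l1_D[OF R w y]
  let ?b = "\<lambda>n. if na then max (rnm R (x n) * w n) (rnm R (y n) * w n) else rnm R (x n) * w n + rnm R (y n) * w n"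
  have "rnm R (x n \<ominus>\<^bsub>R\<^esub> y n) * w n \<le> ?b n" for n
  proof -
    have "rnm R (x n \<ominus>\<^bsub>R\<^esub> y n) \<le> (if na then max (rnm R (x n)) (rnm R (y n)) else rnm R (x n) + rnm R (y n))"
      using D(3) X(1) Y(1) unfolding banach_norm_def by blast
    then have "rnm R (x n \<ominus>\<^bsub>R\<^esub> y n) * w n \<le>
        (if na then max (rnm R (x n)) (rnm R (y n)) else rnm R (x n) + rnm R (y n)) * w n"
      by (rule mult_right_mono) (rule less_imp_le[OF w])
    also have "\<dots> = ?b n" using w[of n] by (simp add: distrib_right max_mult_distrib_right less_imp_le)
    finally show ?thesis .
  qed
  moreover have "small na ?b"
    by (rule small_mono[OF small_add[OF X(2) Y(2)]]) (use X(3) Y(3) in \<open>auto simp: le_max_iff_disj\<close>)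
  ultimately have "nm ?L (\<lambda>n. x n \<ominus>\<^bsub>R\<^esub> y n) \<le> seq_norm na ?b"
    using X(1) Y(1) by (intro l1_I(2)[OF _ _ _ R w]) auto
  also have "\<dots> \<le> (if na then max (nm ?L x) (nm ?L y) else nm ?L x + nm ?L y)"
    unfolding l1_simps(5) by (rule seq_norm_add[OF X(2,3) Y(2,3)])
  finally show "nm ?L (x \<ominus>\<^bsub>?L\<^esub> y) \<le> (if na then max (nm ?L x) (nm ?L y) else nm ?L x + nm ?L y)"
    unfolding l1_module(2)[OF R w x y] .
next
  fix s :: "nat \<Rightarrow> nat \<Rightarrow> 'a" assume "range s \<subseteq> carrier (l1 na R w) \<and>
    (\<forall>e>0. \<exists>N. \<forall>m\<ge>N. \<forall>n\<ge>N. nm (l1 na R w) (s m \<ominus>\<^bsub>l1 na R w\<^esub> s n) < e)"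
  then show "\<exists>x\<in>carrier (l1 na R w). (\<lambda>n. nm (l1 na R w) (s n \<ominus>\<^bsub>l1 na R w\<^esub> x)) \<longlonglongrightarrow> 0"
    by (intro l1_complete[OF R w]) (auto intro: range_subsetD)
next
  fix a x assume "a \<in> carrier R" "x \<in> carrier (l1 na R w)"
  then show "nm (l1 na R w) (a \<odot>\<^bsub>l1 na R w\<^esub> x) \<le> rnm R a * nm (l1 na R w) x"
    using l1_smult_closed(2)[OF R w] by (simp only: l1_simps(4))
qed


section \<open>Convergent series in Banach modules\<close>

primrec psum :: "('r, 'm) nmodule \<Rightarrow> (nat \<Rightarrow> 'm) \<Rightarrow> nat \<Rightarrow> 'm" where
  "psum M a 0 = \<zero>\<^bsub>M\<^esub>"
| "psum M a (Suc n) = psum M a n \<oplus>\<^bsub>M\<^esub> a n"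

definition series :: "('r, 'm) nmodule \<Rightarrow> (nat \<Rightarrow> 'm) \<Rightarrow> 'm" where
  "series M a = (SOME z. z \<in> carrier M \<and> (\<lambda>n. nm M (psum M a n \<ominus>\<^bsub>M\<^esub> z)) \<longlonglongrightarrow> 0)"

lemma psum_closed:
  assumes M: "banach_module na R M" and a: "\<And>n. a n \<in> carrier M" shows "psum M a n \<in> carrier M"
proof -
  interpret abelian_group M by (rule banach_moduleD(2)[OF M])
  show ?thesis by (induction n) (simp_all add: a)
qed

lemma psum_norm:
  assumes M: "banach_module na R M" and a: "\<And>n. a n \<in> carrier M"
    and e: "seq_norm_le na (\<lambda>n. nm M (a n)) e"
  shows "nm M (psum M a n) \<le> e"
proof -
  note D = banach_moduleD[OF M]
  note add = banach_norm_add(1)[OF D(2,4) psum_closed[where a = a, OF M a] a]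
  note z = banach_norm_zero[OF M]
  show ?thesis
  proof (cases na)
    case True
    show ?thesis
    proof (induction n)
      case 0 then show ?case using seq_norm_le_0(2)[OF e D(6)[OF a]] z by simp
    next
      case (Suc n) then show ?case using add[of n n] True e by (simp add: seq_norm_le_def) (meson max.bounded_iff order_trans)
    qed
  next
    case False
    have "nm M (psum M a n) \<le> (\<Sum>k<n. nm M (a k))"
    proof (induction n)
      case (Suc n) then show ?case using add[of n n] False by simp
    qed (simp add: z)
    also have "\<dots> \<le> e" using e False by (simp add: seq_norm_le_def)
    finally show ?thesis .
  qed
qed

text \<open>With the difference written as a partial sum of a sequence that starts with zeros, the
  norm bound for partial sums and the tail norm yield the Cauchy estimate in both settings.\<close>

lemma psum_diff:
  assumes M: "banach_module na R M" and a: "\<And>n. a n \<in> carrier M" and "N \<le> m"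
  shows "psum M a m \<ominus>\<^bsub>M\<^esub> psum M a N = psum M (\<lambda>n. if n < N then \<zero>\<^bsub>M\<^esub> else a n) m"
proof -
  interpret abelian_group M by (rule banach_moduleD(2)[OF M])
  note c = psum_closed[where a = a, OF M a]
  let ?t = "\<lambda>n. if n < N then \<zero>\<^bsub>M\<^esub> else a n"
  have 0: "n \<le> N \<Longrightarrow> psum M ?t n = \<zero>\<^bsub>M\<^esub>" for n by (induction n) auto
  show ?thesis using assms(3)
  proof (induction rule: dec_induct)
    case base then show ?case using 0[of N] c by (simp add: minus_eq r_neg)
  next
    case (step m)
    have "psum M a (Suc m) \<ominus>\<^bsub>M\<^esub> psum M a N = (psum M a m \<ominus>\<^bsub>M\<^esub> psum M a N) \<oplus>\<^bsub>M\<^esub> a m"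
      using c a by (simp add: minus_eq a_ac)
    then show ?case using step by simp
  qed
qed

lemma series_lim:
  assumes M: "banach_module na R M" and a: "\<And>n. a n \<in> carrier M" and s: "small na (\<lambda>n. nm M (a n))"
  shows "series M a \<in> carrier M" "(\<lambda>n. nm M (psum M a n \<ominus>\<^bsub>M\<^esub> series M a)) \<longlonglongrightarrow> 0"
proof -
  interpret abelian_group M by (rule banach_moduleD(2)[OF M])
  note D = banach_moduleD[OF M]
  note c = psum_closed[where a = a, OF M a]
  note z = banach_norm_zero[OF M]
  let ?T = "\<lambda>N. seq_norm na (\<lambda>n. if n < N then 0 else nm M (a n))"
  note T = seq_norm_tail[OF s D(6)[OF a]]
  have b: "nm M (psum M a m \<ominus>\<^bsub>M\<^esub> psum M a N) \<le> ?T N" if "N \<le> m" for N m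
  proof -
    have e: "nm M (if n < N then \<zero>\<^bsub>M\<^esub> else a n) = (if n < N then 0 else nm M (a n))" for n using z by simp
    have "seq_norm_le na (\<lambda>n. if n < N then 0 else nm M (a n)) (?T N)"
      using seq_norm_le_iff[OF T(1), of N "?T N"] D(6)[OF a] by simp
    then show ?thesis unfolding psum_diff[where a = a, OF M a that]
      by (intro psum_norm[OF M]) (simp_all add: a e)
  qed
  have "\<exists>z\<in>carrier M. (\<lambda>n. nm M (psum M a n \<ominus>\<^bsub>M\<^esub> z)) \<longlonglongrightarrow> 0"
  proof (rule banach_norm_complete[OF D(4) c], intro allI impI)
    fix e :: real assume "0 < e"
    then obtain K where K: "\<forall>N\<ge>K. norm (?T N - 0) < e" using LIMSEQ_D[OF T(2)] by blast
    have *: "nm M (psum M a m \<ominus>\<^bsub>M\<^esub> psum M a n) < e" if "n \<ge> K" "n \<le> m" for m n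
      using b[OF that(2)] K[rule_format, OF that(1)] by simp
    have "nm M (psum M a m \<ominus>\<^bsub>M\<^esub> psum M a n) < e" if "m \<ge> K" "n \<ge> K" for m n
    proof (cases "n \<le> m")
      case True then show ?thesis using * that by blast
    next
      case False
      have "psum M a m \<ominus>\<^bsub>M\<^esub> psum M a n = \<ominus>\<^bsub>M\<^esub> (psum M a n \<ominus>\<^bsub>M\<^esub> psum M a m)"
        using c by (simp add: minus_eq minus_add a_comm)
      then show ?thesis using banach_norm_minus[OF D(2,4) minus_closed[OF c c]] *[OF that(1), of n] False by simp
    qed
    then show "\<exists>K. \<forall>m\<ge>K. \<forall>n\<ge>K. nm M (psum M a m \<ominus>\<^bsub>M\<^esub> psum M a n) < e" by blast
  qed
  then obtain z where "z \<in> carrier M \<and> (\<lambda>n. nm M (psum M a n \<ominus>\<^bsub>M\<^esub> z)) \<longlonglongrightarrow> 0" by blast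
  from someI[of "\<lambda>z. z \<in> carrier M \<and> (\<lambda>n. nm M (psum M a n \<ominus>\<^bsub>M\<^esub> z)) \<longlonglongrightarrow> 0", OF this]
  have "series M a \<in> carrier M \<and> (\<lambda>n. nm M (psum M a n \<ominus>\<^bsub>M\<^esub> series M a)) \<longlonglongrightarrow> 0"
    unfolding series_def .
  then show "series M a \<in> carrier M" "(\<lambda>n. nm M (psum M a n \<ominus>\<^bsub>M\<^esub> series M a)) \<longlonglongrightarrow> 0" by auto
qed

lemma series_eqI:
  assumes M: "banach_module na R M" and a: "\<And>n. a n \<in> carrier M"
    and z: "z \<in> carrier M" "(\<lambda>n. nm M (psum M a n \<ominus>\<^bsub>M\<^esub> z)) \<longlonglongrightarrow> 0"
  shows "series M a = z"
proof -
  from someI[of "\<lambda>z. z \<in> carrier M \<and> (\<lambda>n. nm M (psum M a n \<ominus>\<^bsub>M\<^esub> z)) \<longlonglongrightarrow> 0", OF conjI[OF z]]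
  have s: "series M a \<in> carrier M \<and> (\<lambda>n. nm M (psum M a n \<ominus>\<^bsub>M\<^esub> series M a)) \<longlonglongrightarrow> 0"
    unfolding series_def .
  show ?thesis
    by (rule banach_conv_unique[OF M psum_closed[where a = a, OF M a] conjunct1[OF s] z(1) conjunct2[OF s] z(2)])
qed

lemma series_norm:
  assumes M: "banach_module na R M" and a: "\<And>n. a n \<in> carrier M" and s: "small na (\<lambda>n. nm M (a n))"
    and e: "seq_norm_le na (\<lambda>n. nm M (a n)) e"
  shows "nm M (series M a) \<le> e"
proof -
  interpret abelian_group M by (rule banach_moduleD(2)[OF M])
  note D = banach_moduleD[OF M]
  note c = psum_closed[where a = a, OF M a]
  note S = series_lim[where a = a, OF M a s]
  have "nm M (series M a) \<le> e + nm M (psum M a n \<ominus>\<^bsub>M\<^esub> series M a)" for n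
  proof -
    have "series M a = psum M a n \<ominus>\<^bsub>M\<^esub> (psum M a n \<ominus>\<^bsub>M\<^esub> series M a)"
      by (rule abelian_group_diff(2)[OF D(2) c S(1) S(1)])
    then have "nm M (series M a) \<le> nm M (psum M a n) + nm M (psum M a n \<ominus>\<^bsub>M\<^esub> series M a)"
      using banach_norm_add(3)[OF D(2,4) c[of n] minus_closed[OF c[of n] S(1)]] by simp
    then show ?thesis using psum_norm[where a = a, OF M a e, of n] by linarith
  qed
  moreover have "(\<lambda>n. e + nm M (psum M a n \<ominus>\<^bsub>M\<^esub> series M a)) \<longlonglongrightarrow> e + 0"
    by (rule tendsto_add[OF tendsto_const S(2)])
  ultimately show ?thesis by (intro LIMSEQ_le_const) auto
qed

lemma psum_add:
  assumes M: "banach_module na R M" and a: "\<And>n. a n \<in> carrier M" and b: "\<And>n. b n \<in> carrier M"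
  shows "psum M (\<lambda>n. a n \<oplus>\<^bsub>M\<^esub> b n) n = psum M a n \<oplus>\<^bsub>M\<^esub> psum M b n"
proof -
  interpret abelian_group M by (rule banach_moduleD(2)[OF M])
  show ?thesis
    by (induction n) (simp_all add: a b a_ac psum_closed[where a = a, OF M a] psum_closed[where a = b, OF M b])
qed

lemma series_add:
  assumes M: "banach_module na R M" and a: "\<And>n. a n \<in> carrier M" "small na (\<lambda>n. nm M (a n))"
    and b: "\<And>n. b n \<in> carrier M" "small na (\<lambda>n. nm M (b n))"
  shows "series M (\<lambda>n. a n \<oplus>\<^bsub>M\<^esub> b n) = series M a \<oplus>\<^bsub>M\<^esub> series M b"
proof -
  interpret abelian_group M by (rule banach_moduleD(2)[OF M])
  note A = series_lim[where a = a, OF M a] and B = series_lim[where a = b, OF M b]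
  show ?thesis
    by (rule series_eqI[OF M a_closed[OF a(1) b(1)] a_closed[OF A(1) B(1)]])
      (simp only: psum_add[where a = a and b = b, OF M a(1) b(1)]
        banach_conv_add[OF M psum_closed[where a = a, OF M a(1)] psum_closed[where a = b, OF M b(1)] A(1) B(1) A(2) B(2)])
qed

lemma psum_blm:
  assumes M: "banach_module na R M" and P: "banach_module na R P" and f: "bounded_linear_map R M P f"
    and a: "\<And>n. a n \<in> carrier M"
  shows "f (psum M a n) = psum P (\<lambda>n. f (a n)) n"
proof (induction n)
  case 0 then show ?case by (simp add: blm_zero[OF M P f])
next
  case (Suc n) then show ?case using blmD(2)[OF f psum_closed[where a = a, OF M a] a] by simp
qed

text \<open>What enters is convergence of the partial sums to \<open>z\<close>, because this is the
  form in which the expansion of an element in a step of \<lambda>(\<rho>) is obtained; the norms of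
  its terms are not estimated there.\<close>

lemma series_blm:
  assumes M: "banach_module na R M" and P: "banach_module na R P" and f: "bounded_linear_map R M P f"
    and a: "\<And>n. a n \<in> carrier M" and z: "z \<in> carrier M" "(\<lambda>n. nm M (psum M a n \<ominus>\<^bsub>M\<^esub> z)) \<longlonglongrightarrow> 0"
  shows "f z = series P (\<lambda>n. f (a n))"
  by (rule series_eqI[symmetric, OF P blmD(1)[OF f a] blmD(1)[OF f z(1)]])
    (simp only: psum_blm[OF M P f a, symmetric] blm_conv[OF M P f psum_closed[where a = a, OF M a] z])

section \<open>Unit vectors and the expansion of a sequence\<close>

definition unit_seq :: "'r nring \<Rightarrow> nat \<Rightarrow> nat \<Rightarrow> 'r" where
  "unit_seq R n = (\<lambda>m. if m = n then \<one>\<^bsub>R\<^esub> else \<zero>\<^bsub>R\<^esub>)"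

text \<open>The norm is only bounded by the weight, since |1| <= 1 is what the ring norm provides;
  in the zero ring the norm is 0.\<close>

lemma unit_seq_mem:
  assumes R: "banach_ring na R" and w: "\<And>n. 0 < w n"
  shows "unit_seq R n \<in> carrier (l1 na R w)" "nm (l1 na R w) (unit_seq R n) \<le> w n"
proof -
  note D = banach_ringD[OF R]
  interpret cring R by (rule D(1))
  let ?b = "\<lambda>m. if m = n then w n else 0"
  have s: "small na ?b"
  proof (cases na)
    case True
    have "eventually (\<lambda>m. ?b m = 0) sequentially" using eventually_gt_at_top[of n] by eventually_elim simp
    then show ?thesis using True by (simp add: small_def tendsto_eventually)
  qed (simp add: small_def)
  have "seq_norm_le na ?b (w n)" using w[of n] by (simp add: seq_norm_le_def less_imp_le)
  then have "seq_norm na ?b \<le> w n" using w[of n] by (subst seq_norm_le_iff[OF s]) (auto simp: less_imp_le)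
  moreover have "rnm R (unit_seq R n m) * w m \<le> ?b m" for m
    using D(7,8) w[of n] by (simp add: unit_seq_def)
  note l1_I[of "unit_seq R n" R, OF _ s this R w]
  ultimately show "unit_seq R n \<in> carrier (l1 na R w)" "nm (l1 na R w) (unit_seq R n) \<le> w n"
    by (force simp: unit_seq_def)+
qed

lemma l1_expansion:
  assumes R: "banach_ring na R" and w: "\<And>n. 0 < w n" and x: "x \<in> carrier (l1 na R w)"
  shows "psum (l1 na R w) (\<lambda>n. x n \<odot>\<^bsub>l1 na R w\<^esub> unit_seq R n) N = (\<lambda>n. if n < N then x n else \<zero>\<^bsub>R\<^esub>)"
    and "psum (l1 na R w) (\<lambda>n. x n \<odot>\<^bsub>l1 na R w\<^esub> unit_seq R n) N \<in> carrier (l1 na R w)"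
    and "nm (l1 na R w) (psum (l1 na R w) (\<lambda>n. x n \<odot>\<^bsub>l1 na R w\<^esub> unit_seq R n) N \<ominus>\<^bsub>l1 na R w\<^esub> x) =
      seq_norm na (\<lambda>n. if n < N then 0 else rnm R (x n) * w n)"
proof -
  let ?L = "l1 na R w"
  note D = banach_ringD[OF R]
  interpret cring R by (rule D(1))
  note X = l1_D[OF R w x]
  interpret L: module R ?L by (rule l1_module(1)[OF R w])
  have *: "psum ?L (\<lambda>n. x n \<odot>\<^bsub>?L\<^esub> unit_seq R n) N = (\<lambda>n. if n < N then x n else \<zero>\<^bsub>R\<^esub>)" for N
    by (induction N) (auto simp: l1_simps unit_seq_def X(1) less_Suc_eq fun_eq_iff)
  then show "psum ?L (\<lambda>n. x n \<odot>\<^bsub>?L\<^esub> unit_seq R n) N = (\<lambda>n. if n < N then x n else \<zero>\<^bsub>R\<^esub>)" .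
  show c: "psum ?L (\<lambda>n. x n \<odot>\<^bsub>?L\<^esub> unit_seq R n) N \<in> carrier ?L"
    by (rule psum_closed[OF l1_banach[OF R w] L.smult_closed[OF X(1) unit_seq_mem(1)[OF R w]]])
  have "rnm R ((if n < N then x n else \<zero>\<^bsub>R\<^esub>) \<ominus>\<^bsub>R\<^esub> x n) * w n = (if n < N then 0 else rnm R (x n) * w n)" for n
    using X(1)[of n] D(8) banach_norm_minus[OF D(2,3) X(1)[of n]] by (simp add: minus_eq r_neg)
  then show "nm ?L (psum ?L (\<lambda>n. x n \<odot>\<^bsub>?L\<^esub> unit_seq R n) N \<ominus>\<^bsub>?L\<^esub> x) =
      seq_norm na (\<lambda>n. if n < N then 0 else rnm R (x n) * w n)"
    unfolding l1_module(2)[OF R w c x] unfolding * by (simp add: l1_simps(5))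
qed

text \<open>In a single weighted module the truncations converge in its own norm, so a bounded
  linear map is recovered without a change of step. In a step of \<lambda>(\<rho>) the unit vectors
  need not even be elements, and \<open>\<Lambda>_expansion\<close> takes over.\<close>

lemma l1_blm_eq_series:
  assumes R: "banach_ring na R" and w: "\<And>n. 0 < w n" and x: "x \<in> carrier (l1 na R w)"
    and P: "banach_module na R P" and f: "bounded_linear_map R (l1 na R w) P f"
  shows "f x = series P (\<lambda>n. x n \<odot>\<^bsub>P\<^esub> f (unit_seq R n))"
proof -
  interpret L: module R "l1 na R w" by (rule l1_module(1)[OF R w])
  note X = l1_D[OF R w x] and u = unit_seq_mem(1)[OF R w]
  have "(\<lambda>N. nm (l1 na R w) (psum (l1 na R w) (\<lambda>n. x n \<odot>\<^bsub>l1 na R w\<^esub> unit_seq R n) N \<ominus>\<^bsub>l1 na R w\<^esub> x)) \<longlonglongrightarrow> 0"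
    unfolding l1_expansion(3)[OF R w x] by (rule seq_norm_tail(2)[OF X(2,3)])
  from series_blm[OF l1_banach[OF R w] P f L.smult_closed[OF X(1) u] x this]
  show ?thesis by (simp only: blmD(3)[OF f X(1) u])
qed

section \<open>Bilinear pairings of ind-objects\<close>

lemma tensor_map_id:
  assumes P: "banach_pair na R M N" and A: "A \<in> carrier (ban_tensor na R M N)"
    and f: "\<And>x. x \<in> carrier M \<Longrightarrow> f x = x" and g: "\<And>y. y \<in> carrier N \<Longrightarrow> g y = y"
    and fb: "bounded_linear_map R M M f" and gb: "bounded_linear_map R N N g"
  shows "tensor_map na R M N f g A = A"
proof -
  interpret P: banach_pair na R M N by fact
  obtain s where s: "s \<in> P.CS" "A = P.cls s" using A by (auto simp: P.T_carrier)
  have "map (map_prod f g) (s n) = s n" for n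
    using P.CS_V[OF s(1), of n] f g by (intro map_idI) (auto simp: in_lists_conv_set)
  then show ?thesis unfolding s(2) tensor_map_class(2)[OF P P fb gb s(1)] by simp
qed

lemma tensor_map_comp:
  assumes P: "banach_pair na R M N" and Q: "banach_pair na R M' N'" and S: "banach_pair na R M'' N''"
    and A: "A \<in> carrier (ban_tensor na R M N)"
    and f: "bounded_linear_map R M M' f" and g: "bounded_linear_map R N N' g"
    and f': "bounded_linear_map R M' M'' f'" and g': "bounded_linear_map R N' N'' g'"
    and f'': "bounded_linear_map R M M'' f''" and g'': "bounded_linear_map R N N'' g''"
    and ff: "\<And>x. x \<in> carrier M \<Longrightarrow> f' (f x) = f'' x" and gg: "\<And>y. y \<in> carrier N \<Longrightarrow> g' (g y) = g'' y"
  shows "tensor_map na R M'' N'' f' g' (tensor_map na R M' N' f g A) = tensor_map na R M'' N'' f'' g'' A"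
proof -
  interpret P: banach_pair na R M N by fact
  obtain s where s: "s \<in> P.CS" "A = P.cls s" using A by (auto simp: P.T_carrier)
  note C = tensor_map_class[OF P Q f g s(1)]
  have "map (map_prod f' g') (map (map_prod f g) (s n)) = map (map_prod f'' g'') (s n)" for n
    using P.CS_V[OF s(1), of n] ff gg by (auto simp: in_lists_conv_set)
  then show ?thesis unfolding s(2) C(2) tensor_map_class(2)[OF Q S f' g' C(1)] tensor_map_class(2)[OF P S f'' g'' s(1)]
    by (simp only:)
qed

lemma ind_tensor_obj:
  assumes R: "banach_ring na R" and X: "ind_obj na R X" and Y: "ind_obj na R Y"
  shows "ind_obj na R (ind_tensor na R X Y)"
proof -
  note DX = ind_objD[OF X] and DY = ind_objD[OF Y]
  have P: "banach_pair na R (obj X i) (obj Y j)" if "i \<in> idx X" "j \<in> idx Y" for i j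
    using R DX(4)[OF that(1)] DY(4)[OF that(2)] by (simp add: banach_pair_def)
  have simps: "idx (ind_tensor na R X Y) = idx X \<times> idx Y"
    "ile (ind_tensor na R X Y) (i, j) (i', j') \<longleftrightarrow> ile X i i' \<and> ile Y j j'"
    "obj (ind_tensor na R X Y) (i, j) = ban_tensor na R (obj X i) (obj Y j)"
    "tr (ind_tensor na R X Y) (i, j) (i', j') = tensor_map na R (obj X i') (obj Y j') (tr X i i') (tr Y j j')"
    for i j i' j' by (simp_all add: ind_tensor_def)
  have ball: "(\<forall>k\<in>idx (ind_tensor na R X Y). Q k) \<longleftrightarrow> (\<forall>i\<in>idx X. \<forall>j\<in>idx Y. Q (i, j))" for Q
    by (auto simp: simps)
  have bex: "(\<exists>k\<in>idx (ind_tensor na R X Y). Q k) \<longleftrightarrow> (\<exists>i\<in>idx X. \<exists>j\<in>idx Y. Q (i, j))" for Q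
    by (auto simp: simps)
  show ?thesis unfolding ind_obj_def ball bex unfolding simps
  proof (intro conjI ballI impI)
    show "idx X \<times> idx Y \<noteq> {}" using X Y by (simp add: ind_obj_def)
  next
    fix i j assume i: "i \<in> idx X" and j: "j \<in> idx Y"
    show "ile X i i" "ile Y j j" by (rule DX(1)[OF i], rule DY(1)[OF j])
    show "banach_module na R (ban_tensor na R (obj X i) (obj Y j))"
      by (rule banach_pair.ban_tensor_banach[OF P[OF i j]])
    show "tensor_map na R (obj X i) (obj Y j) (tr X i i) (tr Y j j) A = A"
      if "A \<in> carrier (ban_tensor na R (obj X i) (obj Y j))" for A
      by (rule tensor_map_id[OF P[OF i j] that DX(6)[OF i] DY(6)[OF j]
            DX(5)[OF i i DX(1)[OF i]] DY(5)[OF j j DY(1)[OF j]]])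
    fix i' j' assume i': "i' \<in> idx X" and j': "j' \<in> idx Y"
    obtain k l where "k \<in> idx X" "ile X i k" "ile X i' k" "l \<in> idx Y" "ile Y j l" "ile Y j' l"
      using DX(3)[OF i i'] DY(3)[OF j j'] by blast
    then show "\<exists>k\<in>idx X. \<exists>l\<in>idx Y. (ile X i k \<and> ile Y j l) \<and> ile X i' k \<and> ile Y j' l" by blast
    show "bounded_linear_map R (ban_tensor na R (obj X i) (obj Y j)) (ban_tensor na R (obj X i') (obj Y j'))
        (tensor_map na R (obj X i') (obj Y j') (tr X i i') (tr Y j j'))" if "ile X i i' \<and> ile Y j j'"
      using that by (intro tensor_map_blm[OF P[OF i j] P[OF i' j']] DX(5)[OF i i'] DY(5)[OF j j']) auto
    fix i'' j'' assume i'': "i'' \<in> idx X" and j'': "j'' \<in> idx Y"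
      and le: "(ile X i i' \<and> ile Y j j') \<and> ile X i' i'' \<and> ile Y j' j''"
    then have l: "ile X i i'" "ile Y j j'" "ile X i' i''" "ile Y j' j''" by auto
    have l': "ile X i i''" "ile Y j j''"
      using DX(2)[OF i i' i'' l(1,3)] DY(2)[OF j j' j'' l(2,4)] by auto
    show "ile X i i''" "ile Y j j''" by (rule l')+
    fix A assume "A \<in> carrier (ban_tensor na R (obj X i) (obj Y j))"
    from tensor_map_comp[OF P[OF i j] P[OF i' j'] P[OF i'' j''] this DX(5)[OF i i' l(1)] DY(5)[OF j j' l(2)]
      DX(5)[OF i' i'' l(3)] DY(5)[OF j' j'' l(4)] DX(5)[OF i i'' l'(1)] DY(5)[OF j j'' l'(2)]
      DX(7)[OF i i' i'' l(1,3)] DY(7)[OF j j' j'' l(2,4)]]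
    show "tensor_map na R (obj X i'') (obj Y j'') (tr X i' i'') (tr Y j' j'')
        (tensor_map na R (obj X i') (obj Y j') (tr X i i') (tr Y j j') A) =
        tensor_map na R (obj X i'') (obj Y j'') (tr X i i'') (tr Y j j'') A" .
  qed
qed

lemma pure_tensor_nm:
  assumes P: "banach_pair na R M N" and x: "x \<in> carrier M" and y: "y \<in> carrier N"
  shows "nm (ban_tensor na R M N) (pure_tensor na R M N x y) \<le> nm M x * nm N y"
proof -
  interpret P: banach_pair na R M N by fact
  have V: "[(x, y)] \<in> P.V" using x y by simp
  have "0 \<le> nm M x * nm N y" using banach_moduleD(6)[OF P.M x] banach_moduleD(6)[OF P.N y] by simp
  then have "P.cost [(x, y)] = nm M x * nm N y" by (simp add: tensor_cost_simps)
  then have "P.q [(x, y)] \<le> nm M x * nm N y" using P.q_le[OF tensor_eq.refl[OF V]] by simp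
  then show ?thesis unfolding pure_tensor_def by (intro P.T_nm_le[OF P.CS_const[OF V]])
qed

text \<open>A pairing given by its bilinear forms on pairs of steps. The bounds \<open>c i j\<close>
  may vary with the steps, as morphisms of ind-objects carry no uniform bound.\<close>

locale ind_bilinear =
  fixes na :: bool and R :: "'r nring" and X :: "('r, 'i, 'm) ind_sys" and Y :: "('r, 'j, 'n) ind_sys"
    and \<beta> :: "'i \<Rightarrow> 'j \<Rightarrow> 'm \<Rightarrow> 'n \<Rightarrow> 'r" and c :: "'i \<Rightarrow> 'j \<Rightarrow> real"
  assumes R: "banach_ring na R" and X: "ind_obj na R X" and Y: "ind_obj na R Y"
    and bilinear: "i \<in> idx X \<Longrightarrow> j \<in> idx Y \<Longrightarrow>
      banach_bilinear na R (obj X i) (obj Y j) (ring_as_module R) (\<beta> i j) (c i j)"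
    and \<beta>_tr: "i \<in> idx X \<Longrightarrow> i' \<in> idx X \<Longrightarrow> j \<in> idx Y \<Longrightarrow> j' \<in> idx Y \<Longrightarrow> ile X i i' \<Longrightarrow> ile Y j j' \<Longrightarrow>
      x \<in> carrier (obj X i) \<Longrightarrow> y \<in> carrier (obj Y j) \<Longrightarrow> \<beta> i' j' (tr X i i' x) (tr Y j j' y) = \<beta> i j x y"
begin

definition pairing :: "('i \<times> 'j, (nat \<Rightarrow> ('m \<times> 'n) list) set, unit, 'r) ind_map" where
  "pairing = \<lparr> im_idx = (\<lambda>k. ()), im_map = (\<lambda>(i, j). tensor_ext (ring_as_module R) (\<beta> i j)) \<rparr>"

lemma pair: "i \<in> idx X \<Longrightarrow> j \<in> idx Y \<Longrightarrow> banach_pair na R (obj X i) (obj Y j)"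
  using R ind_objD(4)[OF X] ind_objD(4)[OF Y] by (simp add: banach_pair_def)

lemma pairing_mor: "ind_mor na R (ind_tensor na R X Y) (ind_unit R) pairing"
  unfolding ind_unit_def ind_mor_const_iff
proof (intro conjI ballI impI)
  show "ind_obj na R (ind_tensor na R X Y)" by (rule ind_tensor_obj[OF R X Y])
  show "ind_obj na R (ind_const (ring_as_module R))" by (rule ind_const_obj[OF ring_as_module_banach[OF R]])
  fix k assume "k \<in> idx (ind_tensor na R X Y)"
  then obtain i j where k: "k = (i, j)" "i \<in> idx X" "j \<in> idx Y" by (auto simp: ind_tensor_def)
  show "bounded_linear_map R (obj (ind_tensor na R X Y) k) (ring_as_module R) (im_map pairing k)"
    using banach_bilinear.tensor_ext_blm[OF bilinear[OF k(2,3)]] by (simp add: k pairing_def ind_tensor_def)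
  fix l A assume "l \<in> idx (ind_tensor na R X Y)" and le: "ile (ind_tensor na R X Y) k l"
    and A: "A \<in> carrier (obj (ind_tensor na R X Y) k)"
  then obtain i' j' where l: "l = (i', j')" "i' \<in> idx X" "j' \<in> idx Y" by (auto simp: ind_tensor_def)
  have le: "ile X i i'" "ile Y j j'" using le by (auto simp: k l ind_tensor_def)
  show "im_map pairing l (tr (ind_tensor na R X Y) k l A) = im_map pairing k A"
    using tensor_ext_map[OF bilinear[OF k(2,3)] bilinear[OF l(2,3)] ind_objD(5)[OF X k(2) l(2) le(1)]
        ind_objD(5)[OF Y k(3) l(3) le(2)] \<beta>_tr[OF k(2) l(2) k(3) l(3) le]] A
    by (simp add: k l pairing_def ind_tensor_def)
qed

lemma pairing_pure:
  assumes "i \<in> idx X" "j \<in> idx Y" "x \<in> carrier (obj X i)" "y \<in> carrier (obj Y j)"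
  shows "im_map pairing (i, j) (pure_tensor na R (obj X i) (obj Y j) x y) = \<beta> i j x y"
  using banach_bilinear.tensor_ext_pure(2)[OF bilinear[OF assms(1,2)] assms(3,4)] by (simp add: pairing_def)

abbreviation pairing_norm where
  "pairing_norm i j \<equiv> op_norm (ban_tensor na R (obj X i) (obj Y j)) (ring_as_module R) (im_map pairing (i, j))"

text \<open>The adjuncts are indexed by operator norms on the tensor steps, so the forms have to be
  bounded by these and not by \<open>c i j\<close>. The passage uses that a pure tensor has at most
  the product norm.\<close>

lemma pairing_bound:
  assumes i: "i \<in> idx X" and j: "j \<in> idx Y"
  shows "0 < 1 + pairing_norm i j"
    and "x \<in> carrier (obj X i) \<Longrightarrow> y \<in> carrier (obj Y j) \<Longrightarrow>
      rnm R (\<beta> i j x y) \<le> (1 + pairing_norm i j) * (nm (obj X i) x * nm (obj Y j) y)"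
proof -
  note P = pair[OF i j]
  note B = banach_pair.ban_tensor_banach[OF P]
  have b: "bounded_linear_map R (ban_tensor na R (obj X i) (obj Y j)) (ring_as_module R) (im_map pairing (i, j))"
    using banach_bilinear.tensor_ext_blm[OF bilinear[OF i j]] by (simp add: pairing_def)
  note o = blm_bound[OF B b]
  show "0 < 1 + pairing_norm i j" using o(1) by simp
  assume x: "x \<in> carrier (obj X i)" and y: "y \<in> carrier (obj Y j)"
  note pt = banach_bilinear.tensor_ext_pure(1)[OF bilinear[OF i j] x y]
  have n: "0 \<le> nm (obj X i) x * nm (obj Y j) y"
    using banach_moduleD(6)[OF ind_objD(4)[OF X i] x] banach_moduleD(6)[OF ind_objD(4)[OF Y j] y] by simp
  have "rnm R (\<beta> i j x y) \<le> pairing_norm i j *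
      nm (ban_tensor na R (obj X i) (obj Y j)) (pure_tensor na R (obj X i) (obj Y j) x y)"
    using o(2)[OF pt] pairing_pure[OF i j x y] by (simp add: ring_as_module_simps)
  also have "\<dots> \<le> pairing_norm i j * (nm (obj X i) x * nm (obj Y j) y)"
    by (rule mult_left_mono[OF pure_tensor_nm[OF P x y] o(1)])
  also have "\<dots> \<le> (1 + pairing_norm i j) * (nm (obj X i) x * nm (obj Y j) y)"
    using n by (intro mult_right_mono) auto
  finally show "rnm R (\<beta> i j x y) \<le> (1 + pairing_norm i j) * (nm (obj X i) x * nm (obj Y j) y)" .
qed

lemma \<beta>_tr_left:
  assumes "i \<in> idx X" "i' \<in> idx X" "ile X i i'" "j \<in> idx Y" "x \<in> carrier (obj X i)" "y \<in> carrier (obj Y j)"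
  shows "\<beta> i' j (tr X i i' x) y = \<beta> i j x y"
  using \<beta>_tr[OF assms(1,2,4,4,3) ind_objD(1)[OF Y assms(4)] assms(5,6)] ind_objD(6)[OF Y assms(4,6)] by simp

lemma \<beta>_tr_right:
  assumes "i \<in> idx X" "j \<in> idx Y" "j' \<in> idx Y" "ile Y j j'" "x \<in> carrier (obj X i)" "y \<in> carrier (obj Y j)"
  shows "\<beta> i j' x (tr Y j j' y) = \<beta> i j x y"
  using \<beta>_tr[OF assms(1,1,2,3) ind_objD(1)[OF X assms(1)] assms(4,5,6)] ind_objD(6)[OF X assms(1,5)] by simp

lemma adj_right_mor: "ind_mor na R Y (ind_dual R X) (adj_right na R X Y pairing)"
proof (rule ind_mor_dualI[OF R Y X, where \<beta> = "\<lambda>j i y x. \<beta> i j x y"])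
  fix j i assume j: "j \<in> idx Y" and i: "i \<in> idx X"
  show "0 < im_idx (adj_right na R X Y pairing) j i" using pairing_bound(1)[OF i j] by (simp add: adj_right_def)
next
  fix j y assume j: "j \<in> idx Y" and y: "y \<in> carrier (obj Y j)"
  show "im_map (adj_right na R X Y pairing) j y = (\<lambda>i\<in>idx X. \<lambda>x\<in>carrier (obj X i). \<beta> i j x y)"
    using pairing_pure[OF _ j _ y] by (auto simp: adj_right_def intro!: restrict_ext)
next
  fix j i y x assume j: "j \<in> idx Y" and i: "i \<in> idx X" and y: "y \<in> carrier (obj Y j)" and x: "x \<in> carrier (obj X i)"
  interpret B: banach_bilinear na R "obj X i" "obj Y j" "ring_as_module R" "\<beta> i j" "c i j" by (rule bilinear[OF i j])
  show "\<beta> i j x y \<in> carrier R" using B.\<beta>_closed[OF x y] by (simp add: ring_as_module_simps)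
  show "rnm R (\<beta> i j x y) \<le> im_idx (adj_right na R X Y pairing) j i * (nm (obj Y j) y * nm (obj X i) x)"
    using pairing_bound(2)[OF i j x y] by (simp add: adj_right_def mult_ac)
  show "\<beta> i j (x \<oplus>\<^bsub>obj X i\<^esub> x') y = \<beta> i j x y \<oplus>\<^bsub>R\<^esub> \<beta> i j x' y" if "x' \<in> carrier (obj X i)" for x'
    using B.\<beta>_add_left[OF x that y] by (simp add: ring_as_module_simps)
  show "\<beta> i j (a \<odot>\<^bsub>obj X i\<^esub> x) y = a \<otimes>\<^bsub>R\<^esub> \<beta> i j x y" if "a \<in> carrier R" for a
    using B.\<beta>_smult_left[OF that x y] by (simp add: ring_as_module_simps)
  show "\<beta> i j x (y \<oplus>\<^bsub>obj Y j\<^esub> y') = \<beta> i j x y \<oplus>\<^bsub>R\<^esub> \<beta> i j x y'" if "y' \<in> carrier (obj Y j)" for y'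
    using B.\<beta>_add_right[OF x y that] by (simp add: ring_as_module_simps)
  show "\<beta> i j x (a \<odot>\<^bsub>obj Y j\<^esub> y) = a \<otimes>\<^bsub>R\<^esub> \<beta> i j x y" if "a \<in> carrier R" for a
    using B.\<beta>_smult_right[OF that x y] by (simp add: ring_as_module_simps)
  show "\<beta> i' j (tr X i i' x) y = \<beta> i j x y" if "i' \<in> idx X" "ile X i i'" for i'
    by (rule \<beta>_tr_left[OF i that j x y])
  show "\<beta> i j' x (tr Y j j' y) = \<beta> i j x y" if "j' \<in> idx Y" "ile Y j j'" for j'
    by (rule \<beta>_tr_right[OF i j that x y])
qed

lemma adj_left_mor: "ind_mor na R X (ind_dual R Y) (adj_left na R X Y pairing)"
proof (rule ind_mor_dualI[OF R X Y, where \<beta> = \<beta>])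
  fix i j assume i: "i \<in> idx X" and j: "j \<in> idx Y"
  show "0 < im_idx (adj_left na R X Y pairing) i j" using pairing_bound(1)[OF i j] by (simp add: adj_left_def)
next
  fix i x assume i: "i \<in> idx X" and x: "x \<in> carrier (obj X i)"
  show "im_map (adj_left na R X Y pairing) i x = (\<lambda>j\<in>idx Y. \<lambda>y\<in>carrier (obj Y j). \<beta> i j x y)"
    using pairing_pure[OF i _ x] by (auto simp: adj_left_def intro!: restrict_ext)
next
  fix i j x y assume i: "i \<in> idx X" and j: "j \<in> idx Y" and x: "x \<in> carrier (obj X i)" and y: "y \<in> carrier (obj Y j)"
  interpret B: banach_bilinear na R "obj X i" "obj Y j" "ring_as_module R" "\<beta> i j" "c i j" by (rule bilinear[OF i j])
  show "\<beta> i j x y \<in> carrier R" using B.\<beta>_closed[OF x y] by (simp add: ring_as_module_simps)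
  show "rnm R (\<beta> i j x y) \<le> im_idx (adj_left na R X Y pairing) i j * (nm (obj X i) x * nm (obj Y j) y)"
    using pairing_bound(2)[OF i j x y] by (simp add: adj_left_def mult_ac)
  show "\<beta> i j (x \<oplus>\<^bsub>obj X i\<^esub> x') y = \<beta> i j x y \<oplus>\<^bsub>R\<^esub> \<beta> i j x' y" if "x' \<in> carrier (obj X i)" for x'
    using B.\<beta>_add_left[OF x that y] by (simp add: ring_as_module_simps)
  show "\<beta> i j (a \<odot>\<^bsub>obj X i\<^esub> x) y = a \<otimes>\<^bsub>R\<^esub> \<beta> i j x y" if "a \<in> carrier R" for a
    using B.\<beta>_smult_left[OF that x y] by (simp add: ring_as_module_simps)
  show "\<beta> i j x (y \<oplus>\<^bsub>obj Y j\<^esub> y') = \<beta> i j x y \<oplus>\<^bsub>R\<^esub> \<beta> i j x y'" if "y' \<in> carrier (obj Y j)" for y'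
    using B.\<beta>_add_right[OF x y that] by (simp add: ring_as_module_simps)
  show "\<beta> i j x (a \<odot>\<^bsub>obj Y j\<^esub> y) = a \<otimes>\<^bsub>R\<^esub> \<beta> i j x y" if "a \<in> carrier R" for a
    using B.\<beta>_smult_right[OF that x y] by (simp add: ring_as_module_simps)
  show "\<beta> i' j (tr X i i' x) y = \<beta> i j x y" if "i' \<in> idx X" "ile X i i'" for i'
    by (rule \<beta>_tr_left[OF i that j x y])
  show "\<beta> i j' x (tr Y j j' y) = \<beta> i j x y" if "j' \<in> idx Y" "ile Y j j'" for j'
    by (rule \<beta>_tr_right[OF i j that x y])
qed

lemma adj_apply:
  assumes "i \<in> idx X" "j \<in> idx Y" "x \<in> carrier (obj X i)" "y \<in> carrier (obj Y j)"
  shows "im_map (adj_right na R X Y pairing) j y i x = \<beta> i j x y"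
    "im_map (adj_left na R X Y pairing) i x j y = \<beta> i j x y"
  using assms pairing_pure[OF assms] by (simp_all add: adj_right_def adj_left_def)

end

section \<open>The duality\<close>

lemma l1_incl_blm:
  assumes R: "banach_ring na R" and v: "\<And>n. 0 < v n" and w: "\<And>n. 0 < w n"
    and d: "0 \<le> d" "\<And>n. w n \<le> d * v n"
  shows "bounded_linear_map R (l1 na R v) (l1 na R w) (\<lambda>x. x)"
proof -
  have *: "x \<in> carrier (l1 na R w) \<and> nm (l1 na R w) x \<le> d * nm (l1 na R v) x" if x: "x \<in> carrier (l1 na R v)" for x
  proof -
    note X = l1_D[OF R v x]
    have b: "rnm R (x n) * w n \<le> d * (rnm R (x n) * v n)" for n
      using mult_left_mono[OF d(2)[of n] banach_ringD(4)[OF R X(1)[of n]]] by (simp add: mult_ac)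
    note I = l1_I[of x R, OF X(1) small_cmult[OF X(2)] b R w]
    show ?thesis using I seq_norm_cmult[OF X(2,3) d(1)] by (simp add: l1_simps)
  qed
  then show ?thesis unfolding bounded_linear_map_def by (auto simp: l1_simps(3,4))
qed

definition seq_pairing :: "'r nring \<Rightarrow> (nat \<Rightarrow> 'r) \<Rightarrow> (nat \<Rightarrow> 'r) \<Rightarrow> 'r" where
  "seq_pairing R x y = series (ring_as_module R) (\<lambda>n. x n \<otimes>\<^bsub>R\<^esub> y n)"

text \<open>The Hoelder inequality for exponents 1 and infinity: the weights of the two factors
  cancel in each term. For \<open>y\<close> a supremum bound suffices, which an element of a step of
  \<lambda>(\<rho>) has for every weight.\<close>

lemma seq_pairing_small:
  assumes R: "banach_ring na R" and v: "\<And>n. 0 < v n"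
    and x: "x \<in> carrier (l1 na R (\<lambda>n. inverse (v n)))"
    and y: "\<And>n. y n \<in> carrier R" "\<And>n. rnm R (y n) * v n \<le> B"
  shows "\<And>n. x n \<otimes>\<^bsub>R\<^esub> y n \<in> carrier R" "small na (\<lambda>n. rnm R (x n \<otimes>\<^bsub>R\<^esub> y n))"
    "seq_pairing R x y \<in> carrier R"
    "rnm R (seq_pairing R x y) \<le> B * nm (l1 na R (\<lambda>n. inverse (v n))) x"
proof -
  note D = banach_ringD[OF R]
  interpret cring R by (rule D(1))
  have iv: "0 < inverse (v n)" for n using v by simp
  note X = l1_D[OF R iv x]
  let ?b = "\<lambda>n. rnm R (x n) * inverse (v n)"
  show c: "x n \<otimes>\<^bsub>R\<^esub> y n \<in> carrier R" for n using X(1) y(1) by simp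
  have B: "0 \<le> B" using y(2)[of 0] D(4)[OF y(1)[of 0]] v[of 0] by (meson less_imp_le mult_nonneg_nonneg order_trans)
  have 0: "0 \<le> rnm R (x n \<otimes>\<^bsub>R\<^esub> y n)" for n by (rule D(4)[OF c])
  have b: "rnm R (x n \<otimes>\<^bsub>R\<^esub> y n) \<le> B * ?b n" for n
  proof -
    have "rnm R (x n \<otimes>\<^bsub>R\<^esub> y n) \<le> rnm R (x n) * rnm R (y n)" by (rule D(6)[OF X(1) y(1)])
    also have "\<dots> = ?b n * (rnm R (y n) * v n)" using v[of n] by (simp add: field_simps)
    also have "\<dots> \<le> ?b n * B" by (rule mult_left_mono[OF y(2) X(3)])
    finally show ?thesis by (simp add: mult.commute)
  qed
  show s: "small na (\<lambda>n. rnm R (x n \<otimes>\<^bsub>R\<^esub> y n))" by (rule small_mono[OF small_cmult[OF X(2)] 0 b])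
  have e: "seq_norm na (\<lambda>n. rnm R (x n \<otimes>\<^bsub>R\<^esub> y n)) \<le> B * nm (l1 na R (\<lambda>n. inverse (v n))) x"
    using seq_norm_mono[OF small_cmult[OF X(2)] 0 b] seq_norm_cmult[OF X(2,3) B] by (simp add: l1_simps)
  note M = ring_as_module_banach[OF R]
  show "seq_pairing R x y \<in> carrier R"
    using series_lim(1)[OF M, of "\<lambda>n. x n \<otimes>\<^bsub>R\<^esub> y n"] c s by (simp add: seq_pairing_def ring_as_module_simps)
  show "rnm R (seq_pairing R x y) \<le> B * nm (l1 na R (\<lambda>n. inverse (v n))) x"
    using series_norm[OF M, of "\<lambda>n. x n \<otimes>\<^bsub>R\<^esub> y n"] c s e seq_norm_le_iff[OF s 0]
    by (simp add: seq_pairing_def ring_as_module_simps)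
qed

text \<open>The factors are kept arbitrary and only the products are related, so that the same
  statement gives additivity in either argument.\<close>

lemma seq_pairing_add:
  assumes R: "banach_ring na R" and a: "\<And>n. x n \<otimes>\<^bsub>R\<^esub> y n \<in> carrier R" "small na (\<lambda>n. rnm R (x n \<otimes>\<^bsub>R\<^esub> y n))"
    and b: "\<And>n. x' n \<otimes>\<^bsub>R\<^esub> y' n \<in> carrier R" "small na (\<lambda>n. rnm R (x' n \<otimes>\<^bsub>R\<^esub> y' n))"
    and e: "\<And>n. u n \<otimes>\<^bsub>R\<^esub> v n = x n \<otimes>\<^bsub>R\<^esub> y n \<oplus>\<^bsub>R\<^esub> x' n \<otimes>\<^bsub>R\<^esub> y' n"
  shows "seq_pairing R u v = seq_pairing R x y \<oplus>\<^bsub>R\<^esub> seq_pairing R x' y'"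
  using series_add[OF ring_as_module_banach[OF R], of "\<lambda>n. x n \<otimes>\<^bsub>R\<^esub> y n" "\<lambda>n. x' n \<otimes>\<^bsub>R\<^esub> y' n"] a b
  by (simp add: seq_pairing_def e ring_as_module_simps)

lemma seq_pairing_smult:
  assumes R: "banach_ring na R" and c: "c \<in> carrier R"
    and a: "\<And>n. x n \<otimes>\<^bsub>R\<^esub> y n \<in> carrier R" "small na (\<lambda>n. rnm R (x n \<otimes>\<^bsub>R\<^esub> y n))"
    and e: "\<And>n. u n \<otimes>\<^bsub>R\<^esub> v n = c \<otimes>\<^bsub>R\<^esub> (x n \<otimes>\<^bsub>R\<^esub> y n)"
  shows "seq_pairing R u v = c \<otimes>\<^bsub>R\<^esub> seq_pairing R x y"
proof -
  note M = ring_as_module_banach[OF R]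
  have "\<And>n. x n \<otimes>\<^bsub>R\<^esub> y n \<in> carrier (ring_as_module R)"
    "small na (\<lambda>n. nm (ring_as_module R) (x n \<otimes>\<^bsub>R\<^esub> y n))" using a by (simp_all add: ring_as_module_simps)
  note s = series_blm[OF M M blm_smult[OF R M c] this(1) series_lim[where a = "\<lambda>n. x n \<otimes>\<^bsub>R\<^esub> y n", OF M this]]
  show ?thesis using s by (simp add: seq_pairing_def e ring_as_module_simps)
qed

lemma seq_pairing_unit:
  assumes R: "banach_ring na R" and y: "\<And>n. y n \<in> carrier R"
  shows "seq_pairing R (unit_seq R n) y = y n" "seq_pairing R y (unit_seq R n) = y n"
proof -
  note D = banach_ringD[OF R] and M = ring_as_module_banach[OF R]
  interpret cring R by (rule D(1))
  interpret M: abelian_group "ring_as_module R" by (rule banach_moduleD(2)[OF M])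
  let ?a = "\<lambda>m. if m = n then y n else \<zero>\<^bsub>R\<^esub>"
  have p: "psum (ring_as_module R) ?a N = (if n < N then y n else \<zero>\<^bsub>R\<^esub>)" for N
    by (induction N) (auto simp: ring_as_module_simps y less_Suc_eq)
  have "eventually (\<lambda>N. nm (ring_as_module R) (psum (ring_as_module R) ?a N \<ominus>\<^bsub>ring_as_module R\<^esub> y n) = 0) sequentially"
    using eventually_gt_at_top[of n]
  proof eventually_elim
    case (elim N)
    have "y n \<ominus>\<^bsub>ring_as_module R\<^esub> y n = \<zero>\<^bsub>R\<^esub>"
      using y[of n] M.r_neg[of "y n"] by (simp add: a_minus_def ring_as_module_simps)
    then show ?case using elim D(8) by (simp add: p ring_as_module_simps)
  qed
  then have "series (ring_as_module R) ?a = y n"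
    by (intro series_eqI[OF M] tendsto_eventually) (auto simp: ring_as_module_simps y)
  moreover have "(\<lambda>m. unit_seq R n m \<otimes>\<^bsub>R\<^esub> y m) = ?a" "(\<lambda>m. y m \<otimes>\<^bsub>R\<^esub> unit_seq R n m) = ?a"
    using y by (auto simp: unit_seq_def)
  ultimately show "seq_pairing R (unit_seq R n) y = y n" "seq_pairing R y (unit_seq R n) = y n"
    by (simp_all add: seq_pairing_def)
qed

section \<open>The weights, the two systems and their pairing\<close>

locale weights =
  fixes na :: bool and R :: "'r nring" and \<rho> :: "nat \<Rightarrow> nat \<Rightarrow> real"
  assumes R: "banach_ring na R" and \<rho>: "\<And>j n. 0 < \<rho> j n"
    and ratio: "\<And>j. small na (\<lambda>n. \<rho> j n / \<rho> (Suc j) n)"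
begin

sublocale R: cring R by (rule banach_ringD(1)[OF R])

abbreviation RM where "RM \<equiv> ring_as_module R"
abbreviation \<kappa> where "\<kappa> \<equiv> kappa_space na R \<rho>"
abbreviation \<Lambda> where "\<Lambda> \<equiv> lambda_space na R \<rho>"
text \<open>The constant for passing from a supremum bound with weight \<open>\<rho> (Suc j)\<close>
  to a bound in the norm of the module with weight \<open>\<rho> j\<close>.\<close>

abbreviation ratio_norm where "ratio_norm j \<equiv> seq_norm na (\<lambda>n. \<rho> j n / \<rho> (Suc j) n)"

lemma ratio_bounds: "0 \<le> \<rho> j n / \<rho> (Suc j) n" "\<rho> j n / \<rho> (Suc j) n \<le> ratio_norm j" "0 \<le> ratio_norm j"
proof -
  show *: "0 \<le> \<rho> j n / \<rho> (Suc j) n" for n using \<rho>[of j n] \<rho>[of "Suc j" n] by simp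
  show "\<rho> j n / \<rho> (Suc j) n \<le> ratio_norm j" "0 \<le> ratio_norm j" using seq_norm_ge[OF ratio *] by auto
qed

text \<open>A small sequence is bounded, so consecutive weights are comparable, and the constants
  multiply along the chain from \<open>i\<close> to \<open>j\<close>.\<close>

lemma \<rho>_le:
  assumes "i \<le> j" shows "\<exists>d\<ge>1. \<forall>n. \<rho> i n \<le> d * \<rho> j n"
  using assms
proof (induction rule: dec_induct)
  case base then show ?case by (intro exI[of _ 1]) simp
next
  case (step j)
  then obtain d where d: "1 \<le> d" "\<forall>n. \<rho> i n \<le> d * \<rho> j n" by blast
  have "\<rho> i n \<le> (d * (1 + ratio_norm j)) * \<rho> (Suc j) n" for n
  proof -
    have "\<rho> j n = (\<rho> j n / \<rho> (Suc j) n) * \<rho> (Suc j) n" using \<rho>[of "Suc j" n] by simp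
    also have "\<dots> \<le> (1 + ratio_norm j) * \<rho> (Suc j) n"
      using ratio_bounds(2)[of j n] \<rho>[of "Suc j" n] by (intro mult_right_mono) auto
    finally have "d * \<rho> j n \<le> d * ((1 + ratio_norm j) * \<rho> (Suc j) n)" using d(1) by (intro mult_left_mono) auto
    then show ?thesis using d(2)[rule_format, of n] by (simp add: mult.assoc)
  qed
  moreover have "1 \<le> d * (1 + ratio_norm j)"
    using d(1) ratio_bounds(3)[of j] mult_mono[of 1 d 1 "1 + ratio_norm j"] by simp
  ultimately show ?case by blast
qed

text \<open>The gliding hump needs one constant for all \<open>i \<le> j\<close>; the sum of the
  finitely many constants serves.\<close>

lemma \<rho>_le_uniform: "\<exists>d\<ge>1. \<forall>i\<le>j. \<forall>n. \<rho> i n \<le> d * \<rho> j n"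
proof -
  have "\<forall>i. \<exists>d. i \<le> j \<longrightarrow> 1 \<le> d \<and> (\<forall>n. \<rho> i n \<le> d * \<rho> j n)" using \<rho>_le by blast
  then obtain d where d: "\<And>i. i \<le> j \<Longrightarrow> 1 \<le> d i" "\<And>i n. i \<le> j \<Longrightarrow> \<rho> i n \<le> d i * \<rho> j n" by metis
  let ?d = "\<Sum>i\<le>j. d i"
  have le: "d i \<le> ?d" if "i \<le> j" for i
    using that d(1) by (intro member_le_sum) (auto intro: order_trans[of 0 1])
  have "\<rho> i n \<le> ?d * \<rho> j n" if "i \<le> j" for i n
    using d(2)[OF that, of n] mult_right_mono[OF le[OF that] less_imp_le[OF \<rho>[of j n]]] by linarith
  moreover have "1 \<le> ?d" using d(1)[of j] le[of j] by simp
  ultimately show ?thesis by blast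
qed

abbreviation dual_weight where "dual_weight j \<equiv> (\<lambda>n. inverse (\<rho> j n))"

lemma dual_weight_pos: "0 < dual_weight j n"
  using \<rho>[of j n] by simp

lemma \<kappa>_simps: "idx \<kappa> = UNIV" "ile \<kappa> i j \<longleftrightarrow> i \<le> j" "obj \<kappa> j = l1 na R (dual_weight j)" "tr \<kappa> i j x = x"
  by (simp_all add: kappa_space_def)

lemma \<kappa>_obj: "ind_obj na R \<kappa>"
proof -
  have "bounded_linear_map R (l1 na R (dual_weight i)) (l1 na R (dual_weight j)) (\<lambda>x. x)" if ij: "i \<le> j" for i j
  proof -
    obtain d where d: "1 \<le> d" "\<forall>n. \<rho> i n \<le> d * \<rho> j n" using \<rho>_le[OF ij] by blast
    have "dual_weight j n \<le> d * dual_weight i n" for n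
      using d(2)[rule_format, of n] \<rho>[of i n] \<rho>[of j n] by (simp add: field_simps)
    then show ?thesis using d(1) dual_weight_pos by (intro l1_incl_blm[OF R, of _ _ d]) auto
  qed
  moreover have "banach_module na R (l1 na R (dual_weight j))" for j by (rule l1_banach[OF R dual_weight_pos])
  moreover have "\<exists>k::nat. i \<le> k \<and> j \<le> k" for i j by (rule exI[of _ "max i j"]) simp
  ultimately show ?thesis unfolding ind_obj_def \<kappa>_simps by (auto simp: kappa_space_def)
qed

lemma \<Lambda>_inverse_system: "inverse_system na R UNIV (\<le>) (\<lambda>j. l1 na R (\<rho> j)) (\<lambda>i j x. x)"
proof -
  have "bounded_linear_map R (l1 na R (\<rho> j)) (l1 na R (\<rho> i)) (\<lambda>x. x)" if ij: "i \<le> j" for i j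
  proof -
    obtain d where d: "1 \<le> d" "\<forall>n. \<rho> i n \<le> d * \<rho> j n" using \<rho>_le[OF ij] by blast
    show ?thesis by (rule l1_incl_blm[OF R \<rho> \<rho>, of d]) (use d in auto)
  qed
  then show ?thesis unfolding inverse_system_def using l1_banach[OF R \<rho>] by auto
qed

lemma \<Lambda>_obj: "ind_obj na R \<Lambda>"
  unfolding lambda_space_def by (rule ind_lim_obj[OF R \<Lambda>_inverse_system])

lemma \<Lambda>_simps:
  "idx \<Lambda> = {\<phi>. \<forall>j. 0 < \<phi> j}" "ile \<Lambda> \<phi> \<psi> \<longleftrightarrow> (\<forall>j. \<phi> j \<le> \<psi> j)" "tr \<Lambda> \<phi> \<psi> x = x"
  "x \<oplus>\<^bsub>obj \<Lambda> \<phi>\<^esub> y = (\<lambda>j n. x j n \<oplus>\<^bsub>R\<^esub> y j n)" "a \<odot>\<^bsub>obj \<Lambda> \<phi>\<^esub> x = (\<lambda>j n. a \<otimes>\<^bsub>R\<^esub> x j n)"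
  by (simp_all add: lambda_space_def ind_lim_def bounded_families_def l1_simps restrict_def)

text \<open>Compatibility under identity maps forces a family to be constant, so the entry
  \<open>x 0\<close> is the underlying sequence and the other entries only record its norms.\<close>

lemma \<Lambda>_D:
  assumes \<phi>: "\<And>j. 0 < \<phi> j" and x: "x \<in> carrier (obj \<Lambda> \<phi>)"
  shows "\<And>j. x j = x 0" "\<And>j. x 0 \<in> carrier (l1 na R (\<rho> j))" "0 \<le> nm (obj \<Lambda> \<phi>) x"
    "\<And>j. nm (l1 na R (\<rho> j)) (x 0) \<le> nm (obj \<Lambda> \<phi>) x * \<phi> j"
proof -
  have x': "x \<in> carrier (bounded_families UNIV (\<le>) (\<lambda>j. l1 na R (\<rho> j)) (\<lambda>i j x. x) \<phi>)"
    using x by (simp add: lambda_space_def ind_lim_def)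
  note D = bounded_familiesD[where \<phi> = \<phi>, OF \<Lambda>_inverse_system \<phi> x']
  show e: "x j = x 0" for j using D(2)[of 0 j] by simp
  show "x 0 \<in> carrier (l1 na R (\<rho> j))" for j using PiE_mem[OF D(1), of j] e[of j] by simp
  show "0 \<le> nm (obj \<Lambda> \<phi>) x" using D(3) by (simp add: lambda_space_def ind_lim_def)
  show "nm (l1 na R (\<rho> j)) (x 0) \<le> nm (obj \<Lambda> \<phi>) x * \<phi> j" for j
    using D(4)[of j] e[of j] by (simp add: lambda_space_def ind_lim_def)
qed

lemma \<Lambda>_I:
  assumes \<phi>: "\<And>j. 0 < \<phi> j" and z: "\<And>j. z \<in> carrier (l1 na R (\<rho> j))"
    and t: "0 \<le> t" "\<And>j. nm (l1 na R (\<rho> j)) z \<le> t * \<phi> j"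
  shows "(\<lambda>j. z) \<in> carrier (obj \<Lambda> \<phi>)" "nm (obj \<Lambda> \<phi>) (\<lambda>j. z) \<le> t"
proof -
  show "(\<lambda>j. z) \<in> carrier (obj \<Lambda> \<phi>)"
    using z t by (auto simp: lambda_space_def ind_lim_def bounded_families_def)
  show "nm (obj \<Lambda> \<phi>) (\<lambda>j. z) \<le> t"
    using bounded_families_nm_le[of UNIV \<phi> t "\<lambda>j. l1 na R (\<rho> j)" "\<lambda>j. z"] \<phi> t
    by (simp add: lambda_space_def ind_lim_def)
qed

lemma \<Lambda>_coeff:
  assumes \<phi>: "\<And>j. 0 < \<phi> j" and x: "x \<in> carrier (obj \<Lambda> \<phi>)"
  shows "x 0 n \<in> carrier R" "rnm R (x 0 n) * \<rho> j n \<le> nm (obj \<Lambda> \<phi>) x * \<phi> j"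
  using l1_D(1)[OF R \<rho> \<Lambda>_D(2)[OF \<phi> x]] l1_D(4)[OF R \<rho> \<Lambda>_D(2)[OF \<phi> x], of n j] \<Lambda>_D(4)[OF \<phi> x, of j]
  by auto

text \<open>An element \<open>y\<close> of the step \<open>\<phi>\<close> satisfies a supremum bound
  with weight \<open>\<rho> j\<close> and constant \<open>\<phi> j\<close> times its norm. Hence the
  form on the steps \<open>j\<close> and \<open>\<phi>\<close> has bound
  \<open>\<phi> j\<close>.\<close>

sublocale pair: ind_bilinear na R \<kappa> \<Lambda> "\<lambda>j \<phi> x y. seq_pairing R x (y 0)" "\<lambda>j \<phi>. \<phi> j"
proof (rule ind_bilinear.intro)
  show "banach_ring na R" by (rule R)
  show "ind_obj na R \<kappa>" by (rule \<kappa>_obj)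
  show "ind_obj na R \<Lambda>" by (rule \<Lambda>_obj)
next
  fix j \<phi> assume "\<phi> \<in> idx \<Lambda>"
  then have \<phi>: "\<And>i. 0 < \<phi> i" by (simp add: \<Lambda>_simps)
  have B: "banach_module na R (obj \<kappa> j)" "banach_module na R (obj \<Lambda> \<phi>)"
    using ind_objD(4)[OF \<kappa>_obj, of j] ind_objD(4)[OF \<Lambda>_obj, of \<phi>] \<phi> by (simp_all add: \<kappa>_simps \<Lambda>_simps)
  note S = seq_pairing_small[where v = "\<rho> j", OF R \<rho>]
  show "banach_bilinear na R (obj \<kappa> j) (obj \<Lambda> \<phi>) RM (\<lambda>x y. seq_pairing R x (y 0)) (\<phi> j)"
  proof unfold_locales
    show "banach_ring na R" by (rule R)
    show "banach_module na R (obj \<kappa> j)" "banach_module na R (obj \<Lambda> \<phi>)" "banach_module na R RM"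
      using B ring_as_module_banach[OF R] by auto
    show "0 \<le> \<phi> j" using \<phi>[of j] by simp
  next
    fix x y assume x: "x \<in> carrier (obj \<kappa> j)" and y: "y \<in> carrier (obj \<Lambda> \<phi>)"
    then have x': "x \<in> carrier (l1 na R (dual_weight j))" by (simp add: \<kappa>_simps)
    note X = l1_D(1)[OF R dual_weight_pos x']
    note Y = \<Lambda>_coeff[OF \<phi> y]
    note XY = S[where y = "y 0", OF x' Y]
    show "seq_pairing R x (y 0) \<in> carrier RM" using XY(3) by (simp add: ring_as_module_simps)
    show "nm RM (seq_pairing R x (y 0)) \<le> \<phi> j * (nm (obj \<kappa> j) x * nm (obj \<Lambda> \<phi>) y)"
      using XY(4) by (simp add: ring_as_module_simps \<kappa>_simps mult_ac)
    show "seq_pairing R (x \<oplus>\<^bsub>obj \<kappa> j\<^esub> x') (y 0) = seq_pairing R x (y 0) \<oplus>\<^bsub>RM\<^esub> seq_pairing R x' (y 0)"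
      if "x' \<in> carrier (obj \<kappa> j)" for x'
    proof -
      have x2: "x' \<in> carrier (l1 na R (dual_weight j))" using that by (simp add: \<kappa>_simps)
      show ?thesis unfolding ring_as_module_simps
        by (rule seq_pairing_add[OF R XY(1,2) S(1,2)[where y = "y 0", OF x2 Y]])
          (use X Y l1_D(1)[OF R dual_weight_pos x2] in \<open>simp add: \<kappa>_simps l1_simps R.l_distr\<close>)
    qed
    show "seq_pairing R x ((y \<oplus>\<^bsub>obj \<Lambda> \<phi>\<^esub> y') 0) = seq_pairing R x (y 0) \<oplus>\<^bsub>RM\<^esub> seq_pairing R x (y' 0)"
      if y': "y' \<in> carrier (obj \<Lambda> \<phi>)" for y'
      unfolding ring_as_module_simps
      by (rule seq_pairing_add[OF R XY(1,2) S(1,2)[where y = "y' 0", OF x' \<Lambda>_coeff[OF \<phi> y']]])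
        (use X Y \<Lambda>_coeff(1)[OF \<phi> y'] in \<open>simp add: \<Lambda>_simps R.r_distr\<close>)
    fix a assume a: "a \<in> carrier R"
    show "seq_pairing R (a \<odot>\<^bsub>obj \<kappa> j\<^esub> x) (y 0) = a \<odot>\<^bsub>RM\<^esub> seq_pairing R x (y 0)"
      unfolding ring_as_module_simps
      by (rule seq_pairing_smult[OF R a XY(1,2)]) (use a X Y in \<open>simp add: \<kappa>_simps l1_simps R.m_assoc\<close>)
    show "seq_pairing R x ((a \<odot>\<^bsub>obj \<Lambda> \<phi>\<^esub> y) 0) = a \<odot>\<^bsub>RM\<^esub> seq_pairing R x (y 0)"
      unfolding ring_as_module_simps
      by (rule seq_pairing_smult[OF R a XY(1,2)]) (use a X Y in \<open>simp add: \<Lambda>_simps R.m_lcomm\<close>)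
  qed
qed (simp add: \<kappa>_simps \<Lambda>_simps)

end

section \<open>Inverses of the two adjuncts\<close>

context weights
begin

abbreviation adjr where "adjr \<equiv> adj_right na R \<kappa> \<Lambda> pair.pairing"
abbreviation adjl where "adjl \<equiv> adj_left na R \<kappa> \<Lambda> pair.pairing"

lemma adj_eq:
  assumes "\<And>i. 0 < \<phi> i" "x \<in> carrier (obj \<kappa> j)" "y \<in> carrier (obj \<Lambda> \<phi>)"
  shows "im_map adjr \<phi> y j x = seq_pairing R x (y 0)" "im_map adjl j x \<phi> y = seq_pairing R x (y 0)"
  using pair.adj_apply[of j \<phi> x y] assms by (simp_all add: \<kappa>_simps \<Lambda>_simps)

lemma ind_dual_\<kappa>_coeff:
  assumes \<phi>: "\<phi> \<in> idx (ind_dual R \<kappa>)" and f: "f \<in> carrier (obj (ind_dual R \<kappa>) \<phi>)"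
  shows "0 < \<phi> j" "f 0 (unit_seq R n) \<in> carrier R" "f j (unit_seq R n) = f 0 (unit_seq R n)"
    "(\<lambda>n. f 0 (unit_seq R n)) \<in> carrier (l1 na R (\<rho> j))"
    "nm (l1 na R (\<rho> j)) (\<lambda>n. f 0 (unit_seq R n)) \<le> nm (obj (ind_dual R \<kappa>) \<phi>) f * (\<phi> (Suc j) * (1 + ratio_norm j))"
proof -
  note D = ind_dualD[OF R \<kappa>_obj \<phi> f, unfolded \<kappa>_simps, simplified]
  let ?c = "nm (obj (ind_dual R \<kappa>) \<phi>) f"
  have \<phi>: "0 < \<phi> j" for j using \<phi> by (simp add: ind_dual_simps \<kappa>_simps)
  then show "0 < \<phi> j" .
  note u = unit_seq_mem[where w = "dual_weight j" for j, OF R dual_weight_pos]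
  show c: "f 0 (unit_seq R n) \<in> carrier R" for n by (rule D(4)[OF u(1)])
  show e: "f j (unit_seq R n) = f 0 (unit_seq R n)" for j n using D(7)[OF _ u(1), of 0 j] by simp
  \<comment> \<open>Testing \<open>f\<close> in the step \<open>Suc j\<close>, where the unit vector
    has norm at most the inverse of \<open>\<rho> (Suc j) n\<close>, leaves the ratio of consecutive
    weights as a factor. Testing in the step \<open>j\<close> would leave only a bounded
    sequence.\<close>
  have b: "rnm R (f 0 (unit_seq R n)) * \<rho> j n \<le> (?c * \<phi> (Suc j)) * (\<rho> j n / \<rho> (Suc j) n)" for n
  proof -
    have "rnm R (f (Suc j) (unit_seq R n)) \<le> ?c * \<phi> (Suc j) * nm (l1 na R (dual_weight (Suc j))) (unit_seq R n)"
      by (rule D(6)[OF u(1)])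
    also have "\<dots> \<le> ?c * \<phi> (Suc j) * dual_weight (Suc j) n"
      using D(5) \<phi>[of "Suc j"] by (intro mult_left_mono u(2)) simp
    finally have "rnm R (f 0 (unit_seq R n)) * \<rho> j n \<le> (?c * \<phi> (Suc j) * dual_weight (Suc j) n) * \<rho> j n"
      unfolding e[of "Suc j" n] using \<rho>[of j n] by (intro mult_right_mono) auto
    then show ?thesis by (simp add: divide_inverse mult_ac)
  qed
  have c0: "0 \<le> ?c * \<phi> (Suc j)" using D(5) \<phi>[of "Suc j"] by simp
  note I = l1_I[of "\<lambda>n. f 0 (unit_seq R n)" R, OF c small_cmult[OF ratio] b R \<rho>]
  show "(\<lambda>n. f 0 (unit_seq R n)) \<in> carrier (l1 na R (\<rho> j))" by (rule I(1))
  have "nm (l1 na R (\<rho> j)) (\<lambda>n. f 0 (unit_seq R n)) \<le> (?c * \<phi> (Suc j)) * ratio_norm j"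
    by (rule order_trans[OF I(2) seq_norm_cmult[OF ratio ratio_bounds(1) c0]])
  also have "\<dots> \<le> (?c * \<phi> (Suc j)) * (1 + ratio_norm j)" using c0 by (intro mult_left_mono) auto
  finally show "nm (l1 na R (\<rho> j)) (\<lambda>n. f 0 (unit_seq R n)) \<le> ?c * (\<phi> (Suc j) * (1 + ratio_norm j))"
    by (simp add: mult.assoc)
qed

text \<open>The inverse of \<open>adjr\<close>. The shift to \<open>\<phi> (Suc j)\<close> is the
  price for turning a supremum bound into membership, and the summand 1 makes the index visibly
  positive.\<close>

definition coeff_map :: "(nat \<Rightarrow> real, nat \<Rightarrow> (nat \<Rightarrow> 'r) \<Rightarrow> 'r, nat \<Rightarrow> real, nat \<Rightarrow> nat \<Rightarrow> 'r) ind_map" where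
  "coeff_map = \<lparr> im_idx = (\<lambda>\<phi> j. \<phi> (Suc j) * (1 + ratio_norm j)), im_map = (\<lambda>\<phi> f j n. f 0 (unit_seq R n)) \<rparr>"

lemma coeff_map_mor: "ind_mor na R (ind_dual R \<kappa>) \<Lambda> coeff_map"
  unfolding ind_mor_alt
proof (intro conjI ballI impI)
  show "ind_obj na R (ind_dual R \<kappa>)" by (rule ind_dual_obj[OF R \<kappa>_obj])
  show "ind_obj na R \<Lambda>" by (rule \<Lambda>_obj)
  fix \<phi> assume \<phi>: "\<phi> \<in> idx (ind_dual R \<kappa>)"
  have pos: "0 < im_idx coeff_map \<phi> j" if "\<phi> \<in> idx (ind_dual R \<kappa>)" for j \<phi>
    using that ratio_bounds(3)[of j] by (simp add: coeff_map_def ind_dual_simps \<kappa>_simps add_pos_nonneg)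
  show "im_idx coeff_map \<phi> \<in> idx \<Lambda>" using pos[OF \<phi>] by (simp add: \<Lambda>_simps)
  have mem: "im_map coeff_map \<phi> f \<in> carrier (obj \<Lambda> (im_idx coeff_map \<phi>)) \<and>
      nm (obj \<Lambda> (im_idx coeff_map \<phi>)) (im_map coeff_map \<phi> f) \<le> nm (obj (ind_dual R \<kappa>) \<phi>) f"
    if f: "f \<in> carrier (obj (ind_dual R \<kappa>) \<phi>)" for f
    using \<Lambda>_I[where \<phi> = "im_idx coeff_map \<phi>" and z = "\<lambda>n. f 0 (unit_seq R n)", OF pos[OF \<phi>]
        ind_dual_\<kappa>_coeff(4)[OF \<phi> f] ind_dualD(5)[OF R \<kappa>_obj \<phi> f]] ind_dual_\<kappa>_coeff(5)[OF \<phi> f]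
    by (simp add: coeff_map_def)
  have u: "unit_seq R n \<in> carrier (l1 na R (dual_weight 0))" for n by (rule unit_seq_mem(1)[OF R dual_weight_pos])
  show "bounded_linear_map R (obj (ind_dual R \<kappa>) \<phi>) (obj \<Lambda> (im_idx coeff_map \<phi>)) (im_map coeff_map \<phi>)"
    unfolding bounded_linear_map_def
  proof (intro conjI ballI)
    show "im_map coeff_map \<phi> \<in> carrier (obj (ind_dual R \<kappa>) \<phi>) \<rightarrow> carrier (obj \<Lambda> (im_idx coeff_map \<phi>))"
      using mem by blast
    show "\<exists>C. \<forall>f\<in>carrier (obj (ind_dual R \<kappa>) \<phi>).
        nm (obj \<Lambda> (im_idx coeff_map \<phi>)) (im_map coeff_map \<phi> f) \<le> C * nm (obj (ind_dual R \<kappa>) \<phi>) f"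
      using mem by (intro exI[of _ 1]) simp
  qed (use u in \<open>simp_all add: coeff_map_def ind_dual_simps \<Lambda>_simps \<kappa>_simps\<close>)
  fix \<psi> assume \<psi>: "\<psi> \<in> idx (ind_dual R \<kappa>)"
  show "eventually_equal \<Lambda> (carrier (obj (ind_dual R \<kappa>) \<phi>)) (im_idx coeff_map \<phi>) (im_map coeff_map \<phi>)
      (im_idx coeff_map \<psi>) (\<lambda>f. im_map coeff_map \<psi> (tr (ind_dual R \<kappa>) \<phi> \<psi> f))"
    unfolding eventually_equal_def using pos[OF \<phi>] pos[OF \<psi>]
    by (intro bexI[of _ "\<lambda>j. max (im_idx coeff_map \<phi> j) (im_idx coeff_map \<psi> j)"])
      (auto simp: \<Lambda>_simps less_max_iff_disj ind_dual_simps coeff_map_def)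
qed

text \<open>Pairing with unit vectors recovers the coefficients of \<open>y\<close>, which settles
  one composite. For the other, the functional on each step of \<kappa>(\<rho>) is rebuilt from its
  coefficients by the expansion within that step.\<close>

lemma adjr_iso: "ind_iso na R \<Lambda> (ind_dual R \<kappa>) adjr"
proof -
  note a = pair.adj_right_mor and g = coeff_map_mor
  have "ind_eq \<Lambda> \<Lambda> (ind_comp coeff_map adjr) ind_id"
    unfolding lambda_space_def
  proof (rule ind_eq_limI, fold lambda_space_def)
    fix \<phi> j assume "\<phi> \<in> idx \<Lambda>"
    from ind_morD(3)[OF ind_comp_mor[OF a g] this]
    show "0 < im_idx (ind_comp coeff_map adjr) \<phi> j" by (simp add: \<Lambda>_simps)
  next
    fix \<phi> y assume "\<phi> \<in> idx \<Lambda>" and y: "y \<in> carrier (obj \<Lambda> \<phi>)"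
    then have \<phi>: "0 < \<phi> j" for j by (simp add: \<Lambda>_simps)
    have "im_map adjr \<phi> y 0 (unit_seq R n) = y j n" for j n
      using adj_eq(1)[OF \<phi> _ y, of "unit_seq R n" 0] unit_seq_mem(1)[OF R dual_weight_pos]
        seq_pairing_unit(1)[OF R \<Lambda>_coeff(1)[OF \<phi> y], of n] \<Lambda>_D(1)[OF \<phi> y, of j] by (simp add: \<kappa>_simps)
    then show "im_map (ind_comp coeff_map adjr) \<phi> y = im_map ind_id \<phi> y"
      by (simp add: ind_comp_def coeff_map_def ind_id_def fun_eq_iff)
  qed
  moreover have "ind_eq (ind_dual R \<kappa>) (ind_dual R \<kappa>) (ind_comp adjr coeff_map) ind_id"
  proof (rule ind_eq_dualI[OF ind_comp_mor[OF g a]])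
    note m = ind_comp_mor[OF g a]
    fix \<phi> f assume \<phi>: "\<phi> \<in> idx (ind_dual R \<kappa>)" and f: "f \<in> carrier (obj (ind_dual R \<kappa>) \<phi>)"
    note G = ind_morD(3)[OF g \<phi>] ind_morD(5)[OF g \<phi> f]
    have pos: "0 < im_idx coeff_map \<phi> j" for j using G(1) by (simp add: \<Lambda>_simps)
    show "im_map (ind_comp adjr coeff_map) \<phi> f = im_map ind_id \<phi> f"
    proof (rule ind_dual_ext[OF R \<kappa>_obj ind_morD(3)[OF m \<phi>] ind_morD(5)[OF m \<phi> f] \<phi>])
      show "im_map ind_id \<phi> f \<in> carrier (obj (ind_dual R \<kappa>) \<phi>)" using f by (simp add: ind_id_def)
      fix j x assume j: "j \<in> idx \<kappa>" and x: "x \<in> carrier (obj \<kappa> j)"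
      have b: "bounded_linear_map R (l1 na R (dual_weight j)) RM (f j)"
        using ind_dualD(3)[OF R \<kappa>_obj \<phi> f j] by (simp add: \<kappa>_simps)
      have "f j x = series RM (\<lambda>n. x n \<odot>\<^bsub>RM\<^esub> f j (unit_seq R n))"
        by (rule l1_blm_eq_series[OF R dual_weight_pos _ ring_as_module_banach[OF R] b]) (use x in \<open>simp add: \<kappa>_simps\<close>)
      also have "\<dots> = seq_pairing R x (im_map coeff_map \<phi> f 0)"
        by (simp add: seq_pairing_def coeff_map_def ring_as_module_simps ind_dual_\<kappa>_coeff(3)[OF \<phi> f, of j])
      finally show "im_map (ind_comp adjr coeff_map) \<phi> f j x = im_map ind_id \<phi> f j x"
        using adj_eq(1)[OF pos x G(2)] by (simp add: ind_comp_def ind_id_def)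
    qed
  qed
  ultimately show ?thesis unfolding ind_iso_def using a g by blast
qed

text \<open>A gliding hump argument: if no \<open>J\<close> works, pick for every \<open>J\<close> a witness \<open>N J\<close>.  The function
  \<open>\<phi>\<close> below dominates all unit vectors at the positions \<open>N J\<close>, suitably scaled, so that \<open>\<Phi> \<phi> > J\<close> for all \<open>J\<close>.\<close>

lemma ind_dual_\<Lambda>_bound:
  fixes \<Phi> :: "(nat \<Rightarrow> real) \<Rightarrow> real"
  shows "\<exists>J c. 0 \<le> c \<and> (\<forall>n. \<exists>\<phi> t. (\<forall>j. 0 < \<phi> j) \<and> 0 \<le> t \<and> (\<forall>i. \<rho> i n \<le> t * \<phi> i) \<and> \<Phi> \<phi> * t \<le> c * \<rho> J n)"
proof (rule ccontr)
  assume neg: "\<not> ?thesis"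
  have "\<forall>j. \<exists>d\<ge>1. \<forall>i\<le>j. \<forall>n. \<rho> i n \<le> d * \<rho> j n" using \<rho>_le_uniform by blast
  then obtain d where "\<forall>j. 1 \<le> d j \<and> (\<forall>i\<le>j. \<forall>n. \<rho> i n \<le> d j * \<rho> j n)" using choice[of "\<lambda>j d. 1 \<le> d \<and> (\<forall>i\<le>j. \<forall>n. \<rho> i n \<le> d * \<rho> j n)"] by blast
  then have d: "\<And>j. 1 \<le> d j" "\<And>i j n. i \<le> j \<Longrightarrow> \<rho> i n \<le> d j * \<rho> j n" by auto
  \<comment> \<open>Such a pair \<open>\<phi>\<close>, \<open>t\<close> puts the unit vector at
    \<open>n\<close> into the step \<open>\<phi>\<close> with norm at most \<open>t\<close>. The
    bound is denied for the constant \<open>real J * d J\<close>: the factor \<open>d J\<close> pays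
    for the normalisation \<open>?t\<close> below, and \<open>real J\<close> is left over as the
    lower bound for \<open>\<Phi> \<phi>\<close>.\<close>
  have "\<exists>n. \<forall>\<phi> t. (\<forall>j. 0 < \<phi> j) \<longrightarrow> 0 \<le> t \<longrightarrow> (\<forall>i. \<rho> i n \<le> t * \<phi> i) \<longrightarrow> real J * d J * \<rho> J n < \<Phi> \<phi> * t" for J
  proof -
    have "0 \<le> real J * d J" using d(1)[of J] by simp
    with neg have "\<not> (\<forall>n. \<exists>\<phi> t. (\<forall>j. 0 < \<phi> j) \<and> 0 \<le> t \<and> (\<forall>i. \<rho> i n \<le> t * \<phi> i) \<and> \<Phi> \<phi> * t \<le> (real J * d J) * \<rho> J n)" by blast
    then obtain n where n: "\<not> (\<exists>\<phi> t. (\<forall>j. 0 < \<phi> j) \<and> 0 \<le> t \<and> (\<forall>i. \<rho> i n \<le> t * \<phi> i) \<and> \<Phi> \<phi> * t \<le> (real J * d J) * \<rho> J n)"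
      unfolding not_all by (rule exE)
    show ?thesis
    proof (intro exI allI impI, rule ccontr)
      fix \<phi> t assume "\<forall>j. 0 < \<phi> j" "0 \<le> t" "\<forall>i. \<rho> i n \<le> t * \<phi> i"
        "\<not> real J * d J * \<rho> J n < \<Phi> \<phi> * t"
      then have "(\<forall>j. 0 < \<phi> j) \<and> 0 \<le> t \<and> (\<forall>i. \<rho> i n \<le> t * \<phi> i) \<and> \<Phi> \<phi> * t \<le> (real J * d J) * \<rho> J n" by simp
      then show False using n by blast
    qed
  qed
  then obtain N where "\<forall>J \<phi> t. (\<forall>j. 0 < \<phi> j) \<longrightarrow> 0 \<le> t \<longrightarrow> (\<forall>i. \<rho> i (N J) \<le> t * \<phi> i) \<longrightarrow>
      real J * d J * \<rho> J (N J) < \<Phi> \<phi> * t"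
    using choice[of "\<lambda>J n. \<forall>\<phi> t. (\<forall>j. 0 < \<phi> j) \<longrightarrow> 0 \<le> t \<longrightarrow> (\<forall>i. \<rho> i n \<le> t * \<phi> i) \<longrightarrow>
      real J * d J * \<rho> J n < \<Phi> \<phi> * t"] by blast
  then have N: "\<And>J \<phi> t. (\<And>j. 0 < \<phi> j) \<Longrightarrow> 0 \<le> t \<Longrightarrow> (\<And>i. \<rho> i (N J) \<le> t * \<phi> i) \<Longrightarrow>
    real J * d J * \<rho> J (N J) < \<Phi> \<phi> * t" by simp
  \<comment> \<open>By the choice of \<open>d J\<close>, the quotient of
    \<open>\<rho> i (N J)\<close> by \<open>?t J\<close> is at most 1 for all
    \<open>i \<le> J\<close>, which the summand 1 of \<open>\<phi> i\<close> covers. Only the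
    finitely many \<open>j < i\<close> remain, and the sum in \<open>\<phi> i\<close> absorbs
    them.\<close>
  let ?t = "\<lambda>J. d J * \<rho> J (N J)"
  define \<phi> where "\<phi> = (\<lambda>i. 1 + (\<Sum>j<i. \<rho> i (N j) / ?t j))"
  have t: "0 < ?t J" for J using d(1)[of J] \<rho>[of J "N J"] by simp
  have s: "0 \<le> \<rho> i (N j) / ?t j" for i j using \<rho>[of i "N j"] t[of j] by simp
  have \<phi>1: "1 \<le> \<phi> i" for i unfolding \<phi>_def using s by (simp add: sum_nonneg)
  then have pos: "0 < \<phi> i" for i using less_le_trans[OF zero_less_one] by blast
  have dom: "\<rho> i (N J) \<le> ?t J * \<phi> i" for i J
  proof -
    have "\<rho> i (N J) / ?t J \<le> \<phi> i"
    proof (cases "i \<le> J")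
      case True
      then have "\<rho> i (N J) / ?t J \<le> 1" using d(2)[OF True, of "N J"] t[of J] by simp
      then show ?thesis using \<phi>1[of i] by simp
    next
      case False
      then have "\<rho> i (N J) / ?t J \<le> (\<Sum>j<i. \<rho> i (N j) / ?t j)" using s by (intro member_le_sum) auto
      then show ?thesis by (simp add: \<phi>_def)
    qed
    then show ?thesis using t[of J] by (simp add: pos_divide_le_eq mult.commute)
  qed
  have "real J < \<Phi> \<phi>" for J
  proof -
    have "real J * ?t J < \<Phi> \<phi> * ?t J"
      using N[OF pos less_imp_le[OF t] dom, of J] by (simp add: mult.assoc)
    then show ?thesis using t[of J] by (simp only: mult_less_cancel_right)
  qed
  moreover obtain J :: nat where "\<Phi> \<phi> \<le> real J" using real_arch_simple by blast
  ultimately show False using not_le by blast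
qed

text \<open>For \<open>j > n\<close> the sum contains \<open>\<rho> j n\<close>, so the step with this index contains every unit vector.\<close>

definition base_index :: "nat \<Rightarrow> real" where
  "base_index j = 1 + (\<Sum>m<j. \<rho> j m)"

lemma base_index_ge: "1 \<le> base_index j"
  unfolding base_index_def using \<rho> by (simp add: sum_nonneg less_imp_le)

lemma base_index_pos: "0 < base_index j"
  using less_le_trans[OF zero_less_one base_index_ge] .

lemma base_index_dom: "\<exists>t\<ge>0. \<forall>j. \<rho> j n \<le> t * base_index j"
proof -
  \<comment> \<open>The terms \<open>i \<le> n\<close> are those that \<open>base_index\<close> does
    not see; being finitely many, they fit into \<open>t\<close>.\<close>
  define t where "t = 1 + (\<Sum>i\<le>n. \<rho> i n)"
  have t: "1 \<le> t" unfolding t_def using \<rho> by (simp add: sum_nonneg less_imp_le)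
  have "\<rho> j n \<le> t * base_index j" for j
  proof (cases "j \<le> n")
    case True
    then have "\<rho> j n \<le> (\<Sum>i\<le>n. \<rho> i n)"
      using member_le_sum[of j "{..n}" "\<lambda>i. \<rho> i n"] \<rho> by (simp add: less_imp_le)
    then have "\<rho> j n \<le> t" by (simp add: t_def)
    then show ?thesis using mult_mono[of "\<rho> j n" t 1 "base_index j"] t base_index_ge[of j] by simp
  next
    case False
    then have "\<rho> j n \<le> (\<Sum>m<j. \<rho> j m)"
      using member_le_sum[of n "{..<j}" "\<rho> j"] \<rho> by (simp add: less_imp_le)
    then have "\<rho> j n \<le> base_index j" by (simp add: base_index_def)
    then show ?thesis using mult_mono[of 1 t "\<rho> j n" "base_index j"] t \<rho>[of j n] by simp
  qed
  then show ?thesis using t by (intro exI[of _ t]) auto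
qed

abbreviation unit_fam where "unit_fam n \<equiv> (\<lambda>j::nat. unit_seq R n)"

lemma unit_fam_mem:
  assumes \<phi>: "\<And>j. 0 < \<phi> j" and t: "0 \<le> t" "\<And>j. \<rho> j n \<le> t * \<phi> j"
  shows "unit_fam n \<in> carrier (obj \<Lambda> \<phi>)" "nm (obj \<Lambda> \<phi>) (unit_fam n) \<le> t"
proof -
  have "nm (l1 na R (\<rho> j)) (unit_seq R n) \<le> t * \<phi> j" for j
    using unit_seq_mem(2)[where w = "\<rho> j" and n = n, OF R \<rho>] t(2)[of j] by simp
  from \<Lambda>_I[where z = "unit_seq R n", OF \<phi> unit_seq_mem(1)[OF R \<rho>] t(1) this]
  show "unit_fam n \<in> carrier (obj \<Lambda> \<phi>)" "nm (obj \<Lambda> \<phi>) (unit_fam n) \<le> t" by auto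
qed

lemma unit_fam_base: "(\<And>j. base_index j \<le> \<phi> j) \<Longrightarrow> unit_fam n \<in> carrier (obj \<Lambda> \<phi>)"
proof -
  assume le: "\<And>j. base_index j \<le> \<phi> j"
  obtain t where t: "0 \<le> t" "\<forall>j. \<rho> j n \<le> t * base_index j" using base_index_dom by blast
  have "\<rho> j n \<le> t * \<phi> j" for j using t(2)[rule_format, of j] mult_left_mono[OF le[of j] t(1)] by simp
  then show ?thesis using less_le_trans[OF base_index_pos le] t(1) by (intro unit_fam_mem(1)) auto
qed

lemma \<Lambda>_proj_blm:
  assumes \<phi>: "\<And>j. 0 < \<phi> j" shows "bounded_linear_map R (obj \<Lambda> \<phi>) (l1 na R (\<rho> j)) (\<lambda>x. x j)"
  using ind_lim_proj(1)[OF R \<Lambda>_inverse_system, of j] \<phi>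
  unfolding lambda_space_def ind_mor_const_iff by (simp add: lim_proj_def ind_lim_def)

text \<open>The factor \<open>j + 1\<close> makes the error of truncation small uniformly for all large \<open>j\<close>, which leaves
  finitely many \<open>j\<close>.\<close>

lemma \<Lambda>_expansion:
  assumes \<phi>: "\<And>j. 0 < \<phi> j" and x: "x \<in> carrier (obj \<Lambda> \<phi>)"
    and \<psi>: "\<And>j. base_index j \<le> \<psi> j" "\<And>j. real (Suc j) * \<phi> j \<le> \<psi> j"
  shows "x \<in> carrier (obj \<Lambda> \<psi>)"
    "(\<lambda>N. nm (obj \<Lambda> \<psi>) (psum (obj \<Lambda> \<psi>) (\<lambda>n. x 0 n \<odot>\<^bsub>obj \<Lambda> \<psi>\<^esub> unit_fam n) N \<ominus>\<^bsub>obj \<Lambda> \<psi>\<^esub> x)) \<longlonglongrightarrow> 0"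
proof -
  have p\<psi>: "0 < \<psi> j" for j using less_le_trans[OF base_index_pos \<psi>(1)] .
  have B: "banach_module na R (obj \<Lambda> \<psi>)" using ind_objD(4)[OF \<Lambda>_obj] p\<psi> by (simp add: \<Lambda>_simps)
  interpret B: module R "obj \<Lambda> \<psi>" by (rule banach_moduleD(1)[OF B])
  let ?c = "nm (obj \<Lambda> \<phi>) x"
  note X = \<Lambda>_D[OF \<phi> x]
  have \<phi>\<psi>: "\<phi> j \<le> \<psi> j" for j
  proof -
    have "1 * \<phi> j \<le> real (Suc j) * \<phi> j" using \<phi>[of j] by (intro mult_right_mono) auto
    then show ?thesis using \<psi>(2)[of j] by simp
  qed
  have "nm (l1 na R (\<rho> j)) (x 0) \<le> ?c * \<psi> j" for j
    using X(4)[of j] mult_left_mono[OF \<phi>\<psi>[of j] X(3)] by simp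
  from \<Lambda>_I(1)[OF p\<psi> X(2) X(3) this]
  have "(\<lambda>j. x 0) \<in> carrier (obj \<Lambda> \<psi>)" .
  moreover have "(\<lambda>j. x 0) = x" by (rule ext) (rule X(1)[symmetric])
  ultimately show x\<psi>: "x \<in> carrier (obj \<Lambda> \<psi>)" by simp
  let ?a = "\<lambda>n. x 0 n \<odot>\<^bsub>obj \<Lambda> \<psi>\<^esub> unit_fam n"
  have a: "?a n \<in> carrier (obj \<Lambda> \<psi>)" for n
    by (rule B.smult_closed[OF \<Lambda>_coeff(1)[OF \<phi> x] unit_fam_base[OF \<psi>(1)]])
  let ?u = "psum (obj \<Lambda> \<psi>) ?a"
  note u = psum_closed[where a = ?a, OF B a]
  let ?\<tau> = "\<lambda>j N. seq_norm na (\<lambda>n. if n < N then 0 else rnm R (x 0 n) * \<rho> j n)"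
  \<comment> \<open>Evaluation at \<open>j\<close> is bounded and linear, so it commutes with
    partial sums and reduces the error at \<open>j\<close> to a tail norm in one weighted
    module.\<close>
  have \<tau>: "nm (l1 na R (\<rho> j)) ((?u N \<ominus>\<^bsub>obj \<Lambda> \<psi>\<^esub> x) j) = ?\<tau> j N" for j N
  proof -
    note pj = \<Lambda>_proj_blm[where j = j, OF p\<psi>] and L = l1_banach[where w = "\<rho> j", OF R \<rho>]
    have "(?u N \<ominus>\<^bsub>obj \<Lambda> \<psi>\<^esub> x) j = ?u N j \<ominus>\<^bsub>l1 na R (\<rho> j)\<^esub> x j"
      by (rule blm_minus[OF B L pj u x\<psi>])
    also have "?u N j = psum (l1 na R (\<rho> j)) (\<lambda>n. ?a n j) N" by (rule psum_blm[OF B L pj a])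
    also have "(\<lambda>n. ?a n j) = (\<lambda>n. x 0 n \<odot>\<^bsub>l1 na R (\<rho> j)\<^esub> unit_seq R n)"
      by (simp add: \<Lambda>_simps l1_simps)
    finally show ?thesis using l1_expansion(3)[OF R \<rho> X(2)[of j], of N] X(1)[of j] by simp
  qed
  show "(\<lambda>N. nm (obj \<Lambda> \<psi>) (?u N \<ominus>\<^bsub>obj \<Lambda> \<psi>\<^esub> x)) \<longlonglongrightarrow> 0"
  proof (rule LIMSEQ_I)
    fix e :: real assume e: "0 < e"
    obtain J :: nat where J: "?c / (e / 2) \<le> real J" using real_arch_simple by blast
    have T: "?\<tau> j N \<le> nm (l1 na R (\<rho> j)) (x 0)" "?\<tau> j \<longlonglongrightarrow> 0" for j N
      using seq_norm_tail(2,3)[OF l1_D(2)[OF R \<rho> X(2)[of j]] l1_D(3)[OF R \<rho> X(2)[of j]]] by (simp_all add: l1_simps)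
    \<comment> \<open>For these \<open>j\<close> even the whole norm of \<open>x\<close> is small
      enough: it is at most \<open>?c * \<phi> j\<close>, hence at most
      \<open>e / 2 * real (Suc j) * \<phi> j\<close>, uniformly in \<open>N\<close>.\<close>
    have big: "?\<tau> j N \<le> e / 2 * \<psi> j" if "J \<le> j" for j N
    proof -
      have "?c \<le> e / 2 * real J" using J e by (simp add: divide_simps mult_ac)
      also have "\<dots> \<le> e / 2 * real (Suc j)" using that e by (intro mult_left_mono) auto
      finally have "?c * \<phi> j \<le> (e / 2 * real (Suc j)) * \<phi> j" using \<phi>[of j] by (intro mult_right_mono) auto
      also have "\<dots> = e / 2 * (real (Suc j) * \<phi> j)" by simp
      also have "\<dots> \<le> e / 2 * \<psi> j" using \<psi>(2)[of j] e by (intro mult_left_mono) auto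
      finally show ?thesis using T(1)[of N j] X(4)[of j] by linarith
    qed
    have "eventually (\<lambda>N. ?\<tau> j N < e / 2 * \<psi> j) sequentially" for j
      using order_tendstoD(2)[OF T(2)[of j], of "e / 2 * \<psi> j"] e p\<psi>[of j] by simp
    then have "eventually (\<lambda>N. \<forall>j\<in>{..<J}. ?\<tau> j N < e / 2 * \<psi> j) sequentially"
      by (intro eventually_ball_finite) auto
    then obtain K where K: "\<forall>N\<ge>K. \<forall>j\<in>{..<J}. ?\<tau> j N < e / 2 * \<psi> j" by (auto simp: eventually_sequentially)
    have "norm (nm (obj \<Lambda> \<psi>) (?u N \<ominus>\<^bsub>obj \<Lambda> \<psi>\<^esub> x) - 0) < e" if N: "N \<ge> K" for N
    proof -
      have c: "?u N \<ominus>\<^bsub>obj \<Lambda> \<psi>\<^esub> x \<in> carrier (obj \<Lambda> \<psi>)" by (rule B.M.minus_closed[OF u x\<psi>])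
      have "?\<tau> j N \<le> e / 2 * \<psi> j" for j
        using big[of j N] K[rule_format, OF N, of j] by (cases "J \<le> j") (auto simp: less_imp_le)
      then have "nm (obj \<Lambda> \<psi>) (?u N \<ominus>\<^bsub>obj \<Lambda> \<psi>\<^esub> x) \<le> e / 2"
        using bounded_families_nm_le[of UNIV \<psi> "e / 2" "\<lambda>j. l1 na R (\<rho> j)" "?u N \<ominus>\<^bsub>obj \<Lambda> \<psi>\<^esub> x" "(\<le>)" "\<lambda>i j x. x"]
          p\<psi> e unfolding \<tau>[symmetric] by (simp add: lambda_space_def ind_lim_def)
      then show ?thesis using banach_moduleD(6)[OF B c] e by simp
    qed
    then show "\<exists>K. \<forall>N\<ge>K. norm (nm (obj \<Lambda> \<psi>) (?u N \<ominus>\<^bsub>obj \<Lambda> \<psi>\<^esub> x) - 0) < e" by blast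
  qed
qed

context
  fixes \<Phi> f assumes \<Phi>: "\<Phi> \<in> idx (ind_dual R \<Lambda>)" and f: "f \<in> carrier (obj (ind_dual R \<Lambda>) \<Phi>)"
begin

lemmas dual_\<Lambda>D = ind_dualD[OF R \<Lambda>_obj \<Phi> f, unfolded \<Lambda>_simps, simplified]

text \<open>Two steps that contain \<open>x\<close> both map to the step given by their pointwise
  maximum, where compatibility compares the values. This makes the coefficient at a unit vector
  independent of the step in which it is tested.\<close>

lemma dual_\<Lambda>_same:
  assumes \<phi>: "\<And>j. 0 < \<phi> j" "x \<in> carrier (obj \<Lambda> \<phi>)" and \<psi>: "\<And>j. 0 < \<psi> j" "x \<in> carrier (obj \<Lambda> \<psi>)"
  shows "f \<phi> x = f \<psi> x"
proof -
  let ?m = "\<lambda>j. max (\<phi> j) (\<psi> j)"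
  have "f ?m x = f \<phi> x" using dual_\<Lambda>D(7)[of \<phi> ?m x] \<phi> by (simp add: less_max_iff_disj)
  moreover have "f ?m x = f \<psi> x" using dual_\<Lambda>D(7)[of \<psi> ?m x] \<psi> by (simp add: less_max_iff_disj)
  ultimately show ?thesis by simp
qed

lemma unit_fam_base': "unit_fam n \<in> carrier (obj \<Lambda> base_index)"
  by (rule unit_fam_base) simp

text \<open>Each unit vector is tested in its own step \<open>\<phi>\<close>, the one that the
  hypothesis supplies for \<open>n\<close>, and the value is carried back to
  \<open>base_index\<close>. This bounds the coefficient by a multiple of \<open>\<rho> J n\<close>;
  the inverse of \<open>\<rho> (Suc J) n\<close> then completes it to a small ratio.\<close>

lemma dual_\<Lambda>_coeff:
  assumes c: "0 \<le> c" "\<And>n. \<exists>\<phi> t. (\<forall>j. 0 < \<phi> j) \<and> 0 \<le> t \<and> (\<forall>i. \<rho> i n \<le> t * \<phi> i) \<and> \<Phi> \<phi> * t \<le> c * \<rho> J n"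
  shows "f base_index (unit_fam n) \<in> carrier R"
    "(\<lambda>n. f base_index (unit_fam n)) \<in> carrier (l1 na R (dual_weight (Suc J)))"
    "nm (l1 na R (dual_weight (Suc J))) (\<lambda>n. f base_index (unit_fam n)) \<le>
      (c * ratio_norm J) * nm (obj (ind_dual R \<Lambda>) \<Phi>) f"
proof -
  let ?c = "nm (obj (ind_dual R \<Lambda>) \<Phi>) f"
  show cl: "f base_index (unit_fam n) \<in> carrier R" for n
    using dual_\<Lambda>D(4)[of base_index "unit_fam n"] base_index_pos unit_fam_base' by blast
  have b: "rnm R (f base_index (unit_fam n)) * dual_weight (Suc J) n \<le> (?c * c) * (\<rho> J n / \<rho> (Suc J) n)" for n
  proof -
    obtain \<phi> t where t: "\<And>j. 0 < \<phi> j" "0 \<le> t" "\<And>i. \<rho> i n \<le> t * \<phi> i" "\<Phi> \<phi> * t \<le> c * \<rho> J n" using c(2)[of n] by blast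
    note m = unit_fam_mem[OF t(1-3)]
    have pos: "0 < \<Phi> \<phi>" using \<Phi> t(1) by (simp add: ind_dual_simps \<Lambda>_simps)
    have "rnm R (f base_index (unit_fam n)) = rnm R (f \<phi> (unit_fam n))"
      using dual_\<Lambda>_same[OF base_index_pos unit_fam_base' t(1) m(1)] by simp
    also have "\<dots> \<le> ?c * \<Phi> \<phi> * nm (obj \<Lambda> \<phi>) (unit_fam n)" using dual_\<Lambda>D(6)[of \<phi>] t(1) m(1) by blast
    also have "\<dots> \<le> ?c * \<Phi> \<phi> * t" using m(2) dual_\<Lambda>D(5) pos by (intro mult_left_mono) auto
    also have "\<dots> \<le> ?c * (c * \<rho> J n)"
      using mult_left_mono[OF t(4) dual_\<Lambda>D(5)] by (simp add: mult.assoc)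
    finally have "rnm R (f base_index (unit_fam n)) * dual_weight (Suc J) n \<le> ?c * (c * \<rho> J n) * dual_weight (Suc J) n"
      using dual_weight_pos[of "Suc J" n] by (intro mult_right_mono) auto
    then show ?thesis by (simp add: divide_inverse mult_ac)
  qed
  have c0: "0 \<le> ?c * c" using dual_\<Lambda>D(5) c(1) by simp
  note I = l1_I[of "\<lambda>n. f base_index (unit_fam n)" R, OF cl small_cmult[OF ratio] b R dual_weight_pos]
  show "(\<lambda>n. f base_index (unit_fam n)) \<in> carrier (l1 na R (dual_weight (Suc J)))" by (rule I(1))
  show "nm (l1 na R (dual_weight (Suc J))) (\<lambda>n. f base_index (unit_fam n)) \<le> (c * ratio_norm J) * ?c"
    using order_trans[OF I(2) seq_norm_cmult[OF ratio ratio_bounds(1) c0]] by (simp add: mult_ac)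
qed

lemma dual_\<Lambda>_eq_pairing:
  assumes \<phi>: "\<And>j. 0 < \<phi> j" and x: "x \<in> carrier (obj \<Lambda> \<phi>)"
  shows "f \<phi> x = seq_pairing R (\<lambda>n. f base_index (unit_fam n)) (x 0)"
proof -
  \<comment> \<open>The sum dominates both lower bounds that \<open>\<Lambda>_expansion\<close> asks
    for: the unit vectors lie in the step \<open>\<psi>\<close>, and the truncations of
    \<open>x\<close> converge there.\<close>
  define \<psi> where "\<psi> = (\<lambda>j. base_index j + real (Suc j) * \<phi> j)"
  have \<psi>: "base_index j \<le> \<psi> j" "real (Suc j) * \<phi> j \<le> \<psi> j" for j
    using \<phi>[of j] base_index_pos[of j] by (simp_all add: \<psi>_def)
  have p\<psi>: "0 < \<psi> j" for j using less_le_trans[OF base_index_pos \<psi>(1)] .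
  have B: "banach_module na R (obj \<Lambda> \<psi>)" using ind_objD(4)[OF \<Lambda>_obj] p\<psi> by (simp add: \<Lambda>_simps)
  interpret B: module R "obj \<Lambda> \<psi>" by (rule banach_moduleD(1)[OF B])
  have fb: "bounded_linear_map R (obj \<Lambda> \<psi>) RM (f \<psi>)" using dual_\<Lambda>D(3)[of \<psi>] p\<psi> by blast
  note E = \<Lambda>_expansion[OF \<phi> x \<psi>]
  note xc = \<Lambda>_coeff(1)[OF \<phi> x] and u = unit_fam_base[OF \<psi>(1)]
  have "f \<phi> x = f \<psi> x" by (rule dual_\<Lambda>_same[OF \<phi> x p\<psi> E(1)])
  also have "\<dots> = series RM (\<lambda>n. f \<psi> (x 0 n \<odot>\<^bsub>obj \<Lambda> \<psi>\<^esub> unit_fam n))"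
    by (rule series_blm[OF B ring_as_module_banach[OF R] fb B.smult_closed[OF xc u] E])
  also have "(\<lambda>n. f \<psi> (x 0 n \<odot>\<^bsub>obj \<Lambda> \<psi>\<^esub> unit_fam n)) = (\<lambda>n. f base_index (unit_fam n) \<otimes>\<^bsub>R\<^esub> x 0 n)"
  proof
    fix n
    have "f \<psi> (unit_fam n) = f base_index (unit_fam n)" by (rule dual_\<Lambda>_same[OF p\<psi> u base_index_pos unit_fam_base'])
    moreover have "f \<psi> (unit_fam n) \<in> carrier R" using blmD(1)[OF fb u] by (simp add: ring_as_module_simps)
    ultimately show "f \<psi> (x 0 n \<odot>\<^bsub>obj \<Lambda> \<psi>\<^esub> unit_fam n) = f base_index (unit_fam n) \<otimes>\<^bsub>R\<^esub> x 0 n"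
      using blmD(3)[OF fb xc u] xc by (simp add: ring_as_module_simps R.m_comm)
  qed
  finally show ?thesis by (simp add: seq_pairing_def)
qed

end

lemma adjl_iso: "ind_iso na R \<kappa> (ind_dual R \<Lambda>) adjl"
proof -
  \<comment> \<open>\<open>J\<close> and \<open>c\<close> are chosen as functions of
    \<open>\<Phi>\<close> alone, since a representative of a morphism must send the whole step
    \<open>\<Phi>\<close> of the dual boundedly into a single step of \<kappa>(\<rho>).\<close>
  let ?P = "\<lambda>\<Phi> (J, c). 0 \<le> c \<and>
    (\<forall>n. \<exists>\<phi> t. (\<forall>j. 0 < \<phi> j) \<and> 0 \<le> t \<and> (\<forall>i. \<rho> i n \<le> t * \<phi> i) \<and> \<Phi> \<phi> * t \<le> c * \<rho> J n)"
  have "\<forall>\<Phi>. \<exists>Jc. ?P \<Phi> Jc"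
  proof
    fix \<Phi> obtain J c where "?P \<Phi> (J, c)" using ind_dual_\<Lambda>_bound[of \<Phi>] by auto
    then show "\<exists>Jc. ?P \<Phi> Jc" by (rule exI)
  qed
  then obtain Jc where Jc: "\<forall>\<Phi>. ?P \<Phi> (Jc \<Phi>)" by (rule choice[THEN exE])
  define J c where "J \<Phi> = fst (Jc \<Phi>)" and "c \<Phi> = snd (Jc \<Phi>)" for \<Phi>
  have c: "0 \<le> c \<Phi>" "\<exists>\<phi> t. (\<forall>j. 0 < \<phi> j) \<and> 0 \<le> t \<and> (\<forall>i. \<rho> i n \<le> t * \<phi> i) \<and> \<Phi> \<phi> * t \<le> c \<Phi> * \<rho> (J \<Phi>) n" for \<Phi> n
    using Jc[rule_format, of \<Phi>] by (simp_all add: J_def c_def case_prod_beta)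
  \<comment> \<open>The coefficients are always read at \<open>base_index\<close>, whatever
    \<open>\<Phi>\<close> is, so different steps of the dual give the same sequence and
    compatibility of \<open>h\<close> is immediate.\<close>
  define h :: "((nat \<Rightarrow> real) \<Rightarrow> real, (nat \<Rightarrow> real) \<Rightarrow> (nat \<Rightarrow> nat \<Rightarrow> 'r) \<Rightarrow> 'r, nat, nat \<Rightarrow> 'r) ind_map" where
    "h = \<lparr> im_idx = (\<lambda>\<Phi>. Suc (J \<Phi>)), im_map = (\<lambda>\<Phi> f n. f base_index (unit_fam n)) \<rparr>"
  note a = pair.adj_left_mor
  have base: "base_index \<in> idx \<Lambda>" using base_index_pos by (simp add: \<Lambda>_simps)
  have h: "ind_mor na R (ind_dual R \<Lambda>) \<kappa> h"
    unfolding ind_mor_alt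
  proof (intro conjI ballI impI)
    show "ind_obj na R (ind_dual R \<Lambda>)" by (rule ind_dual_obj[OF R \<Lambda>_obj])
    show "ind_obj na R \<kappa>" by (rule \<kappa>_obj)
    fix \<Phi> assume \<Phi>: "\<Phi> \<in> idx (ind_dual R \<Lambda>)"
    show "im_idx h \<Phi> \<in> idx \<kappa>" by (simp add: \<kappa>_simps)
    note D = dual_\<Lambda>_coeff[OF \<Phi> _ c]
    show "bounded_linear_map R (obj (ind_dual R \<Lambda>) \<Phi>) (obj \<kappa> (im_idx h \<Phi>)) (im_map h \<Phi>)"
      unfolding bounded_linear_map_def
    proof (intro conjI ballI)
      show "im_map h \<Phi> \<in> carrier (obj (ind_dual R \<Lambda>) \<Phi>) \<rightarrow> carrier (obj \<kappa> (im_idx h \<Phi>))"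
        using D(2) by (simp add: h_def \<kappa>_simps)
      show "\<exists>C. \<forall>f\<in>carrier (obj (ind_dual R \<Lambda>) \<Phi>).
          nm (obj \<kappa> (im_idx h \<Phi>)) (im_map h \<Phi> f) \<le> C * nm (obj (ind_dual R \<Lambda>) \<Phi>) f"
        using D(3) by (intro exI[of _ "c \<Phi> * ratio_norm (J \<Phi>)"]) (simp add: h_def \<kappa>_simps)
    qed (use unit_fam_base[OF order_refl] base in \<open>simp_all add: h_def ind_dual_simps \<kappa>_simps l1_simps\<close>)
    fix \<Psi>
    show "eventually_equal \<kappa> (carrier (obj (ind_dual R \<Lambda>) \<Phi>)) (im_idx h \<Phi>) (im_map h \<Phi>)
        (im_idx h \<Psi>) (\<lambda>f. im_map h \<Psi> (tr (ind_dual R \<Lambda>) \<Phi> \<Psi> f))"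
      unfolding eventually_equal_def
      by (intro bexI[of _ "max (im_idx h \<Phi>) (im_idx h \<Psi>)"]) (auto simp: \<kappa>_simps ind_dual_simps h_def)
  qed
  have "ind_eq \<kappa> \<kappa> (ind_comp h adjl) ind_id"
    unfolding ind_eq_alt
  proof
    fix j assume "j \<in> idx \<kappa>"
    have "im_map (ind_comp h adjl) j x = x" if x: "x \<in> carrier (obj \<kappa> j)" for x
    proof
      fix n
      have "im_map adjl j x base_index (unit_fam n) = x n"
        using adj_eq(2)[OF base_index_pos x unit_fam_base[OF order_refl], of n]
          seq_pairing_unit(2)[OF R, of x n] l1_D(1)[OF R dual_weight_pos, of x] x by (simp add: \<kappa>_simps)
      then show "im_map (ind_comp h adjl) j x n = x n" by (simp add: ind_comp_def h_def)
    qed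
    then show "eventually_equal \<kappa> (carrier (obj \<kappa> j)) (im_idx (ind_comp h adjl) j) (im_map (ind_comp h adjl) j)
        (im_idx ind_id j) (im_map ind_id j)"
      unfolding eventually_equal_def
      by (intro bexI[of _ "max (im_idx (ind_comp h adjl) j) (im_idx ind_id j)"]) (auto simp: \<kappa>_simps ind_id_def)
  qed
  moreover have "ind_eq (ind_dual R \<Lambda>) (ind_dual R \<Lambda>) (ind_comp adjl h) ind_id"
  proof (rule ind_eq_dualI[OF ind_comp_mor[OF h a]])
    note m = ind_comp_mor[OF h a]
    fix \<Phi> f assume \<Phi>: "\<Phi> \<in> idx (ind_dual R \<Lambda>)" and f: "f \<in> carrier (obj (ind_dual R \<Lambda>) \<Phi>)"
    show "im_map (ind_comp adjl h) \<Phi> f = im_map ind_id \<Phi> f"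
    proof (rule ind_dual_ext[OF R \<Lambda>_obj ind_morD(3)[OF m \<Phi>] ind_morD(5)[OF m \<Phi> f] \<Phi>])
      show "im_map ind_id \<Phi> f \<in> carrier (obj (ind_dual R \<Lambda>) \<Phi>)" using f by (simp add: ind_id_def)
      fix \<phi> x assume "\<phi> \<in> idx \<Lambda>" and x: "x \<in> carrier (obj \<Lambda> \<phi>)"
      then have \<phi>: "0 < \<phi> j" for j by (simp add: \<Lambda>_simps)
      show "im_map (ind_comp adjl h) \<Phi> f \<phi> x = im_map ind_id \<Phi> f \<phi> x"
        using adj_eq(2)[OF \<phi> ind_morD(5)[OF h \<Phi> f] x] dual_\<Lambda>_eq_pairing[OF \<Phi> f \<phi> x]
        by (simp add: ind_comp_def ind_id_def h_def)
    qed
  qed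
  ultimately show ?thesis unfolding ind_iso_def using a h by blast
qed

lemma reflexive: "reflexive na R \<Lambda>" "reflexive na R \<kappa>"
proof -
  show "reflexive na R \<Lambda>"
    by (rule reflexive_if_dual_pair[OF R adjr_iso adjl_iso]) (simp add: pair.adj_apply)
  show "reflexive na R \<kappa>"
    by (rule reflexive_if_dual_pair[OF R adjl_iso adjr_iso]) (simp add: pair.adj_apply)
qed

end

text \<open>Identity transition maps are injective, so the system itself is the required
  presentation.\<close>

lemma bornologicalI:
  assumes X: "ind_obj na R X" and tr: "\<And>i j x. tr X i j x = x" shows "bornological na R X"
proof -
  have id: "ind_mor na R X X ind_id" by (rule ind_id_mor[OF X])
  have "ind_eq X X (ind_comp ind_id ind_id) ind_id" unfolding ind_comp_id_left by (rule ind_eq_refl[OF id])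
  then have "ind_iso na R X X ind_id" unfolding ind_iso_def using id by blast
  then show ?thesis unfolding bornological_def using tr by (auto simp: inj_on_def)
qed

theorem mainTheorem1:
  fixes R :: "'r nring" and na :: bool and \<rho> :: "nat \<Rightarrow> nat \<Rightarrow> real"
  assumes "banach_ring na R"
    and "\<And>j n. 0 < \<rho> j n"
    and "\<And>j. if na then (\<lambda>n. \<rho> j n / \<rho> (Suc j) n) \<longlonglongrightarrow> 0
              else summable (\<lambda>n. \<rho> j n / \<rho> (Suc j) n)"
  shows "(\<exists>p. ind_mor na R (ind_tensor na R (kappa_space na R \<rho>) (lambda_space na R \<rho>)) (ind_unit R) p \<and>
             ind_iso na R (lambda_space na R \<rho>) (ind_dual R (kappa_space na R \<rho>))
               (adj_right na R (kappa_space na R \<rho>) (lambda_space na R \<rho>) p) \<and>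
             ind_iso na R (kappa_space na R \<rho>) (ind_dual R (lambda_space na R \<rho>))
               (adj_left na R (kappa_space na R \<rho>) (lambda_space na R \<rho>) p)) \<and>
         reflexive na R (lambda_space na R \<rho>) \<and> bornological na R (lambda_space na R \<rho>) \<and>
         reflexive na R (kappa_space na R \<rho>) \<and> bornological na R (kappa_space na R \<rho>)"
proof -
  interpret weights na R \<rho>
    by (rule weights.intro) (use assms in \<open>simp_all add: small_def\<close>)
  have "bornological na R (lambda_space na R \<rho>)" "bornological na R (kappa_space na R \<rho>)"
    using \<Lambda>_obj \<kappa>_obj by (auto intro!: bornologicalI simp: \<Lambda>_simps \<kappa>_simps)
  with pair.pairing_mor adjr_iso adjl_iso reflexive show ?thesis by blast
qed

end
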